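(* Let $d\in\mathbb{N}$ and let $w(e^{i\theta})=h(e^{i\theta})h(e^{i\theta})^*$, $\theta\in[-\pi,\pi)$, where $h:\mathbb{T}\to\mathbb{C}^{d\times d}$ has entries that are rational functions of $z$ without poles in $\overline{\mathbb{D}}$ and $\det h(z)$ has no zeros in $\overline{\mathbb{D}}$. Write $h^{-1}$ in the partial fraction form given in the context and assume $K\ge1$. With $m_0$, $a_k$, $\tilde a_k$, $\ell_{n,s}$, $\tilde\ell_{n,s}$, $r_{n,s}$, $\tilde r_{n,s}$ as defined in the context, the following four assertions hold. (i) For $n\ge m_0+1$, $s\in\{1,\dots,n\}$ and $t\in\{1,\dots,n-m_0\}$, $$\left(T_n(w)^{-1}\right)^{s,t}=\tilde r_{n,s}^*\tilde\ell_{n,t}^*+\sum_{\lambda=1}^{s\wedge t}\tilde a_{s-\lambda}^*\tilde a_{t-\lambda}.$$ (ii) For $n\ge m_0+1$, $s\in\{1,\dots,n-m_0\}$ and $t\in\{1,\dots,n\}$, $$\left(T_n(w)^{-1}\right)^{s,t}=\tilde\ell_{n,s}\tilde r_{n,t}+\sum_{\lambda=1}^{s\wedge t}\tilde a_{s-\lambda}^*\tilde a_{t-\lambda}.$$ (iii) For $n\ge m_0+1$, $s\in\{1,\dots,n\}$ and $t\in\{m_0+1,\dots,n\}$, $$\left(T_n(w)^{-1}\right)^{s,t}=r_{n,s}^*\ell_{n,t}^*+\sum_{\lambda=s\vee t}^{n}a_{\lambda-s}^*a_{\lambda-t}.$$ (iv) For $n\ge m_0+1$, $s\in\{m_0+1,\dots,n\}$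 and $t\in\{1,\dots,n\}$, $$\left(T_n(w)^{-1}\right)^{s,t}=\ell_{n,s}r_{n,t}+\sum_{\lambda=s\vee t}^{n}a_{\lambda-s}^*a_{\lambda-t}.$$
   Context: $\mathbb{T}$ is the unit circle, $\mathbb{D}$ the open and $\overline{\mathbb{D}}$ the closed unit disk. $A^*$, $A^\top$, $\overline A$ denote conjugate transpose, transpose and entrywise conjugate. $s\vee t=\max(s,t)$, $s\wedge t=\min(s,t)$. $\gamma(k)=\int_{-\pi}^{\pi}e^{-ik\theta}w(e^{i\theta})\frac{d\theta}{2\pi}$, and $T_n(w)\in\mathbb{C}^{dn\times dn}$ has $(s,t)$ block $\gamma(s-t)$; $A^{s,t}$ denotes the $(s,t)$ $d\times d$ block of $A\in\mathbb{C}^{dn\times dn}$. Partial fractions: $h^{-1}$ can be written as $$h(z)^{-1}=-\rho_{0,0}-\sum_{\mu=1}^K\sum_{j=1}^{m_\mu}\frac{1}{(1-\overline{p}_\mu z)^j}\rho_{\mu,j}-\sum_{j=1}^{m_0}z^j\rho_{0,j},$$ with $K,m_0\in\mathbb{N}\cup\{0\}$, $m_\mu\in\mathbb{N}$ ($1\le\mu\le K$), distinct $p_1,\dots,p_K\in\mathbb{D}\setminus\{0\}$, $\rho_{\mu,j}\in\mathbb{C}^{d\times d}$, $\rho_{\mu,m_\mu}\ne0$ for $1\le\mu\le K$, and $\rho_{0,m_0}\neq0$ if $m_0\ge1$ (empty sums are $0$). Here $K\ge1$, and $M:=\sum_{\mu=1}^Km_\mu$. $h$ is an outer function in the matrix Hardy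 space $H_2^{d\times d}(\mathbb{T})$ (entries in $H_2$, $\det h$ a scalar outer function). Let $h_\sharp\in H_2^{d\times d}(\mathbb{T})$ be an outer function with $w=h_\sharp^*h_\sharp$ on $\mathbb{T}$ (unique up to a constant unitary left factor; it is also rational with no poles in $\overline{\mathbb{D}}$ and $\det h_\sharp$ has no zeros in $\overline{\mathbb{D}}$). Put $\tilde h(z)=\{h_\sharp(\overline z)\}^*$, and define $a_k,\tilde a_k\in\mathbb{C}^{d\times d}$ by $-h(z)^{-1}=\sum_{k\ge0}z^ka_k$ and $-\tilde h(z)^{-1}=\sum_{k\ge0}z^k\tilde a_k$, $z\in\mathbb{D}$. For $\mu\in\{1,\dots,K\}$, $i\in\mathbb{N}$, $k\in\mathbb{Z}$ put $p_{\mu,i}(k)=\binom{k}{i-1}p_\mu^{k-i+1}I_d$ (generalized binomial coefficient, $\binom{0}{0}=1$). For $n\in\mathbb{Z}$, $\mathbf{p}_n\in\mathbb{C}^{dM\times d}$ is the block column obtained by stacking $p_{1,1}(n),\dots,p_{1,m_1}(n),p_{2,1}(n),\dots,p_{2,m_2}(n),\dots,p_{K,1}(n),\dots,p_{K,m_K}(n)$ from top to bottom. Put $$\Lambda=\sum_{\ell=0}^\infty\mathbf{p}_\ell\mathbf{p}_\ell^*\in\mathbb{C}^{dM\times dM}.$$ With $h^\dagger(z)=h(1/\overline z)^*$, for $1\le\mu\le K$, $1\le j\le m_\mu$ put $$\theta_{\mu,j}=-\lim_{z\to p_\mu}\frac{1}{(m_\mu-j)!}\frac{d^{m_\mu-j}}{dz^{m_\mu-j}}\left\{(z-p_\mu)^{m_\mu}h_\sharp(z)h^\dagger(z)^{-1}\right\}\in\mathbb{C}^{d\times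 d}.$$ $\Theta\in\mathbb{C}^{dM\times dM}$ is block diagonal with diagonal blocks $\Theta_1,\dots,\Theta_K$, where $\Theta_\mu\in\mathbb{C}^{dm_\mu\times dm_\mu}$ has $(i,j)$ block $\theta_{\mu,i+j-1}$ if $i+j-1\le m_\mu$ and $0$ otherwise. For $n\in\mathbb{Z}$, $\Pi_n\in\mathbb{C}^{dM\times dM}$ is block diagonal with diagonal blocks $\Pi_{1,n},\dots,\Pi_{K,n}$, where $\Pi_{\mu,n}\in\mathbb{C}^{dm_\mu\times dm_\mu}$ has $(i,j)$ block $p_{\mu,j-i+1}(n)$ if $i\le j$ and $0$ if $i>j$. Put $$G_n=\Pi_n\Theta\Lambda,\qquad \tilde G_n=(\Pi_n\Theta)^*\Lambda^\top .$$ For $n\in\mathbb{N}$ put $v_n=\sum_{\ell=0}^\infty\mathbf{p}_\ell a_{n+\ell}$, $\tilde v_n=\sum_{\ell=0}^\infty\overline{\mathbf{p}}_\ell\tilde a_{n+\ell}$, and for $n\in\mathbb{Z}$ put $w_n=\sum_{\ell=0}^\infty\mathbf{p}_{\ell-n}a_\ell$, $\tilde w_n=\sum_{\ell=0}^\infty\overline{\mathbf{p}}_{\ell-n}\tilde a_\ell$ (all in $\mathbb{C}^{dM\times d}$). For $n\ge m_0+1$ and $s\in\{1,\dots,n\}$ define (the inverses exist) $$\ell_{n,s}=\{w_{n+1-s}-v_{n+1-s}\}^*(I_{dM}-\tilde G_nG_n)^{-1},\qquad \tilde\ell_{n,s}=\{\tilde w_s-\tilde v_s\}^*(I_{dM}-G_n\tilde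 G_n)^{-1}\quad(\in\mathbb{C}^{d\times dM}),$$ $$r_{n,s}=(\Pi_n\Theta)^*\tilde v_s+\tilde G_n\Pi_n\Theta v_{n+1-s},\qquad \tilde r_{n,s}=\Pi_n\Theta v_{n+1-s}+G_n(\Pi_n\Theta)^*\tilde v_s\quad(\in\mathbb{C}^{dM\times d}).$$ *)

theory Defs
  imports
    "HOL-Complex_Analysis.Complex_Analysis"
    "Jordan_Normal_Form.Gauss_Jordan_Elimination"
    "Jordan_Normal_Form.Schur_Decomposition"
begin

text \<open>
  Matrices are those of \<^theory>\<open>Jordan_Normal_Form.Matrix\<close>, because the sizes \<open>d * n\<close> and
  \<open>d * M\<close> vary. Matrix entries are indexed from 0; block indices are kept 1-based, as in the
  formulas that are to be stated. HOL-Analysis also has a constant \<open>det\<close>, hence the qualified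
  name \<open>Determinant.det\<close> below.
\<close>

text \<open>Only meaningful for invertible \<open>A\<close>; the value at a singular matrix is unspecified.\<close>

definition mat_inv :: "complex mat \<Rightarrow> complex mat"
  where "mat_inv A = the (mat_inverse A)"

definition mat_cnj :: "complex mat \<Rightarrow> complex mat"
  where "mat_cnj A = map_mat cnj A"

definition mat_sum :: "nat \<Rightarrow> nat \<Rightarrow> 'i set \<Rightarrow> ('i \<Rightarrow> complex mat) \<Rightarrow> complex mat"
  where "mat_sum nr nc S f = Matrix.mat nr nc (\<lambda>(i, j). \<Sum>x\<in>S. f x $$ (i, j))"

definition mat_suminf :: "nat \<Rightarrow> nat \<Rightarrow> (nat \<Rightarrow> complex mat) \<Rightarrow> complex mat"
  where "mat_suminf nr nc f = Matrix.mat nr nc (\<lambda>(i, j). \<Sum>l. f l $$ (i, j))"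

text \<open>The matrix with \<open>R \<times> C\<close> blocks, whose block \<open>(s, t)\<close> is the \<open>d \<times> d\<close> matrix \<open>B s t\<close>,
  for \<open>s\<close> in \<open>{1..R}\<close> and \<open>t\<close> in \<open>{1..C}\<close>.\<close>

definition mat_of_blocks ::
    "nat \<Rightarrow> nat \<Rightarrow> nat \<Rightarrow> (nat \<Rightarrow> nat \<Rightarrow> complex mat) \<Rightarrow> complex mat"
  where "mat_of_blocks d R C B = Matrix.mat (d * R) (d * C)
    (\<lambda>(i, j). B (Suc (i div d)) (Suc (j div d)) $$ (i mod d, j mod d))"

definition block :: "nat \<Rightarrow> complex mat \<Rightarrow> nat \<Rightarrow> nat \<Rightarrow> complex mat"
  where "block d A s t = Matrix.mat d d (\<lambda>(i, j). A $$ (d * (s - 1) + i, d * (t - 1) + j))"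

text \<open>Rational without poles in the closed unit disk. The function \<open>f\<close> is defined on the whole
  plane, since it is also evaluated outside the disk, where its values at the finitely many zeros of
  the denominator are left open.\<close>

definition rational_no_poles_cdisk :: "(complex \<Rightarrow> complex) \<Rightarrow> bool"
  where "rational_no_poles_cdisk f \<longleftrightarrow> (\<exists>P Q :: complex poly.
    (\<forall>z\<in>cball 0 1. poly Q z \<noteq> 0) \<and> (\<forall>z. poly Q z \<noteq> 0 \<longrightarrow> f z = poly P z / poly Q z))"

text \<open>An element of the Hardy class is a function on the closed disk: its restriction to the open
  disk is in \<open>H\<^sub>2(\<bbbD>)\<close>, and on the circle it agrees a.e. with the radial boundary
  values. This is the usual identification of \<open>H\<^sub>2(\<bbbD>)\<close> with \<open>H\<^sub>2(\<bbbT>)\<close>.\<close>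

definition hardy_H2 :: "(complex \<Rightarrow> complex) \<Rightarrow> bool"
  where "hardy_H2 f \<longleftrightarrow>
    f holomorphic_on ball 0 1 \<and>
    (\<exists>C. \<forall>r\<in>{0..<1}. integral {-pi..pi} (\<lambda>\<theta>. (cmod (f (complex_of_real r * cis \<theta>)))\<^sup>2) \<le> C) \<and>
    (AE \<theta> in lebesgue_on {-pi..pi}.
      ((\<lambda>r. f (complex_of_real r * cis \<theta>)) \<longlongrightarrow> f (cis \<theta>)) (at_left (1::real)))"

text \<open>Scalar outer functions, given on the closed disk as above: up to a unimodular factor, \<open>f\<close> is
  the exponential of the Herglotz integral of \<open>log \<bar>f\<bar>\<close> on the circle.\<close>

definition outer_fun :: "(complex \<Rightarrow> complex) \<Rightarrow> bool"
  where "outer_fun f \<longleftrightarrow>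
    (\<lambda>\<theta>. ln (cmod (f (cis \<theta>)))) absolutely_integrable_on {-pi..pi} \<and>
    (\<exists>c. cmod c = 1 \<and> (\<forall>z\<in>ball 0 1. f z = c * exp (integral {-pi..pi}
      (\<lambda>\<theta>. (cis \<theta> + z) / (cis \<theta> - z) * complex_of_real (ln (cmod (f (cis \<theta>)))))
        / complex_of_real (2 * pi))))"

definition outer_H2_mat :: "nat \<Rightarrow> (complex \<Rightarrow> complex mat) \<Rightarrow> bool"
  where "outer_H2_mat d H \<longleftrightarrow>
    (\<forall>z\<in>cball 0 1. H z \<in> carrier_mat d d) \<and>
    (\<forall>i<d. \<forall>j<d. hardy_H2 (\<lambda>z. H z $$ (i, j))) \<and>
    outer_fun (\<lambda>z. Determinant.det (H z))"

definition has_mat_power_series ::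
    "nat \<Rightarrow> (complex \<Rightarrow> complex mat) \<Rightarrow> (nat \<Rightarrow> complex mat) \<Rightarrow> bool"
  where "has_mat_power_series d F c \<longleftrightarrow>
    (\<forall>k. c k \<in> carrier_mat d d) \<and>
    (\<forall>z\<in>ball 0 1. \<forall>i<d. \<forall>j<d. (\<lambda>k. z ^ k * c k $$ (i, j)) sums (F z $$ (i, j)))"

definition fourier_coeff :: "nat \<Rightarrow> (complex \<Rightarrow> complex mat) \<Rightarrow> int \<Rightarrow> complex mat"
  where "fourier_coeff d w k = Matrix.mat d d (\<lambda>(i, j).
    integral {-pi..pi} (\<lambda>\<theta>. cis (- (of_int k * \<theta>)) * w (cis \<theta>) $$ (i, j))
      / complex_of_real (2 * pi))"

definition toeplitz :: "nat \<Rightarrow> (complex \<Rightarrow> complex mat) \<Rightarrow> nat \<Rightarrow> complex mat"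
  where "toeplitz d w n = mat_of_blocks d n n (\<lambda>s t. fourier_coeff d w (int s - int t))"

text \<open>
  The multiplicities are given by one function \<open>m\<close>: \<open>m 0\<close> is the degree of the polynomial part and
  \<open>m \<mu>\<close>, for \<open>\<mu>\<close> in \<open>{1..K}\<close>, is the order of the pole belonging to \<open>p \<mu>\<close>. Functions whose names
  end in \<open>_t\<close> stand for the symbols with a tilde.
\<close>

definition pf_rhs :: "nat \<Rightarrow> nat \<Rightarrow> (nat \<Rightarrow> nat) \<Rightarrow> (nat \<Rightarrow> complex) \<Rightarrow>
    (nat \<Rightarrow> nat \<Rightarrow> complex mat) \<Rightarrow> complex \<Rightarrow> complex mat"
  where "pf_rhs d K m p \<rho> z =
    - \<rho> 0 0
    - mat_sum d d {1..K} (\<lambda>\<mu>. mat_sum d d {1..m \<mu>} (\<lambda>j. (1 / (1 - cnj (p \<mu>) * z) ^ j) \<cdot>\<^sub>m \<rho> \<mu> j))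
    - mat_sum d d {1..m 0} (\<lambda>j. z ^ j \<cdot>\<^sub>m \<rho> 0 j)"

definition total_mult :: "nat \<Rightarrow> (nat \<Rightarrow> nat) \<Rightarrow> nat"
  where "total_mult K m = (\<Sum>\<mu>=1..K. m \<mu>)"

definition p_block :: "nat \<Rightarrow> (nat \<Rightarrow> complex) \<Rightarrow> nat \<Rightarrow> nat \<Rightarrow> int \<Rightarrow> complex mat"
  where "p_block d p \<mu> i k =
    (((of_int k :: complex) gchoose (i - 1)) * p \<mu> powi (k - int i + 1)) \<cdot>\<^sub>m 1\<^sub>m d"

text \<open>The pairs \<open>(1, 1), \<dots>, (1, m 1), (2, 1), \<dots>, (K, m K)\<close>, in this order.\<close>

definition pf_index :: "nat \<Rightarrow> (nat \<Rightarrow> nat) \<Rightarrow> (nat \<times> nat) list"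
  where "pf_index K m = concat (map (\<lambda>\<mu>. map (Pair \<mu>) [1..<Suc (m \<mu>)]) [1..<Suc K])"

definition p_col :: "nat \<Rightarrow> nat \<Rightarrow> (nat \<Rightarrow> nat) \<Rightarrow> (nat \<Rightarrow> complex) \<Rightarrow> int \<Rightarrow> complex mat"
  where "p_col d K m p n = mat_of_blocks d (total_mult K m) 1
    (\<lambda>s _. case pf_index K m ! (s - 1) of (\<mu>, i) \<Rightarrow> p_block d p \<mu> i n)"

definition Lambda :: "nat \<Rightarrow> nat \<Rightarrow> (nat \<Rightarrow> nat) \<Rightarrow> (nat \<Rightarrow> complex) \<Rightarrow> complex mat"
  where "Lambda d K m p = mat_suminf (d * total_mult K m) (d * total_mult K m)
    (\<lambda>l. p_col d K m p (int l) * mat_adjoint (p_col d K m p (int l)))"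

definition dagger :: "(complex \<Rightarrow> complex mat) \<Rightarrow> complex \<Rightarrow> complex mat"
  where "dagger h z = mat_adjoint (h (1 / cnj z))"

definition theta :: "nat \<Rightarrow> (nat \<Rightarrow> nat) \<Rightarrow> (nat \<Rightarrow> complex) \<Rightarrow>
    (complex \<Rightarrow> complex mat) \<Rightarrow> (complex \<Rightarrow> complex mat) \<Rightarrow> nat \<Rightarrow> nat \<Rightarrow> complex mat"
  where "theta d m p h hs \<mu> j = Matrix.mat d d (\<lambda>(a, b).
    - Lim (at (p \<mu>)) (\<lambda>z.
        1 / fact (m \<mu> - j) *
        (deriv ^^ (m \<mu> - j))
          (\<lambda>u. (u - p \<mu>) ^ m \<mu> * (hs u * mat_inv (dagger h u)) $$ (a, b)) z))"

definition Theta :: "nat \<Rightarrow> nat \<Rightarrow> (nat \<Rightarrow> nat) \<Rightarrow> (nat \<Rightarrow> complex) \<Rightarrow>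
    (complex \<Rightarrow> complex mat) \<Rightarrow> (complex \<Rightarrow> complex mat) \<Rightarrow> complex mat"
  where "Theta d K m p h hs = diag_block_mat (map (\<lambda>\<mu>. mat_of_blocks d (m \<mu>) (m \<mu>)
    (\<lambda>i j. if i + j - 1 \<le> m \<mu> then theta d m p h hs \<mu> (i + j - 1) else 0\<^sub>m d d)) [1..<Suc K])"

definition Pi_mat :: "nat \<Rightarrow> nat \<Rightarrow> (nat \<Rightarrow> nat) \<Rightarrow> (nat \<Rightarrow> complex) \<Rightarrow> int \<Rightarrow> complex mat"
  where "Pi_mat d K m p n = diag_block_mat (map (\<lambda>\<mu>. mat_of_blocks d (m \<mu>) (m \<mu>)
    (\<lambda>i j. if i \<le> j then p_block d p \<mu> (j - i + 1) n else 0\<^sub>m d d)) [1..<Suc K])"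

definition G_mat :: "nat \<Rightarrow> nat \<Rightarrow> (nat \<Rightarrow> nat) \<Rightarrow> (nat \<Rightarrow> complex) \<Rightarrow>
    (complex \<Rightarrow> complex mat) \<Rightarrow> (complex \<Rightarrow> complex mat) \<Rightarrow> int \<Rightarrow> complex mat"
  where "G_mat d K m p h hs n = Pi_mat d K m p n * Theta d K m p h hs * Lambda d K m p"

definition G_mat_t :: "nat \<Rightarrow> nat \<Rightarrow> (nat \<Rightarrow> nat) \<Rightarrow> (nat \<Rightarrow> complex) \<Rightarrow>
    (complex \<Rightarrow> complex mat) \<Rightarrow> (complex \<Rightarrow> complex mat) \<Rightarrow> int \<Rightarrow> complex mat"
  where "G_mat_t d K m p h hs n =
    mat_adjoint (Pi_mat d K m p n * Theta d K m p h hs) * transpose_mat (Lambda d K m p)"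

definition v_mat :: "nat \<Rightarrow> nat \<Rightarrow> (nat \<Rightarrow> nat) \<Rightarrow> (nat \<Rightarrow> complex) \<Rightarrow>
    (nat \<Rightarrow> complex mat) \<Rightarrow> nat \<Rightarrow> complex mat"
  where "v_mat d K m p a n = mat_suminf (d * total_mult K m) d
    (\<lambda>l. p_col d K m p (int l) * a (n + l))"

definition v_mat_t :: "nat \<Rightarrow> nat \<Rightarrow> (nat \<Rightarrow> nat) \<Rightarrow> (nat \<Rightarrow> complex) \<Rightarrow>
    (nat \<Rightarrow> complex mat) \<Rightarrow> nat \<Rightarrow> complex mat"
  where "v_mat_t d K m p a_t n = mat_suminf (d * total_mult K m) d
    (\<lambda>l. mat_cnj (p_col d K m p (int l)) * a_t (n + l))"

definition w_mat :: "nat \<Rightarrow> nat \<Rightarrow> (nat \<Rightarrow> nat) \<Rightarrow> (nat \<Rightarrow> complex) \<Rightarrow>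
    (nat \<Rightarrow> complex mat) \<Rightarrow> int \<Rightarrow> complex mat"
  where "w_mat d K m p a n = mat_suminf (d * total_mult K m) d
    (\<lambda>l. p_col d K m p (int l - n) * a l)"

definition w_mat_t :: "nat \<Rightarrow> nat \<Rightarrow> (nat \<Rightarrow> nat) \<Rightarrow> (nat \<Rightarrow> complex) \<Rightarrow>
    (nat \<Rightarrow> complex mat) \<Rightarrow> int \<Rightarrow> complex mat"
  where "w_mat_t d K m p a_t n = mat_suminf (d * total_mult K m) d
    (\<lambda>l. mat_cnj (p_col d K m p (int l - n)) * a_t l)"

definition ell :: "nat \<Rightarrow> nat \<Rightarrow> (nat \<Rightarrow> nat) \<Rightarrow> (nat \<Rightarrow> complex) \<Rightarrow>
    (complex \<Rightarrow> complex mat) \<Rightarrow> (complex \<Rightarrow> complex mat) \<Rightarrow> (nat \<Rightarrow> complex mat) \<Rightarrow>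
    nat \<Rightarrow> nat \<Rightarrow> complex mat"
  where "ell d K m p h hs a n s =
    mat_adjoint (w_mat d K m p a (int (n + 1 - s)) - v_mat d K m p a (n + 1 - s)) *
    mat_inv (1\<^sub>m (d * total_mult K m) - G_mat_t d K m p h hs (int n) * G_mat d K m p h hs (int n))"

definition ell_t :: "nat \<Rightarrow> nat \<Rightarrow> (nat \<Rightarrow> nat) \<Rightarrow> (nat \<Rightarrow> complex) \<Rightarrow>
    (complex \<Rightarrow> complex mat) \<Rightarrow> (complex \<Rightarrow> complex mat) \<Rightarrow> (nat \<Rightarrow> complex mat) \<Rightarrow>
    nat \<Rightarrow> nat \<Rightarrow> complex mat"
  where "ell_t d K m p h hs a_t n s =
    mat_adjoint (w_mat_t d K m p a_t (int s) - v_mat_t d K m p a_t s) *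
    mat_inv (1\<^sub>m (d * total_mult K m) - G_mat d K m p h hs (int n) * G_mat_t d K m p h hs (int n))"

definition r_mat :: "nat \<Rightarrow> nat \<Rightarrow> (nat \<Rightarrow> nat) \<Rightarrow> (nat \<Rightarrow> complex) \<Rightarrow>
    (complex \<Rightarrow> complex mat) \<Rightarrow> (complex \<Rightarrow> complex mat) \<Rightarrow> (nat \<Rightarrow> complex mat) \<Rightarrow>
    (nat \<Rightarrow> complex mat) \<Rightarrow> nat \<Rightarrow> nat \<Rightarrow> complex mat"
  where "r_mat d K m p h hs a a_t n s =
    (let PT = Pi_mat d K m p (int n) * Theta d K m p h hs in
      mat_adjoint PT * v_mat_t d K m p a_t s +
      G_mat_t d K m p h hs (int n) * PT * v_mat d K m p a (n + 1 - s))"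

definition r_mat_t :: "nat \<Rightarrow> nat \<Rightarrow> (nat \<Rightarrow> nat) \<Rightarrow> (nat \<Rightarrow> complex) \<Rightarrow>
    (complex \<Rightarrow> complex mat) \<Rightarrow> (complex \<Rightarrow> complex mat) \<Rightarrow> (nat \<Rightarrow> complex mat) \<Rightarrow>
    (nat \<Rightarrow> complex mat) \<Rightarrow> nat \<Rightarrow> nat \<Rightarrow> complex mat"
  where "r_mat_t d K m p h hs a a_t n s =
    (let PT = Pi_mat d K m p (int n) * Theta d K m p h hs in
      PT * v_mat d K m p a (n + 1 - s) +
      G_mat d K m p h hs (int n) * mat_adjoint PT * v_mat_t d K m p a_t s)"

end

theory Submission
  imports Defs
begin

text \<open>The inverse of \<open>T\<^sub>n(w)\<close> is found by verification: \<open>T\<^sub>n(w)\<close> is applied to a candidate for a block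
  column, and the result is a block column of the identity.

  Let \<open>\<gamma>\<close> be the Fourier coefficients of \<open>w = h h\<^sup>* = H\<^sup>* H\<close>, where \<open>H\<close> continues the outer factor
  \<open>hs\<close> across the circle, and let \<open>U\<close> be the phase function, \<open>H\<close> times the adjoint of the inverse of \<open>h\<close>; it is
  unitary on the circle. The series \<open>a\<close> and \<open>a_t\<close> belong to the negative of the inverse of \<open>h\<close> and, with
  frequencies \<open>\<le> 0\<close>, to the negative of the adjoint inverse of \<open>H\<close>. Multiplying them by \<open>w\<close> and \<open>U\<close> and comparing
  Fourier coefficients gives all that is needed about the two sequences.

  \<^item> \<open>\<Sum>k. a k \<gamma>(j - k) = 0\<close> and \<open>\<Sum>k. a_t k \<gamma>(k - j) = 0\<close> for \<open>j \<ge> 1\<close>, because the products with \<open>w\<close> are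
    \<open>- h\<^sup>*\<close> and \<open>- H\<close>, each with frequencies of one sign. Hence the infinite Toeplitz matrix is inverted by
    \<open>Y s t = \<Sum>l=1..min s t. a_t(s - l)\<^sup>* a_t(t - l)\<close>, a product of triangular factors
    (\<open>Y_convolution\<close>).
  \<^item> \<open>a_t(k + 1) = - \<Sum>l. b(k + l) a l\<close> and \<open>a(k + 1) = - \<Sum>l. b(k + l)\<^sup>* a_t l\<close> for \<open>k \<ge> m 0\<close>, where \<open>- b k\<close> is
    the coefficient of \<open>U\<close> at the frequency \<open>- (k + 1)\<close>. By the residue theorem \<open>b\<close> is a sum of
    powers of the poles with binomial coefficients (\<open>hank_symbol_fcoef\<close>), and
    Vandermonde's convolution turns it into the bilinear form of
    \<open>\<Pi>\<^sub>n \<Theta>\<close> (\<open>hankel_identity\<close>). So the Hankel matrix with the entries \<open>b(n + k + l)\<close> factors through a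
    space of dimension \<open>d M\<close>; this is why the finite matrix has an inverse in closed form.

  Cut off after \<open>n\<close> terms, the equation for \<open>Y\<close> is violated by its tail, which by the second group of relations is
  a product \<open>g\<^sub>u\<^sup>* q\<^sub>t\<close>: here \<open>q\<^sub>t\<close> is the adjoint of the first factor in the definition of \<open>ell_t\<close>, and \<open>g\<^sub>u\<close>
  depends on the row \<open>u\<close> only. The same relations show that \<open>\<Sum>s=1..n. r s \<gamma>(s - u) = (1 - G G') g\<^sub>u\<close>, where \<open>r\<close>,
  \<open>G\<close> and \<open>G'\<close> stand for \<open>r_mat_t\<close>, \<open>G_mat\<close> and \<open>G_mat_t\<close>. The product of the adjoints of \<open>r_mat_t\<close> and
  \<open>ell_t\<close> therefore cancels the tail (\<open>column_equation\<close>), which is assertion (i).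
  Assertion (iii) is the same computation for the dual data,
  with \<open>\<gamma>(-k)\<close>, \<open>a\<close> and \<open>a_t\<close> exchanged, \<open>P\<close> conjugated and \<open>\<Pi>\<^sub>n \<Theta>\<close> replaced by its adjoint, read with the
  block indices reversed; (ii) and (iv) are the adjoints of (i) and (iii), since \<open>T\<^sub>n(w)\<close> is Hermitian.

  The matrix \<open>1 - G G'\<close> is invertible because a vector in its kernel produces an analytic function \<open>Z\<close> and an
  antianalytic function \<open>V\<close> with \<open>U Z + V\<close> of mean square zero. Then \<open>h Z = - H\<^sup>* V\<close> has no frequencies at all, and \<open>Z\<close> vanishes
  (\<open>G_det\<close>).

  The continuation \<open>H\<close> has to be constructed, as \<open>hs\<close> is given as an outer function in the Hardy class only. It is
  bounded because \<open>w\<close> is, and its determinant is bounded below because outer functions satisfy a minimum principle; on the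
  circle \<open>hs\<close> is its own adjoint inverse times \<open>h h\<^sup>*\<close>, so its Taylor coefficients inherit the geometric decay of
  those of \<open>h\<close> (\<open>outer_factor_extends\<close>).\<close>

section \<open>Matrices, blocks and matrix-valued sums\<close>

subsection \<open>Adjoints, inverses and determinants\<close>

lemma mat_adjoint_carrier [simp]: "A \<in> carrier_mat m n \<Longrightarrow> mat_adjoint A \<in> carrier_mat n m"
  by (auto simp: mat_adjoint_def)

lemma dim_mat_adjoint [simp]: "dim_row (mat_adjoint A) = dim_col A" "dim_col (mat_adjoint A) = dim_row A"
  by (auto simp: mat_adjoint_def)

lemma index_mat_adjoint [simp]:
  "i < dim_col A \<Longrightarrow> j < dim_row A \<Longrightarrow> mat_adjoint A $$ (i, j) = cnj (A $$ (j, i))"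
  by (auto simp: mat_adjoint_def mat_of_rows_index)

lemma mult_carrier_mat_iff:
  fixes A B :: "complex mat"
  shows "A * B \<in> carrier_mat m n \<longleftrightarrow> dim_row A = m \<and> dim_col B = n"
  by (metis carrier_matD carrier_matI index_mult_mat(2,3))

lemma mat_adjoint_mult:
  fixes A B :: "complex mat"
  assumes "A \<in> carrier_mat m n" "B \<in> carrier_mat n k"
  shows "mat_adjoint (A * B) = mat_adjoint B * mat_adjoint A"
  using assms by (intro eq_matI) (auto simp: scalar_prod_def atLeast0LessThan mult.commute intro!: sum.cong)

lemma mat_adjoint_adjoint [simp]: "mat_adjoint (mat_adjoint (A :: complex mat)) = A"
  by (intro eq_matI) auto

lemma mat_adjoint_add:
  "A \<in> carrier_mat m n \<Longrightarrow> B \<in> carrier_mat m n \<Longrightarrow>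
    mat_adjoint (A + B) = mat_adjoint A + mat_adjoint (B :: complex mat)"
  by (intro eq_matI) auto

lemma mat_adjoint_uminus: "mat_adjoint (- A) = - mat_adjoint (A :: complex mat)"
  by (intro eq_matI) auto

lemma mat_adjoint_one [simp]: "mat_adjoint (1\<^sub>m n :: complex mat) = 1\<^sub>m n"
  by (intro eq_matI) auto

lemma mat_adjoint_zero [simp]: "mat_adjoint (0\<^sub>m m n :: complex mat) = 0\<^sub>m n m"
  by (intro eq_matI) auto

lemma mat_cnj_carrier [simp]: "mat_cnj A \<in> carrier_mat m n \<longleftrightarrow> A \<in> carrier_mat m n"
  by (auto simp: mat_cnj_def)

lemma dim_mat_cnj [simp]: "dim_row (mat_cnj A) = dim_row A" "dim_col (mat_cnj A) = dim_col A"
  by (auto simp: mat_cnj_def)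

lemma index_mat_cnj [simp]:
  "i < dim_row A \<Longrightarrow> j < dim_col A \<Longrightarrow> mat_cnj A $$ (i, j) = cnj (A $$ (i, j))"
  by (auto simp: mat_cnj_def)

lemma mat_cnj_cnj [simp]: "mat_cnj (mat_cnj A) = A"
  by (intro eq_matI) auto

lemma mat_adjoint_cnj: "mat_adjoint (mat_cnj A) = transpose_mat A"
  by (intro eq_matI) auto

lemma transpose_cnj: "transpose_mat (mat_cnj A) = mat_adjoint A"
  by (intro eq_matI) auto

lemma mat_adjoint_transpose: "mat_adjoint (transpose_mat A) = mat_cnj A"
  by (intro eq_matI) auto

lemma assoc_mult_mat4:
  fixes A B x y :: "complex mat"
  assumes "A \<in> carrier_mat k m" "B \<in> carrier_mat m n" "x \<in> carrier_mat n p" "y \<in> carrier_mat p q"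
  shows "A * B * (x * y) = A * (B * x) * y"
proof -
  have "A * (B * x) * y = (A * B * x) * y"
    by (subst assoc_mult_mat[OF assms(1-3)]) simp
  also have "\<dots> = A * B * (x * y)"
    by (rule assoc_mult_mat[OF mult_carrier_mat[OF assms(1,2)] assms(3,4)])
  finally show ?thesis by simp
qed

lemma mat_add_eq_zero:
  fixes A B :: "complex mat"
  assumes "A + B = 0\<^sub>m m n" "A \<in> carrier_mat m n" "B \<in> carrier_mat m n"
  shows "B = - A"
proof (rule eq_matI)
  fix i j assume "i < dim_row (- A)" "j < dim_col (- A)"
  with assms(2,3) have "(A + B) $$ (i, j) = A $$ (i, j) + B $$ (i, j)" "i < m" "j < n" by auto
  with assms show "B $$ (i, j) = (- A) $$ (i, j)" by (auto simp: eq_neg_iff_add_eq_0 add.commute)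
qed (use assms in auto)

lemma mat_inv_unique:
  assumes "A \<in> carrier_mat n n" "B \<in> carrier_mat n n" "A * B = 1\<^sub>m n"
  shows "mat_inv A = B"
proof -
  have BA: "B * A = 1\<^sub>m n" using mat_mult_left_right_inverse[OF assms] .
  have "mat_inverse A \<noteq> None"
  proof
    assume "mat_inverse A = None"
    from mat_inverse(1)[OF assms(1) this] have "A \<notin> Units (ring_mat TYPE(complex) n n)" .
    moreover have "A \<in> Units (ring_mat TYPE(complex) n n)"
      using assms BA unfolding Units_def ring_mat_def by auto
    ultimately show False by blast
  qed
  then obtain C where C: "mat_inverse A = Some C" by auto
  from mat_inverse(2)[OF assms(1) this]
  have CA: "C * A = 1\<^sub>m n" "C \<in> carrier_mat n n" by auto
  have "C = C * (A * B)" using assms CA by simp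
  also have "\<dots> = (C * A) * B" using assms CA by (intro assoc_mult_mat[symmetric]) auto
  also have "\<dots> = B" unfolding CA(1) using assms by simp
  finally have "C = B" .
  then show ?thesis using C by (simp add: mat_inv_def)
qed

lemma mat_inv_props:
  assumes A: "A \<in> carrier_mat n n" and det: "Determinant.det A \<noteq> 0"
  shows "mat_inv A \<in> carrier_mat n n" "A * mat_inv A = 1\<^sub>m n" "mat_inv A * A = 1\<^sub>m n"
    "mat_inv A = (1 / Determinant.det A) \<cdot>\<^sub>m adj_mat A"
proof -
  let ?B = "(1 / Determinant.det A) \<cdot>\<^sub>m adj_mat A"
  have B: "?B \<in> carrier_mat n n" using adj_mat(1)[OF A] by simp
  have AB: "A * ?B = 1\<^sub>m n"
    using A adj_mat[OF A] det by (auto simp: mult_smult_distrib)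
  show eq: "mat_inv A = ?B" by (rule mat_inv_unique[OF A B AB])
  show "mat_inv A \<in> carrier_mat n n" "A * mat_inv A = 1\<^sub>m n" unfolding eq by fact+
  show "mat_inv A * A = 1\<^sub>m n" unfolding eq by (rule mat_mult_left_right_inverse[OF A B AB])
qed

lemma mat_inv_adjoint:
  assumes "A \<in> carrier_mat n n" "Determinant.det A \<noteq> 0"
  shows "mat_inv (mat_adjoint A) = mat_adjoint (mat_inv A)"
proof (rule mat_inv_unique[of _ n])
  show "mat_adjoint A * mat_adjoint (mat_inv A) = 1\<^sub>m n"
    using mat_adjoint_mult[of "mat_inv A" n n A n] mat_inv_props(1,3)[OF assms] assms by simp
qed (use assms mat_inv_props(1)[OF assms] in auto)

lemma minus_mat_eq_zero:
  fixes A B :: "complex mat"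
  assumes "A \<in> carrier_mat m n" "B \<in> carrier_mat m n" "A - B = 0\<^sub>m m n"
  shows "A = B"
proof (rule eq_matI)
  fix i j assume ij: "i < dim_row B" "j < dim_col B"
  then have "(A - B) $$ (i, j) = A $$ (i, j) - B $$ (i, j)" by simp
  then show "A $$ (i, j) = B $$ (i, j)" unfolding assms(3) using ij assms(2) by auto
qed (use assms in auto)

lemma one_minus_mult_mult:
  fixes A B :: "complex mat"
  assumes "A \<in> carrier_mat N N" "B \<in> carrier_mat N N" "x \<in> carrier_mat N q"
  shows "(1\<^sub>m N - A * B) * x = x - A * (B * x)"
proof -
  have "(1\<^sub>m N - A * B) * x = 1\<^sub>m N * x - A * B * x"
    by (rule minus_mult_distrib_mat[of _ N N]) (use assms in \<open>auto simp: mult_carrier_mat_iff\<close>)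
  then show ?thesis using assms by (simp add: assoc_mult_mat[of _ N N _ N _ q])
qed

text \<open>The kernel is tested on matrices with one column, so that all computations stay within one type.\<close>

lemma det_nonzeroI:
  fixes A :: "complex mat"
  assumes A: "A \<in> carrier_mat n n" and inj: "\<And>x. x \<in> carrier_mat n 1 \<Longrightarrow> A * x = 0\<^sub>m n 1 \<Longrightarrow> x = 0\<^sub>m n 1"
  shows "Determinant.det A \<noteq> 0"
proof
  assume "Determinant.det A = 0"
  then obtain v where v: "v \<in> carrier_vec n" "v \<noteq> 0\<^sub>v n" "A *\<^sub>v v = 0\<^sub>v n"
    using det_0_iff_vec_prod_zero[OF A] by blast
  define x where "x = Matrix.mat n 1 (\<lambda>(i, j). vec_index v i)"
  have xc: "x \<in> carrier_mat n 1" by (simp add: x_def)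
  have xv: "x $$ (i, 0) = vec_index v i" if "i < n" for i using that by (simp add: x_def)
  have Ax: "A * x = 0\<^sub>m n 1"
  proof (rule eq_matI)
    fix i j assume "i < dim_row (0\<^sub>m n 1 :: complex mat)" "j < dim_col (0\<^sub>m n 1 :: complex mat)"
    then have ij: "i < n" "j = 0" by auto
    have "(A * x) $$ (i, j) = vec_index (A *\<^sub>v v) i"
      using ij A v(1) carrier_matD[OF xc] by (simp add: xv scalar_prod_def)
    then show "(A * x) $$ (i, j) = 0\<^sub>m n 1 $$ (i, j)" using v(3) ij by simp
  qed (use carrier_matD[OF A] carrier_matD[OF xc] in simp_all)
  have x0: "x = 0\<^sub>m n 1" by (rule inj[OF xc Ax])
  have "v = 0\<^sub>v n"
  proof (rule eq_vecI)
    fix i assume "i < dim_vec (0\<^sub>v n :: complex Matrix.vec)"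
    then have i: "i < n" by simp
    show "vec_index v i = vec_index (0\<^sub>v n) i" using xv[OF i] i unfolding x0 by simp
  qed (use v(1) in simp)
  with v(2) show False ..
qed

text \<open>If \<open>x = B A x\<close>, then \<open>A x\<close> is in the kernel of \<open>1 - A B\<close>.\<close>

lemma det_one_minus_commute:
  fixes A B :: "complex mat"
  assumes A: "A \<in> carrier_mat N N" and B: "B \<in> carrier_mat N N"
    and det: "Determinant.det (1\<^sub>m N - A * B) \<noteq> 0"
  shows "Determinant.det (1\<^sub>m N - B * A) \<noteq> 0"
proof (rule det_nonzeroI[of _ N])
  have AB: "1\<^sub>m N - A * B \<in> carrier_mat N N" by (intro minus_carrier_mat mult_carrier_mat[OF A B])
  show "1\<^sub>m N - B * A \<in> carrier_mat N N" by (intro minus_carrier_mat mult_carrier_mat[OF B A])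
  fix x assume x: "x \<in> carrier_mat N 1" and zero: "(1\<^sub>m N - B * A) * x = 0\<^sub>m N 1"
  note One_nat_def [simp del]
  define y where "y = A * x"
  have y: "y \<in> carrier_mat N 1" unfolding y_def by (rule mult_carrier_mat[OF A x])
  have By: "B * y \<in> carrier_mat N 1" by (rule mult_carrier_mat[OF B y])
  have xy: "x = B * y"
    by (rule minus_mat_eq_zero[OF x By]) (use zero one_minus_mult_mult[OF B A x] in \<open>simp add: y_def\<close>)
  then have "A * (B * y) = y" by (simp add: y_def)
  then have "(1\<^sub>m N - A * B) * y = 0\<^sub>m N 1" using one_minus_mult_mult[OF A B y] y by simp
  then have "mat_inv (1\<^sub>m N - A * B) * ((1\<^sub>m N - A * B) * y) = 0\<^sub>m N 1"
    using mat_inv_props(1)[OF AB det] by (simp add: right_mult_zero_mat[of _ N N])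
  moreover have "mat_inv (1\<^sub>m N - A * B) * ((1\<^sub>m N - A * B) * y) = y"
    using assoc_mult_mat[OF mat_inv_props(1)[OF AB det] AB y] mat_inv_props(3)[OF AB det] y by simp
  ultimately have "y = 0\<^sub>m N 1" by simp
  then show "x = 0\<^sub>m N 1" unfolding xy using B by (simp add: right_mult_zero_mat[of _ N N])
qed

subsection \<open>Entrywise absolute convergence\<close>

text \<open>All series of matrices are controlled by the sum of the absolute values of the entries, which is
  submultiplicative and invariant under adjoints.\<close>

definition mnorm :: "complex mat \<Rightarrow> real"
  where "mnorm A = (\<Sum>i<dim_row A. \<Sum>j<dim_col A. cmod (A $$ (i, j)))"

lemma mnorm_nonneg [simp]: "0 \<le> mnorm A"
  by (auto simp: mnorm_def intro!: sum_nonneg)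

lemma entry_le_mnorm:
  assumes "A \<in> carrier_mat m n" "i < m" "j < n"
  shows "cmod (A $$ (i, j)) \<le> mnorm A"
proof -
  have "cmod (A $$ (i, j)) \<le> (\<Sum>j<n. cmod (A $$ (i, j)))"
    using assms by (intro member_le_sum) auto
  also have "\<dots> \<le> (\<Sum>i<m. \<Sum>j<n. cmod (A $$ (i, j)))"
    using assms by (intro member_le_sum[where f = "\<lambda>i. \<Sum>j<n. cmod (A $$ (i, j))"]) (auto intro!: sum_nonneg)
  finally show ?thesis using assms by (simp add: mnorm_def)
qed

lemma mnorm_adjoint [simp]: "mnorm (mat_adjoint A) = mnorm A"
  unfolding mnorm_def by (subst sum.swap) simp

lemma mnorm_cnj [simp]: "mnorm (mat_cnj A) = mnorm A"
  unfolding mnorm_def by simp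

lemma mnorm_mult:
  assumes A: "A \<in> carrier_mat m n" and B: "B \<in> carrier_mat n k"
  shows "mnorm (A * B) \<le> mnorm A * mnorm B"
proof -
  have row: "(\<Sum>j<k. cmod (B $$ (l, j))) \<le> mnorm B" if "l < n" for l
    using that B unfolding mnorm_def
    by (auto intro!: member_le_sum[where f = "\<lambda>l. \<Sum>j<k. cmod (B $$ (l, j))"] sum_nonneg)
  have "mnorm (A * B) = (\<Sum>i<m. \<Sum>j<k. cmod (\<Sum>l<n. A $$ (i, l) * B $$ (l, j)))"
    using A B by (auto simp: mnorm_def scalar_prod_def atLeast0LessThan)
  also have "\<dots> \<le> (\<Sum>i<m. \<Sum>j<k. \<Sum>l<n. cmod (A $$ (i, l)) * cmod (B $$ (l, j)))"
    by (intro sum_mono order.trans[OF norm_sum]) (simp add: norm_mult)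
  also have "\<dots> = (\<Sum>i<m. \<Sum>l<n. cmod (A $$ (i, l)) * (\<Sum>j<k. cmod (B $$ (l, j))))"
    by (subst sum.swap[of _ "{..<n}"]) (simp add: sum_distrib_left)
  also have "\<dots> \<le> (\<Sum>i<m. \<Sum>l<n. cmod (A $$ (i, l)) * mnorm B)"
    using row by (intro sum_mono mult_left_mono) auto
  also have "\<dots> = mnorm A * mnorm B"
    using A by (simp add: mnorm_def sum_distrib_right)
  finally show ?thesis .
qed

lemma has_sum_congI:
  "(g has_sum S) I \<Longrightarrow> (\<And>x. x \<in> I \<Longrightarrow> f x = g x) \<Longrightarrow> T = S \<Longrightarrow> (f has_sum T) I"
  using has_sum_cong[of I f g] by blast

text \<open>Unordered summation over arbitrary index sets makes reindexing and exchanging the order of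
  summation available for series of rectangular matrices, whose sizes are not types.\<close>

definition mat_has_sum ::
    "nat \<Rightarrow> nat \<Rightarrow> ('i \<Rightarrow> complex mat) \<Rightarrow> complex mat \<Rightarrow> 'i set \<Rightarrow> bool"
  where "mat_has_sum nr nc f S I \<longleftrightarrow> S \<in> carrier_mat nr nc \<and> (\<forall>x\<in>I. f x \<in> carrier_mat nr nc) \<and>
    (\<forall>i<nr. \<forall>j<nc. ((\<lambda>x. f x $$ (i, j)) has_sum S $$ (i, j)) I)"

lemma mat_has_sumD:
  assumes "mat_has_sum nr nc f S I"
  shows "S \<in> carrier_mat nr nc" "\<And>x. x \<in> I \<Longrightarrow> f x \<in> carrier_mat nr nc"
    "\<And>i j. i < nr \<Longrightarrow> j < nc \<Longrightarrow> ((\<lambda>x. f x $$ (i, j)) has_sum S $$ (i, j)) I"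
  using assms by (auto simp: mat_has_sum_def)

lemma mat_has_sum_unique:
  assumes "mat_has_sum nr nc f S I" "mat_has_sum nr nc f T I"
  shows "S = T"
proof (rule eq_matI)
  note D = mat_has_sumD[OF assms(1)] and E = mat_has_sumD[OF assms(2)]
  fix i j assume "i < dim_row T" "j < dim_col T"
  then have "i < nr" "j < nc" using E(1) by auto
  then show "S $$ (i, j) = T $$ (i, j)" by (intro has_sum_unique[OF D(3) E(3)])
qed (use mat_has_sumD(1)[OF assms(1)] mat_has_sumD(1)[OF assms(2)] in auto)

lemma mat_has_sum_cong:
  assumes "\<And>x. x \<in> I \<Longrightarrow> f x = g x"
  shows "mat_has_sum nr nc f S I = mat_has_sum nr nc g S I"
proof -
  have "((\<lambda>x. f x $$ (i, j)) has_sum S $$ (i, j)) I = ((\<lambda>x. g x $$ (i, j)) has_sum S $$ (i, j)) I" for i j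
    using assms by (intro has_sum_cong) auto
  then show ?thesis using assms by (auto simp: mat_has_sum_def)
qed

lemma mat_has_sum_congI:
  "mat_has_sum nr nc g S I \<Longrightarrow> (\<And>x. x \<in> I \<Longrightarrow> f x = g x) \<Longrightarrow> T = S \<Longrightarrow> mat_has_sum nr nc f T I"
  using mat_has_sum_cong[of I f g] by blast

lemma mat_has_sum_suminf:
  assumes "mat_has_sum nr nc f S UNIV"
  shows "mat_suminf nr nc f = S"
proof (rule eq_matI)
  note D = mat_has_sumD[OF assms]
  fix i j assume "i < dim_row S" "j < dim_col S"
  then have ij: "i < nr" "j < nc" using D(1) by auto
  show "mat_suminf nr nc f $$ (i, j) = S $$ (i, j)"
    using sums_unique[OF has_sum_imp_sums[OF D(3)[OF ij]]] ij by (simp add: mat_suminf_def)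
qed (use mat_has_sumD(1)[OF assms] in \<open>auto simp: mat_suminf_def\<close>)

lemma mat_has_sum_finite:
  assumes "finite I" "\<And>x. x \<in> I \<Longrightarrow> f x \<in> carrier_mat nr nc"
  shows "mat_has_sum nr nc f (mat_sum nr nc I f) I"
  using assms by (auto simp: mat_has_sum_def mat_sum_def)

lemma mat_sum_eqI:
  assumes "finite I" "mat_has_sum nr nc f S I"
  shows "mat_sum nr nc I f = S"
  using mat_has_sum_unique[OF mat_has_sum_finite[OF assms(1)] assms(2)] mat_has_sumD(2)[OF assms(2)]
  by auto

lemma mat_sum_carrier [simp]: "mat_sum nr nc I f \<in> carrier_mat nr nc"
  by (simp add: mat_sum_def)

lemma mat_sum_cong: "(\<And>x. x \<in> I \<Longrightarrow> f x = g x) \<Longrightarrow> mat_sum nr nc I f = mat_sum nr nc I g"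
  by (auto simp: mat_sum_def intro!: eq_matI sum.cong)

lemma mat_has_sum_mult_left:
  assumes A: "A \<in> carrier_mat k nr" and f: "mat_has_sum nr nc f S I"
  shows "mat_has_sum k nc (\<lambda>x. A * f x) (A * S) I"
  unfolding mat_has_sum_def
proof (intro conjI allI impI ballI)
  note D = mat_has_sumD[OF f]
  show "A * S \<in> carrier_mat k nc" using A D by auto
  show "A * f x \<in> carrier_mat k nc" if "x \<in> I" for x using A D(2)[OF that] by auto
  fix i j assume ij: "i < k" "j < nc"
  have "((\<lambda>x. \<Sum>l\<in>L. A $$ (i, l) * f x $$ (l, j)) has_sum (\<Sum>l\<in>L. A $$ (i, l) * S $$ (l, j))) I"
    if "finite L" "L \<subseteq> {..<nr}" for L
    using that
  proof (induction L)
    case (insert l L)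
    then show ?case using has_sum_add[OF has_sum_cmult_right[OF D(3)[of l j]]] ij by simp
  qed simp
  from this[of "{..<nr}"]
  have "((\<lambda>x. \<Sum>l<nr. A $$ (i, l) * f x $$ (l, j)) has_sum (\<Sum>l<nr. A $$ (i, l) * S $$ (l, j))) I"
    by simp
  moreover have "(A * f x) $$ (i, j) = (\<Sum>l<nr. A $$ (i, l) * f x $$ (l, j))" if "x \<in> I" for x
    using ij A D(2)[OF that] by (auto simp: scalar_prod_def atLeast0LessThan)
  moreover have "(A * S) $$ (i, j) = (\<Sum>l<nr. A $$ (i, l) * S $$ (l, j))"
    using ij A D(1) by (auto simp: scalar_prod_def atLeast0LessThan)
  ultimately show "((\<lambda>x. (A * f x) $$ (i, j)) has_sum (A * S) $$ (i, j)) I"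
    by (rule has_sum_congI)
qed

lemma mat_has_sum_adjoint:
  assumes "mat_has_sum nr nc f S I"
  shows "mat_has_sum nc nr (\<lambda>x. mat_adjoint (f x)) (mat_adjoint S) I"
  unfolding mat_has_sum_def
proof (intro conjI allI impI ballI)
  note D = mat_has_sumD[OF assms]
  show "mat_adjoint S \<in> carrier_mat nc nr" using D by auto
  show "mat_adjoint (f x) \<in> carrier_mat nc nr" if "x \<in> I" for x using D(2)[OF that] by auto
  fix i j assume ij: "i < nc" "j < nr"
  have "((\<lambda>x. cnj (f x $$ (j, i))) has_sum cnj (S $$ (j, i))) I"
    using D(3)[of j i] ij by (simp only: has_sum_cnj_iff)
  moreover have "mat_adjoint (f x) $$ (i, j) = cnj (f x $$ (j, i))" if "x \<in> I" for x
    using D(2)[OF that] ij by auto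
  ultimately show "((\<lambda>x. mat_adjoint (f x) $$ (i, j)) has_sum mat_adjoint S $$ (i, j)) I"
    by (rule has_sum_congI) (use D(1) ij in auto)
qed

lemma mat_has_sum_cnj:
  assumes "mat_has_sum nr nc f S I"
  shows "mat_has_sum nr nc (\<lambda>x. mat_cnj (f x)) (mat_cnj S) I"
  unfolding mat_has_sum_def
proof (intro conjI allI impI ballI)
  note D = mat_has_sumD[OF assms]
  show "mat_cnj S \<in> carrier_mat nr nc" using D by auto
  show "mat_cnj (f x) \<in> carrier_mat nr nc" if "x \<in> I" for x using D(2)[OF that] by auto
  fix i j assume ij: "i < nr" "j < nc"
  have "((\<lambda>x. cnj (f x $$ (i, j))) has_sum cnj (S $$ (i, j))) I"
    using D(3)[of i j] ij by (simp only: has_sum_cnj_iff)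
  moreover have "mat_cnj (f x) $$ (i, j) = cnj (f x $$ (i, j))" if "x \<in> I" for x
    using D(2)[OF that] ij by auto
  ultimately show "((\<lambda>x. mat_cnj (f x) $$ (i, j)) has_sum mat_cnj S $$ (i, j)) I"
    by (rule has_sum_congI) (use D(1) ij in auto)
qed

lemma mat_has_sum_mult_right:
  assumes A: "A \<in> carrier_mat nc k" and f: "mat_has_sum nr nc f S I"
  shows "mat_has_sum nr k (\<lambda>x. f x * A) (S * A) I"
proof -
  have "mat_has_sum nr k (\<lambda>x. mat_adjoint (mat_adjoint A * mat_adjoint (f x)))
      (mat_adjoint (mat_adjoint A * mat_adjoint S)) I"
    using A by (intro mat_has_sum_adjoint mat_has_sum_mult_left[OF _ mat_has_sum_adjoint[OF f]]) auto
  moreover have "mat_adjoint (mat_adjoint A * mat_adjoint S) = S * A"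
    using A mat_has_sumD(1)[OF f] by (simp add: mat_adjoint_mult[of _ k nc _ nr])
  moreover have "mat_adjoint (mat_adjoint A * mat_adjoint (f x)) = f x * A" if "x \<in> I" for x
    using A mat_has_sumD(2)[OF f that] by (simp add: mat_adjoint_mult[of _ k nc _ nr])
  ultimately show ?thesis
    by - (erule mat_has_sum_congI, simp_all)
qed

lemma mat_has_sum_transpose:
  assumes "mat_has_sum nr nc f S I"
  shows "mat_has_sum nc nr (\<lambda>x. transpose_mat (f x)) (transpose_mat S) I"
  using mat_has_sum_adjoint[OF mat_has_sum_cnj[OF assms]] by (simp add: mat_adjoint_cnj)

lemma mat_has_sum_add:
  assumes "mat_has_sum nr nc f S I" "mat_has_sum nr nc g T I"
  shows "mat_has_sum nr nc (\<lambda>x. f x + g x) (S + T) I"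
  unfolding mat_has_sum_def
proof (intro conjI allI impI ballI)
  note D = mat_has_sumD[OF assms(1)] and E = mat_has_sumD[OF assms(2)]
  show "S + T \<in> carrier_mat nr nc" using D E by auto
  show "f x + g x \<in> carrier_mat nr nc" if "x \<in> I" for x using D(2)[OF that] E(2)[OF that] by auto
  fix i j assume ij: "i < nr" "j < nc"
  have "(f x + g x) $$ (i, j) = f x $$ (i, j) + g x $$ (i, j)" if "x \<in> I" for x
    using D(2)[OF that] E(2)[OF that] ij by auto
  then show "((\<lambda>x. (f x + g x) $$ (i, j)) has_sum (S + T) $$ (i, j)) I"
    using D(1) E(1) ij by (auto intro!: has_sum_congI[OF has_sum_add[OF D(3)[OF ij] E(3)[OF ij]]])
qed

lemma mat_has_sum_uminus:
  assumes "mat_has_sum nr nc f S I"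
  shows "mat_has_sum nr nc (\<lambda>x. - f x) (- S) I"
proof -
  note D = mat_has_sumD[OF assms]
  have "mat_has_sum nr nc (\<lambda>x. (- 1\<^sub>m nr) * f x) ((- 1\<^sub>m nr) * S) I"
    by (rule mat_has_sum_mult_left[OF _ assms]) auto
  moreover have "(- 1\<^sub>m nr) * S = - S" using D(1) by (simp add: uminus_mult_left_mat)
  moreover have "(- 1\<^sub>m nr) * f x = - f x" if "x \<in> I" for x
    using D(2)[OF that] by (simp add: uminus_mult_left_mat)
  ultimately show ?thesis
    by - (erule mat_has_sum_congI, simp_all)
qed

lemma mat_has_sum_Un:
  assumes "mat_has_sum nr nc f S I" "mat_has_sum nr nc f T J" "I \<inter> J = {}"
  shows "mat_has_sum nr nc f (S + T) (I \<union> J)"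
  unfolding mat_has_sum_def
proof (intro conjI allI impI)
  note D = mat_has_sumD[OF assms(1)] and E = mat_has_sumD[OF assms(2)]
  show "S + T \<in> carrier_mat nr nc" "\<forall>x\<in>I \<union> J. f x \<in> carrier_mat nr nc" using D E by auto
  fix i j assume ij: "i < nr" "j < nc"
  show "((\<lambda>x. f x $$ (i, j)) has_sum (S + T) $$ (i, j)) (I \<union> J)"
    using has_sum_Un_disjoint[OF D(3)[OF ij] E(3)[OF ij] assms(3)] D(1) E(1) ij by simp
qed

lemma mat_has_sum_reindex:
  assumes "bij_betw g I J"
  shows "mat_has_sum nr nc (\<lambda>x. f (g x)) S I \<longleftrightarrow> mat_has_sum nr nc f S J"
proof -
  have "(\<forall>x\<in>I. f (g x) \<in> carrier_mat nr nc) \<longleftrightarrow> (\<forall>y\<in>J. f y \<in> carrier_mat nr nc)"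
    using assms by (auto simp: bij_betw_def)
  then show ?thesis
    unfolding mat_has_sum_def by (simp add: has_sum_reindex_bij_betw[OF assms, of "\<lambda>y. f y $$ _"])
qed

lemma mat_has_sum_Sigma:
  assumes "mat_has_sum nr nc f S (Sigma A B)"
    and "\<And>x. x \<in> A \<Longrightarrow> mat_has_sum nr nc (\<lambda>y. f (x, y)) (g x) (B x)"
  shows "mat_has_sum nr nc g S A"
  unfolding mat_has_sum_def
proof (intro conjI allI impI ballI)
  show "S \<in> carrier_mat nr nc" "\<And>x. x \<in> A \<Longrightarrow> g x \<in> carrier_mat nr nc"
    using assms mat_has_sumD(1) by blast+
  fix i j assume ij: "i < nr" "j < nc"
  show "((\<lambda>x. g x $$ (i, j)) has_sum S $$ (i, j)) A"
    by (rule has_sum_SigmaD[OF mat_has_sumD(3)[OF assms(1) ij]])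
      (rule mat_has_sumD(3)[OF assms(2) ij])
qed

lemma mat_summable:
  assumes "\<And>x. x \<in> I \<Longrightarrow> f x \<in> carrier_mat nr nc" "(\<lambda>x. mnorm (f x)) summable_on I"
  obtains S where "mat_has_sum nr nc f S I"
proof -
  let ?S = "Matrix.mat nr nc (\<lambda>(i, j). infsum (\<lambda>x. f x $$ (i, j)) I)"
  have "((\<lambda>x. f x $$ (i, j)) has_sum ?S $$ (i, j)) I" if ij: "i < nr" "j < nc" for i j
  proof -
    have "(\<lambda>x. norm (f x $$ (i, j))) summable_on I"
      by (rule Infinite_Sum.abs_summable_on_comparison_test'[OF assms(2)]) (use assms(1) ij entry_le_mnorm in blast)
    then have "(\<lambda>x. f x $$ (i, j)) summable_on I" by (rule Infinite_Sum.abs_summable_summable)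
    then show ?thesis using ij by simp
  qed
  then have "mat_has_sum nr nc f ?S I" using assms(1) by (auto simp: mat_has_sum_def)
  then show thesis by (rule that)
qed

lemma mat_summable_le:
  assumes "\<And>x. x \<in> I \<Longrightarrow> f x \<in> carrier_mat nr nc" "g summable_on I"
    and "\<And>x. x \<in> I \<Longrightarrow> mnorm (f x) \<le> g x"
  obtains S where "mat_has_sum nr nc f S I"
  by (rule mat_summable[of I f]) (use assms in \<open>auto intro: summable_on_comparison_test\<close>)

lemma summable_on_prod:
  fixes f :: "'a \<Rightarrow> real" and g :: "'b \<Rightarrow> real"
  assumes "f summable_on A" "g summable_on B" "\<And>x. 0 \<le> f x" "\<And>y. 0 \<le> g y"
  shows "(\<lambda>(x, y). f x * g y) summable_on A \<times> B"
proof (rule summable_on_SigmaI)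
  show "((\<lambda>y. (case (x, y) of (x, y) \<Rightarrow> f x * g y)) has_sum f x * infsum g B) B" for x
    using assms(2) by (auto intro: has_sum_cmult_right)
  show "(\<lambda>x. f x * infsum g B) summable_on A" using assms(1) by (rule summable_on_cmult_left)
qed (use assms in auto)

lemma mat_suminf_carrier [simp]: "mat_suminf nr nc f \<in> carrier_mat nr nc"
  by (simp add: mat_suminf_def)

lemma mat_has_sum_suminfI:
  assumes "mat_has_sum nr nc f S UNIV"
  shows "mat_has_sum nr nc f (mat_suminf nr nc f) UNIV"
  using assms mat_has_sum_suminf[OF assms] by simp

lemma mat_has_sum_mat_sum:
  assumes "finite L" "\<And>l. l \<in> L \<Longrightarrow> mat_has_sum nr nc (f l) (S l) I"
  shows "mat_has_sum nr nc (\<lambda>x. mat_sum nr nc L (\<lambda>l. f l x)) (mat_sum nr nc L S) I"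
  unfolding mat_has_sum_def
proof (intro conjI allI impI ballI)
  fix i j assume ij: "i < nr" "j < nc"
  have "((\<lambda>x. \<Sum>l\<in>L. f l x $$ (i, j)) has_sum (\<Sum>l\<in>L. S l $$ (i, j))) I"
    using assms
  proof (induction L)
    case (insert l L)
    then show ?case using has_sum_add[OF mat_has_sumD(3)[of nr nc "f l" "S l" I i j]] ij by simp
  qed simp
  then show "((\<lambda>x. mat_sum nr nc L (\<lambda>l. f l x) $$ (i, j)) has_sum mat_sum nr nc L S $$ (i, j)) I"
    using ij by (simp add: mat_sum_def)
qed auto

lemma mat_has_sum_0: "mat_has_sum m n (\<lambda>_. 0\<^sub>m m n) (0\<^sub>m m n) I"
  by (auto simp: mat_has_sum_def)

lemma mat_has_sum_head_tail:
  fixes n :: nat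
  assumes "mat_has_sum nr nc f V {1..n}" "mat_has_sum nr nc f T {n + 1..}" "mat_has_sum nr nc f S {1..}"
  shows "V + T = S"
proof -
  have "{1..n} \<union> {n + 1..} = {1..}" "{1..n} \<inter> {n + 1..} = {}" by auto
  with mat_has_sum_Un[OF assms(1,2)] have "mat_has_sum nr nc f (V + T) {1..}" by simp
  then show ?thesis using assms(3) by (rule mat_has_sum_unique)
qed

lemma mat_sum_mult_left:
  assumes "finite I" "A \<in> carrier_mat k nr" "\<And>x. x \<in> I \<Longrightarrow> f x \<in> carrier_mat nr nc"
  shows "A * mat_sum nr nc I f = mat_sum k nc I (\<lambda>x. A * f x)"
  using mat_sum_eqI[OF assms(1) mat_has_sum_mult_left[OF assms(2) mat_has_sum_finite[OF assms(1,3)]]] by simp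

lemma mat_sum_adjoint:
  assumes "finite I" "\<And>x. x \<in> I \<Longrightarrow> f x \<in> carrier_mat nr nc"
  shows "mat_adjoint (mat_sum nr nc I f) = mat_sum nc nr I (\<lambda>x. mat_adjoint (f x))"
  using mat_sum_eqI[OF assms(1) mat_has_sum_adjoint[OF mat_has_sum_finite[OF assms]]] by simp

lemma mat_sum_reindex:
  assumes "bij_betw g I J"
  shows "mat_sum nr nc J f = mat_sum nr nc I (\<lambda>x. f (g x))"
  unfolding mat_sum_def by (simp add: sum.reindex_bij_betw[OF assms, symmetric])

lemma mat_sum_gram_adjoint:
  assumes "finite I" "\<And>l. b l \<in> carrier_mat d d" "\<And>l. c l \<in> carrier_mat d d"
  shows "mat_adjoint (mat_sum d d I (\<lambda>l. mat_adjoint (b l) * c l)) = mat_sum d d I (\<lambda>l. mat_adjoint (c l) * b l)"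
proof -
  have "mat_adjoint (mat_sum d d I (\<lambda>l. mat_adjoint (b l) * c l)) = mat_sum d d I (\<lambda>l. mat_adjoint (mat_adjoint (b l) * c l))"
    by (rule mat_sum_adjoint[OF assms(1)]) (rule mult_carrier_mat[OF mat_adjoint_carrier[OF assms(2)] assms(3)])
  also have "\<dots> = mat_sum d d I (\<lambda>l. mat_adjoint (c l) * b l)"
    by (rule mat_sum_cong) (simp add: mat_adjoint_mult[OF mat_adjoint_carrier[OF assms(2)] assms(3)])
  finally show ?thesis .
qed

lemma summable_on_nat_nonneg:
  fixes f :: "nat \<Rightarrow> real"
  assumes "summable f" "\<And>n. 0 \<le> f n"
  shows "f summable_on A"
  by (rule summable_on_subset_banach[OF summable_nonneg_imp_summable_on[OF assms]]) auto

lemma mat_has_sum_bounded: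
  assumes "\<And>l. f l \<in> carrier_mat n k" "\<And>l. g l \<in> carrier_mat k m"
    and "summable (\<lambda>l. mnorm (f l))" "\<And>l. mnorm (g l) \<le> C"
  shows "mat_has_sum n m (\<lambda>l. f l * g l) (mat_suminf n m (\<lambda>l. f l * g l)) (UNIV :: nat set)"
proof -
  have "(\<lambda>l. mnorm (f l) * C) summable_on UNIV"
    using assms(3) by (intro summable_on_cmult_left summable_on_nat_nonneg) auto
  moreover have "mnorm (f l * g l) \<le> mnorm (f l) * C" for l
    using mnorm_mult[OF assms(1,2)] mult_left_mono[OF assms(4)] mnorm_nonneg order_trans by blast
  moreover have "f l * g l \<in> carrier_mat n m" for l by (rule mult_carrier_mat[OF assms(1,2)])
  ultimately obtain S where "mat_has_sum n m (\<lambda>l. f l * g l) S UNIV"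
    using mat_summable_le[of UNIV "\<lambda>l. f l * g l" n m] by blast
  then show ?thesis by (rule mat_has_sum_suminfI)
qed

lemma mnorm_mult_summable:
  fixes f :: "nat \<Rightarrow> complex mat"
  assumes "\<And>l. f l \<in> carrier_mat m n" "x \<in> carrier_mat n q" "summable (\<lambda>l. mnorm (f l))"
  shows "summable (\<lambda>l. mnorm (f l * x))"
proof (rule summable_comparison_test')
  show "summable (\<lambda>l. mnorm (f l) * mnorm x)" using assms(3) by (rule summable_mult2)
  show "norm (mnorm (f l * x)) \<le> mnorm (f l) * mnorm x" for l
    using mnorm_mult[OF assms(1,2)] by simp
qed

subsection \<open>Block matrices\<close>

lemma mat_of_blocks_carrier [simp]: "mat_of_blocks d R C B \<in> carrier_mat (d * R) (d * C)"
  by (simp add: mat_of_blocks_def)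

lemma block_index_less: "i < d \<Longrightarrow> s \<in> {1..n} \<Longrightarrow> d * (s - 1) + i < d * (n :: nat)"
proof -
  assume "i < d" "s \<in> {1..n}"
  then have "d * (s - 1) + i < d * (s - 1) + d" by simp
  also have "\<dots> = d * Suc (s - 1)" by simp
  also have "\<dots> \<le> d * n" using \<open>s \<in> {1..n}\<close> by (intro mult_le_mono2) auto
  finally show ?thesis .
qed

lemma block_index_cases:
  assumes "i < d * (n :: nat)"
  obtains s i' where "i = d * (s - 1) + i'" "i' < d" "s \<in> {1..n}"
proof
  have "d > 0" using assms by (cases d) auto
  show "i = d * (Suc (i div d) - 1) + i mod d" by simp
  show "i mod d < d" using \<open>d > 0\<close> by simp
  have "i div d < n" using assms by (simp add: less_mult_imp_div_less mult.commute)
  then show "Suc (i div d) \<in> {1..n}" by auto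
qed

lemma mat_of_blocks_index:
  assumes "s \<in> {1..R}" "t \<in> {1..C}" "i < d" "j < d"
  shows "mat_of_blocks d R C B $$ (d * (s - 1) + i, d * (t - 1) + j) = B s t $$ (i, j)"
  using assms block_index_less[of i d s R] block_index_less[of j d t C]
  by (auto simp: mat_of_blocks_def)

lemma block_mat_eqI:
  assumes "A \<in> carrier_mat (d * R) (d * C)" "A' \<in> carrier_mat (d * R) (d * C)"
    and "\<And>s t. s \<in> {1..R} \<Longrightarrow> t \<in> {1..C} \<Longrightarrow> block d A s t = block d A' s t"
  shows "A = A'"
proof (rule eq_matI)
  fix i j assume "i < dim_row A'" "j < dim_col A'"
  with assms obtain s i' t j' where *: "i = d * (s - 1) + i'" "i' < d" "s \<in> {1..R}"
      "j = d * (t - 1) + j'" "j' < d" "t \<in> {1..C}"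
    by (metis block_index_cases carrier_matD)
  from assms(3)[OF *(3) *(6)] have "block d A s t $$ (i', j') = block d A' s t $$ (i', j')" by simp
  then show "A $$ (i, j) = A' $$ (i, j)" using * by (simp add: block_def)
qed (use assms in auto)

lemma block_carrier [simp]: "block d A s t \<in> carrier_mat d d"
  by (simp add: block_def)

lemma block_mat_of_blocks:
  assumes "s \<in> {1..R}" "t \<in> {1..C}" "B s t \<in> carrier_mat d d"
  shows "block d (mat_of_blocks d R C B) s t = B s t"
  using assms by (intro eq_matI) (auto simp: block_def mat_of_blocks_index simp del: One_nat_def)

lemma sum_blocks:
  fixes f :: "nat \<Rightarrow> 'a::comm_monoid_add"
  shows "(\<Sum>k<d * n. f k) = (\<Sum>r=1..n. \<Sum>i<d. f (d * (r - 1) + i))"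
proof (induction n)
  case (Suc n)
  have "{..<d * Suc n} = {..<d * n} \<union> (\<lambda>i. d * n + i) ` {..<d}"
  proof (auto simp: image_iff)
    fix x assume "x < d + d * n" "\<forall>i\<in>{..<d}. x \<noteq> d * n + i"
    then show "x < d * n" by (metis add_less_cancel_left le_Suc_ex lessThan_iff not_le_imp_less add.commute)
  qed
  then have "(\<Sum>k<d * Suc n. f k) = (\<Sum>k<d * n. f k) + (\<Sum>k\<in>(\<lambda>i. d * n + i) ` {..<d}. f k)"
    by (simp only:) (rule sum.union_disjoint, auto)
  also have "(\<Sum>k\<in>(\<lambda>i. d * n + i) ` {..<d}. f k) = (\<Sum>i<d. f (d * n + i))"
    by (subst sum.reindex) (auto simp: inj_on_def)
  finally show ?case using Suc by simp
qed simp

lemma block_mult: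
  assumes A: "A \<in> carrier_mat (d * R) (d * C)" and B: "B \<in> carrier_mat (d * C) (d * E)"
    and s: "s \<in> {1..R}" and t: "t \<in> {1..E}"
  shows "block d (A * B) s t = mat_sum d d {1..C} (\<lambda>r. block d A s r * block d B r t)"
proof (rule eq_matI)
  fix i j assume "i < dim_row (mat_sum d d {1..C} (\<lambda>r. block d A s r * block d B r t))"
    "j < dim_col (mat_sum d d {1..C} (\<lambda>r. block d A s r * block d B r t))"
  then have ij: "i < d" "j < d" by (auto simp: mat_sum_def)
  have "block d (A * B) s t $$ (i, j) = (\<Sum>k<d * C. A $$ (d * (s - 1) + i, k) * B $$ (k, d * (t - 1) + j))"
    using ij A B block_index_less[OF ij(1) s] block_index_less[OF ij(2) t]
    by (auto simp: block_def scalar_prod_def atLeast0LessThan)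
  also have "\<dots> = (\<Sum>r=1..C. \<Sum>k<d. A $$ (d * (s - 1) + i, d * (r - 1) + k) * B $$ (d * (r - 1) + k, d * (t - 1) + j))"
    by (rule sum_blocks)
  also have "\<dots> = mat_sum d d {1..C} (\<lambda>r. block d A s r * block d B r t) $$ (i, j)"
    using ij by (auto simp: mat_sum_def block_def scalar_prod_def atLeast0LessThan)
  finally show "block d (A * B) s t $$ (i, j) = mat_sum d d {1..C} (\<lambda>r. block d A s r * block d B r t) $$ (i, j)" .
qed (auto simp: block_def mat_sum_def)

lemma block_adjoint:
  assumes "A \<in> carrier_mat (d * R) (d * C)" "s \<in> {1..C}" "t \<in> {1..R}"
  shows "block d (mat_adjoint A) s t = mat_adjoint (block d A t s)"
proof (rule eq_matI)
  fix i j assume "i < dim_row (mat_adjoint (block d A t s))" "j < dim_col (mat_adjoint (block d A t s))"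
  then have ij: "i < d" "j < d" by (auto simp: block_def)
  show "block d (mat_adjoint A) s t $$ (i, j) = mat_adjoint (block d A t s) $$ (i, j)"
    using assms ij block_index_less[OF ij(1) assms(2)] block_index_less[OF ij(2) assms(3)]
    by (auto simp: block_def)
qed (auto simp: block_def)

text \<open>A block column is identified by its equation alone, since the determinant does not vanish.\<close>

lemma toeplitz_block_column:
  assumes w: "\<And>k. fourier_coeff d w k \<in> carrier_mat d d"
    and det: "Determinant.det (toeplitz d w n) \<noteq> 0" and t: "t \<in> {1..n}" and s: "s \<in> {1..n}"
    and X: "\<And>s. X s \<in> carrier_mat d d"
    and eq: "\<And>u. u \<in> {1..n} \<Longrightarrow> mat_sum d d {1..n} (\<lambda>s. fourier_coeff d w (int u - int s) * X s) =
      (if u = t then 1\<^sub>m d else 0\<^sub>m d d)"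
  shows "block d (mat_inv (toeplitz d w n)) s t = X s"
proof -
  let ?T = "toeplitz d w n" and ?e = "\<lambda>u. if u = t then 1\<^sub>m d else 0\<^sub>m d d :: complex mat"
  let ?X = "mat_of_blocks d n 1 (\<lambda>s _. X s)" and ?E = "mat_of_blocks d n 1 (\<lambda>u _. ?e u)"
  have T: "?T \<in> carrier_mat (d * n) (d * n)" by (simp add: toeplitz_def)
  note I = mat_inv_props[OF T det]
  have Tb: "block d ?T u r = fourier_coeff d w (int u - int r)" if "u \<in> {1..n}" "r \<in> {1..n}" for u r
    unfolding toeplitz_def by (rule block_mat_of_blocks[OF that w])
  have Xb: "block d ?X r 1 = X r" if "r \<in> {1..n}" for r
    by (rule block_mat_of_blocks) (use that X in auto)
  have Eb: "block d ?E r 1 = ?e r" if "r \<in> {1..n}" for r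
    by (rule block_mat_of_blocks) (use that in auto)
  have one: "{1..1::nat} = {1}" by auto
  have "?T * ?X = ?E"
  proof (rule block_mat_eqI[of _ d n 1])
    show "?T * ?X \<in> carrier_mat (d * n) (d * 1)" by (rule mult_carrier_mat[OF T mat_of_blocks_carrier])
    fix u r assume u: "u \<in> {1..n}" and "r \<in> {1..1::nat}"
    then have r: "r = 1" by simp
    have "block d (?T * ?X) u 1 = mat_sum d d {1..n} (\<lambda>r. block d ?T u r * block d ?X r 1)"
      by (rule block_mult[OF T mat_of_blocks_carrier u]) simp
    also have "\<dots> = mat_sum d d {1..n} (\<lambda>r. fourier_coeff d w (int u - int r) * X r)"
      using u by (intro mat_sum_cong) (simp only: Tb Xb)
    also have "\<dots> = block d ?E u 1" using eq[OF u] Eb[OF u] by simp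
    finally show "block d (?T * ?X) u r = block d ?E u r" using r by simp
  qed (rule mat_of_blocks_carrier)
  then have "mat_inv ?T * (?T * ?X) = mat_inv ?T * ?E" by simp
  moreover have "mat_inv ?T * (?T * ?X) = ?X"
  proof -
    have Xc: "?X \<in> carrier_mat (d * n) (d * 1)" by (rule mat_of_blocks_carrier)
    have "mat_inv ?T * (?T * ?X) = mat_inv ?T * ?T * ?X" by (rule assoc_mult_mat[OF I(1) T Xc, symmetric])
    then show ?thesis using Xc by (simp add: I(3))
  qed
  ultimately have "X s = block d (mat_inv ?T * ?E) s 1" using Xb[OF s] by simp
  also have "\<dots> = mat_sum d d {1..n} (\<lambda>r. block d (mat_inv ?T) s r * block d ?E r 1)"
    by (rule block_mult[OF I(1) mat_of_blocks_carrier s]) simp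
  also have "\<dots> = mat_sum d d {1..n} (\<lambda>r. if r = t then block d (mat_inv ?T) s t else 0\<^sub>m d d)"
    by (intro mat_sum_cong) (auto simp: Eb right_mult_one_mat[of _ d d] right_mult_zero_mat[of _ d d] simp del: One_nat_def)
  also have "\<dots> = block d (mat_inv ?T) s t"
    by (rule eq_matI) (use t in \<open>auto simp: mat_sum_def block_def if_distrib[of "\<lambda>A. A $$ _"] cong: if_cong\<close>)
  finally show ?thesis by simp
qed

section \<open>Toeplitz matrices with a Hankel symbol of finite rank\<close>

text \<open>The tail sums \<open>v\<^sub>s\<close> and the shifted sums \<open>w\<^sub>e\<close> of a coefficient sequence \<open>a\<close> against a family \<open>P\<close>; with the
  conjugate family and the dual sequence they are the sums that carry a tilde.\<close>

definition vseq :: "nat \<Rightarrow> nat \<Rightarrow> (int \<Rightarrow> complex mat) \<Rightarrow> (nat \<Rightarrow> complex mat) \<Rightarrow> nat \<Rightarrow> complex mat"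
  where "vseq N d P a s = mat_suminf N d (\<lambda>l. P (int l) * a (s + l))"

definition wseq :: "nat \<Rightarrow> nat \<Rightarrow> (int \<Rightarrow> complex mat) \<Rightarrow> (nat \<Rightarrow> complex mat) \<Rightarrow> int \<Rightarrow> complex mat"
  where "wseq N d P a s = mat_suminf N d (\<lambda>l. P (int l - s) * a l)"

lemma vseq_carrier [simp]: "vseq N d P a s \<in> carrier_mat N d"
  and wseq_carrier [simp]: "wseq N d P a e \<in> carrier_mat N d"
  by (simp_all add: vseq_def wseq_def)

text \<open>Since the Hankel form factors through \<open>P\<close>, applying it to a sequence only involves the sum of the
  sequence against \<open>P\<close>.\<close>

lemma hankel_series:
  assumes P: "\<And>k. P k \<in> carrier_mat N d" and Q: "Q \<in> carrier_mat N N"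
    and hank: "\<And>k l. transpose_mat (P k) * Q * P l = B (int n + k + l)"
    and z: "\<And>l. z l \<in> carrier_mat d q"
    and S: "mat_has_sum N q (\<lambda>l. P (int l) * z l) V UNIV"
  shows "mat_has_sum d q (\<lambda>l. B (int n + k + int l) * z l) (transpose_mat (P k) * (Q * V)) UNIV"
proof -
  have PQ: "transpose_mat (P k) * Q \<in> carrier_mat d N" by (rule mult_carrier_mat[of _ d N]) (use P Q in auto)
  show ?thesis
  proof (rule mat_has_sum_congI[OF mat_has_sum_mult_left[OF PQ S]])
    show "B (int n + k + int l) * z l = transpose_mat (P k) * Q * (P (int l) * z l)" for l
      unfolding hank[symmetric] by (rule assoc_mult_mat[OF PQ P z])
    show "transpose_mat (P k) * (Q * V) = transpose_mat (P k) * Q * V"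
      using assoc_mult_mat[OF _ Q mat_has_sumD(1)[OF S], of "transpose_mat (P k)" d] P by simp
  qed
qed

lemma bij_betw_reverse: "bij_betw (\<lambda>s. n + 1 - s) {1..n} {1..(n::nat)}"
  by (rule bij_betwI[where g = "\<lambda>s. n + 1 - s"]) auto

lemma summable_int_shift:
  fixes f :: "int \<Rightarrow> real"
  assumes "summable (\<lambda>l. f (int l))"
  shows "summable (\<lambda>l. f (int l + e))"
proof (cases "e \<ge> 0")
  case True
  then have "(\<lambda>l. f (int l + e)) = (\<lambda>l. f (int (l + nat e)))" by auto
  then show ?thesis using assms summable_iff_shift[of "\<lambda>l. f (int l)" "nat e"] by simp
next
  case False
  then have "(\<lambda>l. f (int l)) = (\<lambda>l. f (int (l + nat (- e)) + e))" by (auto simp: nat_minus_as_int)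
  then show ?thesis using assms summable_iff_shift[of "\<lambda>l. f (int l + e)" "nat (- e)"] by simp
qed

lemma summable_nonneg_bounded:
  fixes f :: "nat \<Rightarrow> real"
  assumes "summable f" "\<And>n. 0 \<le> f n"
  shows "f n \<le> suminf f"
  using sum_le_suminf[OF assms(1), of "{n}"] assms(2) by simp

text \<open>The part of the data that enters symmetrically for \<open>a\<close> with \<open>P\<close> and for the dual sequence with the conjugate
  family.\<close>

locale coeff_data =
  fixes d N :: nat and P :: "int \<Rightarrow> complex mat" and a :: "nat \<Rightarrow> complex mat"
  assumes P_carrier [simp]: "\<And>k. P k \<in> carrier_mat N d"
    and a_carrier [simp]: "\<And>k. a k \<in> carrier_mat d d"
    and P_summable: "summable (\<lambda>l. mnorm (P (int l)))"
    and a_summable: "summable (\<lambda>l. mnorm (a l))"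

begin

lemma P_dim [simp]: "dim_row (P k) = N" "dim_col (P k) = d"
  using carrier_matD[OF P_carrier] by auto

lemma a_dim [simp]: "dim_row (a k) = d" "dim_col (a k) = d"
  using carrier_matD[OF a_carrier] by auto

lemma a_le: "mnorm (a k) \<le> (\<Sum>k. mnorm (a k))"
  by (rule summable_nonneg_bounded[OF a_summable]) simp

lemma P_le: "mnorm (P (int k)) \<le> (\<Sum>k. mnorm (P (int k)))"
  by (rule summable_nonneg_bounded[OF P_summable]) simp

lemma vseq_has_sum: "mat_has_sum N d (\<lambda>l. P (int l) * a (s + l)) (vseq N d P a s) UNIV"
  unfolding vseq_def by (rule mat_has_sum_bounded[OF _ _ P_summable a_le]) auto

lemma wseq_has_sum: "mat_has_sum N d (\<lambda>l. P (int l - e) * a l) (wseq N d P a e) UNIV"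
  unfolding wseq_def
  by (rule mat_has_sum_bounded[OF _ _ _ a_le])
    (use summable_int_shift[OF P_summable, of "- e"] in auto)

text \<open>The double series \<open>\<Sum>k i. P k * a i * g (i - k - u)\<close> vanishes, because its inner sums over \<open>i\<close> do. Cutting it
  along the diagonal \<open>i = k\<close> leaves the \<open>v\<close>-series on one side and the \<open>w\<close>-series on the other.\<close>

lemma vseq_wseq_balance:
  fixes g :: "int \<Rightarrow> complex mat" and u :: int
  assumes g: "\<And>k. g k \<in> carrier_mat d d" "\<And>k. mnorm (g k) \<le> C"
    and orth: "\<And>j. j \<ge> (1 :: int) \<Longrightarrow> mat_has_sum d d (\<lambda>k. a k * g (int k - j)) (0\<^sub>m d d) UNIV"
    and u: "u \<ge> 1"
  obtains T where
    "mat_has_sum N d (\<lambda>s. vseq N d P a s * g (int s - u)) T {1..}"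
    "mat_has_sum N d (\<lambda>s. wseq N d P a (- int s) * g (- int s - u)) (- T) UNIV"
proof -
  define f where "f = (\<lambda>(k, i). P (int k) * (a i * g (int i - int k - u)))"
  define A where "A = {(k, i). (i :: nat) \<ge> k + 1}"
  define B where "B = {(k, i). (i :: nat) \<le> k}"
  have C: "C \<ge> 0" using g(2)[of 0] mnorm_nonneg[of "g 0"] by linarith
  have fc: "f x \<in> carrier_mat N d" for x
    using carrier_matD[OF g(1)] by (cases x) (auto simp: f_def mult_carrier_mat_iff)
  have prod: "(\<lambda>(k, i). mnorm (P (int k)) * (mnorm (a i) * C)) summable_on UNIV \<times> UNIV"
    by (intro summable_on_prod summable_on_cmult_left summable_on_nat_nonneg P_summable a_summable)
      (auto simp: C)
  have f_le: "mnorm (f x) \<le> (case x of (k, i) \<Rightarrow> mnorm (P (int k)) * (mnorm (a i) * C))" for x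
  proof (cases x)
    case (Pair k i)
    have "mnorm (f x) \<le> mnorm (P (int k)) * mnorm (a i * g (int i - int k - u))"
      unfolding f_def Pair prod.case
      by (rule mnorm_mult[where n = d]) (use carrier_matD[OF g(1)] in \<open>auto simp: mult_carrier_mat_iff\<close>)
    also have "\<dots> \<le> mnorm (P (int k)) * (mnorm (a i) * mnorm (g (int i - int k - u)))"
      by (intro mult_left_mono mnorm_mult[OF a_carrier g(1)]) auto
    also have "\<dots> \<le> mnorm (P (int k)) * (mnorm (a i) * C)"
      using g(2) by (intro mult_left_mono) auto
    finally show ?thesis using Pair by simp
  qed
  have ex: "\<exists>S. mat_has_sum N d f S I" for I
  proof -
    have "(\<lambda>x. case x of (k, i) \<Rightarrow> mnorm (P (int k)) * (mnorm (a i) * C)) summable_on I"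
      by (rule summable_on_subset_banach[OF prod]) auto
    from mat_summable_le[OF fc this f_le] show ?thesis by blast
  qed
  obtain TA where TA: "mat_has_sum N d f TA A" using ex by blast
  obtain TB where TB: "mat_has_sum N d f TB B" using ex by blast
  have "mat_has_sum N d f (TA + TB) (A \<union> B)"
    by (rule mat_has_sum_Un[OF TA TB]) (auto simp: A_def B_def)
  also have "A \<union> B = Sigma UNIV (\<lambda>_. UNIV)" by (auto simp: A_def B_def)
  finally have tot: "mat_has_sum N d f (TA + TB) (Sigma UNIV (\<lambda>_. UNIV))" .
  have "mat_has_sum N d (\<lambda>k. 0\<^sub>m N d) (TA + TB) (UNIV :: nat set)"
  proof (rule mat_has_sum_Sigma[OF tot])
    fix k :: nat
    have "mat_has_sum N d (\<lambda>i. P (int k) * (a i * g (int i - (int k + u)))) (P (int k) * 0\<^sub>m d d) UNIV"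
      by (rule mat_has_sum_mult_left[OF P_carrier orth]) (use u in auto)
    moreover have "P (int k) * 0\<^sub>m d d = 0\<^sub>m N d" using P_carrier right_mult_zero_mat by blast
    ultimately show "mat_has_sum N d (\<lambda>i. f (k, i)) (0\<^sub>m N d) UNIV"
      by (simp add: f_def algebra_simps)
  qed
  moreover have "mat_has_sum N d (\<lambda>k. 0\<^sub>m N d) (0\<^sub>m N d) (UNIV :: nat set)"
    by (auto simp: mat_has_sum_def)
  ultimately have "TA + TB = 0\<^sub>m N d" by (rule mat_has_sum_unique)
  then have TB': "TB = - TA"
    using mat_has_sumD(1)[OF TA] mat_has_sumD(1)[OF TB] by (rule mat_add_eq_zero)
  have "bij_betw (\<lambda>(s, k). (k, s + k)) (Sigma {1..} (\<lambda>_. UNIV)) A"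
    by (rule bij_betwI[where g = "\<lambda>(k, i). (i - k, k)"]) (auto simp: A_def)
  from mat_has_sum_reindex[OF this, of N d f TA] TA
  have "mat_has_sum N d (\<lambda>x. f (case x of (s, k) \<Rightarrow> (k, s + k))) TA (Sigma {1..} (\<lambda>_. UNIV))" by simp
  then have 1: "mat_has_sum N d (\<lambda>s. vseq N d P a s * g (int s - u)) TA {1..}"
  proof (rule mat_has_sum_Sigma)
    fix s :: nat
    have "mat_has_sum N d (\<lambda>k. P (int k) * a (s + k) * g (int s - u)) (vseq N d P a s * g (int s - u)) UNIV"
      by (rule mat_has_sum_mult_right[OF g(1) vseq_has_sum])
    then show "mat_has_sum N d (\<lambda>k. f (case (s, k) of (s, k) \<Rightarrow> (k, s + k))) (vseq N d P a s * g (int s - u)) UNIV"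
      by (rule mat_has_sum_congI) (use g(1) in \<open>auto simp: f_def assoc_mult_mat[of _ N d _ d _ d]\<close>)
  qed
  have "bij_betw (\<lambda>(s, i). (i + s, i)) (Sigma UNIV (\<lambda>_. UNIV)) B"
    by (rule bij_betwI[where g = "\<lambda>(k, i). (k - i, i)"]) (auto simp: B_def)
  from mat_has_sum_reindex[OF this, of N d f TB] TB
  have "mat_has_sum N d (\<lambda>x. f (case x of (s, i) \<Rightarrow> (i + s, i))) TB (Sigma UNIV (\<lambda>_. UNIV))" by simp
  then have 2: "mat_has_sum N d (\<lambda>s. wseq N d P a (- int s) * g (- int s - u)) TB UNIV"
  proof (rule mat_has_sum_Sigma)
    fix s :: nat
    have "mat_has_sum N d (\<lambda>i. P (int i - (- int s)) * a i * g (- int s - u)) (wseq N d P a (- int s) * g (- int s - u)) UNIV"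
      by (rule mat_has_sum_mult_right[OF g(1) wseq_has_sum])
    then show "mat_has_sum N d (\<lambda>i. f (case (s, i) of (s, i) \<Rightarrow> (i + s, i))) (wseq N d P a (- int s) * g (- int s - u)) UNIV"
      by (rule mat_has_sum_congI) (use g(1) in \<open>auto simp: f_def assoc_mult_mat[of _ N d _ d _ d]\<close>)
  qed
  from 1 2 show thesis unfolding TB' by (rule that)
qed

text \<open>The terms of \<open>w\<^sub>t\<close> with index at least \<open>t\<close> make up \<open>v\<^sub>t\<close>, so the difference is a finite sum.\<close>

lemma wseq_split:
  "mat_has_sum N d (\<lambda>k. P (int k - int t) * a k) (wseq N d P a (int t) - vseq N d P a t) {..<t}"
proof -
  have "bij_betw (\<lambda>l. t + l) UNIV {t..}"
    by (rule bij_betwI[where g = "\<lambda>l. l - t"]) auto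
  from mat_has_sum_reindex[OF this, of N d "\<lambda>k. P (int k - int t) * a k"]
  have 1: "mat_has_sum N d (\<lambda>k. P (int k - int t) * a k) (vseq N d P a t) {t..}"
    using vseq_has_sum[of t] by simp
  let ?S = "mat_sum N d {..<t} (\<lambda>k. P (int k - int t) * a k)"
  have 2: "mat_has_sum N d (\<lambda>k. P (int k - int t) * a k) ?S {..<t}"
    by (rule mat_has_sum_finite) (auto intro!: mult_carrier_mat[of _ N d])
  have "mat_has_sum N d (\<lambda>k. P (int k - int t) * a k) (?S + vseq N d P a t) ({..<t} \<union> {t..})"
    by (rule mat_has_sum_Un[OF 2 1]) auto
  also have "{..<t} \<union> {t..} = UNIV" by auto
  finally have "wseq N d P a (int t) = ?S + vseq N d P a t"
    using wseq_has_sum mat_has_sum_unique by blast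
  then have "wseq N d P a (int t) - vseq N d P a t = ?S"
    by (auto simp: mat_sum_def intro!: eq_matI simp: carrier_matD[OF vseq_carrier])
  then show ?thesis using 2 by simp
qed

text \<open>The Gram matrix of the conjugate family. Taken for the conjugate family it is \<open>\<Lambda>\<close>, for \<open>P\<close> itself the
  transpose of \<open>\<Lambda>\<close>.\<close>

definition gram :: "complex mat"
  where "gram = mat_suminf N N (\<lambda>l. mat_cnj (P (int l)) * transpose_mat (P (int l)))"

lemma gram_has_sum: "mat_has_sum N N (\<lambda>l. mat_cnj (P (int l)) * transpose_mat (P (int l))) gram UNIV"
proof -
  have "mnorm (transpose_mat (P (int l))) \<le> (\<Sum>k. mnorm (P (int k)))" for l
    using P_le[of l] mnorm_adjoint[of "mat_cnj (P (int l))"] by (simp add: mat_adjoint_cnj)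
  then show ?thesis
    unfolding gram_def by (intro mat_has_sum_bounded[where k = d]) (use P_summable in auto)
qed

text \<open>A Hankel form with symbol \<open>B\<close> sends \<open>w\<^sub>-\<^sub>r\<close> to a single term of the sequence \<open>b\<close> which \<open>B\<close> produces
  from \<open>a\<close>.\<close>

lemma hankel_row:
  assumes X: "X \<in> carrier_mat N N"
    and hank: "\<And>k l. transpose_mat (P k) * X * P l = B (int n + k + l)"
    and rel: "\<And>k. k \<ge> n0 \<Longrightarrow> mat_has_sum d d (\<lambda>l. B (int (k + l)) * a l) (- b (Suc k)) UNIV"
    and b: "\<And>k. b k \<in> carrier_mat d d"
    and e: "int n + int r + e \<ge> int n0"
  shows "transpose_mat (P e) * (X * wseq N d P a (- int r)) = - b (nat (int n + int r + e + 1))"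
proof -
  let ?k = "nat (int n + int r + e)"
  have "mat_has_sum d d (\<lambda>l. transpose_mat (P e) * X * (P (int l - (- int r)) * a l))
      (transpose_mat (P e) * X * wseq N d P a (- int r)) UNIV"
    by (rule mat_has_sum_mult_left[OF _ wseq_has_sum]) (use X in auto)
  then have 1: "mat_has_sum d d (\<lambda>l. B (int (?k + l)) * a l) (transpose_mat (P e) * X * wseq N d P a (- int r)) UNIV"
  proof (rule mat_has_sum_congI)
    fix l :: nat
    have "transpose_mat (P e) * X * (P (int l - (- int r)) * a l) = (transpose_mat (P e) * X * P (int l + int r)) * a l"
      using X by (simp add: assoc_mult_mat[of "transpose_mat (P e) * X" d N "P (int l + int r)" d "a l" d] mult_carrier_mat_iff)
    also have "\<dots> = B (int (?k + l)) * a l"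
      using e by (simp add: hank algebra_simps)
    finally show "B (int (?k + l)) * a l = transpose_mat (P e) * X * (P (int l - (- int r)) * a l)" by simp
  qed simp
  have "transpose_mat (P e) * X * wseq N d P a (- int r) = - b (Suc ?k)"
    by (rule mat_has_sum_unique[OF 1 rel]) (use e in linarith)
  moreover have "Suc ?k = nat (int n + int r + e + 1)" using e by (auto simp: nat_add_distrib)
  ultimately show ?thesis using X by (simp add: assoc_mult_mat[of _ d N _ N _ d])
qed

text \<open>The rows of \<open>hankel_row\<close>, summed against the conjugate family, give a tail sum of \<open>b\<close>.\<close>

lemma hankel_gram:
  assumes X: "X \<in> carrier_mat N N"
    and hank: "\<And>k l. transpose_mat (P k) * X * P l = B (int n + k + l)"
    and rel: "\<And>k. k \<ge> n0 \<Longrightarrow> mat_has_sum d d (\<lambda>l. B (int (k + l)) * a l) (- b (Suc k)) UNIV"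
    and b: "\<And>k. b k \<in> carrier_mat d d"
    and n: "n0 \<le> n"
  shows "gram * (X * wseq N d P a (- int r)) = - vseq N d (\<lambda>k. mat_cnj (P k)) b (n + 1 + r)"
proof -
  let ?Y = "X * wseq N d P a (- int r)"
  have Y: "?Y \<in> carrier_mat N d" using X by (auto intro!: mult_carrier_mat[of _ N N])
  have "mat_has_sum N d (\<lambda>l. - (mat_cnj (P (int l)) * transpose_mat (P (int l)) * ?Y)) (- (gram * ?Y)) UNIV"
    by (intro mat_has_sum_uminus mat_has_sum_mult_right[OF Y] gram_has_sum)
  then have "mat_has_sum N d (\<lambda>l. mat_cnj (P (int l)) * b (n + 1 + r + l)) (- (gram * ?Y)) UNIV"
  proof (rule mat_has_sum_congI)
    fix l :: nat
    have "mat_cnj (P (int l)) * transpose_mat (P (int l)) * ?Y = mat_cnj (P (int l)) * (transpose_mat (P (int l)) * ?Y)"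
      using Y by (intro assoc_mult_mat[of _ N d _ N _ d]) auto
    also have "transpose_mat (P (int l)) * ?Y = - b (nat (int n + int r + int l + 1))"
      by (rule hankel_row[OF X hank rel b]) (use n in auto)
    also have "nat (int n + int r + int l + 1) = n + 1 + r + l" by simp
    also have "mat_cnj (P (int l)) * - b (n + 1 + r + l) = - (mat_cnj (P (int l)) * b (n + 1 + r + l))"
      by (rule uminus_mult_right_mat) (simp add: carrier_matD[OF b])
    finally show "mat_cnj (P (int l)) * b (n + 1 + r + l) = - (mat_cnj (P (int l)) * transpose_mat (P (int l)) * ?Y)"
      by simp
  qed simp
  then have "vseq N d (\<lambda>k. mat_cnj (P k)) b (n + 1 + r) = - (gram * ?Y)"
    unfolding vseq_def by (rule mat_has_sum_suminf)
  then show ?thesis by simp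
qed

end

text \<open>What the verification of the inverse uses about the coefficients \<open>g\<close> of a Hermitian density. The sequence \<open>c\<close>
  is what \<open>g\<close> produces from \<open>a'\<close>, and the adjoint of \<open>c\<close> is inverse to \<open>a'\<close> under convolution, up to the sign.
  The Hankel symbol \<open>B\<close> turns \<open>a\<close> into \<open>a'\<close> and \<open>a'\<close> into \<open>a\<close> from the index \<open>n0\<close> on, and beyond the index \<open>n\<close>
  it factors through \<open>Q\<close>. The assumptions up to \<open>a'_orth\<close> are symmetric under exchanging \<open>a\<close> with \<open>a'\<close>, \<open>g k\<close> with
  \<open>g (- k)\<close>, \<open>P\<close> with its conjugate, and \<open>Q\<close> and \<open>B\<close> with their adjoints; this symmetry exchanges \<open>G\<close> and \<open>G'\<close>.\<close>

locale toeplitz_inverse_data =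
  fixes d N n0 n :: nat and g :: "int \<Rightarrow> complex mat" and a a' c :: "nat \<Rightarrow> complex mat"
    and P B :: "int \<Rightarrow> complex mat" and Q :: "complex mat"
  assumes P_carrier: "\<And>k. P k \<in> carrier_mat N d"
    and P_summable: "summable (\<lambda>l. mnorm (P (int l)))"
    and a_carrier: "\<And>k. a k \<in> carrier_mat d d" "\<And>k. a' k \<in> carrier_mat d d"
    and a_summable: "summable (\<lambda>l. mnorm (a l))" "summable (\<lambda>l. mnorm (a' l))"
    and g_carrier [simp]: "\<And>k. g k \<in> carrier_mat d d"
    and g_bounded: "\<exists>C. \<forall>k. mnorm (g k) \<le> C"
    and g_herm: "\<And>k. mat_adjoint (g k) = g (- k)"
    and Q_carrier [simp]: "Q \<in> carrier_mat N N"
    and hank: "\<And>k l. transpose_mat (P k) * Q * P l = B (int n + k + l)"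
    and n: "n0 + 1 \<le> n"
    and a'_rel: "\<And>k. k \<ge> n0 \<Longrightarrow> mat_has_sum d d (\<lambda>l. B (int (k + l)) * a l) (- a' (Suc k)) UNIV"
    and a_rel: "\<And>k. k \<ge> n0 \<Longrightarrow>
      mat_has_sum d d (\<lambda>l. mat_adjoint (B (int (k + l))) * a' l) (- a (Suc k)) UNIV"
    and a_orth: "\<And>j. j \<ge> 1 \<Longrightarrow> mat_has_sum d d (\<lambda>k. a k * g (j - int k)) (0\<^sub>m d d) UNIV"
    and a'_orth: "\<And>j. j \<ge> 1 \<Longrightarrow> mat_has_sum d d (\<lambda>k. a' k * g (int k - j)) (0\<^sub>m d d) UNIV"
    and c_carrier [simp]: "\<And>k. c k \<in> carrier_mat d d"
    and a'_c: "\<And>j. mat_has_sum d d (\<lambda>k. a' k * g (int k + int j)) (- c j) UNIV"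
    and c_inv: "\<And>q. mat_sum d d {..q} (\<lambda>i. mat_adjoint (c i) * a' (q - i)) =
      (if q = 0 then - 1\<^sub>m d else 0\<^sub>m d d)"

begin

sublocale X: coeff_data d N P a
  by unfold_locales (rule P_carrier a_carrier P_summable a_summable)+

sublocale Y: coeff_data d N "\<lambda>k. mat_cnj (P k)" a'
  by unfold_locales (simp_all add: P_carrier a_carrier P_summable a_summable)

lemma g_dim [simp]: "dim_row (g k) = d" "dim_col (g k) = d"
  using carrier_matD[OF g_carrier] by auto

lemma Q_dim [simp]: "dim_row Q = N" "dim_col Q = N"
  using carrier_matD[OF Q_carrier] by auto

abbreviation "v s \<equiv> vseq N d P a s"

abbreviation "v' s \<equiv> vseq N d (\<lambda>k. mat_cnj (P k)) a' s"

abbreviation "w e \<equiv> wseq N d P a e"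

abbreviation "w' e \<equiv> wseq N d (\<lambda>k. mat_cnj (P k)) a' e"

definition "Lam = mat_suminf N N (\<lambda>l. P (int l) * mat_adjoint (P (int l)))"

definition "G = Q * Lam"

definition "G' = mat_adjoint Q * transpose_mat Lam"

definition "R s = Q * v (n + 1 - s) + G * mat_adjoint Q * v' s"

definition "L t = mat_adjoint (w' (int t) - v' t) * mat_inv (1\<^sub>m N - G * G')"

definition "Y s t = mat_sum d d {1..min s t} (\<lambda>l. mat_adjoint (a' (s - l)) * a' (t - l))"

lemma Lam_eq: "Lam = Y.gram"
  by (simp add: Lam_def Y.gram_def transpose_cnj)

lemma Lam_carrier [simp]: "Lam \<in> carrier_mat N N"
  by (simp add: Lam_def)

lemma Lam_dim [simp]: "dim_row Lam = N" "dim_col Lam = N"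
  using carrier_matD[OF Lam_carrier] by auto

lemma G_carrier [simp]: "G \<in> carrier_mat N N" "G' \<in> carrier_mat N N"
  by (simp_all add: G_def G'_def mult_carrier_mat_iff)

lemma G_dim [simp]: "dim_row G = N" "dim_col G = N" "dim_row G' = N" "dim_col G' = N"
  using carrier_matD[OF G_carrier(1)] carrier_matD[OF G_carrier(2)] by auto

lemma Lam_transpose: "transpose_mat Lam = X.gram"
proof -
  have "mat_has_sum N N (\<lambda>l. transpose_mat (mat_cnj (mat_cnj (P (int l))) * transpose_mat (mat_cnj (P (int l)))))
      (transpose_mat Lam) UNIV"
    unfolding Lam_eq by (rule mat_has_sum_transpose[OF Y.gram_has_sum])
  then have "mat_has_sum N N (\<lambda>l. mat_cnj (P (int l)) * transpose_mat (P (int l))) (transpose_mat Lam) UNIV"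
    by (rule mat_has_sum_congI) (simp_all add: transpose_mult[of _ N d _ N])
  with X.gram_has_sum show ?thesis using mat_has_sum_unique by blast
qed

lemma hank': "transpose_mat (mat_cnj (P k)) * mat_adjoint Q * mat_cnj (P l) = mat_adjoint (B (int n + k + l))"
proof -
  have "mat_adjoint (B (int n + l + k)) = mat_adjoint (transpose_mat (P l) * Q * P k)"
    by (simp add: hank)
  also have "\<dots> = mat_adjoint (P k) * mat_adjoint (transpose_mat (P l) * Q)"
    by (rule mat_adjoint_mult[of _ d N]) (auto simp: mult_carrier_mat_iff)
  also have "mat_adjoint (transpose_mat (P l) * Q) = mat_adjoint Q * mat_cnj (P l)"
    by (subst mat_adjoint_mult[of _ d N _ N]) (auto simp: mat_adjoint_transpose)
  finally show ?thesis
    by (simp add: transpose_cnj algebra_simps assoc_mult_mat[of _ d N _ N _ d])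
qed

lemma Lam_wseq: "Lam * (mat_adjoint Q * w' (- int r)) = - v (n + 1 + r)"
  using Y.hankel_gram[of "mat_adjoint Q" "\<lambda>k. mat_adjoint (B k)", OF _ hank' a_rel a_carrier(1)] n
  by (simp add: Lam_eq)

lemma Lam_transpose_wseq: "transpose_mat Lam * (Q * w (- int r)) = - v' (n + 1 + r)"
  using X.hankel_gram[of Q B, OF _ hank a'_rel a_carrier(2)] n by (simp add: Lam_transpose)

text \<open>The full series of the \<open>v\<close> and of the \<open>v'\<close> against \<open>g\<close> are known from \<open>vseq_wseq_balance\<close>, up to two unknowns \<open>S\<close>
  and \<open>T\<close>. Their tails are again multiples of \<open>T\<close> and \<open>S\<close>, so the sums up to \<open>n\<close> satisfy a linear system in \<open>S\<close>
  and \<open>T\<close>. The combination \<open>R\<close> is chosen such that \<open>T\<close> is eliminated and \<open>1 - G * G'\<close> remains in front of \<open>Q * S\<close>.\<close>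

lemma R_convolution:
  assumes u: "u \<in> {1..n}"
  obtains T where "mat_has_sum N d (\<lambda>j. w (- int j) * g (int (n + 1 + j) - int u)) (- T) UNIV"
    "mat_has_sum N d (\<lambda>s. R s * g (int s - int u)) ((1\<^sub>m N - G * G') * (Q * T)) {1..n}"
proof -
  obtain C where C: "\<And>k. mnorm (g k) \<le> C" using g_bounded by blast
  obtain T where T: "mat_has_sum N d (\<lambda>s. v' s * g (int s - int u)) T {1..}"
      "mat_has_sum N d (\<lambda>s. w' (- int s) * g (- int s - int u)) (- T) UNIV"
    using Y.vseq_wseq_balance[OF g_carrier C a'_orth, of "int u"] u by auto
  obtain S where S: "mat_has_sum N d (\<lambda>s. v s * g (- (int s - int (n + 1 - u)))) S {1..}"
      "mat_has_sum N d (\<lambda>s. w (- int s) * g (- (- int s - int (n + 1 - u)))) (- S) UNIV"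
  proof -
    have orth: "mat_has_sum d d (\<lambda>k. a k * g (- (int k - j))) (0\<^sub>m d d) UNIV" if "1 \<le> j" for j
      using a_orth[OF that] by simp
    have u1: "1 \<le> int (n + 1 - u)" using u by auto
    show ?thesis
      by (rule X.vseq_wseq_balance[of "\<lambda>k. g (- k)", OF g_carrier C orth u1]) (assumption, erule (1) that)
  qed
  have Tc: "T \<in> carrier_mat N d" using mat_has_sumD(1)[OF T(1)] .
  have Sc: "S \<in> carrier_mat N d" using mat_has_sumD(1)[OF S(1)] .
  have bij: "bij_betw (\<lambda>r. n + 1 + r) UNIV {n + 1..}"
    by (rule bij_betwI[where g = "\<lambda>l. l - (n + 1)"]) auto
  have Sw: "mat_has_sum N d (\<lambda>j. w (- int j) * g (int (n + 1 + j) - int u)) (- S) UNIV"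
    by (rule mat_has_sum_congI[OF S(2)]) (use u in \<open>auto simp: algebra_simps of_nat_diff\<close>)
  \<comment> \<open>the tail of the series for \<open>S\<close> is expressed by \<open>T\<close>\<close>
  have "mat_has_sum N d (\<lambda>s. - (Lam * mat_adjoint Q * (w' (- int s) * g (- int s - int u))))
      (- (Lam * mat_adjoint Q * - T)) UNIV"
    by (intro mat_has_sum_uminus mat_has_sum_mult_left[OF _ T(2)]) (simp add: mult_carrier_mat_iff)
  then have "mat_has_sum N d (\<lambda>r. v (n + 1 + r) * g (- (int (n + 1 + r) - int (n + 1 - u))))
      (Lam * (mat_adjoint Q * T)) UNIV"
  proof (rule mat_has_sum_congI)
    fix r :: nat
    have "Lam * mat_adjoint Q * (w' (- int r) * g (- int r - int u)) =
        Lam * (mat_adjoint Q * w' (- int r)) * g (- int r - int u)"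
      by (rule assoc_mult_mat4[of _ N N _ N _ d _ d]) auto
    also have "\<dots> = - (v (n + 1 + r) * g (- int r - int u))"
      unfolding Lam_wseq by (rule uminus_mult_left_mat) (simp add: carrier_matD[OF vseq_carrier])
    finally show "v (n + 1 + r) * g (- (int (n + 1 + r) - int (n + 1 - u))) =
      - (Lam * mat_adjoint Q * (w' (- int r) * g (- int r - int u)))"
      using u by (simp add: of_nat_diff algebra_simps)
  next
    have "Lam * mat_adjoint Q * - T = - (Lam * mat_adjoint Q * T)"
      using Tc by (intro uminus_mult_right_mat) auto
    then show "Lam * (mat_adjoint Q * T) = - (Lam * mat_adjoint Q * - T)"
      using Tc by (simp add: assoc_mult_mat[of _ N N _ N _ d])
  qed
  then have tail: "mat_has_sum N d (\<lambda>s. v s * g (- (int s - int (n + 1 - u)))) (Lam * (mat_adjoint Q * T)) {n + 1..}"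
    using mat_has_sum_reindex[OF bij, of N d "\<lambda>s. v s * g (- (int s - int (n + 1 - u)))"] by simp
  define V where "V = mat_sum N d {1..n} (\<lambda>s. v s * g (- (int s - int (n + 1 - u))))"
  have V: "mat_has_sum N d (\<lambda>s. v s * g (- (int s - int (n + 1 - u)))) V {1..n}"
    unfolding V_def by (rule mat_has_sum_finite) (auto simp: mult_carrier_mat_iff carrier_matD[OF vseq_carrier])
  have VS: "V + Lam * (mat_adjoint Q * T) = S"
    by (rule mat_has_sum_head_tail[OF V tail S(1)])
  have "bij_betw (\<lambda>s. n + 1 - s) {1..n} {1..n}"
    by (rule bij_betwI[where g = "\<lambda>s. n + 1 - s"]) auto
  from mat_has_sum_reindex[OF this, of N d "\<lambda>s. v s * g (- (int s - int (n + 1 - u)))"] V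
  have "mat_has_sum N d (\<lambda>s. v (n + 1 - s) * g (- (int (n + 1 - s) - int (n + 1 - u)))) V {1..n}" by simp
  then have V': "mat_has_sum N d (\<lambda>s. v (n + 1 - s) * g (int s - int u)) V {1..n}"
    by (rule mat_has_sum_congI) (use u in \<open>auto simp: of_nat_diff algebra_simps\<close>)
  \<comment> \<open>and the tail of the series for \<open>T\<close> by \<open>S\<close>\<close>
  have "mat_has_sum N d (\<lambda>j. - (transpose_mat Lam * Q * (w (- int j) * g (int (n + 1 + j) - int u))))
      (- (transpose_mat Lam * Q * - S)) UNIV"
    by (intro mat_has_sum_uminus mat_has_sum_mult_left[OF _ Sw]) (simp add: mult_carrier_mat_iff)
  then have "mat_has_sum N d (\<lambda>r. v' (n + 1 + r) * g (int (n + 1 + r) - int u))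
      (transpose_mat Lam * (Q * S)) UNIV"
  proof (rule mat_has_sum_congI)
    fix r :: nat
    have "transpose_mat Lam * Q * (w (- int r) * g (int (n + 1 + r) - int u)) =
        transpose_mat Lam * (Q * w (- int r)) * g (int (n + 1 + r) - int u)"
      by (rule assoc_mult_mat4[of _ N N _ N _ d _ d]) auto
    also have "\<dots> = - (v' (n + 1 + r) * g (int (n + 1 + r) - int u))"
      unfolding Lam_transpose_wseq by (rule uminus_mult_left_mat) (simp add: carrier_matD[OF vseq_carrier])
    finally show "v' (n + 1 + r) * g (int (n + 1 + r) - int u) =
      - (transpose_mat Lam * Q * (w (- int r) * g (int (n + 1 + r) - int u)))" by simp
  next
    have "transpose_mat Lam * Q * - S = - (transpose_mat Lam * Q * S)"
      using Sc by (intro uminus_mult_right_mat) auto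
    then show "transpose_mat Lam * (Q * S) = - (transpose_mat Lam * Q * - S)"
      using Sc by (simp add: assoc_mult_mat[of _ N N _ N _ d])
  qed
  then have tail': "mat_has_sum N d (\<lambda>s. v' s * g (int s - int u)) (transpose_mat Lam * (Q * S)) {n + 1..}"
    using mat_has_sum_reindex[OF bij, of N d "\<lambda>s. v' s * g (int s - int u)"] by simp
  define W where "W = mat_sum N d {1..n} (\<lambda>s. v' s * g (int s - int u))"
  have W: "mat_has_sum N d (\<lambda>s. v' s * g (int s - int u)) W {1..n}"
    unfolding W_def by (rule mat_has_sum_finite) (auto simp: mult_carrier_mat_iff carrier_matD[OF vseq_carrier])
  have WT: "W + transpose_mat Lam * (Q * S) = T"
    by (rule mat_has_sum_head_tail[OF W tail' T(1)])
  have c: "V \<in> carrier_mat N d" "W \<in> carrier_mat N d" by (simp_all add: V_def W_def)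
  have "mat_has_sum N d (\<lambda>s. Q * (v (n + 1 - s) * g (int s - int u)) + G * mat_adjoint Q * (v' s * g (int s - int u)))
      (Q * V + G * mat_adjoint Q * W) {1..n}"
    by (intro mat_has_sum_add mat_has_sum_mult_left[OF _ V'] mat_has_sum_mult_left[OF _ W])
      (simp_all add: mult_carrier_mat_iff)
  then have "mat_has_sum N d (\<lambda>s. R s * g (int s - int u)) ((1\<^sub>m N - G * G') * (Q * S)) {1..n}"
  proof (rule mat_has_sum_congI)
    fix s
    have "R s * g (int s - int u) = Q * v (n + 1 - s) * g (int s - int u) + G * mat_adjoint Q * v' s * g (int s - int u)"
      unfolding R_def by (rule add_mult_distrib_mat[of _ N d _ _ d]) (auto simp: mult_carrier_mat_iff carrier_matD[OF vseq_carrier])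
    then show "R s * g (int s - int u) =
      Q * (v (n + 1 - s) * g (int s - int u)) + G * mat_adjoint Q * (v' s * g (int s - int u))"
      by (simp add: assoc_mult_mat[of _ N N _ d _ d] mult_carrier_mat_iff)
  next
    let ?Z = "G * (mat_adjoint Q * T)"
    have QS: "Q * S \<in> carrier_mat N d" using Sc by (simp add: mult_carrier_mat_iff)
    have Z: "?Z \<in> carrier_mat N d" using Tc by (simp add: mult_carrier_mat_iff)
    have eq1: "Q * S = Q * V + ?Z"
    proof -
      have "Q * S = Q * V + Q * (Lam * (mat_adjoint Q * T))"
        unfolding VS[symmetric] using c Tc by (intro mult_add_distrib_mat[of _ N N]) (auto simp: mult_carrier_mat_iff)
      also have "Q * (Lam * (mat_adjoint Q * T)) = ?Z"
        unfolding G_def using Tc by (intro assoc_mult_mat[symmetric, of _ N N _ N _ d]) (auto simp: mult_carrier_mat_iff)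
      finally show ?thesis .
    qed
    have eq2: "?Z = G * mat_adjoint Q * W + G * G' * (Q * S)"
    proof -
      have "?Z = G * mat_adjoint Q * T" using Tc by (simp add: assoc_mult_mat[of _ N N _ N _ d])
      also have "\<dots> = G * mat_adjoint Q * W + G * mat_adjoint Q * (transpose_mat Lam * (Q * S))"
        unfolding WT[symmetric] using c Sc by (intro mult_add_distrib_mat[of _ N N]) (auto simp: mult_carrier_mat_iff)
      also have "G * mat_adjoint Q * (transpose_mat Lam * (Q * S)) = G * G' * (Q * S)"
        unfolding G'_def using QS by (simp add: assoc_mult_mat[of _ N N _ N _ d] mult_carrier_mat_iff)
      finally show ?thesis .
    qed
    have "(1\<^sub>m N - G * G') * (Q * S) = Q * S - G * G' * (Q * S)"
      using QS by (subst minus_mult_distrib_mat[of _ N N]) (auto simp: mult_carrier_mat_iff)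
    also have "\<dots> = Q * V + G * mat_adjoint Q * W"
    proof (rule eq_matI)
      fix i j assume "i < dim_row (Q * V + G * mat_adjoint Q * W)" "j < dim_col (Q * V + G * mat_adjoint Q * W)"
      then have ij: "i < N" "j < d" using c by auto
      have "(Q * S) $$ (i, j) = (Q * V) $$ (i, j) + ?Z $$ (i, j)"
        using arg_cong[OF eq1, of "\<lambda>M. M $$ (i, j)"] ij c Tc by simp
      moreover have "?Z $$ (i, j) = (G * mat_adjoint Q * W) $$ (i, j) + (G * G' * (Q * S)) $$ (i, j)"
        using arg_cong[OF eq2, of "\<lambda>M. M $$ (i, j)"] ij c Sc by simp
      ultimately show "(Q * S - G * G' * (Q * S)) $$ (i, j) = (Q * V + G * mat_adjoint Q * W) $$ (i, j)"
        using ij c Sc by simp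
    qed (use c Sc in auto)
    finally show "(1\<^sub>m N - G * G') * (Q * S) = Q * V + G * mat_adjoint Q * W" .
  qed
  with Sw show thesis by (rule that)
qed

text \<open>\<open>Y\<close> inverts the infinite Toeplitz matrix: \<open>g\<close> against a shift of \<open>a'\<close> is a term of \<open>c\<close> or zero, and
  \<open>c_inv\<close> evaluates the remaining finite sum.\<close>

lemma Y_convolution:
  assumes u: "u \<ge> 1" and t: "t \<ge> 1"
  shows "mat_has_sum d d (\<lambda>s. g (int u - int s) * Y s t) (if u = t then 1\<^sub>m d else 0\<^sub>m d d) {1..}"
proof -
  \<comment> \<open>\<open>S l\<close> is the contribution of the \<open>l\<close>-th term of \<open>Y\<close> to the whole series\<close>
  define S where "S = (\<lambda>l. if l \<ge> u then - (mat_adjoint (c (l - u)) * a' (t - l)) else 0\<^sub>m d d)"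
  define f where "f = (\<lambda>l s. if l \<le> s then g (int u - int s) * (mat_adjoint (a' (s - l)) * a' (t - l)) else 0\<^sub>m d d)"
  have f: "mat_has_sum d d (f l) (S l) {1..}" if l: "l \<in> {1..t}" for l
  proof -
    have "\<exists>Z. mat_has_sum d d (\<lambda>i. a' i * g (int i - (int u - int l))) Z UNIV \<and>
        mat_adjoint Z * a' (t - l) = S l"
    proof (cases "l \<ge> u")
      case True
      have "mat_has_sum d d (\<lambda>i. a' i * g (int i - (int u - int l))) (- c (l - u)) UNIV"
        using a'_c[of "l - u"] True by (simp add: of_nat_diff algebra_simps)
      moreover have "mat_adjoint (- c (l - u)) * a' (t - l) = - (mat_adjoint (c (l - u)) * a' (t - l))"
        unfolding mat_adjoint_uminus by (rule uminus_mult_left_mat) (simp add: carrier_matD[OF c_carrier])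
      ultimately show ?thesis using True by (auto simp: S_def)
    next
      case False
      then show ?thesis using a'_orth[of "int u - int l"] by (auto simp: S_def a_carrier intro!: exI[of _ "0\<^sub>m d d"])
    qed
    then obtain Z where Z: "mat_has_sum d d (\<lambda>i. a' i * g (int i - (int u - int l))) Z UNIV"
        "mat_adjoint Z * a' (t - l) = S l" by blast
    have "mat_has_sum d d (\<lambda>i. mat_adjoint (a' i * g (int i - (int u - int l))) * a' (t - l)) (S l) UNIV"
      unfolding Z(2)[symmetric] by (rule mat_has_sum_mult_right[OF a_carrier(2) mat_has_sum_adjoint[OF Z(1)]])
    then have "mat_has_sum d d (\<lambda>i. f l (l + i)) (S l) UNIV"
    proof (rule mat_has_sum_congI)
      fix i
      have "mat_adjoint (a' i * g (int i - (int u - int l))) = g (int u - int (l + i)) * mat_adjoint (a' i)"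
        using a_carrier by (subst mat_adjoint_mult[of _ d d _ d]) (auto simp: g_herm algebra_simps)
      then show "f l (l + i) = mat_adjoint (a' i * g (int i - (int u - int l))) * a' (t - l)"
        using a_carrier by (simp add: f_def assoc_mult_mat[of _ d d _ d _ d])
    qed simp
    moreover have "bij_betw (\<lambda>i. l + i) UNIV {l..}"
      by (rule bij_betwI[where g = "\<lambda>i. i - l"]) auto
    ultimately have "mat_has_sum d d (f l) (S l) {l..}"
      using mat_has_sum_reindex[of "\<lambda>i. l + i" UNIV "{l..}" d d "f l"] by simp
    moreover have "mat_has_sum d d (f l) (0\<^sub>m d d) {1..<l}"
      unfolding mat_has_sum_def by (auto simp: f_def intro!: has_sum_0)
    moreover have "{l..} \<inter> {1..<l} = {}" "{l..} \<union> {1..<l} = {1..}" using l by auto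
    ultimately have "mat_has_sum d d (f l) (S l + 0\<^sub>m d d) {1..}" using mat_has_sum_Un by metis
    then show ?thesis using mat_has_sumD(1)[OF \<open>mat_has_sum d d (f l) (S l) {l..}\<close>] by simp
  qed
  have "mat_has_sum d d (\<lambda>s. mat_sum d d {1..t} (\<lambda>l. f l s)) (mat_sum d d {1..t} S) {1..}"
    by (rule mat_has_sum_mat_sum) (use f in auto)
  then show ?thesis
  proof (rule mat_has_sum_congI)
    fix s :: nat
    have "g (int u - int s) * Y s t = mat_sum d d {1..min s t} (\<lambda>l. g (int u - int s) * (mat_adjoint (a' (s - l)) * a' (t - l)))"
      unfolding Y_def by (rule mat_sum_mult_left) (auto simp: mult_carrier_mat_iff)
    also have "\<dots> = mat_sum d d {1..t} (\<lambda>l. f l s)"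
    proof (rule eq_matI)
      fix i j assume "i < dim_row (mat_sum d d {1..t} (\<lambda>l. f l s))" "j < dim_col (mat_sum d d {1..t} (\<lambda>l. f l s))"
      then have ij: "i < d" "j < d" by (auto simp: mat_sum_def)
      have "(\<Sum>l\<in>{1..t}. f l s $$ (i, j)) = (\<Sum>l\<in>{1..min s t}. f l s $$ (i, j))"
        by (rule sum.mono_neutral_right) (use ij in \<open>auto simp: f_def\<close>)
      then show "mat_sum d d {1..min s t} (\<lambda>l. g (int u - int s) * (mat_adjoint (a' (s - l)) * a' (t - l))) $$ (i, j) =
          mat_sum d d {1..t} (\<lambda>l. f l s) $$ (i, j)"
        using ij by (auto simp: mat_sum_def f_def intro!: sum.cong)
    qed (auto simp: mat_sum_def)
    finally show "g (int u - int s) * Y s t = mat_sum d d {1..t} (\<lambda>l. f l s)" .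
  next
    show "(if u = t then 1\<^sub>m d else 0\<^sub>m d d) = mat_sum d d {1..t} S"
    proof (rule eq_matI)
      fix i j assume "i < dim_row (mat_sum d d {1..t} S)" "j < dim_col (mat_sum d d {1..t} S)"
      then have ij: "i < d" "j < d" by (auto simp: mat_sum_def)
      have "(\<Sum>l\<in>{1..t}. S l $$ (i, j)) = (\<Sum>l\<in>{u..t}. - (mat_adjoint (c (l - u)) * a' (t - l)) $$ (i, j))"
        by (rule sum.mono_neutral_cong_right) (use u ij in \<open>auto simp: S_def carrier_matD[OF c_carrier]\<close>)
      also have "\<dots> = (if u = t then 1\<^sub>m d else 0\<^sub>m d d) $$ (i, j)"
      proof (cases "u \<le> t")
        case True
        have "(\<Sum>l\<in>{u..t}. - (mat_adjoint (c (l - u)) * a' (t - l)) $$ (i, j)) =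
            (\<Sum>k\<in>{..t - u}. - (mat_adjoint (c k) * a' (t - u - k)) $$ (i, j))"
          by (rule sum.reindex_bij_witness[of _ "\<lambda>k. k + u" "\<lambda>l. l - u"]) (use True in auto)
        also have "\<dots> = - (mat_sum d d {..t - u} (\<lambda>i. mat_adjoint (c i) * a' (t - u - i)) $$ (i, j))"
          using ij by (simp add: mat_sum_def sum_negf)
        also have "\<dots> = (if u = t then 1\<^sub>m d else 0\<^sub>m d d) $$ (i, j)"
          unfolding c_inv using True ij by auto
        finally show ?thesis .
      qed (use ij in auto)
      finally show "(if u = t then 1\<^sub>m d else 0\<^sub>m d d) $$ (i, j) = mat_sum d d {1..t} S $$ (i, j)"
        using ij by (simp add: mat_sum_def)
    qed (auto simp: mat_sum_def)
  qed
qed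

text \<open>Beyond \<open>n\<close> the terms \<open>a' (s - l)\<close> have indices above \<open>n0\<close>, because \<open>t \<le> n - n0\<close>. There the Hankel relation
  writes them through \<open>w\<^sub>-\<^sub>j\<close>, and the dependence on \<open>t\<close> splits off as a factor.\<close>

lemma Y_convolution_tail:
  assumes u: "u \<in> {1..n}" and t: "t \<in> {1..n - n0}"
    and T: "mat_has_sum N d (\<lambda>j. w (- int j) * g (int (n + 1 + j) - int u)) (- T) UNIV"
  shows "mat_has_sum d d (\<lambda>s. g (int u - int s) * Y s t) (mat_adjoint (Q * T) * (w' (int t) - v' t)) {n + 1..}"
proof -
  let ?q = "w' (int t) - v' t"
  have Tc: "T \<in> carrier_mat N d" using mat_has_sumD(1)[OF T] by auto
  have qc: "?q \<in> carrier_mat N d" by (rule minus_carrier_mat) simp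
  have QTd: "dim_row (Q * T) = N" by simp
  have inner: "mat_adjoint (Q * w (- int j)) * ?q = - Y (n + 1 + j) t" for j
  proof -
    have "mat_has_sum d d (\<lambda>k. mat_adjoint (Q * w (- int j)) * (mat_cnj (P (int k - int t)) * a' k))
        (mat_adjoint (Q * w (- int j)) * ?q) {..<t}"
      by (intro mat_has_sum_mult_left[OF _ Y.wseq_split]) (auto simp: mult_carrier_mat_iff carrier_matD[OF wseq_carrier])
    then have "mat_has_sum d d (\<lambda>k. - (mat_adjoint (a' (n + 1 + j - (t - k))) * a' (t - (t - k))))
      (mat_adjoint (Q * w (- int j)) * ?q) {..<t}"
    proof (rule mat_has_sum_congI)
      fix k assume k: "k \<in> {..<t}"
      let ?x = "Q * w (- int j)"
      have xc: "?x \<in> carrier_mat N d" by (simp add: mult_carrier_mat_iff carrier_matD[OF wseq_carrier])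
      have kt: "int n + int j + (int k - int t) \<ge> int n0" using t n by (auto simp: of_nat_diff)
      have "transpose_mat (P (int k - int t)) * ?x = - a' (nat (int n + int j + (int k - int t) + 1))"
        by (rule X.hankel_row[OF Q_carrier hank a'_rel a_carrier(2) kt])
      also have "nat (int n + int j + (int k - int t) + 1) = n + 1 + j - (t - k)"
        using k t n by (auto simp: nat_eq_iff of_nat_diff)
      finally have "mat_adjoint (transpose_mat (P (int k - int t)) * ?x) = - mat_adjoint (a' (n + 1 + j - (t - k)))"
        by (simp add: mat_adjoint_uminus)
      then have 1: "mat_adjoint ?x * mat_cnj (P (int k - int t)) = - mat_adjoint (a' (n + 1 + j - (t - k)))"
        using xc by (subst (asm) mat_adjoint_mult[of _ d N _ d]) (auto simp: mat_adjoint_transpose)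
      have "mat_adjoint ?x * (mat_cnj (P (int k - int t)) * a' k) = mat_adjoint ?x * mat_cnj (P (int k - int t)) * a' k"
        using xc by (intro assoc_mult_mat[symmetric, of _ d N _ d _ d]) auto
      also have "\<dots> = - (mat_adjoint (a' (n + 1 + j - (t - k))) * a' k)"
        unfolding 1 by (rule uminus_mult_left_mat) simp
      finally show "- (mat_adjoint (a' (n + 1 + j - (t - k))) * a' (t - (t - k))) =
          mat_adjoint ?x * (mat_cnj (P (int k - int t)) * a' k)" using k by simp
    qed simp
    moreover have "bij_betw (\<lambda>k. t - k) {..<t} {1..t}"
      by (rule bij_betwI[where g = "\<lambda>k. t - k"]) auto
    ultimately have 2: "mat_has_sum d d (\<lambda>l. - (mat_adjoint (a' (n + 1 + j - l)) * a' (t - l)))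
        (mat_adjoint (Q * w (- int j)) * ?q) {1..t}"
      using mat_has_sum_reindex[of "\<lambda>k. t - k" "{..<t}" "{1..t}" d d "\<lambda>l. - (mat_adjoint (a' (n + 1 + j - l)) * a' (t - l))"]
      by simp
    have "mat_has_sum d d (\<lambda>l. - (mat_adjoint (a' (n + 1 + j - l)) * a' (t - l))) (- Y (n + 1 + j) t) {1..min (n + 1 + j) t}"
      unfolding Y_def by (intro mat_has_sum_uminus mat_has_sum_finite) (auto simp: mult_carrier_mat_iff)
    moreover have "min (n + 1 + j) t = t" using t by auto
    ultimately show ?thesis using mat_has_sum_unique[OF 2] by simp
  qed
  have "mat_has_sum d d (\<lambda>j. - (mat_adjoint (Q * (w (- int j) * g (int (n + 1 + j) - int u))) * ?q))
      (- (mat_adjoint (Q * (- T)) * ?q)) UNIV"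
    by (intro mat_has_sum_uminus mat_has_sum_mult_right[OF qc] mat_has_sum_adjoint mat_has_sum_mult_left[OF _ T]) simp
  then have "mat_has_sum d d (\<lambda>j. g (int u - int (n + 1 + j)) * Y (n + 1 + j) t) (mat_adjoint (Q * T) * ?q) UNIV"
  proof (rule mat_has_sum_congI)
    fix j :: nat
    let ?x = "Q * w (- int j)" and ?g = "g (int (n + 1 + j) - int u)"
    have xc: "?x \<in> carrier_mat N d" by (simp add: mult_carrier_mat_iff carrier_matD[OF wseq_carrier])
    have "Q * (w (- int j) * ?g) = ?x * ?g" by (rule assoc_mult_mat[symmetric, of _ N N _ d _ d]) auto
    then have "mat_adjoint (Q * (w (- int j) * ?g)) = mat_adjoint ?g * mat_adjoint ?x"
      using xc by (simp add: mat_adjoint_mult[of _ N d _ d])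
    then have "mat_adjoint (Q * (w (- int j) * ?g)) * ?q = mat_adjoint ?g * (mat_adjoint ?x * ?q)"
      by (simp only:) (rule assoc_mult_mat[OF _ _ qc], use xc in auto)
    also have "\<dots> = - (mat_adjoint ?g * Y (n + 1 + j) t)"
      unfolding inner by (rule uminus_mult_right_mat) (simp add: Y_def carrier_matD[OF mat_sum_carrier])
    finally show "g (int u - int (n + 1 + j)) * Y (n + 1 + j) t = - (mat_adjoint (Q * (w (- int j) * ?g)) * ?q)"
      by (simp add: g_herm)
  next
    have "Q * (- T) = - (Q * T)" using Tc by (intro uminus_mult_right_mat) auto
    moreover have "mat_adjoint (- (Q * T)) * ?q = - (mat_adjoint (Q * T) * ?q)"
      unfolding mat_adjoint_uminus by (rule uminus_mult_left_mat) (use QTd carrier_matD(1)[OF qc] in \<open>simp only: dim_mat_adjoint\<close>)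
    ultimately show "mat_adjoint (Q * T) * ?q = - (mat_adjoint (Q * (- T)) * ?q)" by simp
  qed
  moreover have "bij_betw (\<lambda>r. n + 1 + r) UNIV {n + 1..}"
    by (rule bij_betwI[where g = "\<lambda>l. l - (n + 1)"]) auto
  ultimately show ?thesis
    using mat_has_sum_reindex[of "\<lambda>r. n + 1 + r" UNIV "{n + 1..}" d d "\<lambda>s. g (int u - int s) * Y s t"] by simp
qed

text \<open>On \<open>{1..n}\<close> the matrix \<open>Y\<close> misses the identity by the tail, and \<open>R\<close> reproduces the first factor of the tail up to
  \<open>1 - G * G'\<close>, which \<open>L\<close> divides out.\<close>

theorem column_equation:
  assumes u: "u \<in> {1..n}" and t: "t \<in> {1..n - n0}"
    and det: "Determinant.det (1\<^sub>m N - G * G') \<noteq> 0"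
  shows "mat_sum d d {1..n} (\<lambda>s. g (int u - int s) * (mat_adjoint (R s) * mat_adjoint (L t) + Y s t)) =
    (if u = t then 1\<^sub>m d else 0\<^sub>m d d)"
proof -
  let ?q = "w' (int t) - v' t" and ?D = "1\<^sub>m N - G * G'"
  have Dc: "?D \<in> carrier_mat N N" by (simp add: mult_carrier_mat_iff minus_carrier_mat)
  note D = mat_inv_props[OF Dc det]
  have qc: "?q \<in> carrier_mat N d" by (rule minus_carrier_mat) simp
  have Yc: "Y s t \<in> carrier_mat d d" for s by (simp add: Y_def)
  have Rc: "R s \<in> carrier_mat N d" for s by (simp add: R_def mult_carrier_mat_iff carrier_matD[OF vseq_carrier])
  have Lc: "L t \<in> carrier_mat d N" using D(1) qc by (auto simp: L_def mult_carrier_mat_iff)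
  obtain T where T: "mat_has_sum N d (\<lambda>j. w (- int j) * g (int (n + 1 + j) - int u)) (- T) UNIV"
    "mat_has_sum N d (\<lambda>s. R s * g (int s - int u)) (?D * (Q * T)) {1..n}"
    using R_convolution[OF u] .
  have QT: "Q * T \<in> carrier_mat N d" using mat_has_sumD(1)[OF T(1)] by (auto simp: mult_carrier_mat_iff)
  have tot: "mat_has_sum d d (\<lambda>s. g (int u - int s) * Y s t) (if u = t then 1\<^sub>m d else 0\<^sub>m d d) {1..}"
    by (rule Y_convolution) (use u t in auto)
  define W where "W = mat_sum d d {1..n} (\<lambda>s. g (int u - int s) * Y s t)"
  have W: "mat_has_sum d d (\<lambda>s. g (int u - int s) * Y s t) W {1..n}"
    unfolding W_def by (rule mat_has_sum_finite) (simp_all only: finite_atLeastAtMost mult_carrier_mat[OF g_carrier Yc])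
  have WT: "W + mat_adjoint (Q * T) * ?q = (if u = t then 1\<^sub>m d else 0\<^sub>m d d)"
    by (rule mat_has_sum_head_tail[OF W Y_convolution_tail[OF u t T(1)] tot])
  have "mat_has_sum d d (\<lambda>s. mat_adjoint (R s * g (int s - int u)) * mat_adjoint (L t) + g (int u - int s) * Y s t)
      (mat_adjoint (?D * (Q * T)) * mat_adjoint (L t) + W) {1..n}"
    by (rule mat_has_sum_add[OF mat_has_sum_mult_right[OF mat_adjoint_carrier[OF Lc] mat_has_sum_adjoint[OF T(2)]] W])
  then have "mat_has_sum d d (\<lambda>s. g (int u - int s) * (mat_adjoint (R s) * mat_adjoint (L t) + Y s t))
      (if u = t then 1\<^sub>m d else 0\<^sub>m d d) {1..n}"
  proof (rule mat_has_sum_congI)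
    fix s
    have "mat_adjoint (R s * g (int s - int u)) = g (int u - int s) * mat_adjoint (R s)"
      using Rc by (subst mat_adjoint_mult[of _ N d _ d]) (auto simp: g_herm)
    then show "g (int u - int s) * (mat_adjoint (R s) * mat_adjoint (L t) + Y s t) =
        mat_adjoint (R s * g (int s - int u)) * mat_adjoint (L t) + g (int u - int s) * Y s t"
      using Rc[of s] Lc Yc[of s]
      by (simp add: mult_add_distrib_mat[of _ d d _ d] assoc_mult_mat[of _ d d _ N _ d] mult_carrier_mat_iff)
  next
    have "mat_adjoint (?D * (Q * T)) * mat_adjoint (L t) = mat_adjoint (L t * (?D * (Q * T)))"
      using Lc Dc QT by (subst mat_adjoint_mult[of "L t" d N _ d]) (auto simp: mult_carrier_mat_iff)
    also have "L t * (?D * (Q * T)) = mat_adjoint ?q * (mat_inv ?D * (?D * (Q * T)))"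
      unfolding L_def
      by (rule assoc_mult_mat[OF mat_adjoint_carrier[OF qc] D(1) mult_carrier_mat[OF Dc QT]])
    also have "mat_inv ?D * (?D * (Q * T)) = mat_inv ?D * ?D * (Q * T)"
      using D(1) Dc QT by (intro assoc_mult_mat[symmetric, of _ N N _ N _ d]) auto
    also have "\<dots> = Q * T" unfolding D(3) using QT by simp
    also have "mat_adjoint (mat_adjoint ?q * (Q * T)) = mat_adjoint (Q * T) * ?q"
      using QT qc by (subst mat_adjoint_mult[of _ d N _ d]) auto
    finally have "mat_adjoint (?D * (Q * T)) * mat_adjoint (L t) + W = mat_adjoint (Q * T) * ?q + W" by simp
    also have "\<dots> = W + mat_adjoint (Q * T) * ?q"
      using QT qc by (intro comm_add_mat[of _ d d]) (auto simp: W_def mult_carrier_mat_iff)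
    finally show "(if u = t then 1\<^sub>m d else 0\<^sub>m d d) = mat_adjoint (?D * (Q * T)) * mat_adjoint (L t) + W"
      using WT by simp
  qed
  then show ?thesis by (intro mat_sum_eqI) auto
qed

end

section \<open>The pole matrices and the Hankel identity\<close>

text \<open>The scalar factor of \<open>p_block\<close>, with the pair from \<open>pf_index\<close> as one argument.\<close>

definition pole_coeff :: "(nat \<Rightarrow> complex) \<Rightarrow> nat \<times> nat \<Rightarrow> int \<Rightarrow> complex"
  where "pole_coeff p x k = ((of_int k :: complex) gchoose (snd x - 1)) * p (fst x) powi (k - int (snd x) + 1)"

lemma p_block_eq: "p_block d p \<mu> i k = pole_coeff p (\<mu>, i) k \<cdot>\<^sub>m 1\<^sub>m d"
  by (simp add: p_block_def pole_coeff_def)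

text \<open>Vandermonde's convolution makes the columns \<open>p\<^sub>k\<close> a representation of the integers: shifting \<open>k\<close> is a linear
  operation within the block of each pole.\<close>

lemma pole_coeff_Vandermonde:
  assumes "p \<mu> \<noteq> 0" "q \<ge> 1"
  shows "(\<Sum>i=1..q. pole_coeff p (\<mu>, i) k * pole_coeff p (\<mu>, q - i + 1) l) = pole_coeff p (\<mu>, q) (k + l)"
proof -
  have "(\<Sum>i=1..q. pole_coeff p (\<mu>, i) k * pole_coeff p (\<mu>, q - i + 1) l) =
      (\<Sum>i\<le>q - 1. ((of_int k gchoose i) * (of_int l gchoose (q - 1 - i))) * p \<mu> powi (k + l - int q + 1))"
  proof (rule sum.reindex_bij_witness[of _ "\<lambda>i. i + 1" "\<lambda>i. i - 1"])
    fix i assume i: "i \<in> {1..q}"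
    have "p \<mu> powi (k - int i + 1) * p \<mu> powi (l - int (q - i + 1) + 1) = p \<mu> powi (k + l - int q + 1)"
      using assms i by (subst power_int_add[symmetric]) (auto simp: of_nat_diff algebra_simps)
    moreover have "q - 1 - (i - 1) = q - i" using i by auto
    ultimately show "((of_int k gchoose (i - 1)) * (of_int l gchoose (q - 1 - (i - 1)))) * p \<mu> powi (k + l - int q + 1) =
      pole_coeff p (\<mu>, i) k * pole_coeff p (\<mu>, q - i + 1) l"
      by (simp add: pole_coeff_def)
  qed (use assms in auto)
  also have "\<dots> = pole_coeff p (\<mu>, q) (k + l)"
    by (simp only: sum_distrib_right[symmetric] gbinomial_Vandermonde atLeast0AtMost[symmetric])
      (simp add: pole_coeff_def)
  finally show ?thesis .
qed

lemma summable_binomial_power: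
  fixes r :: real
  assumes "0 \<le> r" "r < 1"
  shows "summable (\<lambda>l. of_nat (l choose j) * r ^ l)"
proof (induction j)
  case 0
  then show ?case using assms by (simp add: summable_geometric)
next
  case (Suc j)
  have "summable (\<lambda>k. \<Sum>i\<le>k. (of_nat (i choose j) * r ^ i) * r ^ (k - i))"
    using Suc assms by (intro summable_Cauchy_product) (auto simp: summable_geometric abs_mult)
  also have "(\<lambda>k. \<Sum>i\<le>k. (of_nat (i choose j) * r ^ i) * r ^ (k - i)) = (\<lambda>k. of_nat (Suc k choose Suc j) * r ^ k)"
  proof
    fix k
    have "(\<Sum>i\<le>k. (of_nat (i choose j) * r ^ i) * r ^ (k - i)) = (\<Sum>i\<le>k. of_nat (i choose j) * r ^ k)"
      by (intro sum.cong) (auto simp: mult.assoc power_add[symmetric])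
    also have "\<dots> = of_nat (\<Sum>i\<le>k. i choose j) * r ^ k" by (simp add: sum_distrib_right)
    also have "(\<Sum>i\<le>k. i choose j) = Suc k choose Suc j" by (rule sum_choose_upper)
    finally show "(\<Sum>i\<le>k. (of_nat (i choose j) * r ^ i) * r ^ (k - i)) = of_nat (Suc k choose Suc j) * r ^ k" .
  qed
  finally show ?case
    by (rule summable_comparison_test_ev[rotated])
      (use assms in \<open>auto intro!: always_eventually mult_right_mono simp del: binomial_Suc_Suc simp: binomial_right_mono\<close>)
qed

lemma pole_coeff_summable:
  assumes "p \<mu> \<noteq> 0" "cmod (p \<mu>) < 1"
  shows "summable (\<lambda>l. cmod (pole_coeff p (\<mu>, i) (int l)))"
proof -
  have "cmod (pole_coeff p (\<mu>, i) (int l)) =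
      of_nat (l choose (i - 1)) * cmod (p \<mu>) ^ l * cmod (p \<mu>) powi (1 - int i)" for l
  proof -
    have "p \<mu> powi (int l - int i + 1) = p \<mu> ^ l * p \<mu> powi (1 - int i)"
      using assms power_int_add[of "p \<mu>" "int l" "1 - int i"] by (simp add: algebra_simps)
    moreover have "(of_int (int l) :: complex) gchoose (i - 1) = of_nat (l choose (i - 1))"
      by (simp add: binomial_gbinomial)
    ultimately show ?thesis
      by (simp add: pole_coeff_def norm_mult norm_power norm_power_int)
  qed
  then show ?thesis
    using summable_mult2[OF summable_binomial_power[of "cmod (p \<mu>)" "i - 1"], of "cmod (p \<mu>) powi (1 - int i)"] assms
    by simp
qed

lemma length_pf_index: "length (pf_index K m) = total_mult K m"
  by (simp add: pf_index_def total_mult_def length_concat o_def sum_list_distinct_conv_sum_set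
      atLeastLessThanSuc_atLeastAtMost del: upt_Suc)

lemma set_pf_index: "set (pf_index K m) = Sigma {1..K} (\<lambda>\<mu>. {1..m \<mu>})"
  by (auto simp: pf_index_def image_iff simp del: upt_Suc)

lemma sum_list_pf_index: "sum_list (map f (pf_index K m)) = (\<Sum>\<mu>=1..K. \<Sum>i=1..m \<mu>. f (\<mu>, i))"
proof -
  have "sum_list (map f (concat (map (\<lambda>\<mu>. map (Pair \<mu>) [1..<Suc (m \<mu>)]) xs))) =
      sum_list (map (\<lambda>\<mu>. \<Sum>i=1..m \<mu>. f (\<mu>, i)) xs)" for xs
    by (induction xs)
      (simp_all add: o_def sum_list_distinct_conv_sum_set atLeastLessThanSuc_atLeastAtMost del: upt_Suc)
  then show ?thesis
    by (simp add: pf_index_def sum_list_distinct_conv_sum_set atLeastLessThanSuc_atLeastAtMost del: upt_Suc)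
qed

lemma sum_pf_index:
  "(\<Sum>s=1..total_mult K m. f (pf_index K m ! (s - 1))) = (\<Sum>\<mu>=1..K. \<Sum>i=1..m \<mu>. f (\<mu>, i))"
proof -
  have "(\<Sum>s=1..total_mult K m. f (pf_index K m ! (s - 1))) = (\<Sum>s<total_mult K m. f (pf_index K m ! s))"
    by (rule sum.reindex_bij_witness[of _ "\<lambda>s. s + 1" "\<lambda>s. s - 1"]) auto
  also have "\<dots> = sum_list (map f (pf_index K m))"
    by (simp add: sum_list_sum_nth length_pf_index atLeast0LessThan)
  finally show ?thesis by (simp add: sum_list_pf_index)
qed

text \<open>Block diagonal matrices are flattened to block matrices over the list of pairs, so that products with \<open>p_col\<close>
  become sums over this list.\<close>

lemma diag_block_mat_of_blocks:
  fixes B :: "nat \<Rightarrow> nat \<Rightarrow> nat \<Rightarrow> complex mat" and m :: "nat \<Rightarrow> nat"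
  defines "idx \<equiv> \<lambda>xs. concat (map (\<lambda>\<mu>. map (Pair \<mu>) [1..<Suc (m \<mu>)]) xs)"
  assumes "distinct xs"
  shows "diag_block_mat (map (\<lambda>\<mu>. mat_of_blocks d (m \<mu>) (m \<mu>) (B \<mu>)) xs) =
    mat_of_blocks d (length (idx xs)) (length (idx xs))
      (\<lambda>s t. if fst (idx xs ! (s - 1)) = fst (idx xs ! (t - 1))
         then B (fst (idx xs ! (s - 1))) (snd (idx xs ! (s - 1))) (snd (idx xs ! (t - 1))) else 0\<^sub>m d d)"
  using assms(2)
proof (induction xs)
  case Nil
  then show ?case by (auto simp: idx_def mat_of_blocks_def intro!: eq_matI)
next
  case (Cons x xs)
  let ?M = "length (idx xs)"
  define F where "F = (\<lambda>xs s t. if fst (idx xs ! (s - 1)) = fst (idx xs ! (t - 1))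
         then B (fst (idx xs ! (s - 1))) (snd (idx xs ! (s - 1))) (snd (idx xs ! (t - 1))) else 0\<^sub>m d d)"
  have IH: "diag_block_mat (map (\<lambda>\<mu>. mat_of_blocks d (m \<mu>) (m \<mu>) (B \<mu>)) xs) = mat_of_blocks d ?M ?M (F xs)"
    using Cons by (simp add: F_def)
  have len: "length (idx (x # xs)) = m x + ?M" by (simp add: idx_def)
  have fst_in: "fst (idx xs ! i) \<in> set xs" if "i < ?M" for i
    using nth_mem[OF that] by (auto simp: idx_def)
  have nth1: "idx (x # xs) ! (s - 1) = (x, s)" if "s \<in> {1..m x}" for s
    using that by (auto simp: idx_def nth_append simp del: upt_Suc)
  have nth2: "idx (x # xs) ! (s - 1) = idx xs ! (s - m x - 1)" if "s > m x" for s
  proof -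
    have "s - 1 - m x = s - m x - 1" using that by auto
    then show ?thesis using that by (auto simp: idx_def nth_append simp del: upt_Suc)
  qed
  have "four_block_mat (mat_of_blocks d (m x) (m x) (B x)) (0\<^sub>m (d * m x) (d * ?M)) (0\<^sub>m (d * ?M) (d * m x))
      (mat_of_blocks d ?M ?M (F xs)) = mat_of_blocks d (m x + ?M) (m x + ?M) (F (x # xs))" (is "?L = ?R")
  proof (rule eq_matI)
    fix i j assume "i < dim_row ?R" "j < dim_col ?R"
    then have ij: "i < d * (m x + ?M)" "j < d * (m x + ?M)" by (simp_all add: mat_of_blocks_def)
    obtain s i' where s: "i = d * (s - 1) + i'" "i' < d" "s \<in> {1..m x + ?M}" using block_index_cases[OF ij(1)] .
    obtain t j' where t: "j = d * (t - 1) + j'" "j' < d" "t \<in> {1..m x + ?M}" using block_index_cases[OF ij(2)] .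
    have small: "d * (s - 1) + i' < d * m x \<longleftrightarrow> s \<le> m x" if "s \<ge> 1" "i' < d" for s i'
    proof
      assume "s \<le> m x"
      then show "d * (s - 1) + i' < d * m x" using block_index_less[of i' d s "m x"] that by auto
    next
      assume a: "d * (s - 1) + i' < d * m x"
      show "s \<le> m x"
      proof (rule ccontr)
        assume "\<not> s \<le> m x"
        then have "d * m x \<le> d * (s - 1)" by (intro mult_le_mono2) auto
        with a show False by linarith
      qed
    qed
    have sub: "d * (s - 1) + i' - d * m x = d * (s - m x - 1) + i'" if "s > m x" for s i'
    proof -
      have "s - 1 = m x + (s - m x - 1)" using that by auto
      then have "d * (s - 1) = d * m x + d * (s - m x - 1)" by (metis add_mult_distrib2)
      then show ?thesis by simp
    qed
    have R: "?R $$ (i, j) = F (x # xs) s t $$ (i', j')"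
      unfolding s(1) t(1) by (rule mat_of_blocks_index[OF s(3) t(3) s(2) t(2)])
    have "?L $$ (i, j) = (if i < d * m x then if j < d * m x then mat_of_blocks d (m x) (m x) (B x) $$ (i, j) else 0
        else if j < d * m x then 0 else mat_of_blocks d ?M ?M (F xs) $$ (i - d * m x, j - d * m x))"
      using ij by (auto simp: mat_of_blocks_def index_mat_four_block(1) algebra_simps)
    also have "\<dots> = F (x # xs) s t $$ (i', j')"
    proof (cases "s \<le> m x"; cases "t \<le> m x")
      assume "s \<le> m x" "t \<le> m x"
      then show ?thesis using s t small nth1[of s] nth1[of t]
        by (auto simp: F_def mat_of_blocks_index simp del: One_nat_def)
    next
      assume a: "s \<le> m x" "\<not> t \<le> m x"
      then have "t - m x - 1 < ?M" using t by auto
      from fst_in[OF this] a s t small[of s i'] small[of t j'] Cons.prems nth1[of s] nth2[of t]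
      show ?thesis by (auto simp: F_def simp del: One_nat_def)
    next
      assume a: "\<not> s \<le> m x" "t \<le> m x"
      then have "s - m x - 1 < ?M" using s by auto
      from fst_in[OF this] a s t small[of s i'] small[of t j'] Cons.prems nth1[of t] nth2[of s]
      show ?thesis by (auto simp: F_def simp del: One_nat_def)
    next
      assume a: "\<not> s \<le> m x" "\<not> t \<le> m x"
      then have "s - m x \<in> {1..?M}" "t - m x \<in> {1..?M}" using s t by auto
      then have "mat_of_blocks d ?M ?M (F xs) $$ (i - d * m x, j - d * m x) = F xs (s - m x) (t - m x) $$ (i', j')"
        unfolding s(1) t(1) using a s(2) t(2)
        by (simp only: sub not_le) (rule mat_of_blocks_index, auto)
      also have "F xs (s - m x) (t - m x) = F (x # xs) s t"
        using a by (simp add: F_def nth2 del: One_nat_def)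
      finally show ?thesis using a s t small[of s i'] small[of t j'] by auto
    qed
    finally show "?L $$ (i, j) = ?R $$ (i, j)" using R by simp
  qed (auto simp: mat_of_blocks_def algebra_simps)
  moreover have "diag_block_mat (map (\<lambda>\<mu>. mat_of_blocks d (m \<mu>) (m \<mu>) (B \<mu>)) (x # xs)) =
      four_block_mat (mat_of_blocks d (m x) (m x) (B x)) (0\<^sub>m (d * m x) (d * ?M)) (0\<^sub>m (d * ?M) (d * m x))
      (mat_of_blocks d ?M ?M (F xs))"
    by (simp add: IH Let_def) (simp add: mat_of_blocks_def)
  ultimately show ?case unfolding len F_def by simp
qed

locale pole_data =
  fixes d K :: nat and m :: "nat \<Rightarrow> nat" and p :: "nat \<Rightarrow> complex"
  assumes p_nz: "\<And>\<mu>. \<mu> \<in> {1..K} \<Longrightarrow> p \<mu> \<noteq> 0" and p_lt: "\<And>\<mu>. \<mu> \<in> {1..K} \<Longrightarrow> cmod (p \<mu>) < 1"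

begin

abbreviation "M \<equiv> total_mult K m"

definition "idx s = pf_index K m ! (s - 1)"

abbreviation "P \<equiv> p_col d K m p"

lemma idx_in: "s \<in> {1..M} \<Longrightarrow> idx s \<in> Sigma {1..K} (\<lambda>\<mu>. {1..m \<mu>})"
  using nth_mem[of "s - 1" "pf_index K m"] by (auto simp: idx_def set_pf_index length_pf_index)

lemma sum_idx: "(\<Sum>s=1..M. f (idx s)) = (\<Sum>\<mu>=1..K. \<Sum>i=1..m \<mu>. f (\<mu>, i))"
  unfolding idx_def by (rule sum_pf_index)

lemma P_carrier: "P k \<in> carrier_mat (d * M) d"
  using mat_of_blocks_carrier[of d M 1] by (simp add: p_col_def)

lemma P_index:
  assumes "s \<in> {1..M}" "i < d" "j < d"
  shows "P k $$ (d * (s - 1) + i, j) = pole_coeff p (idx s) k * (if i = j then 1 else 0)"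
  using mat_of_blocks_index[of s M 1 1 i d j] assms
  by (simp add: p_col_def p_block_eq case_prod_unfold idx_def del: One_nat_def)

lemma P_summable: "summable (\<lambda>l. mnorm (P (int l)))"
proof -
  have eq: "mnorm (P k) = (\<Sum>s=1..M. \<Sum>i<d. \<Sum>j<d. cmod (pole_coeff p (idx s) k * (if i = j then 1 else 0)))" for k
    using carrier_matD[OF P_carrier, of k]
    by (auto simp: mnorm_def sum_blocks P_index intro!: sum.cong simp del: One_nat_def)
  have sm: "summable (\<lambda>l. cmod (pole_coeff p (idx s) (int l) * (if i = j then 1 else 0)))"
    if "s \<in> {1..M}" for s i j
  proof -
    have "summable (\<lambda>l. cmod (pole_coeff p (idx s) (int l)))"
      using pole_coeff_summable[of p "fst (idx s)" "snd (idx s)"] idx_in[OF that] p_nz p_lt by auto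
    then show ?thesis by (auto simp: norm_mult)
  qed
  show ?thesis unfolding eq by (intro summable_sum sm)
qed

lemma row_mult_blocks:
  assumes "\<And>s t. s \<in> {1..M} \<Longrightarrow> t \<in> {1..M} \<Longrightarrow> B s t \<in> carrier_mat d d" "t \<in> {1..M}" "x < d" "y < d"
  shows "(transpose_mat (P k) * mat_of_blocks d M M B) $$ (x, d * (t - 1) + y) =
    (\<Sum>s=1..M. pole_coeff p (idx s) k * B s t $$ (x, y))"
proof -
  have "(transpose_mat (P k) * mat_of_blocks d M M B) $$ (x, d * (t - 1) + y) =
      (\<Sum>r<d * M. P k $$ (r, x) * mat_of_blocks d M M B $$ (r, d * (t - 1) + y))"
    using carrier_matD[OF P_carrier, of k] assms block_index_less[OF assms(4,2)]
    by (auto simp: scalar_prod_def mat_of_blocks_def atLeast0LessThan simp del: One_nat_def)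
  also have "\<dots> = (\<Sum>s=1..M. \<Sum>i<d. P k $$ (d * (s - 1) + i, x) * mat_of_blocks d M M B $$ (d * (s - 1) + i, d * (t - 1) + y))"
    by (rule sum_blocks)
  also have "\<dots> = (\<Sum>s=1..M. \<Sum>i<d. pole_coeff p (idx s) k * (if i = x then 1 else 0) * B s t $$ (i, y))"
    using assms by (intro sum.cong refl) (simp add: P_index mat_of_blocks_index del: One_nat_def)
  also have "\<dots> = (\<Sum>s=1..M. pole_coeff p (idx s) k * B s t $$ (x, y))"
  proof (rule sum.cong[OF refl])
    fix s
    have "(\<Sum>i<d. pole_coeff p (idx s) k * (if i = x then 1 else 0) * B s t $$ (i, y)) =
        (\<Sum>i<d. if i = x then pole_coeff p (idx s) k * B s t $$ (i, y) else 0)"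
      by (intro sum.cong) auto
    then show "(\<Sum>i<d. pole_coeff p (idx s) k * (if i = x then 1 else 0) * B s t $$ (i, y)) =
        pole_coeff p (idx s) k * B s t $$ (x, y)"
      using assms by simp
  qed
  finally show ?thesis .
qed

lemma Pi_mat_eq: "Pi_mat d K m p n = mat_of_blocks d M M (\<lambda>s t.
    if fst (idx s) = fst (idx t) \<and> snd (idx s) \<le> snd (idx t)
    then p_block d p (fst (idx s)) (snd (idx t) - snd (idx s) + 1) n else 0\<^sub>m d d)"
proof -
  have "Pi_mat d K m p n = mat_of_blocks d M M (\<lambda>s t.
    if fst (idx s) = fst (idx t)
    then (if snd (idx s) \<le> snd (idx t) then p_block d p (fst (idx s)) (snd (idx t) - snd (idx s) + 1) n else 0\<^sub>m d d)
    else 0\<^sub>m d d)"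
    unfolding Pi_mat_def length_pf_index[symmetric] idx_def pf_index_def by (rule diag_block_mat_of_blocks) simp
  also have "(\<lambda>s t. if fst (idx s) = fst (idx t)
    then (if snd (idx s) \<le> snd (idx t) then p_block d p (fst (idx s)) (snd (idx t) - snd (idx s) + 1) n else 0\<^sub>m d d)
    else 0\<^sub>m d d) = (\<lambda>s t. if fst (idx s) = fst (idx t) \<and> snd (idx s) \<le> snd (idx t)
    then p_block d p (fst (idx s)) (snd (idx t) - snd (idx s) + 1) n else 0\<^sub>m d d)"
    by (intro ext) simp
  finally show ?thesis .
qed

lemma Theta_eq: "Theta d K m p h hs = mat_of_blocks d M M (\<lambda>s t.
    if fst (idx s) = fst (idx t) then
      (if snd (idx s) + snd (idx t) - 1 \<le> m (fst (idx s))
       then theta d m p h hs (fst (idx s)) (snd (idx s) + snd (idx t) - 1) else 0\<^sub>m d d)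
    else 0\<^sub>m d d)"
  unfolding Theta_def length_pf_index[symmetric] idx_def pf_index_def by (rule diag_block_mat_of_blocks) simp

lemma Pi_carrier: "Pi_mat d K m p n \<in> carrier_mat (d * M) (d * M)"
  and Theta_carrier: "Theta d K m p h hs \<in> carrier_mat (d * M) (d * M)"
  by (simp_all add: Pi_mat_eq Theta_eq)

text \<open>\<open>\<Pi>\<^sub>n\<close> is the shift by \<open>n\<close>.\<close>

lemma row_Pi: "transpose_mat (P k) * Pi_mat d K m p n = transpose_mat (P (n + k))"
proof (rule eq_matI)
  note [simp] = carrier_matD[OF P_carrier] carrier_matD[OF Pi_carrier]
  fix x c assume "x < dim_row (transpose_mat (P (n + k)))" "c < dim_col (transpose_mat (P (n + k)))"
  then have x: "x < d" and c: "c < d * M" by auto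
  obtain t y where t: "c = d * (t - 1) + y" "y < d" "t \<in> {1..M}" using block_index_cases[OF c] .
  obtain \<nu> j where \<nu>: "idx t = (\<nu>, j)" by force
  have \<nu>j: "\<nu> \<in> {1..K}" "j \<in> {1..m \<nu>}" using idx_in[OF t(3)] unfolding \<nu> by auto
  let ?e = "if x = y then 1 else 0 :: complex"
  let ?B = "\<lambda>s t. if fst (idx s) = fst (idx t) \<and> snd (idx s) \<le> snd (idx t)
    then p_block d p (fst (idx s)) (snd (idx t) - snd (idx s) + 1) n else 0\<^sub>m d d"
  let ?F = "\<lambda>z. pole_coeff p z k *
      (if fst z = \<nu> \<and> snd z \<le> j then pole_coeff p (\<nu>, j - snd z + 1) n * ?e else 0)"
  have "(transpose_mat (P k) * Pi_mat d K m p n) $$ (x, c) = (\<Sum>s=1..M. pole_coeff p (idx s) k * ?B s t $$ (x, y))"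
    unfolding Pi_mat_eq t(1) by (rule row_mult_blocks) (use t x in \<open>auto simp: p_block_def\<close>)
  also have "\<dots> = (\<Sum>s=1..M. ?F (idx s))"
    using x t by (intro sum.cong refl) (auto simp: \<nu> p_block_eq simp del: One_nat_def)
  also have "\<dots> = (\<Sum>\<mu>=1..K. \<Sum>i=1..m \<mu>. pole_coeff p (\<mu>, i) k *
      (if \<mu> = \<nu> \<and> i \<le> j then pole_coeff p (\<nu>, j - i + 1) n * ?e else 0))"
    unfolding sum_idx[of ?F] by (simp only: fst_conv snd_conv)
  also have "\<dots> = (\<Sum>\<mu>=1..K. if \<mu> = \<nu> then \<Sum>i=1..m \<nu>. pole_coeff p (\<nu>, i) k *
      (if i \<le> j then pole_coeff p (\<nu>, j - i + 1) n * ?e else 0) else 0)"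
    by (intro sum.cong) auto
  also have "\<dots> = (\<Sum>i=1..m \<nu>. pole_coeff p (\<nu>, i) k * (if i \<le> j then pole_coeff p (\<nu>, j - i + 1) n * ?e else 0))"
    using \<nu>j by simp
  also have "\<dots> = (\<Sum>i=1..j. pole_coeff p (\<nu>, i) k * pole_coeff p (\<nu>, j - i + 1) n * ?e)"
    by (rule sum.mono_neutral_cong_right) (use \<nu>j in auto)
  also have "\<dots> = pole_coeff p (\<nu>, j) (k + n) * ?e"
    using \<nu>j p_nz by (subst pole_coeff_Vandermonde[symmetric]) (auto simp: sum_distrib_right)
  also have "\<dots> = transpose_mat (P (n + k)) $$ (x, c)"
    using x t(2) c P_index[OF t(3,2) x, of "n + k", folded t(1)] \<nu> by (auto simp: add.commute)
  finally show "(transpose_mat (P k) * Pi_mat d K m p n) $$ (x, c) = transpose_mat (P (n + k)) $$ (x, c)" .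
qed (use carrier_matD[OF P_carrier] carrier_matD[OF Pi_carrier] in auto)

definition hank_symbol :: "(complex \<Rightarrow> complex mat) \<Rightarrow> (complex \<Rightarrow> complex mat) \<Rightarrow> int \<Rightarrow> complex mat"
  where "hank_symbol h hs e = Matrix.mat d d (\<lambda>(x, y).
    \<Sum>\<mu>=1..K. \<Sum>q=1..m \<mu>. pole_coeff p (\<mu>, q) e * theta d m p h hs \<mu> q $$ (x, y))"

text \<open>Each block of \<open>\<Theta>\<close> is a Hankel triangle in \<open>i + j\<close>; summing along its antidiagonals is again a Vandermonde
  convolution.\<close>

lemma row_Theta_col: "transpose_mat (P k) * Theta d K m p h hs * P l = hank_symbol h hs (k + l)"
proof (rule eq_matI)
  note [simp] = carrier_matD[OF P_carrier] carrier_matD[OF Theta_carrier]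
  fix x y assume "x < dim_row (hank_symbol h hs (k + l))" "y < dim_col (hank_symbol h hs (k + l))"
  then have x: "x < d" and y: "y < d" by (auto simp: hank_symbol_def)
  let ?th = "\<lambda>\<mu> q. theta d m p h hs \<mu> q $$ (x, y)"
  let ?B = "\<lambda>s t. if fst (idx s) = fst (idx t) then
      (if snd (idx s) + snd (idx t) - 1 \<le> m (fst (idx s))
       then theta d m p h hs (fst (idx s)) (snd (idx s) + snd (idx t) - 1) else 0\<^sub>m d d)
    else 0\<^sub>m d d"
  let ?Z = "transpose_mat (P k) * Theta d K m p h hs"
  let ?f = "\<lambda>z z'. pole_coeff p z k * (if fst z = fst z' \<and> snd z + snd z' - 1 \<le> m (fst z)
      then ?th (fst z) (snd z + snd z' - 1) else 0)"
  have th: "theta d m p h hs \<mu> q \<in> carrier_mat d d" for \<mu> q by (simp add: theta_def)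
  have "(?Z * P l) $$ (x, y) = (\<Sum>r<d * M. ?Z $$ (x, r) * P l $$ (r, y))"
    using x y by (simp add: scalar_prod_def atLeast0LessThan)
  also have "\<dots> = (\<Sum>t=1..M. \<Sum>i<d. ?Z $$ (x, d * (t - 1) + i) * P l $$ (d * (t - 1) + i, y))"
    by (rule sum_blocks)
  also have "\<dots> = (\<Sum>t=1..M. \<Sum>i<d. if i = y then ?Z $$ (x, d * (t - 1) + i) * pole_coeff p (idx t) l else 0)"
    using y by (intro sum.cong refl) (auto simp: P_index simp del: One_nat_def)
  also have "\<dots> = (\<Sum>t=1..M. ?Z $$ (x, d * (t - 1) + y) * pole_coeff p (idx t) l)"
    using y by simp
  also have "\<dots> = (\<Sum>t=1..M. (\<Sum>s=1..M. pole_coeff p (idx s) k * ?B s t $$ (x, y)) * pole_coeff p (idx t) l)"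
    unfolding Theta_eq by (intro sum.cong refl arg_cong2[where f = "(*)"] row_mult_blocks) (use x y th in auto)
  also have "\<dots> = (\<Sum>t=1..M. (\<Sum>s=1..M. ?f (idx s) (idx t)) * pole_coeff p (idx t) l)"
    using x y by (intro sum.cong refl arg_cong2[where f = "(*)"]) (auto simp del: One_nat_def)
  also have "\<dots> = (\<Sum>\<nu>=1..K. \<Sum>j=1..m \<nu>. (\<Sum>\<mu>=1..K. \<Sum>i=1..m \<mu>. ?f (\<mu>, i) (\<nu>, j)) * pole_coeff p (\<nu>, j) l)"
    unfolding sum_idx[of "\<lambda>z. ?f z _"]
      sum_idx[of "\<lambda>z'. (\<Sum>\<mu>=1..K. \<Sum>i=1..m \<mu>. ?f (\<mu>, i) z') * pole_coeff p z' l"] ..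
  also have "\<dots> = (\<Sum>\<nu>=1..K. \<Sum>q=1..m \<nu>. pole_coeff p (\<nu>, q) (k + l) * ?th \<nu> q)"
  proof (rule sum.cong[OF refl])
    fix \<nu> assume \<nu>: "\<nu> \<in> {1..K}"
    have "(\<Sum>j=1..m \<nu>. (\<Sum>\<mu>=1..K. \<Sum>i=1..m \<mu>. ?f (\<mu>, i) (\<nu>, j)) * pole_coeff p (\<nu>, j) l) =
        (\<Sum>j=1..m \<nu>. \<Sum>i\<in>{i\<in>{1..m \<nu>}. i + j - 1 \<le> m \<nu>}.
          pole_coeff p (\<nu>, i) k * ?th \<nu> (i + j - 1) * pole_coeff p (\<nu>, j) l)"
    proof (rule sum.cong[OF refl])
      fix j assume "j \<in> {1..m \<nu>}"
      have "(\<Sum>\<mu>=1..K. \<Sum>i=1..m \<mu>. ?f (\<mu>, i) (\<nu>, j)) = (\<Sum>\<mu>=1..K. if \<mu> = \<nu> then \<Sum>i=1..m \<nu>. ?f (\<nu>, i) (\<nu>, j) else 0)"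
        by (intro sum.cong) auto
      also have "\<dots> = (\<Sum>i=1..m \<nu>. ?f (\<nu>, i) (\<nu>, j))" using \<nu> by simp
      also have "\<dots> = (\<Sum>i\<in>{i\<in>{1..m \<nu>}. i + j - 1 \<le> m \<nu>}. pole_coeff p (\<nu>, i) k * ?th \<nu> (i + j - 1))"
        by (rule sum.mono_neutral_cong_right) auto
      finally show "(\<Sum>\<mu>=1..K. \<Sum>i=1..m \<mu>. ?f (\<mu>, i) (\<nu>, j)) * pole_coeff p (\<nu>, j) l =
          (\<Sum>i\<in>{i\<in>{1..m \<nu>}. i + j - 1 \<le> m \<nu>}. pole_coeff p (\<nu>, i) k * ?th \<nu> (i + j - 1) * pole_coeff p (\<nu>, j) l)"
        by (simp add: sum_distrib_right)
    qed
    also have "\<dots> = (\<Sum>(j, i)\<in>Sigma {1..m \<nu>} (\<lambda>j. {i\<in>{1..m \<nu>}. i + j - 1 \<le> m \<nu>}).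
          pole_coeff p (\<nu>, i) k * ?th \<nu> (i + j - 1) * pole_coeff p (\<nu>, j) l)"
      by (rule sum.Sigma) auto
    also have "\<dots> = (\<Sum>(q, i)\<in>Sigma {1..m \<nu>} (\<lambda>q. {1..q}).
          pole_coeff p (\<nu>, i) k * pole_coeff p (\<nu>, q - i + 1) l * ?th \<nu> q)"
      by (rule sum.reindex_bij_witness[of _ "\<lambda>(q, i). (q - i + 1, i)" "\<lambda>(j, i). (i + j - 1, i)"]) auto
    also have "\<dots> = (\<Sum>q=1..m \<nu>. \<Sum>i=1..q. pole_coeff p (\<nu>, i) k * pole_coeff p (\<nu>, q - i + 1) l * ?th \<nu> q)"
      by (rule sum.Sigma[symmetric]) auto
    also have "\<dots> = (\<Sum>q=1..m \<nu>. pole_coeff p (\<nu>, q) (k + l) * ?th \<nu> q)"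
      using p_nz[OF \<nu>] by (intro sum.cong refl) (subst pole_coeff_Vandermonde[symmetric], auto simp: sum_distrib_right)
    finally show "(\<Sum>j=1..m \<nu>. (\<Sum>\<mu>=1..K. \<Sum>i=1..m \<mu>. ?f (\<mu>, i) (\<nu>, j)) * pole_coeff p (\<nu>, j) l) =
        (\<Sum>q=1..m \<nu>. pole_coeff p (\<nu>, q) (k + l) * ?th \<nu> q)" .
  qed
  finally show "(?Z * P l) $$ (x, y) = hank_symbol h hs (k + l) $$ (x, y)"
    using x y by (simp add: hank_symbol_def)
qed (use carrier_matD[OF P_carrier] carrier_matD[OF Theta_carrier] in \<open>auto simp: hank_symbol_def\<close>)

lemma hankel_identity:
  "transpose_mat (P k) * (Pi_mat d K m p n * Theta d K m p h hs) * P l = hank_symbol h hs (n + k + l)"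
proof -
  have "transpose_mat (P k) * (Pi_mat d K m p n * Theta d K m p h hs) =
      transpose_mat (P k) * Pi_mat d K m p n * Theta d K m p h hs"
    by (rule assoc_mult_mat[OF _ Pi_carrier Theta_carrier, symmetric])
      (use P_carrier in auto)
  then show ?thesis by (simp add: row_Pi row_Theta_col)
qed

end

section \<open>Fourier coefficients on the circle\<close>

abbreviation "circ \<equiv> lebesgue_on {-pi..pi}"

definition fcoef :: "(real \<Rightarrow> complex) \<Rightarrow> int \<Rightarrow> complex"
  where "fcoef f k = integral\<^sup>L circ (\<lambda>\<theta>. cis (- (of_int k * \<theta>)) * f \<theta>) / complex_of_real (2 * pi)"

lemma finite_measure_circ: "finite_measure circ"
  by (rule finite_measure_lebesgue_on) simp

lemma measure_circ: "measure circ {-pi..pi} = 2 * pi"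
  by (simp add: measure_restrict_space)

lemma integrable_circ_continuous:
  fixes f :: "real \<Rightarrow> 'a::euclidean_space"
  shows "continuous_on {-pi..pi} f \<Longrightarrow> integrable circ f"
  by (rule continuous_imp_integrable_real)

lemma integrable_circ_bounded:
  fixes f :: "real \<Rightarrow> complex"
  assumes "f \<in> borel_measurable circ" "AE \<theta> in circ. cmod (f \<theta>) \<le> C"
  shows "integrable circ f"
  using finite_measure.integrable_const_bound[OF finite_measure_circ assms(2,1)] .

lemma borel_measurable_circ_continuous:
  fixes f :: "real \<Rightarrow> complex"
  shows "continuous_on UNIV f \<Longrightarrow> f \<in> borel_measurable circ"
  by (rule borel_measurable_integrable[OF integrable_circ_continuous[OF continuous_on_subset]]) auto

lemma integrable_cis_mult:
  assumes "integrable circ f"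
  shows "integrable circ (\<lambda>\<theta>. cis (c * \<theta>) * f \<theta>)"
proof (rule Bochner_Integration.integrable_bound[OF assms])
  have "(\<lambda>\<theta>. cis (c * \<theta>)) \<in> borel_measurable circ"
    by (intro borel_measurable_circ_continuous continuous_intros)
  then show "(\<lambda>\<theta>. cis (c * \<theta>) * f \<theta>) \<in> borel_measurable circ"
    using assms by (intro borel_measurable_times) auto
qed (simp add: norm_mult)

lemma fcoef_cong_AE:
  assumes "AE \<theta> in circ. f \<theta> = g \<theta>" "f \<in> borel_measurable circ" "g \<in> borel_measurable circ"
  shows "fcoef f k = fcoef g k"
proof -
  have "(\<lambda>\<theta>. cis (- (of_int k * \<theta>))) \<in> borel_measurable circ"
    by (intro borel_measurable_circ_continuous continuous_intros)
  then show ?thesis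
    unfolding fcoef_def using assms by (intro arg_cong2[where f = "(/)"] integral_cong_AE refl) auto
qed

lemma fcoef_add:
  "integrable circ f \<Longrightarrow> integrable circ g \<Longrightarrow> fcoef (\<lambda>\<theta>. f \<theta> + g \<theta>) k = fcoef f k + fcoef g k"
  using integrable_cis_mult[of f "- of_int k"] integrable_cis_mult[of g "- of_int k"]
  by (simp add: fcoef_def ring_distribs add_divide_distrib)

lemma fcoef_sum:
  assumes "\<And>i. i \<in> I \<Longrightarrow> integrable circ (f i)"
  shows "fcoef (\<lambda>\<theta>. \<Sum>i\<in>I. f i \<theta>) k = (\<Sum>i\<in>I. fcoef (f i) k)"
  using integrable_cis_mult[OF assms, of _ "- of_int k"]
  by (simp add: fcoef_def sum_distrib_left sum_divide_distrib)

lemma fcoef_mult_const: "fcoef (\<lambda>\<theta>. c * f \<theta>) k = c * fcoef f k"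
proof -
  have "(\<lambda>\<theta>. cis (- (of_int k * \<theta>)) * (c * f \<theta>)) = (\<lambda>\<theta>. c * (cis (- (of_int k * \<theta>)) * f \<theta>))"
    by (simp add: mult.left_commute)
  then show ?thesis by (simp add: fcoef_def)
qed

lemma fcoef_cnj: "fcoef (\<lambda>\<theta>. cnj (f \<theta>)) k = cnj (fcoef f (- k))"
proof -
  have cnj_pi: "cnj (2 * complex_of_real pi) = 2 * complex_of_real pi" by simp
  have "cnj (fcoef f (- k)) = integral\<^sup>L circ (\<lambda>\<theta>. cnj (cis (of_int k * \<theta>) * f \<theta>)) / complex_of_real (2 * pi)"
    by (simp add: fcoef_def integral_cnj[symmetric] cnj_pi del: integral_cnj complex_cnj_mult)
  also have "\<dots> = fcoef (\<lambda>\<theta>. cnj (f \<theta>)) k"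
    unfolding fcoef_def by (simp add: cis_cnj)
  finally show ?thesis by simp
qed

lemma norm_fcoef_le:
  assumes "integrable circ f"
  shows "cmod (fcoef f k) \<le> integral\<^sup>L circ (\<lambda>\<theta>. cmod (f \<theta>))"
proof -
  have "cmod (fcoef f k) \<le> integral\<^sup>L circ (\<lambda>\<theta>. cmod (cis (- (of_int k * \<theta>)) * f \<theta>)) / (2 * pi)"
    unfolding fcoef_def norm_divide
    by (intro frac_le order.trans[OF integral_norm_bound]) (auto simp: norm_mult)
  also have "\<dots> = integral\<^sup>L circ (\<lambda>\<theta>. cmod (f \<theta>)) / (2 * pi)" by (simp add: norm_mult)
  also have "\<dots> \<le> integral\<^sup>L circ (\<lambda>\<theta>. cmod (f \<theta>)) / 1"
    using pi_gt3 by (intro divide_left_mono) auto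
  finally show ?thesis by simp
qed

lemma fcoef_one: "fcoef (\<lambda>_. 1) k = (if k = 0 then 1 else 0)"
proof (cases "k = 0")
  case True
  then show ?thesis using measure_circ by (simp add: fcoef_def scaleR_conv_of_real)
next
  case False
  let ?F = "\<lambda>\<theta>. cis (- (of_int k * \<theta>)) * (\<i> / of_int k)"
  have "((\<lambda>\<theta>. cis (- (of_int k * \<theta>))) has_integral (?F pi - ?F (- pi))) {-pi..pi}"
  proof (rule fundamental_theorem_of_calculus)
    fix x :: real assume "x \<in> {-pi..pi}"
    have "((\<lambda>\<theta>. cis (- (of_int k * \<theta>))) has_vector_derivative (- of_int k) *\<^sub>R (\<i> * cis (- (of_int k * x)))) (at x)"
      unfolding has_vector_derivative_complex_iff by (auto intro!: derivative_eq_intros)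
    then have "(?F has_vector_derivative (- of_int k) *\<^sub>R (\<i> * cis (- (of_int k * x))) * (\<i> / of_int k)) (at x)"
      by (rule has_vector_derivative_mult_left)
    also have "(- of_int k) *\<^sub>R (\<i> * cis (- (of_int k * x))) * (\<i> / of_int k) =
        (- of_int k * \<i> * (\<i> / of_int k)) * cis (- (of_int k * x))"
      by (simp add: scaleR_conv_of_real mult_ac)
    also have "- of_int k * \<i> * (\<i> / of_int k) = 1"
      using False by simp
    also have "1 * cis (- (of_int k * x)) = cis (- (of_int k * x))" by simp
    finally show "(?F has_vector_derivative cis (- (of_int k * x))) (at x within {-pi..pi})"
      by (rule has_vector_derivative_at_within)
  qed simp
  moreover have "cis (- (of_int k * pi)) = cis (- (of_int k * - pi))"
  proof -
    have "cis (- (of_int k * - pi)) = cis (- (of_int k * pi)) * cis (2 * pi * of_int k)"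
      by (simp add: cis_mult algebra_simps)
    also have "cis (2 * pi * of_int k) = 1" by (rule cis_multiple_2pi) simp
    finally show ?thesis by simp
  qed
  ultimately have "integral {-pi..pi} (\<lambda>\<theta>. cis (- (of_int k * \<theta>))) = 0"
    by (simp add: has_integral_iff)
  moreover have "integrable circ (\<lambda>\<theta>. cis (- (of_int k * \<theta>)))"
    by (intro integrable_circ_continuous continuous_intros)
  ultimately have "integral\<^sup>L circ (\<lambda>\<theta>. cis (- (of_int k * \<theta>))) = 0"
    by (simp add: lebesgue_integral_eq_integral)
  then show ?thesis using False by (simp add: fcoef_def)
qed

text \<open>Multiplying by an absolutely convergent trigonometric series, with frequencies \<open>\<sigma> k\<close>, is a convolution.\<close>

lemma fcoef_series_mult:
  fixes c :: "nat \<Rightarrow> complex" and \<sigma> :: "nat \<Rightarrow> int"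
  assumes c: "summable (\<lambda>k. cmod (c k))"
    and f: "\<And>\<theta>. \<theta> \<in> {-pi..pi} \<Longrightarrow> (\<lambda>k. c k * cis (of_int (\<sigma> k) * \<theta>)) sums f \<theta>"
    and g: "integrable circ g"
  shows "((\<lambda>k. c k * fcoef g (j - \<sigma> k)) has_sum fcoef (\<lambda>\<theta>. f \<theta> * g \<theta>) j) UNIV"
    and "integrable circ (\<lambda>\<theta>. f \<theta> * g \<theta>)"
proof -
  let ?F = "\<lambda>k \<theta>. c k * (cis (of_int (\<sigma> k - j) * \<theta>) * g \<theta>)"
  have int: "integrable circ (?F k)" for k
    by (intro integrable_mult_right integrable_cis_mult g)
  have norm: "norm (?F k \<theta>) = cmod (c k) * cmod (g \<theta>)" for k \<theta> by (simp add: norm_mult)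
  have AE: "AE \<theta> in circ. summable (\<lambda>k. norm (?F k \<theta>))"
    unfolding norm by (intro AE_I2 summable_mult2 c)
  have sm: "summable (\<lambda>k. \<integral>\<theta>. norm (?F k \<theta>) \<partial>circ)"
    unfolding norm using c by (simp add: summable_mult2)
  have suminf: "(\<Sum>k. ?F k \<theta>) = cis (- (of_int j * \<theta>)) * (f \<theta> * g \<theta>)" if "\<theta> \<in> {-pi..pi}" for \<theta>
  proof -
    have "(\<lambda>k. c k * cis (of_int (\<sigma> k) * \<theta>) * (cis (- (of_int j * \<theta>)) * g \<theta>)) sums (f \<theta> * (cis (- (of_int j * \<theta>)) * g \<theta>))"
      by (intro sums_mult2 f that)
    moreover have "?F k \<theta> = c k * cis (of_int (\<sigma> k) * \<theta>) * (cis (- (of_int j * \<theta>)) * g \<theta>)" for k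
    proof -
      have "cis (of_int (\<sigma> k - j) * \<theta>) = cis (of_int (\<sigma> k) * \<theta>) * cis (- (of_int j * \<theta>))"
        by (simp add: cis_mult algebra_simps)
      then show ?thesis by simp
    qed
    ultimately have "(\<lambda>k. ?F k \<theta>) sums (f \<theta> * (cis (- (of_int j * \<theta>)) * g \<theta>))" by presburger
    then show ?thesis by (simp add: sums_iff mult.left_commute)
  qed
  have "integrable circ (\<lambda>\<theta>. \<Sum>k. ?F k \<theta>)" by (rule integrable_suminf[OF int AE sm])
  then have "integrable circ (\<lambda>\<theta>. cis (- (of_int j * \<theta>)) * (f \<theta> * g \<theta>))"
    by (subst Bochner_Integration.integrable_cong[OF refl suminf[symmetric]]) auto
  from integrable_cis_mult[OF this, of "of_int j"]
  show "integrable circ (\<lambda>\<theta>. f \<theta> * g \<theta>)"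
    by (simp add: mult.assoc[symmetric] cis_mult)
  have "(\<lambda>k. \<integral>\<theta>. ?F k \<theta> \<partial>circ) sums (\<integral>\<theta>. (\<Sum>k. ?F k \<theta>) \<partial>circ)"
    by (rule sums_integral[OF int AE sm])
  also have "(\<integral>\<theta>. (\<Sum>k. ?F k \<theta>) \<partial>circ) = (\<integral>\<theta>. cis (- (of_int j * \<theta>)) * (f \<theta> * g \<theta>) \<partial>circ)"
    by (intro Bochner_Integration.integral_cong refl suminf) auto
  finally have "(\<lambda>k. (\<integral>\<theta>. ?F k \<theta> \<partial>circ) / complex_of_real (2 * pi)) sums fcoef (\<lambda>\<theta>. f \<theta> * g \<theta>) j"
    unfolding fcoef_def by (rule sums_divide)
  also have "(\<lambda>k. (\<integral>\<theta>. ?F k \<theta> \<partial>circ) / complex_of_real (2 * pi)) = (\<lambda>k. c k * fcoef g (j - \<sigma> k))"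
    by (simp add: fcoef_def algebra_simps)
  finally have "(\<lambda>k. c k * fcoef g (j - \<sigma> k)) sums fcoef (\<lambda>\<theta>. f \<theta> * g \<theta>) j" .
  moreover have "summable (\<lambda>k. norm (c k * fcoef g (j - \<sigma> k)))"
  proof (rule summable_comparison_test_ev[OF always_eventually])
    show "\<forall>k. norm (norm (c k * fcoef g (j - \<sigma> k))) \<le> cmod (c k) * (\<integral>\<theta>. cmod (g \<theta>) \<partial>circ)"
      by (auto simp: norm_mult intro!: mult_left_mono norm_fcoef_le g)
  qed (intro summable_mult2 c)
  ultimately show "((\<lambda>k. c k * fcoef g (j - \<sigma> k)) has_sum fcoef (\<lambda>\<theta>. f \<theta> * g \<theta>) j) UNIV"
    by (intro norm_summable_imp_has_sum)
qed

text \<open>Membership in the Wiener algebra of the disk, with the coefficients as an argument.\<close>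

definition wiener :: "(complex \<Rightarrow> complex) \<Rightarrow> (nat \<Rightarrow> complex) \<Rightarrow> bool"
  where "wiener f c \<longleftrightarrow> summable (\<lambda>k. cmod (c k)) \<and> (\<forall>z\<in>cball 0 1. (\<lambda>k. c k * z ^ k) sums f z)"

lemma wiener_summable: "wiener f c \<Longrightarrow> summable (\<lambda>k. cmod (c k))"
  by (simp add: wiener_def)

lemma wiener_cis:
  assumes "wiener f c"
  shows "(\<lambda>k. c k * cis (of_int (int k) * \<theta>)) sums f (cis \<theta>)"
    and "(\<lambda>k. cnj (c k) * cis (of_int (- int k) * \<theta>)) sums cnj (f (cis \<theta>))"
proof -
  have "cis \<theta> \<in> cball 0 1" by simp
  then show 1: "(\<lambda>k. c k * cis (of_int (int k) * \<theta>)) sums f (cis \<theta>)"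
    using assms by (auto simp: wiener_def Complex.DeMoivre dest!: bspec[of _ _ "cis \<theta>"])
  have "(\<lambda>k. cnj (c k * cis (of_int (int k) * \<theta>))) sums cnj (f (cis \<theta>))"
    using 1 by (simp only: sums_cnj)
  then show "(\<lambda>k. cnj (c k) * cis (of_int (- int k) * \<theta>)) sums cnj (f (cis \<theta>))"
    by (simp add: cis_cnj)
qed

lemma fcoef_wiener_mult:
  assumes "wiener f c" "integrable circ g"
  shows "((\<lambda>k. c k * fcoef g (j - int k)) has_sum fcoef (\<lambda>\<theta>. f (cis \<theta>) * g \<theta>) j) UNIV"
    and "((\<lambda>k. cnj (c k) * fcoef g (j + int k)) has_sum fcoef (\<lambda>\<theta>. cnj (f (cis \<theta>)) * g \<theta>) j) UNIV"
  using fcoef_series_mult(1)[OF wiener_summable[OF assms(1)] wiener_cis(1)[OF assms(1)] assms(2), of j]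
    fcoef_series_mult(1)[of "\<lambda>k. cnj (c k)", OF _ wiener_cis(2)[OF assms(1)] assms(2), of j]
    wiener_summable[OF assms(1)] by simp_all

lemma fcoef_wiener:
  assumes "wiener f c"
  shows "fcoef (\<lambda>\<theta>. f (cis \<theta>)) j = (if j \<ge> 0 then c (nat j) else 0)"
proof -
  have "((\<lambda>k. c k * fcoef (\<lambda>_. 1) (j - int k)) has_sum fcoef (\<lambda>\<theta>. f (cis \<theta>) * 1) j) UNIV"
    by (rule fcoef_wiener_mult[OF assms]) (rule integrable_circ_continuous, auto)
  moreover have "((\<lambda>k. c k * fcoef (\<lambda>_. 1) (j - int k)) has_sum (\<Sum>k\<in>(if j \<ge> 0 then {nat j} else {}). c k * fcoef (\<lambda>_. 1) (j - int k))) UNIV"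
    by (rule has_sum_finite_neutralI) (auto simp: fcoef_one)
  ultimately have "fcoef (\<lambda>\<theta>. f (cis \<theta>)) j = (\<Sum>k\<in>(if j \<ge> 0 then {nat j} else {}). c k * fcoef (\<lambda>_. 1) (j - int k))"
    using has_sum_unique by fastforce
  also have "\<dots> = (if j \<ge> 0 then c (nat j) else 0)" by (auto simp: fcoef_one)
  finally show ?thesis .
qed

lemma holomorphic_wiener:
  assumes "f holomorphic_on ball 0 R" "R > 1"
  obtains c where "wiener f c"
proof -
  define c where "c = (\<lambda>k. (deriv ^^ k) f 0 / fact k)"
  have sums: "(\<lambda>k. c k * z ^ k) sums f z" if "z \<in> ball 0 R" for z
    using holomorphic_power_series[OF assms(1) that] by (simp add: c_def)
  obtain r where r: "1 < r" "r < R" using dense[OF assms(2)] by blast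
  have "summable (\<lambda>k. c k * of_real r ^ k)"
    using sums[of "of_real r"] r by (simp add: sums_iff)
  from powser_insidea[OF this, of 1] r have "summable (\<lambda>k. cmod (c k))" by simp
  then have "wiener f c" using sums assms(2) by (auto simp: wiener_def)
  then show thesis by (rule that)
qed

lemma wiener_continuous:
  assumes "wiener f c"
  shows "continuous_on (cball 0 1) f"
proof -
  have "uniform_limit (cball 0 1) (\<lambda>n z. \<Sum>k<n. c k * z ^ k) (\<lambda>z. \<Sum>k. c k * z ^ k) sequentially"
    by (rule Weierstrass_m_test[where M = "\<lambda>k. cmod (c k)"])
      (use wiener_summable[OF assms] in \<open>auto simp: norm_mult norm_power intro!: mult_left_le power_le_one\<close>)
  then have "continuous_on (cball 0 1) (\<lambda>z. \<Sum>k. c k * z ^ k)"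
    by (rule uniform_limit_theorem[rotated]) (auto intro!: continuous_intros always_eventually)
  then show ?thesis
    by (rule continuous_on_eq) (use assms in \<open>auto simp: wiener_def sums_iff\<close>)
qed

lemma continuous_on_cis_compose:
  assumes "continuous_on (sphere 0 1) f"
  shows "continuous_on A (\<lambda>\<theta>. f (cis \<theta>))"
  by (rule continuous_on_compose2[OF assms]) (auto intro!: continuous_intros)

lemma integrable_cis_compose:
  fixes f :: "complex \<Rightarrow> complex"
  shows "continuous_on (sphere 0 1) f \<Longrightarrow> integrable circ (\<lambda>\<theta>. f (cis \<theta>))"
  by (intro integrable_circ_continuous continuous_on_cis_compose)

text \<open>A nonnegative continuous function with integral zero vanishes everywhere on the circle.\<close>

lemma continuous_zero_mean_square:
  fixes f :: "'i \<Rightarrow> complex \<Rightarrow> complex"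
  assumes "finite I" "\<And>i. i \<in> I \<Longrightarrow> continuous_on (sphere 0 1) (f i)"
    and zero: "fcoef (\<lambda>\<theta>. \<Sum>i\<in>I. cnj (f i (cis \<theta>)) * f i (cis \<theta>)) 0 = 0"
    and "i \<in> I" "z \<in> sphere 0 1"
  shows "f i z = 0"
proof -
  define g where "g = (\<lambda>\<theta>. \<Sum>i\<in>I. (cmod (f i (cis \<theta>)))\<^sup>2)"
  have cont: "continuous_on {-pi..pi} g"
    unfolding g_def by (intro continuous_intros continuous_on_cis_compose assms(2))
  have "(\<Sum>i\<in>I. cnj (f i (cis \<theta>)) * f i (cis \<theta>)) = complex_of_real (g \<theta>)" for \<theta>
    unfolding g_def of_real_sum by (intro sum.cong refl) (metis complex_norm_square mult.commute)
  then have "integral\<^sup>L circ (\<lambda>\<theta>. complex_of_real (g \<theta>)) = 0"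
    using zero by (simp add: fcoef_def)
  then have "integral\<^sup>L circ g = 0" by simp
  moreover have "integrable circ g" by (rule integrable_circ_continuous[OF cont])
  ultimately have "(g has_integral 0) {-pi..pi}"
    using has_integral_integral_lebesgue_on[of "{-pi..pi}" g] by simp
  moreover obtain \<theta> where \<theta>: "\<theta> \<in> {-pi..pi}" "z = cis \<theta>"
  proof
    show "Arg z \<in> {-pi..pi}" using Arg_bounded[of z] by auto
    show "z = cis (Arg z)" using assms(5) cis_Arg[of z] by (cases "z = 0") (auto simp: sgn_div_norm)
  qed
  ultimately have "g \<theta> = 0"
    using has_integral_0_cbox_imp_0[of "-pi" pi g \<theta>] cont pi_gt_zero
    by (auto simp: g_def sum_nonneg)
  then have "(cmod (f i (cis \<theta>)))\<^sup>2 = 0"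
    unfolding g_def using assms(1,4) by (subst (asm) sum_nonneg_eq_0_iff) auto
  then show ?thesis using \<theta> by simp
qed

section \<open>Boundary values of bounded and of outer functions\<close>

text \<open>A property of functions which constants have, and which is closed under sums and products, passes to determinants and
  adjugates. In this way continuity, holomorphy, boundedness and convergence are inherited from the entries.\<close>

lemma det_closed:
  fixes Q :: "('x \<Rightarrow> complex) \<Rightarrow> bool" and A :: "'x \<Rightarrow> complex mat"
  assumes const: "\<And>c. Q (\<lambda>_. c)"
    and add: "\<And>f g. Q f \<Longrightarrow> Q g \<Longrightarrow> Q (\<lambda>x. f x + g x)"
    and mult: "\<And>f g. Q f \<Longrightarrow> Q g \<Longrightarrow> Q (\<lambda>x. f x * g x)"
    and A: "\<And>x. A x \<in> carrier_mat n n"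
    and entries: "\<And>i j. i < n \<Longrightarrow> j < n \<Longrightarrow> Q (\<lambda>x. A x $$ (i, j))"
  shows "Q (\<lambda>x. Determinant.det (A x))"
proof -
  have prod: "Q (\<lambda>x. \<Prod>i\<in>I. f i x)" if "finite I" "\<And>i. i \<in> I \<Longrightarrow> Q (f i)" for I :: "nat set" and f
    using that by (induction I) (auto intro: const mult)
  have sum: "Q (\<lambda>x. \<Sum>i\<in>I. f i x)" if "finite I" "\<And>i. i \<in> I \<Longrightarrow> Q (f i)" for I :: "(nat \<Rightarrow> nat) set" and f
    using that by (induction I) (auto intro: const add)
  have less: "p i < n" if "p permutes {0..<n}" "i < n" for p i
    using permutes_in_image[OF that(1), of i] that(2) by simp
  have "Q (\<lambda>x. \<Sum>p\<in>{p. p permutes {0..<n}}. signof p * (\<Prod>i=0..<n. A x $$ (i, p i)))"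
    by (intro sum mult const prod entries finite_permutations) (auto simp: less)
  then show ?thesis by (simp add: det_def'[OF A])
qed

lemma adj_mat_closed:
  fixes Q :: "('x \<Rightarrow> complex) \<Rightarrow> bool" and A :: "'x \<Rightarrow> complex mat"
  assumes const: "\<And>c. Q (\<lambda>_. c)"
    and add: "\<And>f g. Q f \<Longrightarrow> Q g \<Longrightarrow> Q (\<lambda>x. f x + g x)"
    and mult: "\<And>f g. Q f \<Longrightarrow> Q g \<Longrightarrow> Q (\<lambda>x. f x * g x)"
    and A: "\<And>x. A x \<in> carrier_mat n n"
    and entries: "\<And>i j. i < n \<Longrightarrow> j < n \<Longrightarrow> Q (\<lambda>x. A x $$ (i, j))"
    and ij: "i < n" "j < n"
  shows "Q (\<lambda>x. adj_mat (A x) $$ (i, j))"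
proof -
  have "Q (\<lambda>x. Determinant.det (mat_delete (A x) j i))"
  proof (rule det_closed[where Q = Q and A = "\<lambda>x. mat_delete (A x) j i" and n = "n - 1", OF const add mult])
    show "mat_delete (A x) j i \<in> carrier_mat (n - 1) (n - 1)" for x
      by (rule mat_delete_carrier[OF A])
    fix i' j' assume "i' < n - 1" "j' < n - 1"
    then have "mat_delete (A x) j i $$ (i', j') =
        A x $$ (if i' < j then i' else Suc i', if j' < i then j' else Suc j')" for x
      using A[of x] by (simp add: mat_delete_def)
    then show "Q (\<lambda>x. mat_delete (A x) j i $$ (i', j'))"
      using \<open>i' < n - 1\<close> \<open>j' < n - 1\<close> ij by (auto intro!: entries)
  qed
  moreover have "adj_mat (A x) $$ (i, j) = (- 1) ^ (j + i) * Determinant.det (mat_delete (A x) j i)" for x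
    using A[of x] ij by (simp add: adj_mat_def cofactor_def)
  ultimately show ?thesis by (auto intro: mult const)
qed

definition poisson :: "complex \<Rightarrow> real \<Rightarrow> real"
  where "poisson z \<theta> = (1 - (cmod z)\<^sup>2) / (cmod (1 - cnj z * cis \<theta>))\<^sup>2"

lemma poisson_denom:
  assumes "cmod z < 1"
  shows "1 - cnj z * cis \<theta> \<noteq> 0"
proof
  assume "1 - cnj z * cis \<theta> = 0"
  then have "cmod (cnj z * cis \<theta>) = 1" by simp
  then show False using assms by (simp add: norm_mult)
qed

lemma poisson_nonneg: "cmod z < 1 \<Longrightarrow> poisson z \<theta> \<ge> 0"
  by (auto simp: poisson_def power_le_one)

lemma continuous_poisson: "cmod z < 1 \<Longrightarrow> continuous_on A (poisson z)"
  unfolding poisson_def using poisson_denom[of z]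
  by (intro continuous_intros ballI) simp

text \<open>On the circle the Poisson kernel is \<open>(1 - \<bar>z\<bar>\<^sup>2) / (1 - cnj z * \<zeta>)\<close> times the geometric series
  \<open>\<Sum>k. z ^ k * \<zeta> powi - k\<close>. The mean of the product with \<open>g\<close> is therefore the power series, at \<open>z\<close>, of
  \<open>g\<close> times the first factor, and at \<open>z\<close> this factor is \<open>1\<close>.\<close>

lemma poisson_integral:
  assumes g: "g holomorphic_on ball 0 R" and R: "R > 1" and z: "cmod z < 1"
  shows "fcoef (\<lambda>\<theta>. complex_of_real (poisson z \<theta>) * g (cis \<theta>)) 0 = g z"
proof -
  define F where "F = (\<lambda>\<zeta>. g \<zeta> * complex_of_real (1 - (cmod z)\<^sup>2) / (1 - cnj z * \<zeta>))"
  define R' where "R' = (if z = 0 then R else min R (1 / cmod z))"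
  have R': "R' > 1" using R z by (auto simp: R'_def)
  have nz: "1 - cnj z * \<zeta> \<noteq> 0" if "\<zeta> \<in> ball 0 R'" for \<zeta>
  proof
    assume "1 - cnj z * \<zeta> = 0"
    then have "cmod (cnj z * \<zeta>) = 1" by simp
    then have "cmod z * cmod \<zeta> = 1" by (simp add: norm_mult)
    moreover have "z \<noteq> 0" using calculation by auto
    ultimately show False using that by (auto simp: R'_def field_simps)
  qed
  have "F holomorphic_on ball 0 R'"
    unfolding F_def using nz by (intro holomorphic_intros holomorphic_on_subset[OF g]) (auto simp: R'_def split: if_splits)
  from holomorphic_wiener[OF this R'] obtain c where c: "wiener F c" .
  have "F z = g z"
  proof -
    have "1 - cnj z * z = complex_of_real (1 - (cmod z)\<^sup>2)"
      using complex_norm_square[of z] by (simp add: mult.commute)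
    moreover have "1 - (cmod z)\<^sup>2 \<noteq> 0" using z by (metis abs_norm_cancel abs_square_less_1 diff_gt_0_iff_gt less_irrefl)
    ultimately show ?thesis by (simp add: F_def del: of_real_diff)
  qed
  have sm: "summable (\<lambda>k. cmod (z ^ k))" using z by (simp add: norm_power)
  have geo: "(\<lambda>k. z ^ k * cis (of_int (- int k) * \<theta>)) sums (1 / (1 - z * cis (- \<theta>)))" for \<theta>
  proof -
    have "(\<lambda>k. (z * cis (- \<theta>)) ^ k) sums (1 / (1 - z * cis (- \<theta>)))"
      using z by (intro geometric_sums) (simp add: norm_mult)
    moreover have "(z * cis (- \<theta>)) ^ k = z ^ k * cis (of_int (- int k) * \<theta>)" for k
      by (simp add: power_mult_distrib Complex.DeMoivre)
    ultimately show ?thesis by simp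
  qed
  have int: "integrable circ (\<lambda>\<theta>. F (cis \<theta>))"
    by (rule integrable_cis_compose[OF continuous_on_subset[OF wiener_continuous[OF c]]]) auto
  have "((\<lambda>k. z ^ k * fcoef (\<lambda>\<theta>. F (cis \<theta>)) (0 - - int k)) has_sum
      fcoef (\<lambda>\<theta>. 1 / (1 - z * cis (- \<theta>)) * F (cis \<theta>)) 0) UNIV"
    by (rule fcoef_series_mult(1)[OF sm geo int])
  then have "(\<lambda>k. c k * z ^ k) sums fcoef (\<lambda>\<theta>. 1 / (1 - z * cis (- \<theta>)) * F (cis \<theta>)) 0"
    by (auto simp: fcoef_wiener[OF c] mult.commute dest: has_sum_imp_sums)
  moreover have "(\<lambda>k. c k * z ^ k) sums F z" using c z by (simp add: wiener_def)
  ultimately have "fcoef (\<lambda>\<theta>. 1 / (1 - z * cis (- \<theta>)) * F (cis \<theta>)) 0 = g z"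
    using sums_unique2 \<open>F z = g z\<close> by metis
  moreover have "1 / (1 - z * cis (- \<theta>)) * F (cis \<theta>) = complex_of_real (poisson z \<theta>) * g (cis \<theta>)" for \<theta>
  proof -
    have "cnj (1 - cnj z * cis \<theta>) = 1 - z * cis (- \<theta>)" by (simp add: cis_cnj)
    then have "complex_of_real ((cmod (1 - cnj z * cis \<theta>))\<^sup>2) = (1 - cnj z * cis \<theta>) * (1 - z * cis (- \<theta>))"
      using complex_norm_square by metis
    then have "complex_of_real (poisson z \<theta>) = complex_of_real (1 - (cmod z)\<^sup>2) / ((1 - cnj z * cis \<theta>) * (1 - z * cis (- \<theta>)))"
      by (simp add: poisson_def)
    then show ?thesis by (simp add: F_def mult_ac)
  qed
  ultimately show ?thesis by simp
qed

lemma integral_poisson: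
  assumes "cmod z < 1"
  shows "integral\<^sup>L circ (poisson z) = 2 * pi"
proof -
  have "fcoef (\<lambda>\<theta>. complex_of_real (poisson z \<theta>) * 1) 0 = 1"
    by (rule poisson_integral[of "\<lambda>_. 1" 2]) (use assms in auto)
  then have "complex_of_real (integral\<^sup>L circ (poisson z)) = complex_of_real (2 * pi)"
    by (simp add: fcoef_def field_simps)
  then show ?thesis by (simp only: of_real_eq_iff)
qed

text \<open>A fixed sequence of radii replaces radial limits by limits of sequences, to which dominated convergence and
  measurability of limits apply.\<close>

definition rad :: "nat \<Rightarrow> real" where "rad n = 1 - 1 / (of_nat n + 2)"

lemma rad_bounds: "0 < rad n" "rad n < 1" "0 \<le> rad n"
  by (auto simp: rad_def field_simps)

lemma rad_tendsto: "rad \<longlonglongrightarrow> 1"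
  unfolding rad_def by real_asymp

lemma rad_filterlim: "filterlim rad (at_left 1) sequentially"
  using rad_tendsto rad_bounds(2) by (auto simp: filterlim_at less_imp_neq intro!: always_eventually)

lemma rad_cis_in_ball: "complex_of_real (rad n) * cis \<theta> \<in> ball 0 1"
  using rad_bounds[of n] by (simp add: norm_mult)

lemma holomorphic_dilate:
  assumes "f holomorphic_on ball 0 1"
  shows "(\<lambda>\<zeta>. f (complex_of_real (rad n) * \<zeta>)) holomorphic_on ball 0 (1 / rad n)" "1 / rad n > 1"
proof -
  show "1 / rad n > 1" using rad_bounds[of n] by simp
  have "f \<circ> (\<lambda>\<zeta>. complex_of_real (rad n) * \<zeta>) holomorphic_on ball 0 (1 / rad n)"
    by (rule holomorphic_on_compose_gen[OF _ assms])
      (use rad_bounds[of n] in \<open>auto intro!: holomorphic_intros simp: norm_mult field_simps\<close>)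
  then show "(\<lambda>\<zeta>. f (complex_of_real (rad n) * \<zeta>)) holomorphic_on ball 0 (1 / rad n)" by (simp add: o_def)
qed

lemma continuous_dilate:
  assumes "f holomorphic_on ball 0 1"
  shows "continuous_on A (\<lambda>\<theta>. f (complex_of_real (rad n) * cis \<theta>))"
  by (rule continuous_on_compose2[OF holomorphic_on_imp_continuous_on[OF assms]])
    (use rad_cis_in_ball in \<open>auto intro!: continuous_intros\<close>)

text \<open>Being a limit of continuous functions, this is measurable. With the values on the circle of a function in the
  Hardy class it agrees almost everywhere only (\<open>hardy_bdry\<close>).\<close>

definition bdry :: "(complex \<Rightarrow> complex) \<Rightarrow> real \<Rightarrow> complex"
  where "bdry f \<theta> = lim (\<lambda>n. f (complex_of_real (rad n) * cis \<theta>))"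

lemma bdry_measurable:
  assumes "f holomorphic_on ball 0 1"
  shows "bdry f \<in> borel_measurable circ"
  unfolding bdry_def
  by (intro borel_measurable_lim_metric borel_measurable_circ_continuous continuous_dilate[OF assms])

text \<open>Bounds on mean squares turn pointwise convergence into convergence in the mean: \<open>x \<le> min x N + x\<^sup>2 / N\<close>, where
  the first term converges dominatedly and the second is uniformly small for large \<open>N\<close>.\<close>

lemma mean_convergence:
  fixes f :: "nat \<Rightarrow> real \<Rightarrow> complex"
  assumes f: "\<And>n. continuous_on UNIV (f n)" and sq: "\<And>n. integral\<^sup>L circ (\<lambda>\<theta>. (cmod (f n \<theta>))\<^sup>2) \<le> B"
    and l: "l \<in> borel_measurable circ" and lb: "AE \<theta> in circ. cmod (l \<theta>) \<le> C"
    and lim: "AE \<theta> in circ. (\<lambda>n. f n \<theta>) \<longlonglongrightarrow> l \<theta>"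
  shows "(\<lambda>n. integral\<^sup>L circ (\<lambda>\<theta>. cmod (f n \<theta> - l \<theta>))) \<longlonglongrightarrow> 0"
proof (rule LIMSEQ_I)
  interpret finite_measure circ by (rule finite_measure_circ)
  have fm [measurable]: "f n \<in> borel_measurable circ" for n
    by (rule borel_measurable_circ_continuous[OF f])
  note l [measurable]
  have fi: "integrable circ (\<lambda>\<theta>. (cmod (f n \<theta>))\<^sup>2)" "integrable circ (f n)" for n
    by (auto intro!: integrable_circ_continuous continuous_intros continuous_on_subset[OF f])
  have li: "integrable circ (\<lambda>\<theta>. (cmod (l \<theta>))\<^sup>2)"
    by (rule integrable_const_bound[where B = "C\<^sup>2"]) (use lb in \<open>auto intro!: power_mono elim!: eventually_mono\<close>)
  have lint: "integrable circ l" by (rule integrable_circ_bounded[OF l lb])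
  define D where "D = 2 * B + 2 * integral\<^sup>L circ (\<lambda>\<theta>. (cmod (l \<theta>))\<^sup>2)"
  have par: "(cmod (a - b))\<^sup>2 \<le> 2 * (cmod a)\<^sup>2 + 2 * (cmod b)\<^sup>2" for a b :: complex
  proof -
    have "(cmod (a - b))\<^sup>2 \<le> (cmod a + cmod b)\<^sup>2" by (intro power_mono norm_triangle_ineq4) auto
    also have "\<dots> \<le> 2 * (cmod a)\<^sup>2 + 2 * (cmod b)\<^sup>2"
      using sum_squares_bound[of "cmod a" "cmod b"] by (simp add: power2_eq_square algebra_simps)
    finally show ?thesis .
  qed
  have dsq: "integrable circ (\<lambda>\<theta>. (cmod (f n \<theta> - l \<theta>))\<^sup>2)" for n
    by (rule Bochner_Integration.integrable_bound[where f = "\<lambda>\<theta>. 2 * (cmod (f n \<theta>))\<^sup>2 + 2 * (cmod (l \<theta>))\<^sup>2"])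
      (use fi li par in auto)
  have D: "integral\<^sup>L circ (\<lambda>\<theta>. (cmod (f n \<theta> - l \<theta>))\<^sup>2) \<le> D" for n
  proof -
    have "integral\<^sup>L circ (\<lambda>\<theta>. (cmod (f n \<theta> - l \<theta>))\<^sup>2) \<le>
        integral\<^sup>L circ (\<lambda>\<theta>. 2 * (cmod (f n \<theta>))\<^sup>2 + 2 * (cmod (l \<theta>))\<^sup>2)"
      by (rule integral_mono[OF dsq]) (use fi li par in auto)
    also have "\<dots> \<le> D" using sq[of n] fi li by (simp add: D_def)
    finally show ?thesis .
  qed
  have "D \<ge> 0" by (rule order.trans[OF _ D[of 0]]) auto
  fix e :: real assume e: "e > 0"
  \<comment> \<open>this makes \<open>D / N\<close> at most \<open>e / 2\<close>\<close>
  define N where "N = 2 * (D + 1) / e"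
  have N: "N > 0" using e \<open>D \<ge> 0\<close> by (simp add: N_def)
  have "(\<lambda>n. integral\<^sup>L circ (\<lambda>\<theta>. min (cmod (f n \<theta> - l \<theta>)) N)) \<longlonglongrightarrow> integral\<^sup>L circ (\<lambda>_. 0 :: real)"
  proof (rule integral_dominated_convergence[where w = "\<lambda>_. N"])
    show "AE \<theta> in circ. (\<lambda>n. min (cmod (f n \<theta> - l \<theta>)) N) \<longlonglongrightarrow> 0"
      using lim
    proof eventually_elim
      case (elim \<theta>)
      then have "(\<lambda>n. cmod (f n \<theta> - l \<theta>)) \<longlonglongrightarrow> 0" by (intro tendsto_norm_zero) (simp add: LIM_zero)
      from tendsto_min[OF this tendsto_const[of N]] show ?case using N by simp
    qed
  qed (use N in auto)
  then have "(\<lambda>n. integral\<^sup>L circ (\<lambda>\<theta>. min (cmod (f n \<theta> - l \<theta>)) N)) \<longlonglongrightarrow> 0" by simp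
  from LIMSEQ_D[OF this, of "e / 2"] e obtain n0 where
    n0: "\<And>n. n \<ge> n0 \<Longrightarrow> norm (integral\<^sup>L circ (\<lambda>\<theta>. min (cmod (f n \<theta> - l \<theta>)) N)) < e / 2" by auto
  show "\<exists>n0. \<forall>n\<ge>n0. norm (integral\<^sup>L circ (\<lambda>\<theta>. cmod (f n \<theta> - l \<theta>)) - 0) < e"
  proof (intro exI allI impI)
    fix n assume "n \<ge> n0"
    have mi: "integrable circ (\<lambda>\<theta>. min (cmod (f n \<theta> - l \<theta>)) N)"
      by (rule integrable_const_bound[where B = N]) (use N in auto)
    have "integral\<^sup>L circ (\<lambda>\<theta>. cmod (f n \<theta> - l \<theta>)) \<le>
        integral\<^sup>L circ (\<lambda>\<theta>. min (cmod (f n \<theta> - l \<theta>)) N + (cmod (f n \<theta> - l \<theta>))\<^sup>2 / N)"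
    proof (rule integral_mono)
      fix \<theta>
      show "cmod (f n \<theta> - l \<theta>) \<le> min (cmod (f n \<theta> - l \<theta>)) N + (cmod (f n \<theta> - l \<theta>))\<^sup>2 / N"
      proof (cases "cmod (f n \<theta> - l \<theta>) \<le> N")
        case False
        then have "cmod (f n \<theta> - l \<theta>) * N \<le> (cmod (f n \<theta> - l \<theta>))\<^sup>2"
          unfolding power2_eq_square by (intro mult_left_mono) auto
        then show ?thesis using N False by (simp add: field_simps add_increasing)
      qed (use N in simp)
    qed (use fi lint mi dsq in auto)
    also have "\<dots> = integral\<^sup>L circ (\<lambda>\<theta>. min (cmod (f n \<theta> - l \<theta>)) N) +
        integral\<^sup>L circ (\<lambda>\<theta>. (cmod (f n \<theta> - l \<theta>))\<^sup>2) / N"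
      using mi dsq by simp
    also have "\<dots> < e / 2 + e / 2"
    proof (rule add_less_le_mono)
      show "integral\<^sup>L circ (\<lambda>\<theta>. min (cmod (f n \<theta> - l \<theta>)) N) < e / 2" using n0[OF \<open>n \<ge> n0\<close>] by simp
      have "integral\<^sup>L circ (\<lambda>\<theta>. (cmod (f n \<theta> - l \<theta>))\<^sup>2) / N \<le> D / N" using D N by (intro divide_right_mono) auto
      also have "\<dots> \<le> e / 2" using e \<open>D \<ge> 0\<close> by (simp add: N_def field_simps)
      finally show "integral\<^sup>L circ (\<lambda>\<theta>. (cmod (f n \<theta> - l \<theta>))\<^sup>2) / N \<le> e / 2" .
    qed
    finally show "norm (integral\<^sup>L circ (\<lambda>\<theta>. cmod (f n \<theta> - l \<theta>)) - 0) < e" by simp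
  qed
qed

lemma hardy_bdry:
  assumes "hardy_H2 f"
  shows "AE \<theta> in circ. (\<lambda>n. f (complex_of_real (rad n) * cis \<theta>)) \<longlonglongrightarrow> f (cis \<theta>)"
    and "AE \<theta> in circ. bdry f \<theta> = f (cis \<theta>)"
proof -
  have "AE \<theta> in circ. ((\<lambda>r. f (complex_of_real r * cis \<theta>)) \<longlongrightarrow> f (cis \<theta>)) (at_left (1::real))"
    using assms by (simp add: hardy_H2_def)
  then show 1: "AE \<theta> in circ. (\<lambda>n. f (complex_of_real (rad n) * cis \<theta>)) \<longlonglongrightarrow> f (cis \<theta>)"
  proof eventually_elim
    case (elim \<theta>)
    show ?case by (rule filterlim_compose[OF elim rad_filterlim])
  qed
  then show "AE \<theta> in circ. bdry f \<theta> = f (cis \<theta>)"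
    by eventually_elim (simp add: bdry_def limI)
qed

text \<open>The maximum principle for the Hardy class: dilations are represented by their Poisson integrals, and converge to
  the boundary function in the mean.\<close>

lemma hardy_bounded:
  assumes f: "hardy_H2 f" and C: "AE \<theta> in circ. cmod (f (cis \<theta>)) \<le> C" and z: "z \<in> ball 0 1"
  shows "cmod (f z) \<le> C"
proof -
  have hol: "f holomorphic_on ball 0 1" using f by (simp add: hardy_H2_def)
  define fn where "fn = (\<lambda>n \<theta>. f (complex_of_real (rad n) * cis \<theta>))"
  have cont: "continuous_on A (fn n)" for A n unfolding fn_def by (rule continuous_dilate[OF hol])
  obtain B where B: "\<And>r. r \<in> {0..<1} \<Longrightarrow> integral {-pi..pi} (\<lambda>\<theta>. (cmod (f (complex_of_real r * cis \<theta>)))\<^sup>2) \<le> B"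
    using f unfolding hardy_H2_def by blast
  have B': "integral\<^sup>L circ (\<lambda>\<theta>. (cmod (fn n \<theta>))\<^sup>2) \<le> B" for n
  proof -
    have "integrable circ (\<lambda>\<theta>. (cmod (fn n \<theta>))\<^sup>2)"
      by (intro integrable_circ_continuous continuous_intros cont)
    then show ?thesis using B[of "rad n"] rad_bounds[of n]
      by (simp add: lebesgue_integral_eq_integral fn_def)
  qed
  have lb: "AE \<theta> in circ. cmod (bdry f \<theta>) \<le> C"
    using C hardy_bdry(2)[OF f] by eventually_elim simp
  have lim: "AE \<theta> in circ. (\<lambda>n. fn n \<theta>) \<longlonglongrightarrow> bdry f \<theta>"
    using hardy_bdry[OF f] unfolding fn_def by eventually_elim simp
  note meas = bdry_measurable[OF hol]
  have conv: "(\<lambda>n. integral\<^sup>L circ (\<lambda>\<theta>. cmod (fn n \<theta> - bdry f \<theta>))) \<longlonglongrightarrow> 0"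
    by (rule mean_convergence[OF cont B' meas lb lim])
  have z1: "cmod z < 1" using z by simp
  have pc: "continuous_on {-pi..pi} (poisson z)" by (rule continuous_poisson[OF z1])
  then have "bounded (poisson z ` {-pi..pi})"
    by (intro compact_imp_bounded compact_continuous_image) auto
  then obtain K where K: "\<And>\<theta>. \<theta> \<in> {-pi..pi} \<Longrightarrow> norm (poisson z \<theta>) \<le> K"
    unfolding bounded_iff by blast
  have K0: "K \<ge> 0" using K[of 0] norm_ge_zero[of "poisson z 0"] by (simp del: norm_ge_zero) 
  have pi: "integrable circ (poisson z)" by (rule integrable_circ_continuous[OF pc])
  have bint: "integrable circ (bdry f)" by (rule integrable_circ_bounded[OF meas lb])
  have di: "integrable circ (\<lambda>\<theta>. cmod (fn n \<theta> - bdry f \<theta>))" for n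
    by (intro integrable_norm Bochner_Integration.integrable_diff bint integrable_circ_continuous cont)
  have le: "cmod (f (complex_of_real (rad n) * z)) \<le> C + K * integral\<^sup>L circ (\<lambda>\<theta>. cmod (fn n \<theta> - bdry f \<theta>))" for n
  proof -
    have "f (complex_of_real (rad n) * z) = fcoef (\<lambda>\<theta>. complex_of_real (poisson z \<theta>) * fn n \<theta>) 0"
      using poisson_integral[OF holomorphic_dilate[OF hol] z1] by (simp add: fn_def)
    also have "cmod \<dots> \<le> integral\<^sup>L circ (\<lambda>\<theta>. poisson z \<theta> * cmod (fn n \<theta>)) / (2 * pi)"
      unfolding fcoef_def norm_divide
      by (intro frac_le order.trans[OF integral_norm_bound])
        (use poisson_nonneg[OF z1] in \<open>auto simp: norm_mult intro!: integral_nonneg_AE\<close>)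
    also have "\<dots> \<le> integral\<^sup>L circ (\<lambda>\<theta>. C * poisson z \<theta> + K * cmod (fn n \<theta> - bdry f \<theta>)) / (2 * pi)"
    proof (intro divide_right_mono integral_mono_AE)
      show "integrable circ (\<lambda>\<theta>. poisson z \<theta> * cmod (fn n \<theta>))"
        by (intro integrable_circ_continuous continuous_intros pc cont)
      show "integrable circ (\<lambda>\<theta>. C * poisson z \<theta> + K * cmod (fn n \<theta> - bdry f \<theta>))"
        using pi di by auto
      have "AE \<theta> in circ. \<theta> \<in> {-pi..pi}" using AE_space[of circ] by simp
      with lb show "AE \<theta> in circ. poisson z \<theta> * cmod (fn n \<theta>) \<le> C * poisson z \<theta> + K * cmod (fn n \<theta> - bdry f \<theta>)"
      proof eventually_elim
        case (elim \<theta>)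
        have "poisson z \<theta> * cmod (fn n \<theta>) \<le> poisson z \<theta> * (C + cmod (fn n \<theta> - bdry f \<theta>))"
          using elim norm_triangle_ineq2[of "fn n \<theta>" "bdry f \<theta>"]
          by (intro mult_left_mono poisson_nonneg z1) auto
        also have "\<dots> \<le> C * poisson z \<theta> + K * cmod (fn n \<theta> - bdry f \<theta>)"
          using mult_right_mono[of "poisson z \<theta>" K "cmod (fn n \<theta> - bdry f \<theta>)"] K[of \<theta>] elim
          by (simp add: ring_distribs mult.commute)
        finally show ?case .
      qed
    qed auto
    also have "\<dots> = (C * (2 * pi) + K * integral\<^sup>L circ (\<lambda>\<theta>. cmod (fn n \<theta> - bdry f \<theta>))) / (2 * pi)"
      using pi di by (simp add: integral_poisson[OF z1])
    also have "\<dots> = C + K * integral\<^sup>L circ (\<lambda>\<theta>. cmod (fn n \<theta> - bdry f \<theta>)) / (2 * pi)"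
      by (simp add: field_simps)
    also have "\<dots> \<le> C + K * integral\<^sup>L circ (\<lambda>\<theta>. cmod (fn n \<theta> - bdry f \<theta>)) / 1"
      using K0 pi_gt3 by (intro add_left_mono divide_left_mono) auto
    finally show ?thesis by simp
  qed
  have "(\<lambda>n. C + K * integral\<^sup>L circ (\<lambda>\<theta>. cmod (fn n \<theta> - bdry f \<theta>))) \<longlonglongrightarrow> C + K * 0"
    by (intro tendsto_intros conv)
  moreover have "(\<lambda>n. cmod (f (complex_of_real (rad n) * z))) \<longlonglongrightarrow> cmod (f z)"
  proof -
    have "isCont f z"
      using holomorphic_on_imp_continuous_on[OF hol] z by (simp add: continuous_on_eq_continuous_at)
    moreover have "(\<lambda>n. complex_of_real (rad n) * z) \<longlonglongrightarrow> complex_of_real 1 * z"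
      by (intro tendsto_intros rad_tendsto)
    ultimately show ?thesis by (intro tendsto_norm isCont_tendsto_compose[of z f]) auto
  qed
  ultimately show ?thesis using LIMSEQ_le le by fastforce
qed

text \<open>The minimum principle for outer functions: \<open>ln \<bar>g\<bar>\<close> is the Poisson integral of its boundary values, as the
  real part of the Herglotz kernel is the Poisson kernel.\<close>

lemma outer_lower_bound:
  assumes g: "outer_fun g" and \<delta>: "\<delta> > 0" "AE \<theta> in circ. \<delta> \<le> cmod (g (cis \<theta>))" and z: "z \<in> ball 0 1"
  shows "\<delta> \<le> cmod (g z)"
proof -
  define u where "u = (\<lambda>\<theta>. ln (cmod (g (cis \<theta>))))"
  have z1: "cmod z < 1" using z by simp
  have ui: "integrable circ u"
    using g by (simp add: outer_fun_def u_def absolutely_integrable_on_def set_integrable_def integrable_restrict_space)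
  define k where "k = (\<lambda>\<theta>. (cis \<theta> + z) / (cis \<theta> - z))"
  have nz: "cis \<theta> - z \<noteq> 0" for \<theta> using z1 by auto
  have kc: "continuous_on A k" for A unfolding k_def using nz by (intro continuous_intros) auto
  have "bounded (k ` {-pi..pi})" by (intro compact_imp_bounded compact_continuous_image kc) auto
  then obtain B where B: "\<And>\<theta>. \<theta> \<in> {-pi..pi} \<Longrightarrow> cmod (k \<theta>) \<le> B"
    unfolding bounded_iff by blast
  have ki: "integrable circ (\<lambda>\<theta>. k \<theta> * complex_of_real (u \<theta>))"
  proof (rule Bochner_Integration.integrable_bound[of _ "\<lambda>\<theta>. B * u \<theta>"])
    show "integrable circ (\<lambda>\<theta>. B * u \<theta>)" using ui by simp
    show "(\<lambda>\<theta>. k \<theta> * complex_of_real (u \<theta>)) \<in> borel_measurable circ"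
      using ui borel_measurable_circ_continuous[OF kc] by auto
    show "AE \<theta> in circ. norm (k \<theta> * complex_of_real (u \<theta>)) \<le> norm (B * u \<theta>)"
    proof (rule AE_I2)
      fix \<theta> assume "\<theta> \<in> space circ"
      then have "cmod (k \<theta>) \<le> \<bar>B\<bar>" using B[of \<theta>] by auto
      then show "norm (k \<theta> * complex_of_real (u \<theta>)) \<le> norm (B * u \<theta>)"
        by (simp add: norm_mult abs_mult mult_right_mono)
    qed
  qed
  have Rek: "Re (k \<theta>) = poisson z \<theta>" for \<theta>
  proof -
    have "k \<theta> = (cis \<theta> + z) * cnj (cis \<theta> - z) / complex_of_real ((cmod (cis \<theta> - z))\<^sup>2)"
      using nz[of \<theta>] unfolding k_def by (simp add: complex_div_cnj[of "cis \<theta> + z"] )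
    then have "Re (k \<theta>) = Re ((cis \<theta> + z) * cnj (cis \<theta> - z)) / (cmod (cis \<theta> - z))\<^sup>2"
      by simp
    also have "Re ((cis \<theta> + z) * cnj (cis \<theta> - z)) = 1 - (cmod z)\<^sup>2"
      by (simp add: cmod_power2 algebra_simps power2_eq_square[symmetric])
    also have "cmod (cis \<theta> - z) = cmod (1 - cnj z * cis \<theta>)"
    proof -
      have "cmod (1 - cnj z * cis \<theta>) = cmod (cnj (1 - cnj z * cis \<theta>))" by (rule complex_mod_cnj[symmetric])
      also have "cnj (1 - cnj z * cis \<theta>) = cis (- \<theta>) * (cis \<theta> - z)"
        by (simp add: cis_cnj cis_mult algebra_simps)
      finally show ?thesis by (simp add: norm_mult)
    qed
    finally show ?thesis by (simp add: poisson_def)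
  qed
  obtain c where c: "cmod c = 1" "g z = c * exp (integral {-pi..pi} (\<lambda>\<theta>. k \<theta> * complex_of_real (u \<theta>)) / complex_of_real (2 * pi))"
    using g z unfolding outer_fun_def k_def u_def by blast
  have "ln \<delta> * (2 * pi) = integral\<^sup>L circ (\<lambda>\<theta>. ln \<delta> * poisson z \<theta>)"
    by (simp add: integral_poisson[OF z1])
  also have "\<dots> \<le> integral\<^sup>L circ (\<lambda>\<theta>. Re (k \<theta> * complex_of_real (u \<theta>)))"
  proof (rule integral_mono_AE)
    show "integrable circ (\<lambda>\<theta>. ln \<delta> * poisson z \<theta>)"
      by (intro integrable_circ_continuous continuous_intros continuous_poisson z1)
    show "integrable circ (\<lambda>\<theta>. Re (k \<theta> * complex_of_real (u \<theta>)))" using ki by (rule integrable_Re)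
    show "AE \<theta> in circ. ln \<delta> * poisson z \<theta> \<le> Re (k \<theta> * complex_of_real (u \<theta>))"
      using \<delta>(2)
    proof eventually_elim
      case (elim \<theta>)
      then have "ln \<delta> \<le> u \<theta>" using \<delta>(1) ln_mono[of \<delta> "cmod (g (cis \<theta>))"] by (simp add: u_def)
      from mult_right_mono[OF this poisson_nonneg[OF z1, of \<theta>]] show ?case by (simp add: Rek mult.commute)
    qed
  qed
  also have "\<dots> = Re (integral {-pi..pi} (\<lambda>\<theta>. k \<theta> * complex_of_real (u \<theta>)))"
    using integral_Re[OF ki] lebesgue_integral_eq_integral[OF ki] by simp
  finally have "ln \<delta> \<le> Re (integral {-pi..pi} (\<lambda>\<theta>. k \<theta> * complex_of_real (u \<theta>)) / complex_of_real (2 * pi))"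
    by (simp add: Re_divide_of_real field_simps)
  then have "exp (ln \<delta>) \<le> cmod (g z)" by (simp add: c norm_mult)
  then show ?thesis using \<delta>(1) by simp
qed

text \<open>The Fourier coefficients of the boundary function are the Taylor coefficients, by dominated convergence along the
  dilations.\<close>

lemma fcoef_bounded_holomorphic:
  assumes f: "f holomorphic_on ball 0 1" and C: "\<And>z. z \<in> ball 0 1 \<Longrightarrow> cmod (f z) \<le> C"
    and c: "\<And>z. z \<in> ball 0 1 \<Longrightarrow> (\<lambda>k. c k * z ^ k) sums f z"
    and lim: "AE \<theta> in circ. (\<lambda>n. f (complex_of_real (rad n) * cis \<theta>)) \<longlonglongrightarrow> bdry f \<theta>"
  shows "integrable circ (bdry f)" "fcoef (bdry f) j = (if j \<ge> 0 then c (nat j) else 0)"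
proof -
  note meas = bdry_measurable[OF f]
  have bd: "AE \<theta> in circ. cmod (bdry f \<theta>) \<le> C"
    using lim
  proof eventually_elim
    case (elim \<theta>)
    have "\<forall>n. cmod (f (complex_of_real (rad n) * cis \<theta>)) \<le> C" using C rad_cis_in_ball by blast
    then show ?case using Lim_bounded[OF tendsto_norm[OF elim], of 0 C] by auto
  qed
  show "integrable circ (bdry f)" by (rule integrable_circ_bounded[OF meas bd])
  let ?fn = "\<lambda>n \<theta>. f (complex_of_real (rad n) * cis \<theta>)"
  have cm: "(\<lambda>\<theta>. cis (- (of_int j * \<theta>))) \<in> borel_measurable circ"
    by (intro borel_measurable_circ_continuous continuous_intros)
  have fm: "?fn n \<in> borel_measurable circ" for n
    by (intro borel_measurable_circ_continuous continuous_dilate[OF f])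
  have "(\<lambda>n. integral\<^sup>L circ (\<lambda>\<theta>. cis (- (of_int j * \<theta>)) * ?fn n \<theta>)) \<longlonglongrightarrow>
      integral\<^sup>L circ (\<lambda>\<theta>. cis (- (of_int j * \<theta>)) * bdry f \<theta>)"
  proof (rule integral_dominated_convergence[where w = "\<lambda>_. C"])
    show "AE \<theta> in circ. (\<lambda>n. cis (- (of_int j * \<theta>)) * ?fn n \<theta>) \<longlonglongrightarrow> cis (- (of_int j * \<theta>)) * bdry f \<theta>"
      using lim by eventually_elim (intro tendsto_intros)
    show "AE \<theta> in circ. norm (cis (- (of_int j * \<theta>)) * ?fn n \<theta>) \<le> C" for n
      using C rad_cis_in_ball by (auto simp: norm_mult)
    show "integrable circ (\<lambda>_. C)" by (intro integrable_circ_continuous continuous_intros)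
  qed (use cm fm meas in auto)
  then have "(\<lambda>n. fcoef (?fn n) j) \<longlonglongrightarrow> fcoef (bdry f) j"
    unfolding fcoef_def by (intro tendsto_divide tendsto_const) auto
  moreover have "fcoef (?fn n) j = (if j \<ge> 0 then c (nat j) * complex_of_real (rad n) ^ nat j else 0)" for n
  proof -
    define ck where "ck = (\<lambda>k. c k * complex_of_real (rad n) ^ k)"
    have s: "(\<lambda>k. ck k * z ^ k) sums f (complex_of_real (rad n) * z)" if "z \<in> cball 0 1" for z
    proof -
      have "complex_of_real (rad n) * z \<in> ball 0 1"
      proof -
        have "cmod (complex_of_real (rad n) * z) \<le> rad n * 1"
          using that rad_bounds[of n] by (auto simp: norm_mult intro!: mult_left_le)
        then show ?thesis using rad_bounds[of n] by simp
      qed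
      from c[OF this] show ?thesis by (simp add: ck_def power_mult_distrib mult.assoc)
    qed
    have "summable (\<lambda>k. cmod (ck k))"
    proof -
      obtain r where r: "rad n < r" "r < 1" using dense[OF rad_bounds(2)] by blast
      then have "complex_of_real r \<in> ball 0 1" using rad_bounds[of n] by simp
      then have "summable (\<lambda>k. c k * complex_of_real r ^ k)" using c by (simp add: sums_iff)
      from powser_insidea[OF this, of "complex_of_real (rad n)"] r rad_bounds[of n]
      show ?thesis by (simp add: ck_def)
    qed
    then have "wiener (\<lambda>z. f (complex_of_real (rad n) * z)) ck" using s by (simp add: wiener_def)
    from fcoef_wiener[OF this, of j] show ?thesis by (simp add: ck_def)
  qed
  moreover have "(\<lambda>n. if j \<ge> 0 then c (nat j) * complex_of_real (rad n) ^ nat j else 0) \<longlonglongrightarrow>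
      (if j \<ge> 0 then c (nat j) * complex_of_real 1 ^ nat j else 0)"
    by (cases "j \<ge> 0") (auto simp del: of_real_1 intro!: tendsto_intros rad_tendsto)
  ultimately show "fcoef (bdry f) j = (if j \<ge> 0 then c (nat j) else 0)"
    using LIMSEQ_unique by (auto split: if_splits)
qed

subsection \<open>Analytic continuation of the outer factor\<close>

lemma det_mat_cnj: "Determinant.det (mat_cnj A) = cnj (Determinant.det A)"
proof -
  interpret comm_ring_hom cnj by unfold_locales auto
  show ?thesis unfolding mat_cnj_def by (rule hom_det)
qed

lemma det_mat_adjoint:
  assumes "A \<in> carrier_mat n n"
  shows "Determinant.det (mat_adjoint A) = cnj (Determinant.det A)"
proof -
  have "mat_adjoint A = transpose_mat (mat_cnj A)" by (simp add: transpose_cnj)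
  moreover have "Determinant.det (transpose_mat (mat_cnj A)) = Determinant.det (mat_cnj A)"
    by (rule det_transpose[of _ n]) (use assms in simp)
  ultimately show ?thesis by (simp add: det_mat_cnj)
qed

text \<open>Convergence at the radius \<open>r > 1\<close> gives geometric decay.\<close>

lemma holomorphic_wiener_decay:
  assumes "f holomorphic_on ball 0 R" "1 < r" "r < R"
  obtains c M where "wiener f c" "\<And>k. cmod (c k) \<le> M * (1 / r) ^ k"
proof -
  define c where "c = (\<lambda>k. (deriv ^^ k) f 0 / fact k)"
  have sums: "(\<lambda>k. c k * z ^ k) sums f z" if "z \<in> ball 0 R" for z
    using holomorphic_power_series[OF assms(1) that] by (simp add: c_def)
  have sr: "summable (\<lambda>k. c k * of_real r ^ k)"
    using sums[of "of_real r"] assms by (simp add: sums_iff)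
  from powser_insidea[OF this, of 1] assms have "summable (\<lambda>k. cmod (c k))" by simp
  then have w: "wiener f c" using sums assms by (auto simp: wiener_def)
  from summable_LIMSEQ_zero[OF sr] have "Bseq (\<lambda>k. c k * of_real r ^ k)"
    by (intro convergent_imp_Bseq convergentI)
  then obtain M where M: "\<And>k. norm (c k * of_real r ^ k) \<le> M" by (auto simp: Bseq_def)
  have "cmod (c k) \<le> M * (1 / r) ^ k" for k
    using M[of k] assms by (simp add: norm_mult norm_power power_divide field_simps)
  with w show thesis by (rule that)
qed

text \<open>An antianalytic factor only moves frequencies down. A coefficient at \<open>j \<ge> 0\<close> of the product thus involves
  only the coefficients of \<open>f\<close> from \<open>j\<close> on.\<close>

lemma fcoef_antianalytic_decay:
  assumes f: "wiener f c" and dec: "\<And>k. cmod (c k) \<le> M * \<rho> ^ k" and \<rho>: "0 \<le> \<rho>" "\<rho> < 1"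
    and E: "integrable circ E" and anti: "\<And>i. i > 0 \<Longrightarrow> fcoef E i = 0"
  obtains M' where "\<And>j. cmod (fcoef (\<lambda>\<theta>. f (cis \<theta>) * E \<theta>) (int j)) \<le> M' * \<rho> ^ j"
proof -
  define B where "B = integral\<^sup>L circ (\<lambda>\<theta>. cmod (E \<theta>))"
  have B: "B \<ge> 0" "cmod (fcoef E i) \<le> B" for i
    using norm_fcoef_le[OF E] by (auto simp: B_def)
  have M: "M \<ge> 0" using dec[of 0] norm_ge_zero[of "c 0"] by (simp del: norm_ge_zero)
  have "cmod (fcoef (\<lambda>\<theta>. f (cis \<theta>) * E \<theta>) (int j)) \<le> M * B / (1 - \<rho>) * \<rho> ^ j" for j
  proof -
    have s: "(\<lambda>k. c k * fcoef E (int j - int k)) sums fcoef (\<lambda>\<theta>. f (cis \<theta>) * E \<theta>) (int j)"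
      by (rule has_sum_imp_sums[OF fcoef_wiener_mult(1)[OF f E]])
    have "(\<lambda>k. c (k + j) * fcoef E (- int k)) sums fcoef (\<lambda>\<theta>. f (cis \<theta>) * E \<theta>) (int j)"
      using sums_iff_shift[of "\<lambda>k. c k * fcoef E (int j - int k)" j "fcoef (\<lambda>\<theta>. f (cis \<theta>) * E \<theta>) (int j)"] s
      by (simp add: anti)
    then have 1: "fcoef (\<lambda>\<theta>. f (cis \<theta>) * E \<theta>) (int j) = (\<Sum>k. c (k + j) * fcoef E (- int k))"
      by (simp add: sums_iff)
    have le: "norm (c (k + j) * fcoef E (- int k)) \<le> M * B * \<rho> ^ j * \<rho> ^ k" for k
    proof -
      have "norm (c (k + j) * fcoef E (- int k)) \<le> (M * \<rho> ^ (k + j)) * B"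
        unfolding norm_mult by (intro mult_mono dec B) (use M \<rho> in auto)
      then show ?thesis by (simp add: power_add mult_ac)
    qed
    have geo: "(\<lambda>k. M * B * \<rho> ^ j * \<rho> ^ k) sums (M * B * \<rho> ^ j * (1 / (1 - \<rho>)))"
      using \<rho> by (intro sums_mult geometric_sums) auto
    have "cmod (\<Sum>k. c (k + j) * fcoef E (- int k)) \<le> (\<Sum>k. M * B * \<rho> ^ j * \<rho> ^ k)"
      by (rule norm_suminf_le[OF le]) (use geo in \<open>auto simp: sums_iff\<close>)
    also have "\<dots> = M * B / (1 - \<rho>) * \<rho> ^ j" using geo by (simp add: sums_iff)
    finally show ?thesis using 1 by simp
  qed
  then show thesis by (rule that)
qed

lemma mat_adjoint_gram_diag:
  fixes A :: "complex mat"
  assumes "A \<in> carrier_mat d d" "j < d"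
  shows "(mat_adjoint A * A) $$ (j, j) = complex_of_real (\<Sum>i<d. (cmod (A $$ (i, j)))\<^sup>2)"
proof -
  have "(mat_adjoint A * A) $$ (j, j) = (\<Sum>i<d. cnj (A $$ (i, j)) * A $$ (i, j))"
    using assms by (simp add: scalar_prod_def atLeast0LessThan)
  also have "\<dots> = complex_of_real (\<Sum>i<d. (cmod (A $$ (i, j)))\<^sup>2)"
    unfolding of_real_sum by (intro sum.cong refl) (metis complex_norm_square mult.commute)
  finally show ?thesis .
qed

text \<open>On the circle \<open>hs\<close> equals its own adjoint inverse times \<open>h h\<^sup>*\<close>. The adjoint inverse is antianalytic
  and bounded, so by \<open>fcoef_antianalytic_decay\<close> the Taylor coefficients of \<open>hs\<close> decay like those of \<open>h\<close>.\<close>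

lemma outer_factor_extends:
  assumes hc: "\<And>z. h z \<in> carrier_mat d d" and R: "R > 1"
    and hhol: "\<And>i j. i < d \<Longrightarrow> j < d \<Longrightarrow> (\<lambda>z. h z $$ (i, j)) holomorphic_on ball 0 R"
    and hdet: "\<And>z. z \<in> cball 0 1 \<Longrightarrow> Determinant.det (h z) \<noteq> 0"
    and outer: "outer_H2_mat d hs"
    and factor: "AE \<theta> in circ. h (cis \<theta>) * mat_adjoint (h (cis \<theta>)) = mat_adjoint (hs (cis \<theta>)) * hs (cis \<theta>)"
  obtains r H where "r > 1" "\<And>z. H z \<in> carrier_mat d d"
    "\<And>i j. i < d \<Longrightarrow> j < d \<Longrightarrow> (\<lambda>z. H z $$ (i, j)) holomorphic_on ball 0 r"
    "\<And>z. z \<in> ball 0 1 \<Longrightarrow> H z = hs z"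
    "\<And>z. z \<in> cball 0 1 \<Longrightarrow> Determinant.det (H z) \<noteq> 0"
    "\<And>z. z \<in> sphere 0 1 \<Longrightarrow> h z * mat_adjoint (h z) = mat_adjoint (H z) * H z"
proof -
  \<comment> \<open>outside the closed disk the size of \<open>hs z\<close> is not known\<close>
  define S where "S = (\<lambda>z. if z \<in> cball 0 1 then hs z else 1\<^sub>m d)"
  have S [simp]: "S z \<in> carrier_mat d d" for z using outer by (auto simp: S_def outer_H2_mat_def)
  have Sdim [simp]: "dim_row (S z) = d" "dim_col (S z) = d" for z using carrier_matD[OF S] by auto
  have hdim [simp]: "dim_row (h z) = d" "dim_col (h z) = d" for z using carrier_matD[OF hc] by auto
  have S_hs: "S z = hs z" if "cmod z \<le> 1" for z using that by (simp add: S_def)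
  have hardy: "hardy_H2 (\<lambda>z. hs z $$ (i, j))" if "i < d" "j < d" for i j
    using outer that by (simp add: outer_H2_mat_def)
  have Shol: "(\<lambda>z. S z $$ (i, j)) holomorphic_on ball 0 1" if "i < d" "j < d" for i j
  proof (rule holomorphic_transform)
    show "(\<lambda>z. hs z $$ (i, j)) holomorphic_on ball 0 1" using hardy[OF that] by (simp add: hardy_H2_def)
  qed (simp add: S_hs)
  have hcont: "continuous_on (sphere 0 1) (\<lambda>z. h z $$ (i, j))" if "i < d" "j < d" for i j
    by (rule continuous_on_subset[OF holomorphic_on_imp_continuous_on[OF hhol[OF that]]]) (use R in auto)
  have facS: "AE \<theta> in circ. h (cis \<theta>) * mat_adjoint (h (cis \<theta>)) = mat_adjoint (S (cis \<theta>)) * S (cis \<theta>)"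
    using factor by eventually_elim (simp add: S_hs)
  have AE_all: "AE \<theta> in circ. \<forall>i<d. \<forall>j<d. P i j \<theta>" if "\<And>i j. i < d \<Longrightarrow> j < d \<Longrightarrow> AE \<theta> in circ. P i j \<theta>" for P
  proof -
    have "AE \<theta> in circ. \<forall>i\<in>{..<d}. \<forall>j\<in>{..<d}. P i j \<theta>"
      using that by (intro AE_finite_allI) auto
    then show ?thesis by eventually_elim auto
  qed
  have rl: "AE \<theta> in circ. \<forall>i<d. \<forall>j<d. (\<lambda>n. S (complex_of_real (rad n) * cis \<theta>) $$ (i, j)) \<longlonglongrightarrow> S (cis \<theta>) $$ (i, j)"
  proof (rule AE_all)
    fix i j assume "i < d" "j < d"
    from hardy_bdry(1)[OF hardy[OF this]]
    show "AE \<theta> in circ. (\<lambda>n. S (complex_of_real (rad n) * cis \<theta>) $$ (i, j)) \<longlonglongrightarrow> S (cis \<theta>) $$ (i, j)"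
      by eventually_elim (use rad_bounds in \<open>simp add: S_hs norm_mult less_imp_le\<close>)
  qed
  \<comment> \<open>the diagonal entries of \<open>w\<close> bound the columns of \<open>hs\<close> on the circle, hence in the disk\<close>
  have "\<exists>B. \<forall>z\<in>sphere 0 1. \<forall>j<d. Re ((h z * mat_adjoint (h z)) $$ (j, j)) \<le> B"
  proof -
    have "\<exists>B. \<forall>z\<in>sphere 0 1. cmod ((h z * mat_adjoint (h z)) $$ (j, j)) \<le> B" if "j < d" for j
    proof -
      have "continuous_on (sphere 0 1) (\<lambda>z. \<Sum>i<d. h z $$ (j, i) * cnj (h z $$ (j, i)))"
        using that by (intro continuous_intros hcont) auto
      then have "bounded ((\<lambda>z. \<Sum>i<d. h z $$ (j, i) * cnj (h z $$ (j, i))) ` sphere 0 1)"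
        by (intro compact_imp_bounded compact_continuous_image) auto
      then show ?thesis using that unfolding bounded_iff by (simp add: scalar_prod_def atLeast0LessThan)
    qed
    then obtain B where B: "\<And>j z. j < d \<Longrightarrow> z \<in> sphere 0 1 \<Longrightarrow> cmod ((h z * mat_adjoint (h z)) $$ (j, j)) \<le> B j"
      by metis
    have "Re ((h z * mat_adjoint (h z)) $$ (j, j)) \<le> (\<Sum>j<d. \<bar>B j\<bar>)" if "z \<in> sphere 0 1" "j < d" for z j
    proof -
      have "Re ((h z * mat_adjoint (h z)) $$ (j, j)) \<le> \<bar>B j\<bar>"
        using B[OF that(2,1)] complex_Re_le_cmod order_trans abs_ge_self by meson
      also have "\<dots> \<le> (\<Sum>j<d. \<bar>B j\<bar>)" using that by (intro member_le_sum) auto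
      finally show ?thesis .
    qed
    then show ?thesis by blast
  qed
  then obtain B where B: "\<And>z j. z \<in> sphere 0 1 \<Longrightarrow> j < d \<Longrightarrow> Re ((h z * mat_adjoint (h z)) $$ (j, j)) \<le> B" by blast
  have Sbd: "cmod (S z $$ (i, j)) \<le> sqrt B" if ij: "i < d" "j < d" and z: "z \<in> ball 0 1" for i j z
  proof -
    have "AE \<theta> in circ. cmod (hs (cis \<theta>) $$ (i, j)) \<le> sqrt B"
      using facS
    proof eventually_elim
      case (elim \<theta>)
      have "(cmod (S (cis \<theta>) $$ (i, j)))\<^sup>2 \<le> (\<Sum>i<d. (cmod (S (cis \<theta>) $$ (i, j)))\<^sup>2)"
        using ij by (intro member_le_sum) auto
      also have "\<dots> = Re ((h (cis \<theta>) * mat_adjoint (h (cis \<theta>))) $$ (j, j))"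
        unfolding elim using ij by (subst mat_adjoint_gram_diag[of _ d]) auto
      also have "\<dots> \<le> B" using ij by (intro B) auto
      finally show ?case by (simp add: S_hs real_le_rsqrt)
    qed
    from hardy_bounded[OF hardy[OF ij] this z] z show ?thesis by (simp add: S_hs)
  qed
  \<comment> \<open>the determinants of \<open>h\<close> and \<open>hs\<close> have the same absolute value almost everywhere on the circle\<close>
  have hdetc: "continuous_on (sphere 0 1) (\<lambda>z. Determinant.det (h z))"
    by (rule det_closed[where Q = "continuous_on (sphere 0 1)" and A = h and n = d])
      (auto intro!: continuous_intros hcont hc)
  have "\<exists>\<delta>>0. \<forall>z\<in>sphere 0 1. \<delta> \<le> cmod (Determinant.det (h z))"
  proof -
    have "continuous_on (sphere 0 1) (\<lambda>z. cmod (Determinant.det (h z)))" by (intro continuous_intros hdetc)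
    then obtain z0 where "z0 \<in> sphere (0::complex) 1" "\<forall>z\<in>sphere 0 1. cmod (Determinant.det (h z0)) \<le> cmod (Determinant.det (h z))"
      using continuous_attains_inf[of "sphere (0::complex) 1" "\<lambda>z. cmod (Determinant.det (h z))"]
        compact_sphere[of "0::complex" 1] sphere_eq_empty[of "0::complex" 1] by fastforce
    moreover have "Determinant.det (h z0) \<noteq> 0" using hdet[of z0] calculation(1) by auto
    ultimately show ?thesis by (intro exI[of _ "cmod (Determinant.det (h z0))"]) auto
  qed
  then obtain \<delta> where \<delta>: "\<delta> > 0" "\<And>z. z \<in> sphere 0 1 \<Longrightarrow> \<delta> \<le> cmod (Determinant.det (h z))" by blast
  have detsq: "cmod (Determinant.det (h z)) = cmod (Determinant.det A)"
    if "h z * mat_adjoint (h z) = mat_adjoint A * A" "A \<in> carrier_mat d d" for z A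
  proof -
    have "Determinant.det (h z * mat_adjoint (h z)) = Determinant.det (mat_adjoint A * A)" using that by simp
    then have "Determinant.det (h z) * cnj (Determinant.det (h z)) = cnj (Determinant.det A) * Determinant.det A"
      by (simp add: det_mult[OF hc mat_adjoint_carrier[OF hc]] det_mat_adjoint[OF hc]
          det_mult[OF mat_adjoint_carrier[OF that(2)] that(2)] det_mat_adjoint[OF that(2)])
    then have "(cmod (Determinant.det (h z)))\<^sup>2 = (cmod (Determinant.det A))\<^sup>2"
      by (metis complex_norm_square mult.commute of_real_eq_iff)
    then show ?thesis by simp
  qed
  have dcirc: "AE \<theta> in circ. \<delta> \<le> cmod (Determinant.det (S (cis \<theta>)))"
    using facS
  proof eventually_elim
    case (elim \<theta>)
    show ?case using \<delta>(2)[of "cis \<theta>"] detsq[OF elim S] by simp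
  qed
  have dS: "\<delta> \<le> cmod (Determinant.det (S z))" if z: "z \<in> ball 0 1" for z
  proof -
    have "AE \<theta> in circ. \<delta> \<le> cmod (Determinant.det (hs (cis \<theta>)))"
      using dcirc by eventually_elim (simp add: S_hs)
    then show ?thesis
      using outer_lower_bound[of "\<lambda>z. Determinant.det (hs z)" \<delta> z] outer \<delta> z by (simp add: outer_H2_mat_def S_hs)
  qed
  \<comment> \<open>products of an entry of the inverse of \<open>hs\<close> and one of \<open>h\<close>; the conjugates of their boundary values are
    antianalytic\<close>
  define V where "V = (\<lambda>z. adj_mat (S z))"
  define G where "G = (\<lambda>x a b e z. V z $$ (x, a) / Determinant.det (S z) * h z $$ (b, e))"
  have Ghol: "G x a b e holomorphic_on ball 0 1" if "x < d" "a < d" "b < d" "e < d" for x a b e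
  proof -
    have "(\<lambda>z. V z $$ (x, a)) holomorphic_on ball 0 1"
      unfolding V_def using that
      by (intro adj_mat_closed[where Q = "\<lambda>f. f holomorphic_on ball 0 1" and A = S and n = d])
        (auto intro!: holomorphic_intros Shol)
    moreover have "(\<lambda>z. Determinant.det (S z)) holomorphic_on ball 0 1"
      by (intro det_closed[where Q = "\<lambda>f. f holomorphic_on ball 0 1" and A = S and n = d])
        (auto intro!: holomorphic_intros Shol)
    moreover have "(\<lambda>z. h z $$ (b, e)) holomorphic_on ball 0 1"
      by (rule holomorphic_on_subset[OF hhol]) (use that R in auto)
    moreover have "Determinant.det (S z) \<noteq> 0" if "z \<in> ball 0 1" for z using dS[OF that] \<delta>(1) by auto
    ultimately show ?thesis unfolding G_def by (intro holomorphic_intros) auto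
  qed
  have Gbd: "\<exists>C. \<forall>z\<in>ball 0 1. cmod (G x a b e z) \<le> C" if "x < d" "a < d" "b < d" "e < d" for x a b e
  proof -
    let ?Q = "\<lambda>f :: complex \<Rightarrow> complex. \<exists>C. \<forall>z\<in>ball 0 1. cmod (f z) \<le> C"
    have Qmult: "?Q (\<lambda>z. f z * g z)" if fg: "?Q f" "?Q g" for f g
    proof -
      obtain C D where "\<forall>z\<in>ball 0 1. cmod (f z) \<le> C" "\<forall>z\<in>ball 0 1. cmod (g z) \<le> D" using fg by blast
      then have "\<forall>z\<in>ball 0 1. cmod (f z * g z) \<le> \<bar>C\<bar> * \<bar>D\<bar>"
        unfolding norm_mult by (intro ballI mult_mono) force+
      then show ?thesis by blast
    qed
    have Qadd: "?Q (\<lambda>z. f z + g z)" if fg: "?Q f" "?Q g" for f g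
    proof -
      obtain C D where "\<forall>z\<in>ball 0 1. cmod (f z) \<le> C" "\<forall>z\<in>ball 0 1. cmod (g z) \<le> D" using fg by blast
      then have "\<forall>z\<in>ball 0 1. cmod (f z + g z) \<le> C + D" by (intro ballI norm_triangle_mono) auto
      then show ?thesis by blast
    qed
    have "?Q (\<lambda>z. V z $$ (x, a))"
      unfolding V_def
    proof (rule adj_mat_closed[where Q = ?Q and A = S and n = d, OF _ Qadd Qmult S _ that(1,2)])
      show "?Q (\<lambda>_. c)" for c by blast
      show "?Q (\<lambda>z. S z $$ (i, j))" if "i < d" "j < d" for i j using Sbd[OF that] by blast
    qed
    moreover have "?Q (\<lambda>z. 1 / Determinant.det (S z))"
    proof (intro exI[of _ "1 / \<delta>"] ballI)
      fix z :: complex assume "z \<in> ball 0 1"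
      from dS[OF this] show "cmod (1 / Determinant.det (S z)) \<le> 1 / \<delta>"
        using \<delta>(1) by (simp add: norm_divide frac_le)
    qed
    moreover have "?Q (\<lambda>z. h z $$ (b, e))"
    proof -
      have "bounded ((\<lambda>z. h z $$ (b, e)) ` cball 0 1)"
        by (intro compact_imp_bounded compact_continuous_image continuous_on_subset[OF holomorphic_on_imp_continuous_on[OF hhol]])
          (use that R in auto)
      then show ?thesis unfolding bounded_iff by (meson ball_subset_cball imageI subsetD)
    qed
    ultimately have "?Q (\<lambda>z. V z $$ (x, a) * (1 / Determinant.det (S z)) * h z $$ (b, e))" by (intro Qmult)
    then show ?thesis by (simp add: G_def)
  qed
  have Glim: "AE \<theta> in circ. (\<lambda>n. G x a b e (complex_of_real (rad n) * cis \<theta>)) \<longlonglongrightarrow> G x a b e (cis \<theta>)"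
    if "x < d" "a < d" "b < d" "e < d" for x a b e
    using rl dcirc
  proof eventually_elim
    case (elim \<theta>)
    let ?z = "\<lambda>n. complex_of_real (rad n) * cis \<theta>"
    let ?A = "\<lambda>n. case n of None \<Rightarrow> S (cis \<theta>) | Some k \<Rightarrow> S (?z k)"
    let ?Q = "\<lambda>f :: nat option \<Rightarrow> complex. (\<lambda>k. f (Some k)) \<longlonglongrightarrow> f None"
    have A: "?A n \<in> carrier_mat d d" for n by (cases n) auto
    have ent: "?Q (\<lambda>n. ?A n $$ (i, j))" if "i < d" "j < d" for i j using elim(1) that by simp
    have "?Q (\<lambda>n. adj_mat (?A n) $$ (x, a))"
      by (rule adj_mat_closed[where Q = ?Q and A = ?A, OF _ _ _ A ent that(1,2)]) (intro tendsto_intros; assumption)+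
    moreover have "?Q (\<lambda>n. Determinant.det (?A n))"
      by (rule det_closed[where Q = ?Q and A = ?A, OF _ _ _ A ent]) (intro tendsto_intros; assumption)+
    moreover have "(\<lambda>n. h (?z n) $$ (b, e)) \<longlonglongrightarrow> h (cis \<theta>) $$ (b, e)"
    proof -
      have "isCont (\<lambda>z. h z $$ (b, e)) (cis \<theta>)"
        using holomorphic_on_imp_continuous_on[OF hhol[OF that(3,4)]] R by (simp add: continuous_on_eq_continuous_at)
      moreover have "?z \<longlonglongrightarrow> complex_of_real 1 * cis \<theta>" by (intro tendsto_intros rad_tendsto)
      ultimately show ?thesis by (intro isCont_tendsto_compose[of "cis \<theta>" "\<lambda>z. h z $$ (b, e)"]) auto
    qed
    moreover have "Determinant.det (S (cis \<theta>)) \<noteq> 0" using elim(2) \<delta>(1) by auto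
    ultimately show ?case unfolding G_def V_def by (intro tendsto_intros) auto
  qed
  have Gint: "integrable circ (bdry (G x a b e))" and Gcoef: "i < 0 \<Longrightarrow> fcoef (bdry (G x a b e)) i = 0"
    and Gbdry: "AE \<theta> in circ. bdry (G x a b e) \<theta> = G x a b e (cis \<theta>)"
    if xabe: "x < d" "a < d" "b < d" "e < d" for x a b e i
  proof -
    show 1: "AE \<theta> in circ. bdry (G x a b e) \<theta> = G x a b e (cis \<theta>)"
      using Glim[OF that] by eventually_elim (simp add: bdry_def limI)
    obtain C where C: "\<And>z. z \<in> ball 0 1 \<Longrightarrow> cmod (G x a b e z) \<le> C" using Gbd[OF xabe] by blast
    have lim: "AE \<theta> in circ. (\<lambda>n. G x a b e (complex_of_real (rad n) * cis \<theta>)) \<longlonglongrightarrow> bdry (G x a b e) \<theta>"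
      using Glim[OF that] 1 by eventually_elim simp
    have ps: "(\<lambda>k. (deriv ^^ k) (G x a b e) 0 / fact k * z ^ k) sums G x a b e z" if "z \<in> ball 0 1" for z
      using holomorphic_power_series[OF Ghol[OF xabe] that] by simp
    note F = fcoef_bounded_holomorphic[OF Ghol[OF xabe] C ps lim]
    show "integrable circ (bdry (G x a b e))" by (rule F(1))
    show "fcoef (bdry (G x a b e)) i = 0" if "i < 0"
      using F(2)[of i] that by simp
  qed
  \<comment> \<open>the coefficients of \<open>h\<close> are \<open>O((1 / r) ^ k)\<close> for every \<open>r < R\<close>\<close>
  obtain r where r: "1 < r" "r < R" using dense[OF R] by blast
  define c where "c = (\<lambda>a b k. (deriv ^^ k) (\<lambda>z. S z $$ (a, b)) 0 / fact k)"
  have csums: "(\<lambda>k. c a b k * z ^ k) sums S z $$ (a, b)" if "a < d" "b < d" "z \<in> ball 0 1" for a b z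
    using holomorphic_power_series[OF Shol[OF that(1,2)] that(3)] by (simp add: c_def)
  have Sint: "integrable circ (bdry (\<lambda>z. S z $$ (a, b)))" "fcoef (bdry (\<lambda>z. S z $$ (a, b))) (int j) = c a b j"
    and Sbdry: "AE \<theta> in circ. bdry (\<lambda>z. S z $$ (a, b)) \<theta> = S (cis \<theta>) $$ (a, b)"
    if "a < d" "b < d" for a b j
  proof -
    show 1: "AE \<theta> in circ. bdry (\<lambda>z. S z $$ (a, b)) \<theta> = S (cis \<theta>) $$ (a, b)"
      using rl by eventually_elim (use that in \<open>simp add: bdry_def limI\<close>)
    have lim: "AE \<theta> in circ. (\<lambda>n. S (complex_of_real (rad n) * cis \<theta>) $$ (a, b)) \<longlonglongrightarrow> bdry (\<lambda>z. S z $$ (a, b)) \<theta>"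
      using rl 1 by eventually_elim (use that in simp)
    show "integrable circ (bdry (\<lambda>z. S z $$ (a, b)))" "fcoef (bdry (\<lambda>z. S z $$ (a, b))) (int j) = c a b j"
      using fcoef_bounded_holomorphic[OF Shol[OF that] Sbd[OF that] csums[OF that] lim] by auto
  qed
  have cdecay: "\<exists>M. \<forall>j. cmod (c a b j) \<le> M * (1 / r) ^ j" if ab: "a < d" "b < d" for a b
  proof -
    let ?T = "\<lambda>x e \<theta>. h (cis \<theta>) $$ (x, e) * cnj (bdry (G x a b e) \<theta>)"
    have one: "\<exists>M. integrable circ (?T x e) \<and> (\<forall>j. cmod (fcoef (?T x e) (int j)) \<le> M * (1 / r) ^ j)"
      if xe: "x < d" "e < d" for x e
    proof -
      obtain k M where k: "wiener (\<lambda>z. h z $$ (x, e)) k" "\<And>j. cmod (k j) \<le> M * (1 / r) ^ j"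
        using holomorphic_wiener_decay[OF hhol[OF xe] r] by blast
      have ei: "integrable circ (\<lambda>\<theta>. cnj (bdry (G x a b e) \<theta>))"
        using Gint[OF xe(1) ab xe(2)] by simp
      have anti: "fcoef (\<lambda>\<theta>. cnj (bdry (G x a b e) \<theta>)) i = 0" if "i > 0" for i
        using Gcoef[OF xe(1) ab xe(2)] that by (simp add: fcoef_cnj)
      have "integrable circ (?T x e)"
        by (rule fcoef_series_mult(2)[OF wiener_summable[OF k(1)] wiener_cis(1)[OF k(1)] ei])
      moreover obtain M' where "\<And>j. cmod (fcoef (?T x e) (int j)) \<le> M' * (1 / r) ^ j"
        using fcoef_antianalytic_decay[OF k(1,2) _ _ ei anti] r by auto
      ultimately show ?thesis by blast
    qed
    define M where "M = (\<lambda>x e. SOME M. integrable circ (?T x e) \<and> (\<forall>j. cmod (fcoef (?T x e) (int j)) \<le> M * (1 / r) ^ j))"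
    have M: "integrable circ (?T x e)" "cmod (fcoef (?T x e) (int j)) \<le> M x e * (1 / r) ^ j" if "x < d" "e < d" for x e j
      using someI_ex[OF one[OF that]] by (auto simp: M_def)
    have "AE \<theta> in circ. \<forall>x<d. \<forall>e<d. bdry (G x a b e) \<theta> = G x a b e (cis \<theta>)"
      by (intro AE_all Gbdry ab)
    then have "AE \<theta> in circ. bdry (\<lambda>z. S z $$ (a, b)) \<theta> = (\<Sum>x<d. \<Sum>e<d. ?T x e \<theta>)"
      using Sbdry[OF ab] facS dcirc
    proof eventually_elim
      case (elim \<theta>)
      let ?A = "S (cis \<theta>)" and ?h = "h (cis \<theta>)"
      have "Determinant.det ?A \<noteq> 0" using elim(4) \<delta>(1) by auto
      note I = mat_inv_props[OF S this]
      have "mat_adjoint (mat_inv ?A) * (?h * mat_adjoint ?h) = mat_adjoint (mat_inv ?A) * (mat_adjoint ?A * ?A)"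
        by (simp add: elim(3))
      also have "\<dots> = mat_adjoint (mat_inv ?A) * mat_adjoint ?A * ?A"
        using I(1) by (intro assoc_mult_mat[symmetric, of _ d d _ d _ d]) auto
      also have "mat_adjoint (mat_inv ?A) * mat_adjoint ?A = mat_adjoint (?A * mat_inv ?A)"
        using I(1) by (intro mat_adjoint_mult[symmetric, of _ d d _ d]) auto
      also have "mat_adjoint (?A * mat_inv ?A) * ?A = ?A" unfolding I(2) by simp
      finally have eq: "?A $$ (a, b) = (mat_adjoint (mat_inv ?A) * (?h * mat_adjoint ?h)) $$ (a, b)" by simp
      also have "\<dots> = (\<Sum>x<d. cnj (mat_inv ?A $$ (x, a)) * (\<Sum>e<d. ?h $$ (x, e) * cnj (?h $$ (b, e))))"
        using I(1) ab by (simp add: scalar_prod_def atLeast0LessThan carrier_matD[OF I(1)])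
      also have "\<dots> = (\<Sum>x<d. \<Sum>e<d. ?T x e \<theta>)"
        unfolding sum_distrib_left
      proof (intro sum.cong refl)
        fix x e assume "x \<in> {..<d}" "e \<in> {..<d}"
        then have xe: "x < d" "e < d" by auto
        have "bdry (G x a b e) \<theta> = G x a b e (cis \<theta>)" using elim(1) xe by blast
        also have "\<dots> = mat_inv ?A $$ (x, a) * ?h $$ (b, e)"
          using xe ab adj_mat(1)[OF S[of "cis \<theta>"]] by (simp add: I(4) G_def V_def)
        finally show "cnj (mat_inv ?A $$ (x, a)) * (?h $$ (x, e) * cnj (?h $$ (b, e))) = ?T x e \<theta>"
          by (simp add: mult_ac)
      qed
      finally show ?case using elim(2) by simp
    qed
    then have "fcoef (bdry (\<lambda>z. S z $$ (a, b))) (int j) = fcoef (\<lambda>\<theta>. \<Sum>x<d. \<Sum>e<d. ?T x e \<theta>) (int j)" for j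
      by (rule fcoef_cong_AE)
        (rule borel_measurable_integrable[OF Sint(1)[OF ab]],
         intro borel_measurable_integrable Bochner_Integration.integrable_sum M(1), simp_all)
    moreover have "fcoef (\<lambda>\<theta>. \<Sum>x<d. \<Sum>e<d. ?T x e \<theta>) i = (\<Sum>x<d. \<Sum>e<d. fcoef (?T x e) i)" for i
    proof -
      have "fcoef (\<lambda>\<theta>. \<Sum>x<d. \<Sum>e<d. ?T x e \<theta>) i = (\<Sum>x<d. fcoef (\<lambda>\<theta>. \<Sum>e<d. ?T x e \<theta>) i)"
        by (rule fcoef_sum) (intro Bochner_Integration.integrable_sum M(1), simp_all)
      also have "\<dots> = (\<Sum>x<d. \<Sum>e<d. fcoef (?T x e) i)"
        by (intro sum.cong refl fcoef_sum M(1)) simp_all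
      finally show ?thesis .
    qed
    ultimately have "c a b j = (\<Sum>x<d. \<Sum>e<d. fcoef (?T x e) (int j))" for j
      using Sint(2)[OF ab] by simp
    then have "cmod (c a b j) \<le> (\<Sum>x<d. \<Sum>e<d. M x e * (1 / r) ^ j)" for j
      by (simp only:) (intro sum_norm_le M(2), simp_all)
    then have "cmod (c a b j) \<le> (\<Sum>x<d. \<Sum>e<d. M x e) * (1 / r) ^ j" for j
      by (simp add: sum_distrib_right)
    then show ?thesis by blast
  qed
  define H where "H = (\<lambda>z. Matrix.mat d d (\<lambda>(a, b). \<Sum>k. c a b k * z ^ k))"
  have Hsums: "(\<lambda>k. c a b k * z ^ k) sums H z $$ (a, b)" if ab: "a < d" "b < d" "z \<in> ball 0 r" for a b z
  proof -
    obtain M where M: "\<And>j. cmod (c a b j) \<le> M * (1 / r) ^ j" using cdecay[OF ab(1,2)] by blast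
    have "summable (\<lambda>k. M * (cmod z / r) ^ k)"
      using ab r by (intro summable_mult summable_geometric) simp
    moreover have "norm (c a b k * z ^ k) \<le> M * (cmod z / r) ^ k" for k
    proof -
      have "norm (c a b k * z ^ k) \<le> M * (1 / r) ^ k * cmod z ^ k"
        unfolding norm_mult norm_power by (intro mult_right_mono M) auto
      then show ?thesis by (simp add: power_divide)
    qed
    ultimately have "summable (\<lambda>k. c a b k * z ^ k)" by (rule summable_comparison_test'[where N = 0]) 
    then show ?thesis using ab by (simp add: H_def summable_sums)
  qed
  have Hc: "H z \<in> carrier_mat d d" for z by (simp add: H_def)
  have Hhol: "(\<lambda>z. H z $$ (a, b)) holomorphic_on ball 0 r" if "a < d" "b < d" for a b
    by (rule power_series_holomorphic[of 0 r "c a b"]) (use Hsums[OF that] in simp)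
  have HS: "H z = S z" if "z \<in> ball 0 1" for z
  proof (rule eq_matI)
    fix i j assume "i < dim_row (S z)" "j < dim_col (S z)"
    then have ij: "i < d" "j < d" by auto
    show "H z $$ (i, j) = S z $$ (i, j)"
      using sums_unique2[OF Hsums[OF ij] csums[OF ij that]] that r by auto
  qed (simp_all add: H_def)
  have Hcont: "continuous_on (sphere 0 1) (\<lambda>z. H z $$ (i, j))" if "i < d" "j < d" for i j
    by (rule continuous_on_subset[OF holomorphic_on_imp_continuous_on[OF Hhol[OF that]]]) (use r in auto)
  have HA: "AE \<theta> in circ. H (cis \<theta>) = S (cis \<theta>)"
    using rl
  proof eventually_elim
    case (elim \<theta>)
    show ?case
    proof (rule eq_matI)
      fix i j assume "i < dim_row (S (cis \<theta>))" "j < dim_col (S (cis \<theta>))"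
      then have ij: "i < d" "j < d" by auto
      have "isCont (\<lambda>z. H z $$ (i, j)) (cis \<theta>)"
        using holomorphic_on_imp_continuous_on[OF Hhol[OF ij]] r by (simp add: continuous_on_eq_continuous_at)
      moreover have "(\<lambda>n. complex_of_real (rad n) * cis \<theta>) \<longlonglongrightarrow> complex_of_real 1 * cis \<theta>"
        by (intro tendsto_intros rad_tendsto)
      ultimately have "(\<lambda>n. H (complex_of_real (rad n) * cis \<theta>) $$ (i, j)) \<longlonglongrightarrow> H (cis \<theta>) $$ (i, j)"
        by (intro isCont_tendsto_compose[of "cis \<theta>" "\<lambda>z. H z $$ (i, j)"]) auto
      moreover have "(\<lambda>n. H (complex_of_real (rad n) * cis \<theta>) $$ (i, j)) \<longlonglongrightarrow> S (cis \<theta>) $$ (i, j)"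
        unfolding HS[OF rad_cis_in_ball] using elim ij by blast
      ultimately show "H (cis \<theta>) $$ (i, j) = S (cis \<theta>) $$ (i, j)" by (rule LIMSEQ_unique)
    qed (simp_all add: H_def)
  qed
  have Hfac: "h z * mat_adjoint (h z) = mat_adjoint (H z) * H z" if z: "z \<in> sphere 0 1" for z
  proof (rule eq_matI)
    fix i j assume "i < dim_row (mat_adjoint (H z) * H z)" "j < dim_col (mat_adjoint (H z) * H z)"
    then have ij: "i < d" "j < d" by (auto simp: H_def)
    define f where "f = (\<lambda>z. (h z * mat_adjoint (h z)) $$ (i, j) - (mat_adjoint (H z) * H z) $$ (i, j))"
    have f_eq: "f z = (\<Sum>k<d. h z $$ (i, k) * cnj (h z $$ (j, k))) - (\<Sum>k<d. cnj (H z $$ (k, i)) * H z $$ (k, j))" for z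
      using ij carrier_matD[OF Hc] by (simp add: f_def scalar_prod_def atLeast0LessThan)
    have fc: "continuous_on (sphere 0 1) f"
      unfolding f_eq using ij by (intro continuous_intros hcont Hcont) auto
    have AE0: "AE \<theta> in circ. f (cis \<theta>) = 0"
      using HA facS by eventually_elim (simp add: f_def)
    have "fcoef (\<lambda>\<theta>. \<Sum>i\<in>{0::nat}. cnj (f (cis \<theta>)) * f (cis \<theta>)) 0 = 0"
    proof -
      have "integral\<^sup>L circ (\<lambda>\<theta>. cis (- (of_int 0 * \<theta>)) * (\<Sum>i\<in>{0::nat}. cnj (f (cis \<theta>)) * f (cis \<theta>))) = 0"
        by (rule integral_eq_zero_AE) (use AE0 in \<open>eventually_elim, simp\<close>)
      then show ?thesis by (simp add: fcoef_def)
    qed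
    then have "f z = 0"
      by (rule continuous_zero_mean_square[of "{0::nat}" "\<lambda>_. f", rotated 2]) (use fc z in auto)
    then show "(h z * mat_adjoint (h z)) $$ (i, j) = (mat_adjoint (H z) * H z) $$ (i, j)"
      by (simp add: f_def)
  qed (simp_all add: H_def)
  have Hdet: "Determinant.det (H z) \<noteq> 0" if "z \<in> cball 0 1" for z
  proof (cases "z \<in> ball 0 1")
    case True
    then show ?thesis using dS[OF True] \<delta>(1) HS[OF True] by auto
  next
    case False
    then have "z \<in> sphere 0 1" using that by auto
    from detsq[OF Hfac[OF this] Hc] show ?thesis using \<delta>(2)[OF \<open>z \<in> sphere 0 1\<close>] \<delta>(1) by auto
  qed
  show thesis
    by (rule that[of r H]) (use r Hc Hhol HS Hdet Hfac S_hs in auto)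
qed

section \<open>Residues and the Hankel symbol\<close>

text \<open>The circle is parametrised over \<open>{- pi..pi}\<close>, the interval of all other integrals.\<close>

abbreviation "ucirc \<equiv> part_circlepath 0 1 (- pi) pi"

lemma contour_integral_fcoef:
  fixes f :: "complex \<Rightarrow> complex"
  assumes "continuous_on (sphere 0 1) f"
  shows "contour_integral ucirc f = 2 * pi * \<i> * fcoef (\<lambda>\<theta>. f (cis \<theta>)) (- 1)"
proof -
  let ?g = "\<lambda>\<theta>. f (cis \<theta>) * \<i> * cis \<theta>"
  have int: "integrable circ ?g"
    by (intro integrable_circ_continuous continuous_intros continuous_on_cis_compose assms)
  then have "(?g has_integral integral\<^sup>L circ ?g) {-pi..pi}"
    by (rule has_integral_integral_lebesgue_on) simp
  then have "(f has_contour_integral integral\<^sup>L circ ?g) ucirc"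
    by (subst has_contour_integral_part_circlepath_iff) simp_all
  then have "contour_integral ucirc f = integral\<^sup>L circ ?g" by (rule contour_integral_unique)
  also have "\<dots> = integral\<^sup>L circ (\<lambda>\<theta>. \<i> * (cis (- (of_int (- 1) * \<theta>)) * f (cis \<theta>)))"
    by (intro Bochner_Integration.integral_cong) (simp_all add: mult_ac)
  also have "\<dots> = \<i> * integral\<^sup>L circ (\<lambda>\<theta>. cis (- (of_int (- 1) * \<theta>)) * f (cis \<theta>))" by simp
  also have "\<dots> = 2 * pi * \<i> * fcoef (\<lambda>\<theta>. f (cis \<theta>)) (- 1)" by (simp add: fcoef_def)
  finally show ?thesis .
qed

lemma valid_path_ucirc: "valid_path ucirc"
  by simp

lemma path_image_ucirc: "path_image ucirc \<subseteq> sphere 0 1"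
  by (rule path_image_part_circlepath_subset) auto

lemma closed_ucirc: "pathfinish ucirc = pathstart ucirc"
  by (simp add: exp_eq_polar flip: cis_conv_exp) (simp add: complex_eq_iff)

text \<open>The contour integral of \<open>1 / (w - z)\<close> is a Fourier coefficient of a geometric series.\<close>

lemma winding_number_ucirc:
  assumes z: "cmod z < 1"
  shows "winding_number ucirc z = 1"
proof -
  have nz: "w \<noteq> z" if "w \<in> sphere 0 1" for w using that z by auto
  have "z \<notin> path_image ucirc" using path_image_ucirc z by auto
  then have "winding_number ucirc z = 1 / (2 * pi * \<i>) * contour_integral ucirc (\<lambda>w. 1 / (w - z))"
    by (intro winding_number_valid_path valid_path_ucirc)
  also have "contour_integral ucirc (\<lambda>w. 1 / (w - z)) = 2 * pi * \<i> * fcoef (\<lambda>\<theta>. 1 / (cis \<theta> - z)) (- 1)"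
    by (rule contour_integral_fcoef) (use nz in \<open>auto intro!: continuous_intros\<close>)
  also have "fcoef (\<lambda>\<theta>. 1 / (cis \<theta> - z)) (- 1) = 1"
  proof -
    have s: "(\<lambda>k. z ^ k * cis (of_int (- int k - 1) * \<theta>)) sums (1 / (cis \<theta> - z))" for \<theta>
    proof -
      have "(\<lambda>k. cis (- \<theta>) * (z * cis (- \<theta>)) ^ k) sums (cis (- \<theta>) * (1 / (1 - z * cis (- \<theta>))))"
        using z by (intro sums_mult geometric_sums) (simp add: norm_mult)
      also have "cis (- \<theta>) * (1 / (1 - z * cis (- \<theta>))) = 1 / (cis \<theta> - z)"
      proof -
        have "cis \<theta> * (1 - z * cis (- \<theta>)) = cis \<theta> - z" by (simp add: algebra_simps cis_mult)
        then have "1 / (cis \<theta> - z) = inverse (cis \<theta>) * (1 / (1 - z * cis (- \<theta>)))"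
          by (metis divide_inverse inverse_mult_distrib mult_1)
        then show ?thesis by (simp add: cis_inverse)
      qed
      also have "(\<lambda>k. cis (- \<theta>) * (z * cis (- \<theta>)) ^ k) = (\<lambda>k. z ^ k * cis (of_int (- int k - 1) * \<theta>))"
      proof
        fix k
        have "of_int (- int k - 1) * \<theta> = - \<theta> + real k * - \<theta>" by (simp add: algebra_simps)
        then show "cis (- \<theta>) * (z * cis (- \<theta>)) ^ k = z ^ k * cis (of_int (- int k - 1) * \<theta>)"
          by (simp only: power_mult_distrib Complex.DeMoivre cis_mult[symmetric] mult_ac)
      qed
      finally show ?thesis .
    qed
    have "((\<lambda>k. z ^ k * fcoef (\<lambda>_. 1) (- 1 - (- int k - 1))) has_sum fcoef (\<lambda>\<theta>. 1 / (cis \<theta> - z) * 1) (- 1)) UNIV"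
      by (rule fcoef_series_mult(1)[OF _ s])
        (use z in \<open>auto simp: norm_power intro!: integrable_circ_continuous\<close>)
    moreover have "((\<lambda>k. z ^ k * fcoef (\<lambda>_. 1) (- 1 - (- int k - 1))) has_sum (\<Sum>k\<in>{0}. z ^ k * fcoef (\<lambda>_. 1) (- 1 - (- int k - 1)))) UNIV"
      by (rule has_sum_finite_neutralI[where B = "{0}"]) (auto simp: fcoef_one)
    ultimately have "fcoef (\<lambda>\<theta>. 1 / (cis \<theta> - z) * 1) (- 1) = (\<Sum>k\<in>{0}. z ^ k * fcoef (\<lambda>_. 1) (- 1 - (- int k - 1)))"
      by (rule has_sum_unique)
    then show ?thesis by (simp add: fcoef_one)
  qed
  finally show ?thesis by simp
qed

lemma fcoef_eq_sum_residues:
  assumes R: "R > 1" and pts: "finite pts" "pts \<subseteq> ball 0 1" and f: "f holomorphic_on ball 0 R - pts"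
  shows "fcoef (\<lambda>\<theta>. f (cis \<theta>)) (- 1) = (\<Sum>q\<in>pts. residue f q)"
proof -
  have sub: "sphere 0 1 \<subseteq> ball 0 R - pts" using R pts by auto
  have w0: "winding_number ucirc z = 0" if "z \<notin> ball 0 R" for z
  proof (rule winding_number_zero_outside)
    show "path ucirc" using valid_path_ucirc by (rule valid_path_imp_path)
    show "convex (cball 0 1 :: complex set)" by (rule convex_cball)
    show "z \<notin> cball 0 1" using that R by auto
    show "path_image ucirc \<subseteq> cball 0 1" using path_image_ucirc by auto
  qed (rule closed_ucirc)
  have "contour_integral ucirc f = 2 * pi * \<i> * (\<Sum>q\<in>pts. winding_number ucirc q * residue f q)"
    by (rule Residue_theorem[of "ball 0 R", OF _ _ pts(1) f valid_path_ucirc closed_ucirc])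
      (use path_image_ucirc sub w0 in auto)
  also have "(\<Sum>q\<in>pts. winding_number ucirc q * residue f q) = (\<Sum>q\<in>pts. residue f q)"
    using pts by (intro sum.cong refl) (auto simp: winding_number_ucirc)
  finally have "2 * pi * \<i> * fcoef (\<lambda>\<theta>. f (cis \<theta>)) (- 1) = 2 * pi * \<i> * (\<Sum>q\<in>pts. residue f q)"
    using contour_integral_fcoef[of f] continuous_on_subset[OF holomorphic_on_imp_continuous_on[OF f] sub] by simp
  then show ?thesis by simp
qed

lemma higher_deriv_power_binomial:
  "(deriv ^^ i) (\<lambda>w. w ^ k) (z :: complex) = fact i * of_nat (k choose i) * z ^ (k - i)"
proof (induction i arbitrary: z)
  case (Suc i)
  have "(deriv ^^ i) (\<lambda>w. w ^ k) = (\<lambda>z. fact i * of_nat (k choose i) * z ^ (k - i) :: complex)"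
    using Suc by (intro ext)
  then have "(deriv ^^ Suc i) (\<lambda>w. w ^ k) z = deriv (\<lambda>z. fact i * of_nat (k choose i) * z ^ (k - i)) z"
    by simp
  also have "\<dots> = fact i * of_nat (k choose i) * (of_nat (k - i) * z ^ (k - i - 1))"
    by (rule DERIV_imp_deriv) (auto intro!: derivative_eq_intros)
  also have "\<dots> = fact i * of_nat ((k choose i) * (k - i)) * z ^ (k - Suc i)" by simp
  also have "(k choose i) * (k - i) = Suc i * (k choose Suc i)"
    using binomial_absorb_comp[of k i] binomial_absorption[of i k] by (simp only: mult.commute)
  finally show ?case by (simp add: algebra_simps)
qed simp

lemma pole_coeff_deriv:
  assumes "p \<mu> \<noteq> 0"
  shows "pole_coeff p (\<mu>, Suc i) (int k) = (deriv ^^ i) (\<lambda>w. w ^ k) (p \<mu>) / fact i"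
proof (cases "i \<le> k")
  case True
  have "p \<mu> powi (int k - int (Suc i) + 1) = p \<mu> ^ (k - i)"
  proof -
    have "int k - int (Suc i) + 1 = int (k - i)" using True by simp
    then show ?thesis by (simp only: power_int_of_nat)
  qed
  then show ?thesis
    by (simp add: pole_coeff_def higher_deriv_power_binomial binomial_gbinomial)
next
  case False
  then have "(of_nat k :: complex) gchoose i = 0" by (simp flip: binomial_gbinomial)
  with False show ?thesis by (simp add: pole_coeff_def higher_deriv_power_binomial)
qed

text \<open>Leibniz' rule: the Taylor coefficients of \<open>z ^ k\<close> at the pole are the \<open>pole_coeff\<close>.\<close>

lemma residue_power_times_pole:
  assumes "open S" "p \<mu> \<in> S" "F holomorphic_on S" "p \<mu> \<noteq> 0" "M \<ge> 1"
  shows "residue (\<lambda>z. z ^ k * F z / (z - p \<mu>) ^ M) (p \<mu>) =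
    (\<Sum>q=1..M. pole_coeff p (\<mu>, q) (int k) * ((deriv ^^ (M - q)) F (p \<mu>) / fact (M - q)))"
proof -
  obtain M' where M: "M = Suc M'" using assms(5) by (cases M) auto
  have "residue (\<lambda>z. z ^ k * F z / (z - p \<mu>) ^ Suc M') (p \<mu>) = (deriv ^^ M') (\<lambda>z. z ^ k * F z) (p \<mu>) / fact M'"
    by (rule residue_holomorphic_over_power[OF assms(1,2)]) (intro holomorphic_intros assms(3))
  also have "(deriv ^^ M') (\<lambda>z. z ^ k * F z) (p \<mu>) =
      (\<Sum>i=0..M'. of_nat (M' choose i) * (deriv ^^ i) (\<lambda>z. z ^ k) (p \<mu>) * (deriv ^^ (M' - i)) F (p \<mu>))"
    by (rule higher_deriv_mult[OF _ assms(3,1,2)]) (intro holomorphic_intros)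
  also have "\<dots> / fact M' = (\<Sum>i=0..M'. (deriv ^^ i) (\<lambda>z. z ^ k) (p \<mu>) / fact i * ((deriv ^^ (M' - i)) F (p \<mu>) / fact (M' - i)))"
    unfolding sum_divide_distrib by (intro sum.cong refl) (simp add: binomial_fact field_simps)
  also have "\<dots> = (\<Sum>i=0..M'. pole_coeff p (\<mu>, Suc i) (int k) * ((deriv ^^ (M' - i)) F (p \<mu>) / fact (M' - i)))"
    by (simp add: pole_coeff_deriv[where p = p, OF assms(4)])
  also have "\<dots> = (\<Sum>q=1..M. pole_coeff p (\<mu>, q) (int k) * ((deriv ^^ (M - q)) F (p \<mu>) / fact (M - q)))"
    unfolding M by (rule sum.reindex_bij_witness[of _ "\<lambda>q. q - 1" Suc]) auto
  finally show ?thesis by (simp add: M)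
qed

lemma finite_outside_cdisk_radius:
  fixes Z :: "complex set"
  assumes "finite Z" "Z \<inter> cball 0 1 = {}"
  obtains R where "R > 1" "Z \<inter> ball 0 R = {}"
proof
  let ?R = "Min (insert 2 (cmod ` Z))"
  show "?R > 1" using assms by (auto simp: Min_gr_iff)
  show "Z \<inter> ball 0 ?R = {}" using assms by (auto simp: Min_gr_iff)
qed

text \<open>The partial fractions determine the inverse of \<open>h\<close> in the whole plane up to finitely many points
  (\<open>pf_inverse\<close>). This is needed for \<open>theta\<close>, which evaluates \<open>h\<close> at the reflected points \<open>1 / cnj z\<close>.\<close>

locale pf_data = pole_data d K m p for d K m p +
  fixes h :: "complex \<Rightarrow> complex mat" and \<rho> :: "nat \<Rightarrow> nat \<Rightarrow> complex mat"
  assumes h_carrier: "\<And>z. h z \<in> carrier_mat d d"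
    and h_rational: "\<And>i j. i < d \<Longrightarrow> j < d \<Longrightarrow> rational_no_poles_cdisk (\<lambda>z. h z $$ (i, j))"
    and h_det: "\<And>z. z \<in> cball 0 1 \<Longrightarrow> Determinant.det (h z) \<noteq> 0"
    and p_distinct: "inj_on p {1..K}"
    and m_pos: "\<And>\<mu>. \<mu> \<in> {1..K} \<Longrightarrow> m \<mu> \<ge> 1"
    and \<rho>_carrier: "\<And>\<mu> j. \<mu> \<le> K \<Longrightarrow> j \<le> m \<mu> \<Longrightarrow> \<rho> \<mu> j \<in> carrier_mat d d"
    and partial_fractions: "\<And>z. z \<in> cball 0 1 \<Longrightarrow> mat_inv (h z) = pf_rhs d K m p \<rho> z"

begin

abbreviation "pf \<equiv> pf_rhs d K m p \<rho>"

lemma pf_carrier: "pf z \<in> carrier_mat d d"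
  unfolding pf_rhs_def by (intro minus_carrier_mat) simp

lemma pf_entry:
  assumes "i < d" "j < d"
  shows "pf z $$ (i, j) = - \<rho> 0 0 $$ (i, j)
    - (\<Sum>\<mu>=1..K. \<Sum>l=1..m \<mu>. \<rho> \<mu> l $$ (i, j) * (1 / (1 - cnj (p \<mu>) * z)) ^ l)
    - (\<Sum>l=1..m 0. \<rho> 0 l $$ (i, j) * z ^ l)"
proof -
  have dims: "dim_row (\<rho> \<mu> l) = d" "dim_col (\<rho> \<mu> l) = d" if "\<mu> \<le> K" "l \<le> m \<mu>" for \<mu> l
    using carrier_matD[OF \<rho>_carrier[OF that]] by auto
  show ?thesis
    using assms dims by (simp add: pf_rhs_def mat_sum_def power_one_over mult.commute)
qed

lemma h_poles:
  "\<exists>Z. finite Z \<and> Z \<inter> cball 0 1 = {} \<and>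
    (\<forall>i<d. \<forall>j<d. (\<lambda>z. h z $$ (i, j)) holomorphic_on - Z)"
proof -
  have "\<exists>Q. (\<forall>z\<in>cball 0 1. poly Q z \<noteq> 0) \<and> (\<lambda>z. h z $$ (i, j)) holomorphic_on - {z. poly Q z = 0}"
    if ij: "i < d" "j < d" for i j
  proof -
    obtain P Q :: "complex poly" where Q: "\<forall>z\<in>cball 0 1. poly Q z \<noteq> 0"
        "\<forall>z. poly Q z \<noteq> 0 \<longrightarrow> h z $$ (i, j) = poly P z / poly Q z"
      using h_rational[OF ij] unfolding rational_no_poles_cdisk_def by blast
    have "(\<lambda>z. h z $$ (i, j)) holomorphic_on - {z. poly Q z = 0}"
      by (rule holomorphic_transform[of "\<lambda>z. poly P z / poly Q z"]) (use Q in \<open>auto intro!: holomorphic_intros\<close>)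
    with Q show ?thesis by blast
  qed
  then obtain Q where Q: "\<And>i j. i < d \<Longrightarrow> j < d \<Longrightarrow> (\<forall>z\<in>cball 0 1. poly (Q i j) z \<noteq> 0) \<and>
      (\<lambda>z. h z $$ (i, j)) holomorphic_on - {z. poly (Q i j) z = 0}" by metis
  let ?Z = "\<Union>i<d. \<Union>j<d. {z. poly (Q i j) z = 0}"
  show ?thesis
  proof (intro exI[of _ ?Z] conjI allI impI)
    have "Q i j \<noteq> 0" if "i < d" "j < d" for i j using Q[OF that] by (auto dest!: bspec[of _ _ 0])
    then show "finite ?Z" by (auto intro!: poly_roots_finite)
    show "?Z \<inter> cball 0 1 = {}" using Q by blast
    show "(\<lambda>z. h z $$ (i, j)) holomorphic_on - ?Z" if "i < d" "j < d" for i j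
      by (rule holomorphic_on_subset[of _ "- {z. poly (Q i j) z = 0}"]) (use Q[OF that] that in auto)
  qed
qed

lemma h_holomorphic:
  obtains r where "r > 1" "\<And>i j. i < d \<Longrightarrow> j < d \<Longrightarrow> (\<lambda>z. h z $$ (i, j)) holomorphic_on ball 0 r"
proof -
  obtain Z where Z: "finite Z" "Z \<inter> cball 0 1 = {}"
    "\<forall>i<d. \<forall>j<d. (\<lambda>z. h z $$ (i, j)) holomorphic_on - Z"
    using h_poles by auto
  obtain r where r: "r > 1" "Z \<inter> ball 0 r = {}" using finite_outside_cdisk_radius[OF Z(1,2)] .
  have "(\<lambda>z. h z $$ (i, j)) holomorphic_on ball 0 r" if "i < d" "j < d" for i j
    by (rule holomorphic_on_subset[of _ "- Z"]) (use Z(3) that r(2) in auto)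
  with r(1) show thesis by (rule that)
qed

definition "pf_poles = (\<lambda>\<mu>. 1 / cnj (p \<mu>)) ` {1..K}"

lemma pf_poles: "finite pf_poles" "pf_poles \<inter> cball 0 1 = {}"
proof -
  have "1 < cmod (1 / cnj (p \<mu>))" if "\<mu> \<in> {1..K}" for \<mu>
    using p_nz[OF that] p_lt[OF that] by (simp add: norm_divide less_divide_eq)
  then show "pf_poles \<inter> cball 0 1 = {}" unfolding pf_poles_def by force
qed (simp add: pf_poles_def)

lemma pf_holomorphic:
  assumes "i < d" "j < d"
  shows "(\<lambda>z. pf z $$ (i, j)) holomorphic_on - pf_poles"
proof -
  have "1 - cnj (p \<mu>) * z \<noteq> 0" if "\<mu> \<in> {1..K}" "z \<notin> pf_poles" for \<mu> z
  proof
    assume "1 - cnj (p \<mu>) * z = 0"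
    then have "z = 1 / cnj (p \<mu>)" using p_nz[OF that(1)] by (auto simp: field_simps)
    then show False using that by (auto simp: pf_poles_def)
  qed
  then show ?thesis unfolding pf_entry[OF assms] by (intro holomorphic_intros) auto
qed

text \<open>Both sides are holomorphic off a finite set, whose complement is connected, and they agree in the disk.\<close>

lemma pf_inverse: "\<exists>Z. finite Z \<and> Z \<inter> cball 0 1 = {} \<and> (\<forall>z. z \<notin> Z \<longrightarrow> h z * pf z = 1\<^sub>m d)"
proof -
  obtain Z where Z: "finite Z" "Z \<inter> cball 0 1 = {}"
    "\<And>i j. i < d \<Longrightarrow> j < d \<Longrightarrow> (\<lambda>z. h z $$ (i, j)) holomorphic_on - Z"
    using h_poles by auto
  let ?Z = "Z \<union> pf_poles"
  have fin: "finite ?Z" "?Z \<inter> cball 0 1 = {}" using Z pf_poles by auto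
  have inv: "h z * pf z = 1\<^sub>m d" if z: "z \<notin> ?Z" for z
  proof (rule eq_matI)
    fix i j assume "i < dim_row (1\<^sub>m d :: complex mat)" "j < dim_col (1\<^sub>m d :: complex mat)"
    then have ij: "i < d" "j < d" by auto
    define f where "f = (\<lambda>z. (h z * pf z) $$ (i, j))"
    have f_eq: "f z = (\<Sum>k<d. h z $$ (i, k) * pf z $$ (k, j))" for z
      using ij carrier_matD[OF h_carrier] carrier_matD[OF pf_carrier]
      by (simp add: f_def scalar_prod_def atLeast0LessThan)
    have hol: "f holomorphic_on - ?Z"
      unfolding f_eq using ij
      by (intro holomorphic_intros holomorphic_on_subset[OF Z(3)] holomorphic_on_subset[OF pf_holomorphic]) auto
    have val: "f w = 1\<^sub>m d $$ (i, j)" if "w \<in> ball 0 1" for w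
    proof -
      have w: "w \<in> cball 0 1" using that by auto
      have "h w * pf w = 1\<^sub>m d"
        using mat_inv_props(2)[OF h_carrier h_det[OF w]] partial_fractions[OF w] by simp
      then show ?thesis by (simp add: f_def)
    qed
    have con: "connected (- ?Z)"
      unfolding Compl_eq_Diff_UNIV by (rule connected_open_delete_finite) (use fin in auto)
    have op: "open (- ?Z)" using finite_imp_closed[OF fin(1)] by (simp only: open_Compl)
    have sub: "ball 0 1 \<subseteq> - ?Z" using fin(2) ball_subset_cball by blast
    have "f z = 1\<^sub>m d $$ (i, j)"
      by (rule analytic_continuation_open[OF _ op _ con sub hol holomorphic_on_const val]) (use z in auto)
    then show "(h z * pf z) $$ (i, j) = 1\<^sub>m d $$ (i, j)" by (simp add: f_def)
  qed (use carrier_matD[OF h_carrier] carrier_matD[OF pf_carrier] in auto)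
  show ?thesis using fin inv by (intro exI[of _ ?Z]) simp
qed

text \<open>The entries of the conjugate reflection of the inverse of \<open>h\<close>, in a form that shows its poles at the
  \<open>p \<mu>\<close> and at \<open>0\<close>.\<close>

definition refl_inv :: "nat \<Rightarrow> nat \<Rightarrow> complex \<Rightarrow> complex"
  where "refl_inv c y z = - cnj (\<rho> 0 0 $$ (y, c))
    - (\<Sum>\<mu>=1..K. \<Sum>l=1..m \<mu>. cnj (\<rho> \<mu> l $$ (y, c)) * (z / (z - p \<mu>)) ^ l)
    - (\<Sum>l=1..m 0. cnj (\<rho> 0 l $$ (y, c)) * (1 / z) ^ l)"

lemma refl_inv_eq:
  assumes "c < d" "y < d" "z \<noteq> 0"
  shows "refl_inv c y z = cnj (pf (1 / cnj z) $$ (y, c))"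
proof -
  have "1 / (1 - p \<mu> / z) = z / (z - p \<mu>)" for \<mu>
    using assms(3) by (cases "z = p \<mu>") (auto simp: field_simps)
  then show ?thesis
    unfolding pf_entry[OF assms(2,1)] refl_inv_def by simp
qed

text \<open>The product of \<open>refl_inv\<close> and \<open>(z - p \<mu>) ^ m \<mu>\<close>, holomorphically continued to \<open>p \<mu>\<close>.\<close>

definition refl_inv_at :: "nat \<Rightarrow> nat \<Rightarrow> nat \<Rightarrow> complex \<Rightarrow> complex"
  where "refl_inv_at \<mu> c y z = - cnj (\<rho> 0 0 $$ (y, c)) * (z - p \<mu>) ^ m \<mu>
    - (\<Sum>\<nu>\<in>{1..K} - {\<mu>}. \<Sum>l=1..m \<nu>. cnj (\<rho> \<nu> l $$ (y, c)) * (z / (z - p \<nu>)) ^ l) * (z - p \<mu>) ^ m \<mu>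
    - (\<Sum>l=1..m \<mu>. cnj (\<rho> \<mu> l $$ (y, c)) * z ^ l * (z - p \<mu>) ^ (m \<mu> - l))
    - (\<Sum>l=1..m 0. cnj (\<rho> 0 l $$ (y, c)) * (1 / z) ^ l) * (z - p \<mu>) ^ m \<mu>"

lemma refl_inv_at_eq:
  assumes "\<mu> \<in> {1..K}" "z \<noteq> p \<mu>"
  shows "refl_inv_at \<mu> c y z = (z - p \<mu>) ^ m \<mu> * refl_inv c y z"
proof -
  have "(\<Sum>l=1..m \<mu>. cnj (\<rho> \<mu> l $$ (y, c)) * z ^ l * (z - p \<mu>) ^ (m \<mu> - l)) =
      (\<Sum>l=1..m \<mu>. cnj (\<rho> \<mu> l $$ (y, c)) * (z / (z - p \<mu>)) ^ l) * (z - p \<mu>) ^ m \<mu>"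
    unfolding sum_distrib_right
  proof (rule sum.cong[OF refl])
    fix l assume "l \<in> {1..m \<mu>}"
    then have "(z - p \<mu>) ^ m \<mu> = (z - p \<mu>) ^ l * (z - p \<mu>) ^ (m \<mu> - l)" by (simp flip: power_add)
    then show "cnj (\<rho> \<mu> l $$ (y, c)) * z ^ l * (z - p \<mu>) ^ (m \<mu> - l) =
        cnj (\<rho> \<mu> l $$ (y, c)) * (z / (z - p \<mu>)) ^ l * (z - p \<mu>) ^ m \<mu>"
      using assms(2) by (simp add: power_divide)
  qed
  moreover have "(\<Sum>\<nu>=1..K. \<Sum>l=1..m \<nu>. cnj (\<rho> \<nu> l $$ (y, c)) * (z / (z - p \<nu>)) ^ l) =
      (\<Sum>l=1..m \<mu>. cnj (\<rho> \<mu> l $$ (y, c)) * (z / (z - p \<mu>)) ^ l) +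
      (\<Sum>\<nu>\<in>{1..K} - {\<mu>}. \<Sum>l=1..m \<nu>. cnj (\<rho> \<nu> l $$ (y, c)) * (z / (z - p \<nu>)) ^ l)"
    using assms(1) by (intro sum.remove) auto
  ultimately show ?thesis
    unfolding refl_inv_at_def refl_inv_def by (simp only:) (simp add: algebra_simps)
qed

end

text \<open>\<open>H\<close> is the analytic continuation of \<open>hs\<close> across the circle.\<close>

locale pf_ext_data = pf_data d K m p h \<rho> for d K m p h \<rho> +
  fixes H hs :: "complex \<Rightarrow> complex mat" and R :: real
  assumes R: "R > 1" and H_carrier: "\<And>z. H z \<in> carrier_mat d d"
    and H_holomorphic: "\<And>i j. i < d \<Longrightarrow> j < d \<Longrightarrow> (\<lambda>z. H z $$ (i, j)) holomorphic_on ball 0 R"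
    and H_hs: "\<And>z. z \<in> ball 0 1 \<Longrightarrow> H z = hs z"

begin

definition polar_part :: "nat \<Rightarrow> nat \<Rightarrow> nat \<Rightarrow> complex \<Rightarrow> complex"
  where "polar_part \<mu> x y z = (\<Sum>c<d. H z $$ (x, c) * refl_inv_at \<mu> c y z)"

definition "pole_nbhd \<mu> = ball 0 R - {0} - p ` ({1..K} - {\<mu>})"

lemma pole_nbhd: "open (pole_nbhd \<mu>)" "\<mu> \<in> {1..K} \<Longrightarrow> p \<mu> \<in> pole_nbhd \<mu>"
  unfolding pole_nbhd_def using p_nz p_lt R p_distinct
  by (auto intro!: open_Diff finite_imp_closed dest: inj_onD order.strict_trans)

lemma polar_part_holomorphic:
  assumes "x < d"
  shows "polar_part \<mu> x y holomorphic_on pole_nbhd \<mu>"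
  unfolding polar_part_def refl_inv_at_def using assms
  by (intro holomorphic_intros holomorphic_on_subset[OF H_holomorphic]) (auto simp: pole_nbhd_def)

text \<open>Near \<open>p \<mu>\<close>, but away from it and from the reflections of the finitely many exceptional points, the function
  in the definition of \<open>theta\<close> is holomorphic and equal to \<open>polar_part\<close>. The limit is therefore a derivative.\<close>

lemma theta_eq:
  assumes \<mu>: "\<mu> \<in> {1..K}" and xy: "x < d" "y < d"
  shows "theta d m p h hs \<mu> q $$ (x, y) =
    - ((deriv ^^ (m \<mu> - q)) (polar_part \<mu> x y) (p \<mu>) / fact (m \<mu> - q))"
proof -
  obtain Z where Z: "finite Z" "Z \<inter> cball 0 1 = {}" "\<And>z. z \<notin> Z \<Longrightarrow> h z * pf z = 1\<^sub>m d"
    using pf_inverse by auto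
  define T where "T = (\<lambda>u. (u - p \<mu>) ^ m \<mu> * (hs u * mat_inv (dagger h u)) $$ (x, y))"
  \<comment> \<open>\<open>1 / cnj u\<close> avoids \<open>Z\<close> for \<open>u\<close> in \<open>N\<close> other than \<open>p \<mu>\<close>\<close>
  define N where "N = pole_nbhd \<mu> \<inter> ball 0 1 - ((\<lambda>v. 1 / cnj v) ` Z - {p \<mu>})"
  have oN: "open N" unfolding N_def using pole_nbhd Z(1) by (intro open_Diff open_Int finite_imp_closed) auto
  have pN: "p \<mu> \<in> N" unfolding N_def using pole_nbhd(2)[OF \<mu>] p_lt[OF \<mu>] by auto
  have TN: "T u = polar_part \<mu> x y u" if u: "u \<in> N - {p \<mu>}" for u
  proof -
    have u0: "u \<noteq> 0" "u \<in> ball 0 1" "u \<noteq> p \<mu>" using u by (auto simp: N_def pole_nbhd_def)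
    have "1 / cnj u \<notin> Z"
    proof
      assume "1 / cnj u \<in> Z"
      then have "u \<in> (\<lambda>v. 1 / cnj v) ` Z" by (rule rev_image_eqI) simp
      then show False using u by (auto simp: N_def)
    qed
    from Z(3)[OF this] have inv: "h (1 / cnj u) * pf (1 / cnj u) = 1\<^sub>m d" .
    then have inv': "pf (1 / cnj u) * h (1 / cnj u) = 1\<^sub>m d"
      by (rule mat_mult_left_right_inverse[OF h_carrier pf_carrier])
    have "mat_inv (dagger h u) = mat_adjoint (pf (1 / cnj u))"
      unfolding dagger_def
    proof (rule mat_inv_unique)
      show "mat_adjoint (h (1 / cnj u)) * mat_adjoint (pf (1 / cnj u)) = 1\<^sub>m d"
        using mat_adjoint_mult[OF pf_carrier h_carrier, of "1 / cnj u" "1 / cnj u"] inv' by simp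
    qed (use h_carrier pf_carrier in auto)
    then have "(hs u * mat_inv (dagger h u)) $$ (x, y) = (\<Sum>c<d. H u $$ (x, c) * cnj (pf (1 / cnj u) $$ (y, c)))"
      using xy carrier_matD[OF H_carrier] carrier_matD[OF pf_carrier] H_hs[OF u0(2), symmetric]
      by (simp add: scalar_prod_def atLeast0LessThan)
    also have "\<dots> = (\<Sum>c<d. H u $$ (x, c) * refl_inv c y u)"
      using xy u0 by (intro sum.cong refl) (simp add: refl_inv_eq)
    finally show ?thesis
      unfolding T_def polar_part_def using refl_inv_at_eq[OF \<mu> u0(3)] by (simp add: sum_distrib_left mult_ac)
  qed
  let ?n = "m \<mu> - q"
  have hol: "polar_part \<mu> x y holomorphic_on N"
    using polar_part_holomorphic[OF xy(1)] by (rule holomorphic_on_subset) (auto simp: N_def)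
  have "isCont ((deriv ^^ ?n) (polar_part \<mu> x y)) (p \<mu>)"
    using holomorphic_on_imp_continuous_on[OF holomorphic_higher_deriv[OF hol oN]] oN pN
    by (simp add: continuous_on_eq_continuous_at)
  then have "((\<lambda>z. 1 / fact ?n * (deriv ^^ ?n) (polar_part \<mu> x y) z) \<longlongrightarrow>
      1 / fact ?n * (deriv ^^ ?n) (polar_part \<mu> x y) (p \<mu>)) (at (p \<mu>))"
    by (intro tendsto_mult tendsto_const) (simp add: isCont_def)
  moreover have "eventually (\<lambda>z. 1 / fact ?n * (deriv ^^ ?n) (polar_part \<mu> x y) z = 1 / fact ?n * (deriv ^^ ?n) T z) (at (p \<mu>))"
  proof -
    have "eventually (\<lambda>z. z \<in> N - {p \<mu>}) (at (p \<mu>))"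
      using oN pN by (auto simp: eventually_at_topological)
    then show ?thesis
    proof eventually_elim
      case (elim z)
      have "open (N - {p \<mu>})" using oN by (intro open_Diff) auto
      then have "eventually (\<lambda>w. w \<in> N - {p \<mu>}) (nhds z)" using elim by (rule eventually_nhds_in_open)
      then have "eventually (\<lambda>w. polar_part \<mu> x y w = T w) (nhds z)"
        by eventually_elim (simp add: TN)
      then show ?case by (simp add: higher_deriv_cong_ev)
    qed
  qed
  ultimately have "((\<lambda>z. 1 / fact ?n * (deriv ^^ ?n) T z) \<longlongrightarrow>
      1 / fact ?n * (deriv ^^ ?n) (polar_part \<mu> x y) (p \<mu>)) (at (p \<mu>))"
    by (rule Lim_transform_eventually)
  then have "Lim (at (p \<mu>)) (\<lambda>z. 1 / fact ?n * (deriv ^^ ?n) T z) =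
      1 / fact ?n * (deriv ^^ ?n) (polar_part \<mu> x y) (p \<mu>)"
    by (intro tendsto_Lim) auto
  then show ?thesis using xy by (simp add: theta_def T_def)
qed

text \<open>Multiplying the phase function by \<open>z ^ k\<close> cancels the pole at \<open>0\<close>, which stems from the polynomial part of
  degree \<open>m 0 \<le> k\<close>. The remaining residues, at the \<open>p \<mu>\<close>, are the terms of the symbol.\<close>

theorem hank_symbol_fcoef:
  assumes xy: "x < d" "y < d" and k: "k \<ge> m 0"
  shows "hank_symbol h hs (int k) $$ (x, y) =
    - fcoef (\<lambda>\<theta>. \<Sum>c<d. H (cis \<theta>) $$ (x, c) * cnj (mat_inv (h (cis \<theta>)) $$ (y, c))) (- int (k + 1))"
proof -
  define Y where "Y = (\<lambda>c z. - cnj (\<rho> 0 0 $$ (y, c)) * z ^ k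
    - (\<Sum>\<mu>=1..K. \<Sum>l=1..m \<mu>. cnj (\<rho> \<mu> l $$ (y, c)) * (z / (z - p \<mu>)) ^ l) * z ^ k
    - (\<Sum>l=1..m 0. cnj (\<rho> 0 l $$ (y, c)) * z ^ (k - l)))"
  have Y: "Y c z = z ^ k * refl_inv c y z" if "z \<noteq> 0" for c z
  proof -
    have "(\<Sum>l=1..m 0. cnj (\<rho> 0 l $$ (y, c)) * z ^ (k - l)) =
        (\<Sum>l=1..m 0. cnj (\<rho> 0 l $$ (y, c)) * (1 / z) ^ l) * z ^ k"
      unfolding sum_distrib_right
    proof (rule sum.cong[OF refl])
      fix l assume "l \<in> {1..m 0}"
      then have "z ^ k = z ^ l * z ^ (k - l)" using k by (simp flip: power_add)
      then show "cnj (\<rho> 0 l $$ (y, c)) * z ^ (k - l) = cnj (\<rho> 0 l $$ (y, c)) * (1 / z) ^ l * z ^ k"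
        using that by (simp add: power_divide)
    qed
    then show ?thesis unfolding Y_def refl_inv_def by (simp only:) (simp add: algebra_simps)
  qed
  \<comment> \<open>\<open>Y c\<close> is \<open>z ^ k\<close> times \<open>refl_inv c y\<close>, continued to \<open>0\<close>\<close>
  define f where "f = (\<lambda>z. \<Sum>c<d. H z $$ (x, c) * Y c z)"
  have f: "f z = z ^ k * (\<Sum>c<d. H z $$ (x, c) * refl_inv c y z)" if "z \<noteq> 0" for z
    unfolding f_def using Y[OF that] by (simp add: sum_distrib_left mult_ac)
  have pts: "finite (p ` {1..K})" "p ` {1..K} \<subseteq> ball 0 1" using p_lt by auto
  have "f holomorphic_on ball 0 R - p ` {1..K}"
    unfolding f_def Y_def using xy
    by (intro holomorphic_intros holomorphic_on_subset[OF H_holomorphic]) auto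
  from fcoef_eq_sum_residues[OF R pts this]
  have "fcoef (\<lambda>\<theta>. f (cis \<theta>)) (- 1) = (\<Sum>q\<in>p ` {1..K}. residue f q)" .
  also have "\<dots> = (\<Sum>\<mu>=1..K. residue f (p \<mu>))"
    by (subst sum.reindex[OF p_distinct]) simp
  also have "\<dots> = (\<Sum>\<mu>=1..K. \<Sum>q=1..m \<mu>. - (pole_coeff p (\<mu>, q) (int k) * theta d m p h hs \<mu> q $$ (x, y)))"
  proof (rule sum.cong[OF refl])
    fix \<mu> assume \<mu>: "\<mu> \<in> {1..K}"
    have "eventually (\<lambda>z. z \<in> pole_nbhd \<mu> - {p \<mu>}) (at (p \<mu>))"
      using pole_nbhd(1) pole_nbhd(2)[OF \<mu>] by (auto simp: eventually_at_topological)
    then have "eventually (\<lambda>z. f z = z ^ k * polar_part \<mu> x y z / (z - p \<mu>) ^ m \<mu>) (at (p \<mu>))"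
    proof eventually_elim
      case (elim z)
      then have z: "z \<noteq> 0" "z \<noteq> p \<mu>" by (auto simp: pole_nbhd_def)
      have "polar_part \<mu> x y z = (z - p \<mu>) ^ m \<mu> * (\<Sum>c<d. H z $$ (x, c) * refl_inv c y z)"
        unfolding polar_part_def using refl_inv_at_eq[OF \<mu> z(2)] by (simp add: sum_distrib_left mult_ac)
      then show ?case using f[OF z(1)] z(2) by simp
    qed
    then have "residue f (p \<mu>) = residue (\<lambda>z. z ^ k * polar_part \<mu> x y z / (z - p \<mu>) ^ m \<mu>) (p \<mu>)"
      by (rule residue_cong) simp
    also have "\<dots> = (\<Sum>q=1..m \<mu>. pole_coeff p (\<mu>, q) (int k) *
        ((deriv ^^ (m \<mu> - q)) (polar_part \<mu> x y) (p \<mu>) / fact (m \<mu> - q)))"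
      by (rule residue_power_times_pole[where p = p, OF pole_nbhd(1) pole_nbhd(2)[OF \<mu>] polar_part_holomorphic[OF xy(1)] p_nz[OF \<mu>] m_pos[OF \<mu>]])
    also have "\<dots> = (\<Sum>q=1..m \<mu>. - (pole_coeff p (\<mu>, q) (int k) * theta d m p h hs \<mu> q $$ (x, y)))"
      by (intro sum.cong refl) (simp add: theta_eq[OF \<mu> xy])
    finally show "residue f (p \<mu>) = (\<Sum>q=1..m \<mu>. - (pole_coeff p (\<mu>, q) (int k) * theta d m p h hs \<mu> q $$ (x, y)))" .
  qed
  also have "\<dots> = - hank_symbol h hs (int k) $$ (x, y)"
    using xy by (simp add: hank_symbol_def sum_negf)
  finally have "hank_symbol h hs (int k) $$ (x, y) = - fcoef (\<lambda>\<theta>. f (cis \<theta>)) (- 1)" by simp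
  also have "fcoef (\<lambda>\<theta>. f (cis \<theta>)) (- 1) =
      fcoef (\<lambda>\<theta>. \<Sum>c<d. H (cis \<theta>) $$ (x, c) * cnj (mat_inv (h (cis \<theta>)) $$ (y, c))) (- int (k + 1))"
  proof -
    have "cis (- (of_int (- 1) * \<theta>)) * f (cis \<theta>) = cis (- (of_int (- int (k + 1)) * \<theta>)) *
        (\<Sum>c<d. H (cis \<theta>) $$ (x, c) * cnj (mat_inv (h (cis \<theta>)) $$ (y, c)))" for \<theta>
    proof -
      have "1 / cnj (cis \<theta>) = cis \<theta>" by (simp add: cis_cnj cis_divide[of 0, simplified])
      then have "refl_inv c y (cis \<theta>) = cnj (mat_inv (h (cis \<theta>)) $$ (y, c))" if "c < d" for c
        using refl_inv_eq[OF that xy(2), of "cis \<theta>"] partial_fractions[of "cis \<theta>"] by simp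
      then have "f (cis \<theta>) = cis \<theta> ^ k * (\<Sum>c<d. H (cis \<theta>) $$ (x, c) * cnj (mat_inv (h (cis \<theta>)) $$ (y, c)))"
        by (subst f) auto
      moreover have "cis \<theta> * cis \<theta> ^ k = cis (- (of_int (- int (k + 1)) * \<theta>))"
        by (simp add: Complex.DeMoivre cis_mult algebra_simps)
      ultimately show ?thesis by (simp add: mult.assoc[symmetric])
    qed
    then show ?thesis unfolding fcoef_def by simp
  qed
  finally show ?thesis .
qed

end

section \<open>Fourier coefficients of matrix functions\<close>

text \<open>Matrix functions on the circle with integrable entries, and their Fourier coefficients.\<close>

definition mint :: "nat \<Rightarrow> nat \<Rightarrow> (real \<Rightarrow> complex mat) \<Rightarrow> bool"
  where "mint m n F \<longleftrightarrow> (\<forall>\<theta>. F \<theta> \<in> carrier_mat m n) \<and> (\<forall>i<m. \<forall>j<n. integrable circ (\<lambda>\<theta>. F \<theta> $$ (i, j)))"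

definition mfc :: "nat \<Rightarrow> nat \<Rightarrow> (real \<Rightarrow> complex mat) \<Rightarrow> int \<Rightarrow> complex mat"
  where "mfc m n F k = Matrix.mat m n (\<lambda>(i, j). fcoef (\<lambda>\<theta>. F \<theta> $$ (i, j)) k)"

text \<open>Absolutely convergent series of \<open>C k\<close> times the character of frequency \<open>\<sigma> k\<close>; analytic functions have
  \<open>\<sigma> = int\<close>, antianalytic ones \<open>\<sigma> k = - int k\<close>.\<close>

definition mseries :: "nat \<Rightarrow> nat \<Rightarrow> (real \<Rightarrow> complex mat) \<Rightarrow> (nat \<Rightarrow> complex mat) \<Rightarrow> (nat \<Rightarrow> int) \<Rightarrow> bool"
  where "mseries m n F C \<sigma> \<longleftrightarrow> (\<forall>\<theta>. F \<theta> \<in> carrier_mat m n) \<and> (\<forall>k. C k \<in> carrier_mat m n) \<and>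
    (\<forall>i<m. \<forall>j<n. summable (\<lambda>k. cmod (C k $$ (i, j))) \<and>
      (\<forall>\<theta>. (\<lambda>k. C k $$ (i, j) * cis (of_int (\<sigma> k) * \<theta>)) sums F \<theta> $$ (i, j)))"

lemma mfc_carrier [simp]: "mfc m n F k \<in> carrier_mat m n"
  by (simp add: mfc_def)

lemma mintD:
  assumes "mint m n F"
  shows "F \<theta> \<in> carrier_mat m n" "dim_row (F \<theta>) = m" "dim_col (F \<theta>) = n"
    "i < m \<Longrightarrow> j < n \<Longrightarrow> integrable circ (\<lambda>\<theta>. F \<theta> $$ (i, j))"
  using assms unfolding mint_def by auto

lemma mseriesD:
  assumes "mseries m n F C \<sigma>"
  shows "F \<theta> \<in> carrier_mat m n" "C k \<in> carrier_mat m n"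
    "i < m \<Longrightarrow> j < n \<Longrightarrow> summable (\<lambda>k. cmod (C k $$ (i, j)))"
    "i < m \<Longrightarrow> j < n \<Longrightarrow> (\<lambda>k. C k $$ (i, j) * cis (of_int (\<sigma> k) * \<theta>)) sums F \<theta> $$ (i, j)"
  using assms unfolding mseries_def by auto

lemma mfc_mult_left:
  assumes A: "mseries m n A C \<sigma>" and F: "mint n q F"
  shows "mint m q (\<lambda>\<theta>. A \<theta> * F \<theta>)"
    "mat_has_sum m q (\<lambda>k. C k * mfc n q F (j - \<sigma> k)) (mfc m q (\<lambda>\<theta>. A \<theta> * F \<theta>) j) UNIV"
proof -
  note A' = mseriesD[OF A] and F' = mintD[OF F]
  have entry: "(A \<theta> * F \<theta>) $$ (x, y) = (\<Sum>c<n. A \<theta> $$ (x, c) * F \<theta> $$ (c, y))" if "x < m" "y < q" for \<theta> x y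
    using that carrier_matD[OF A'(1)[of \<theta>]] F'(2,3)[of \<theta>] by (simp add: scalar_prod_def atLeast0LessThan)
  have one: "((\<lambda>k. C k $$ (x, c) * fcoef (\<lambda>\<theta>. F \<theta> $$ (c, y)) (j - \<sigma> k)) has_sum
      fcoef (\<lambda>\<theta>. A \<theta> $$ (x, c) * F \<theta> $$ (c, y)) j) UNIV"
    "integrable circ (\<lambda>\<theta>. A \<theta> $$ (x, c) * F \<theta> $$ (c, y))" if "x < m" "c < n" "y < q" for x c y
    using fcoef_series_mult[OF A'(3)[OF that(1,2)] A'(4)[OF that(1,2)] F'(4)[OF that(2,3)]] by auto
  have c: "A \<theta> * F \<theta> \<in> carrier_mat m q" for \<theta> by (rule mult_carrier_mat[OF A'(1) F'(1)])
  show "mint m q (\<lambda>\<theta>. A \<theta> * F \<theta>)"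
    unfolding mint_def
  proof (intro conjI allI impI c)
    fix x y assume "x < m" "y < q"
    then show "integrable circ (\<lambda>\<theta>. (A \<theta> * F \<theta>) $$ (x, y))"
      unfolding entry[OF \<open>x < m\<close> \<open>y < q\<close>] by (intro Bochner_Integration.integrable_sum one(2)) auto
  qed
  show "mat_has_sum m q (\<lambda>k. C k * mfc n q F (j - \<sigma> k)) (mfc m q (\<lambda>\<theta>. A \<theta> * F \<theta>) j) UNIV"
    unfolding mat_has_sum_def
  proof (intro conjI allI impI ballI)
    show "C k * mfc n q F (j - \<sigma> k) \<in> carrier_mat m q" for k by (rule mult_carrier_mat[OF A'(2)]) simp
    fix x y assume xy: "x < m" "y < q"
    have "((\<lambda>k. \<Sum>c\<in>L. C k $$ (x, c) * fcoef (\<lambda>\<theta>. F \<theta> $$ (c, y)) (j - \<sigma> k)) has_sum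
        (\<Sum>c\<in>L. fcoef (\<lambda>\<theta>. A \<theta> $$ (x, c) * F \<theta> $$ (c, y)) j)) UNIV" if "finite L" "L \<subseteq> {..<n}" for L
      using that
    proof (induction L)
      case (insert c L)
      then show ?case using has_sum_add[OF one(1)[OF xy(1) _ xy(2), of c]] by simp
    qed simp
    from this[of "{..<n}"] have "((\<lambda>k. \<Sum>c<n. C k $$ (x, c) * fcoef (\<lambda>\<theta>. F \<theta> $$ (c, y)) (j - \<sigma> k)) has_sum
        (\<Sum>c<n. fcoef (\<lambda>\<theta>. A \<theta> $$ (x, c) * F \<theta> $$ (c, y)) j)) UNIV" by simp
    then show "((\<lambda>k. (C k * mfc n q F (j - \<sigma> k)) $$ (x, y)) has_sum mfc m q (\<lambda>\<theta>. A \<theta> * F \<theta>) j $$ (x, y)) UNIV"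
    proof (rule has_sum_congI)
      fix k
      show "(C k * mfc n q F (j - \<sigma> k)) $$ (x, y) =
          (\<Sum>c<n. C k $$ (x, c) * fcoef (\<lambda>\<theta>. F \<theta> $$ (c, y)) (j - \<sigma> k))"
        using xy carrier_matD[OF A'(2)[of k]] by (simp add: scalar_prod_def atLeast0LessThan mfc_def)
    next
      have "fcoef (\<lambda>\<theta>. (A \<theta> * F \<theta>) $$ (x, y)) j = fcoef (\<lambda>\<theta>. \<Sum>c<n. A \<theta> $$ (x, c) * F \<theta> $$ (c, y)) j"
        unfolding entry[OF xy] by simp
      also have "\<dots> = (\<Sum>c<n. fcoef (\<lambda>\<theta>. A \<theta> $$ (x, c) * F \<theta> $$ (c, y)) j)"
        by (rule fcoef_sum) (use one(2)[OF xy(1) _ xy(2)] in simp)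
      finally show "mfc m q (\<lambda>\<theta>. A \<theta> * F \<theta>) j $$ (x, y) = (\<Sum>c<n. fcoef (\<lambda>\<theta>. A \<theta> $$ (x, c) * F \<theta> $$ (c, y)) j)"
        using xy by (simp add: mfc_def)
    qed
  qed simp
qed

lemma mseries_adjoint:
  assumes "mseries m n F C \<sigma>"
  shows "mseries n m (\<lambda>\<theta>. mat_adjoint (F \<theta>)) (\<lambda>k. mat_adjoint (C k)) (\<lambda>k. - \<sigma> k)"
  unfolding mseries_def
proof (intro conjI allI impI)
  note F = mseriesD[OF assms]
  show "mat_adjoint (F \<theta>) \<in> carrier_mat n m" for \<theta> using F(1) by simp
  show "mat_adjoint (C k) \<in> carrier_mat n m" for k using F(2) by simp
  fix i j assume ij: "i < n" "j < m"
  have C: "mat_adjoint (C k) $$ (i, j) = cnj (C k $$ (j, i))" for k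
    using ij carrier_matD[OF F(2)[of k]] by simp
  show "summable (\<lambda>k. cmod (mat_adjoint (C k) $$ (i, j)))"
    unfolding C using F(3)[OF ij(2,1)] by simp
  fix \<theta>
  have "(\<lambda>k. cnj (C k $$ (j, i) * cis (of_int (\<sigma> k) * \<theta>))) sums cnj (F \<theta> $$ (j, i))"
    using F(4)[OF ij(2,1)] by (simp only: sums_cnj)
  then show "(\<lambda>k. mat_adjoint (C k) $$ (i, j) * cis (of_int (- \<sigma> k) * \<theta>)) sums mat_adjoint (F \<theta>) $$ (i, j)"
    unfolding C using ij carrier_matD[OF F(1)[of \<theta>]] by (simp add: cis_cnj)
qed

lemma mint_adjoint:
  assumes "mint m n F"
  shows "mint n m (\<lambda>\<theta>. mat_adjoint (F \<theta>))"
  unfolding mint_def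
proof (intro conjI allI impI)
  note F = mintD[OF assms]
  show "mat_adjoint (F \<theta>) \<in> carrier_mat n m" for \<theta> using F(1) by simp
  fix i j assume "i < n" "j < m"
  then show "integrable circ (\<lambda>\<theta>. mat_adjoint (F \<theta>) $$ (i, j))" using F by simp
qed

lemma mfc_adjoint:
  assumes "mint m n F"
  shows "mfc n m (\<lambda>\<theta>. mat_adjoint (F \<theta>)) k = mat_adjoint (mfc m n F (- k))"
proof (rule eq_matI)
  note F = mintD[OF assms]
  fix i j assume "i < dim_row (mat_adjoint (mfc m n F (- k)))" "j < dim_col (mat_adjoint (mfc m n F (- k)))"
  then have "i < n" "j < m" by (auto simp: mfc_def)
  then show "mfc n m (\<lambda>\<theta>. mat_adjoint (F \<theta>)) k $$ (i, j) = mat_adjoint (mfc m n F (- k)) $$ (i, j)"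
    using F by (simp add: mfc_def fcoef_cnj)
qed (simp_all add: mfc_def)

lemma mfc_mult_right:
  assumes A: "mseries n q A C \<sigma>" and F: "mint m n F"
  shows "mint m q (\<lambda>\<theta>. F \<theta> * A \<theta>)"
    "mat_has_sum m q (\<lambda>k. mfc m n F (j - \<sigma> k) * C k) (mfc m q (\<lambda>\<theta>. F \<theta> * A \<theta>) j) UNIV"
proof -
  note A' = mseriesD[OF A] and F' = mintD[OF F]
  have eq: "mat_adjoint (mat_adjoint (A \<theta>) * mat_adjoint (F \<theta>)) = F \<theta> * A \<theta>" for \<theta>
    using mat_adjoint_mult[OF F'(1) A'(1), of \<theta> \<theta>] by (metis mat_adjoint_adjoint)
  note M = mfc_mult_left[OF mseries_adjoint[OF A] mint_adjoint[OF F]]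
  from mint_adjoint[OF M(1)] show "mint m q (\<lambda>\<theta>. F \<theta> * A \<theta>)" by (simp add: eq)
  have "mat_has_sum m q (\<lambda>k. mat_adjoint (mat_adjoint (C k) * mfc n m (\<lambda>\<theta>. mat_adjoint (F \<theta>)) (- j - - \<sigma> k)))
      (mat_adjoint (mfc q m (\<lambda>\<theta>. mat_adjoint (A \<theta>) * mat_adjoint (F \<theta>)) (- j))) UNIV"
    by (rule mat_has_sum_adjoint[OF M(2)])
  then show "mat_has_sum m q (\<lambda>k. mfc m n F (j - \<sigma> k) * C k) (mfc m q (\<lambda>\<theta>. F \<theta> * A \<theta>) j) UNIV"
  proof (rule mat_has_sum_congI)
    fix k
    have "mat_adjoint (C k) * mfc n m (\<lambda>\<theta>. mat_adjoint (F \<theta>)) (- j - - \<sigma> k) =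
        mat_adjoint (mfc m n F (j - \<sigma> k) * C k)"
      unfolding mfc_adjoint[OF F] mat_adjoint_mult[OF mfc_carrier A'(2)] by simp
    then show "mfc m n F (j - \<sigma> k) * C k =
        mat_adjoint (mat_adjoint (C k) * mfc n m (\<lambda>\<theta>. mat_adjoint (F \<theta>)) (- j - - \<sigma> k))" by simp
  next
    show "mfc m q (\<lambda>\<theta>. F \<theta> * A \<theta>) j = mat_adjoint (mfc q m (\<lambda>\<theta>. mat_adjoint (A \<theta>) * mat_adjoint (F \<theta>)) (- j))"
      using mfc_adjoint[OF M(1), of j] by (simp add: eq)
  qed
qed

lemma mfc_add:
  assumes "mint m n F" "mint m n G"
  shows "mint m n (\<lambda>\<theta>. F \<theta> + G \<theta>)" "mfc m n (\<lambda>\<theta>. F \<theta> + G \<theta>) k = mfc m n F k + mfc m n G k"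
proof -
  note F = mintD[OF assms(1)] and G = mintD[OF assms(2)]
  have e: "(F \<theta> + G \<theta>) $$ (i, j) = F \<theta> $$ (i, j) + G \<theta> $$ (i, j)" if "i < m" "j < n" for i j \<theta>
    using that F(2,3)[of \<theta>] G(2,3)[of \<theta>] by simp
  show "mint m n (\<lambda>\<theta>. F \<theta> + G \<theta>)"
    unfolding mint_def
  proof (intro conjI allI impI)
    show "F \<theta> + G \<theta> \<in> carrier_mat m n" for \<theta> using F(1) G(1) by simp
    fix i j assume ij: "i < m" "j < n"
    show "integrable circ (\<lambda>\<theta>. (F \<theta> + G \<theta>) $$ (i, j))"
      unfolding e[OF ij] by (intro Bochner_Integration.integrable_add F(4) G(4) ij)
  qed
  show "mfc m n (\<lambda>\<theta>. F \<theta> + G \<theta>) k = mfc m n F k + mfc m n G k"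
  proof (rule eq_matI)
    fix i j assume "i < dim_row (mfc m n F k + mfc m n G k)" "j < dim_col (mfc m n F k + mfc m n G k)"
    then have ij: "i < m" "j < n" by (auto simp: mfc_def)
    show "mfc m n (\<lambda>\<theta>. F \<theta> + G \<theta>) k $$ (i, j) = (mfc m n F k + mfc m n G k) $$ (i, j)"
      using ij e[OF ij] fcoef_add[OF F(4)[OF ij] G(4)[OF ij]] by (simp add: mfc_def)
  qed (simp_all add: mfc_def)
qed

lemma mseries_fcoef:
  assumes "mseries m n F C \<sigma>"
  shows "mint m n F" "inj \<sigma> \<Longrightarrow> mfc m n F (\<sigma> k) = C k" "j \<notin> range \<sigma> \<Longrightarrow> mfc m n F j = 0\<^sub>m m n"
proof -
  note F = mseriesD[OF assms]
  have one: "integrable circ (\<lambda>_. 1 :: complex)" by (intro integrable_circ_continuous continuous_intros)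
  have 1: "((\<lambda>k. C k $$ (x, y) * fcoef (\<lambda>_. 1) (j - \<sigma> k)) has_sum fcoef (\<lambda>\<theta>. F \<theta> $$ (x, y)) j) UNIV"
    "integrable circ (\<lambda>\<theta>. F \<theta> $$ (x, y))" if "x < m" "y < n" for x y j
    using fcoef_series_mult[OF F(3)[OF that] F(4)[OF that] one] by simp_all
  show "mint m n F" unfolding mint_def using F(1) 1(2) by blast
  show "mfc m n F (\<sigma> k) = C k" if inj: "inj \<sigma>"
  proof (rule eq_matI)
    fix x y assume "x < dim_row (C k)" "y < dim_col (C k)"
    then have xy: "x < m" "y < n" using F(2)[of k] by auto
    have "((\<lambda>l. C l $$ (x, y) * fcoef (\<lambda>_. 1) (\<sigma> k - \<sigma> l)) has_sum
        (\<Sum>l\<in>{k}. C l $$ (x, y) * fcoef (\<lambda>_. 1) (\<sigma> k - \<sigma> l))) UNIV"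
      by (rule has_sum_finite_neutralI[where B = "{k}"]) (use inj in \<open>auto simp: fcoef_one dest: injD\<close>)
    from has_sum_unique[OF 1(1)[OF xy] this] show "mfc m n F (\<sigma> k) $$ (x, y) = C k $$ (x, y)"
      using xy by (simp add: mfc_def fcoef_one)
  qed (use carrier_matD[OF F(2)[of k]] in \<open>simp_all add: mfc_def\<close>)
  show "mfc m n F j = 0\<^sub>m m n" if "j \<notin> range \<sigma>"
  proof (rule eq_matI)
    fix x y assume "x < dim_row (0\<^sub>m m n :: complex mat)" "y < dim_col (0\<^sub>m m n :: complex mat)"
    then have xy: "x < m" "y < n" by auto
    have "j - \<sigma> l \<noteq> 0" for l using that by auto
    then have "((\<lambda>l. C l $$ (x, y) * fcoef (\<lambda>_. 1) (j - \<sigma> l)) has_sum 0) UNIV"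
      by (intro has_sum_0) (simp add: fcoef_one)
    from has_sum_unique[OF 1(1)[OF xy] this] show "mfc m n F j $$ (x, y) = 0\<^sub>m m n $$ (x, y)"
      using xy by (simp add: mfc_def)
  qed (simp_all add: mfc_def)
qed

lemma mseries_uminus:
  assumes "mseries m n F C \<sigma>"
  shows "mseries m n (\<lambda>\<theta>. - F \<theta>) (\<lambda>k. - C k) \<sigma>"
  unfolding mseries_def
proof (intro conjI allI impI)
  note F = mseriesD[OF assms]
  show "- F \<theta> \<in> carrier_mat m n" for \<theta> using F(1) by simp
  show "- C k \<in> carrier_mat m n" for k using F(2) by simp
  fix i j assume ij: "i < m" "j < n"
  have C: "(- C k) $$ (i, j) = - C k $$ (i, j)" for k using ij carrier_matD[OF F(2)[of k]] by simp
  show "summable (\<lambda>k. cmod ((- C k) $$ (i, j)))" unfolding C using F(3)[OF ij] by simp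
  fix \<theta>
  show "(\<lambda>k. (- C k) $$ (i, j) * cis (of_int (\<sigma> k) * \<theta>)) sums (- F \<theta>) $$ (i, j)"
    unfolding C using sums_minus[OF F(4)[OF ij]] ij carrier_matD[OF F(1)[of \<theta>]] by simp
qed

lemma mseries_wiener:
  assumes "\<And>z. A z \<in> carrier_mat m n" "\<And>k. C k \<in> carrier_mat m n"
    "\<And>i j. i < m \<Longrightarrow> j < n \<Longrightarrow> wiener (\<lambda>z. A z $$ (i, j)) (\<lambda>k. C k $$ (i, j))"
  shows "mseries m n (\<lambda>\<theta>. A (cis \<theta>)) C int"
  unfolding mseries_def using assms wiener_summable[OF assms(3)] wiener_cis(1)[OF assms(3)] by blast

lemma mseries_summable:
  assumes "mseries m n F C \<sigma>"
  shows "summable (\<lambda>k. mnorm (C k))"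
proof -
  note F = mseriesD[OF assms]
  have "mnorm (C k) = (\<Sum>i<m. \<Sum>j<n. cmod (C k $$ (i, j)))" for k
    using carrier_matD[OF F(2)[of k]] by (simp add: mnorm_def)
  then show ?thesis using F(3) by (simp only:) (intro summable_sum, simp)
qed

lemma mfc_bounded:
  assumes "mint m n F"
  shows "\<exists>C. \<forall>k. mnorm (mfc m n F k) \<le> C"
proof (intro exI allI)
  fix k
  have "mnorm (mfc m n F k) = (\<Sum>i<m. \<Sum>j<n. cmod (fcoef (\<lambda>\<theta>. F \<theta> $$ (i, j)) k))"
    by (simp add: mnorm_def mfc_def)
  also have "\<dots> \<le> (\<Sum>i<m. \<Sum>j<n. integral\<^sup>L circ (\<lambda>\<theta>. cmod (F \<theta> $$ (i, j))))"
    using mintD(4)[OF assms] by (intro sum_mono norm_fcoef_le) auto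
  finally show "mnorm (mfc m n F k) \<le> (\<Sum>i<m. \<Sum>j<n. integral\<^sup>L circ (\<lambda>\<theta>. cmod (F \<theta> $$ (i, j))))" .
qed

text \<open>The coefficient at \<open>j\<close> of a product only involves pairs of frequencies with sum \<open>j\<close>.\<close>

lemma mfc_mult_zero:
  assumes A: "mseries m n A C \<sigma>" and F: "mint n q F"
    and zero: "\<And>k. C k \<noteq> 0\<^sub>m m n \<Longrightarrow> mfc n q F (j - \<sigma> k) = 0\<^sub>m n q"
  shows "mfc m q (\<lambda>\<theta>. A \<theta> * F \<theta>) j = 0\<^sub>m m q"
proof -
  have "C k * mfc n q F (j - \<sigma> k) = 0\<^sub>m m q" for k
  proof (cases "C k = 0\<^sub>m m n")
    case False
    then show ?thesis using mseriesD(2)[OF A, of k] by (simp add: zero right_mult_zero_mat[of _ m n])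
  qed (simp add: left_mult_zero_mat[of _ n])
  with mfc_mult_left(2)[OF A F, of j]
  have "mat_has_sum m q (\<lambda>k. 0\<^sub>m m q) (mfc m q (\<lambda>\<theta>. A \<theta> * F \<theta>) j) (UNIV :: nat set)" by simp
  then show ?thesis using mat_has_sum_0 mat_has_sum_unique by blast
qed

text \<open>If no frequency of \<open>A\<close> occurs in \<open>F\<close>, then \<open>A\<close> and \<open>F\<close> are orthogonal in the mean.\<close>

lemma mfc_orthogonal:
  assumes A: "mseries m n A C \<sigma>" and F: "mint m q F"
    and zero: "\<And>k. C k \<noteq> 0\<^sub>m m n \<Longrightarrow> mfc m q F (\<sigma> k) = 0\<^sub>m m q"
  shows "mfc n q (\<lambda>\<theta>. mat_adjoint (A \<theta>) * F \<theta>) 0 = 0\<^sub>m n q"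
proof (rule mfc_mult_zero[OF mseries_adjoint[OF A] F])
  fix k assume "mat_adjoint (C k) \<noteq> 0\<^sub>m n m"
  then have "C k \<noteq> 0\<^sub>m m n" by auto
  then show "mfc m q F (0 - - \<sigma> k) = 0\<^sub>m m q" by (simp add: zero)
qed

lemma mseries_exists:
  assumes C: "\<And>k. C k \<in> carrier_mat m n" and summ: "summable (\<lambda>k. mnorm (C k))"
  obtains F where "mseries m n (\<lambda>\<theta>. F (cis \<theta>)) C \<sigma>"
proof
  let ?F = "\<lambda>z. Matrix.mat m n (\<lambda>(i, j). \<Sum>k. C k $$ (i, j) * z powi \<sigma> k)"
  show "mseries m n (\<lambda>\<theta>. ?F (cis \<theta>)) C \<sigma>"
    unfolding mseries_def
  proof (intro conjI allI impI)
    fix i j assume ij: "i < m" "j < n"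
    show s: "summable (\<lambda>k. cmod (C k $$ (i, j)))"
      by (rule summable_comparison_test'[OF summ, of 0]) (use entry_le_mnorm[OF C ij] in auto)
    fix \<theta>
    have "summable (\<lambda>k. C k $$ (i, j) * cis (of_int (\<sigma> k) * \<theta>))"
      by (rule summable_norm_cancel) (use s in \<open>simp add: norm_mult\<close>)
    from summable_sums[OF this]
    show "(\<lambda>k. C k $$ (i, j) * cis (of_int (\<sigma> k) * \<theta>)) sums ?F (cis \<theta>) $$ (i, j)"
      using ij by (simp add: cis_power_int)
  qed (use C in auto)
qed

subsection \<open>Continuous matrix functions\<close>

definition mcont :: "nat \<Rightarrow> nat \<Rightarrow> (complex \<Rightarrow> complex mat) \<Rightarrow> bool"
  where "mcont m n F \<longleftrightarrow> (\<forall>z\<in>sphere 0 1. F z \<in> carrier_mat m n) \<and>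
    (\<forall>i<m. \<forall>j<n. continuous_on (sphere 0 1) (\<lambda>z. F z $$ (i, j)))"

lemma sphere_cis:
  assumes "z \<in> sphere 0 1"
  shows "cis (Arg z) = z"
  using assms cis_Arg[of z] by (cases "z = 0") (auto simp: sgn_div_norm)

lemma mseries_continuous:
  assumes "mseries m n (\<lambda>\<theta>. F (cis \<theta>)) C \<sigma>"
  shows "mcont m n F"
  unfolding mcont_def
proof (intro conjI allI impI ballI)
  note D = mseriesD[OF assms]
  show "F z \<in> carrier_mat m n" if "z \<in> sphere 0 1" for z
    using D(1)[of "Arg z"] sphere_cis[OF that] by simp
  fix i j assume ij: "i < m" "j < n"
  have S: "(\<lambda>k. C k $$ (i, j) * z powi \<sigma> k) sums F z $$ (i, j)" if "z \<in> sphere 0 1" for z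
    using D(4)[OF ij, of "Arg z"] unfolding cis_power_int[symmetric] sphere_cis[OF that] .
  have "uniform_limit (sphere 0 1) (\<lambda>N z. \<Sum>k<N. C k $$ (i, j) * z powi \<sigma> k) (\<lambda>z. \<Sum>k. C k $$ (i, j) * z powi \<sigma> k) sequentially"
    by (rule Weierstrass_m_test[OF _ D(3)[OF ij]]) (auto simp: norm_mult norm_power_int)
  then have "continuous_on (sphere 0 1) (\<lambda>z. \<Sum>k. C k $$ (i, j) * z powi \<sigma> k)"
    by (rule uniform_limit_theorem[rotated]) (auto intro!: always_eventually continuous_intros)
  then show "continuous_on (sphere 0 1) (\<lambda>z. F z $$ (i, j))"
    by (rule continuous_on_eq) (use S sums_unique in metis)
qed

lemma mcont_adjoint:
  assumes "mcont m n F"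
  shows "mcont n m (\<lambda>z. mat_adjoint (F z))"
  unfolding mcont_def
proof (intro conjI allI impI ballI)
  show "mat_adjoint (F z) \<in> carrier_mat n m" if "z \<in> sphere 0 1" for z
    using assms that by (auto simp: mcont_def)
  fix i j assume ij: "i < n" "j < m"
  have "continuous_on (sphere 0 1) (\<lambda>z. cnj (F z $$ (j, i)))"
    using assms ij by (intro continuous_intros) (auto simp: mcont_def)
  then show "continuous_on (sphere 0 1) (\<lambda>z. mat_adjoint (F z) $$ (i, j))"
  proof (rule continuous_on_eq)
    fix z :: complex assume "z \<in> sphere 0 1"
    then have "F z \<in> carrier_mat m n" using assms by (auto simp: mcont_def)
    then show "cnj (F z $$ (j, i)) = mat_adjoint (F z) $$ (i, j)" using ij by auto
  qed
qed

lemma mcont_add: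
  assumes "mcont m n F" "mcont m n G"
  shows "mcont m n (\<lambda>z. F z + G z)"
  unfolding mcont_def
proof (intro conjI allI impI ballI)
  show "F z + G z \<in> carrier_mat m n" if "z \<in> sphere 0 1" for z
    using assms that by (auto simp: mcont_def)
  fix i j assume ij: "i < m" "j < n"
  have "continuous_on (sphere 0 1) (\<lambda>z. F z $$ (i, j) + G z $$ (i, j))"
    using assms ij by (intro continuous_intros) (auto simp: mcont_def)
  then show "continuous_on (sphere 0 1) (\<lambda>z. (F z + G z) $$ (i, j))"
  proof (rule continuous_on_eq)
    fix z :: complex assume "z \<in> sphere 0 1"
    then have "G z \<in> carrier_mat m n" using assms by (auto simp: mcont_def)
    then show "F z $$ (i, j) + G z $$ (i, j) = (F z + G z) $$ (i, j)" using ij by auto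
  qed
qed

lemma mcont_mult:
  assumes "mcont m n F" "mcont n q G"
  shows "mcont m q (\<lambda>z. F z * G z)"
  unfolding mcont_def
proof (intro conjI allI impI ballI)
  show "F z * G z \<in> carrier_mat m q" if "z \<in> sphere 0 1" for z
    using assms that unfolding mcont_def by (blast intro: mult_carrier_mat)
  fix i j assume ij: "i < m" "j < q"
  have "continuous_on (sphere 0 1) (\<lambda>z. \<Sum>c<n. F z $$ (i, c) * G z $$ (c, j))"
    using assms ij by (intro continuous_intros) (auto simp: mcont_def)
  then show "continuous_on (sphere 0 1) (\<lambda>z. (F z * G z) $$ (i, j))"
  proof (rule continuous_on_eq)
    fix z :: complex assume "z \<in> sphere 0 1"
    then have "F z \<in> carrier_mat m n" "G z \<in> carrier_mat n q" using assms by (auto simp: mcont_def)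
    then show "(\<Sum>c<n. F z $$ (i, c) * G z $$ (c, j)) = (F z * G z) $$ (i, j)"
      using ij by (auto simp: scalar_prod_def atLeast0LessThan)
  qed
qed

lemma mean_square_zero:
  assumes F: "mint m 1 (\<lambda>\<theta>. F (cis \<theta>))" and cont: "mcont m 1 F"
    and zero: "mfc 1 1 (\<lambda>\<theta>. mat_adjoint (F (cis \<theta>)) * F (cis \<theta>)) 0 = 0\<^sub>m 1 1"
  shows "F (cis \<theta>) = 0\<^sub>m m 1"
proof (rule eq_matI)
  note F' = mintD[OF F]
  fix i j assume "i < dim_row (0\<^sub>m m 1 :: complex mat)" "j < dim_col (0\<^sub>m m 1 :: complex mat)"
  then have ij: "i < m" "j = 0" by auto
  have "(mat_adjoint (F (cis \<theta>)) * F (cis \<theta>)) $$ (0, 0) = (\<Sum>i<m. cnj (F (cis \<theta>) $$ (i, 0)) * F (cis \<theta>) $$ (i, 0))" for \<theta>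
    using F'(2,3)[of \<theta>] by (simp add: scalar_prod_def atLeast0LessThan)
  then have "fcoef (\<lambda>\<theta>. \<Sum>i<m. cnj (F (cis \<theta>) $$ (i, 0)) * F (cis \<theta>) $$ (i, 0)) 0 =
      mfc 1 1 (\<lambda>\<theta>. mat_adjoint (F (cis \<theta>)) * F (cis \<theta>)) 0 $$ (0, 0)"
    by (simp add: mfc_def)
  also have "\<dots> = 0" unfolding zero by simp
  finally have "F (cis \<theta>) $$ (i, 0) = 0"
    by (intro continuous_zero_mean_square[of "{..<m}" "\<lambda>i z. F z $$ (i, 0)" i "cis \<theta>"]) (use ij cont in \<open>auto simp: mcont_def\<close>)
  then show "F (cis \<theta>) $$ (i, j) = 0\<^sub>m m 1 $$ (i, j)" using ij by simp
qed (use mintD[OF F] in auto)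

text \<open>After the substitution of \<open>z / 2\<close> both series converge absolutely on the closed disk, where the coefficients are
  Fourier coefficients.\<close>

lemma power_series_eq_wiener:
  assumes f: "wiener f c" and b: "\<And>z. z \<in> ball 0 1 \<Longrightarrow> (\<lambda>k. b k * z ^ k) sums f z"
  shows "b = c"
proof
  fix k
  define r :: complex where "r = of_real (1 / 2)"
  have sc: "wiener (\<lambda>z. f (r * z)) (\<lambda>k. e k * r ^ k)"
    if e: "\<And>z. z \<in> ball 0 1 \<Longrightarrow> (\<lambda>k. e k * z ^ k) sums f z" for e
  proof -
    have "summable (\<lambda>k. e k * of_real (3 / 4) ^ k)"
      using e[of "of_real (3 / 4)"] by (simp add: sums_iff norm_divide)
    from powser_insidea[OF this, of r] have "summable (\<lambda>k. cmod (e k * r ^ k))" by (simp add: r_def norm_divide)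
    moreover have "(\<lambda>k. e k * r ^ k * z ^ k) sums f (r * z)" if "z \<in> cball 0 1" for z
    proof -
      have "r * z \<in> ball 0 1" using that by (simp add: r_def)
      from e[OF this] show ?thesis by (simp only: power_mult_distrib mult.assoc)
    qed
    ultimately show ?thesis by (simp add: wiener_def)
  qed
  have "\<And>z. z \<in> ball 0 1 \<Longrightarrow> (\<lambda>k. c k * z ^ k) sums f z" using f by (simp add: wiener_def)
  note cs = this
  have 1: "fcoef (\<lambda>\<theta>. f (r * cis \<theta>)) (int k) = c k * r ^ k"
    using fcoef_wiener[OF sc[OF cs], of "int k"] by simp
  have 2: "fcoef (\<lambda>\<theta>. f (r * cis \<theta>)) (int k) = b k * r ^ k"
    using fcoef_wiener[OF sc[OF b], of "int k"] by simp
  have "b k * r ^ k = c k * r ^ k" by (rule trans[OF 2[symmetric] 1])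
  moreover have "r ^ k \<noteq> 0" by (simp add: r_def)
  ultimately show "b k = c k" using mult_right_cancel[of "r ^ k" "b k" "c k"] by blast
qed

text \<open>By compactness of the closed disk.\<close>

lemma open_superset_cdisk:
  fixes S :: "complex set"
  assumes "open S" "cball 0 1 \<subseteq> S"
  obtains r where "r > 1" "ball 0 r \<subseteq> S"
proof -
  obtain e where e: "e > 0" "(\<Union>x\<in>cball 0 1. ball x e) \<subseteq> S"
    using compact_subset_open_imp_ball_epsilon_subset[OF compact_cball assms] by blast
  have "z \<in> S" if "z \<in> ball 0 (1 + e)" for z
  proof (cases "cmod z \<le> 1")
    case False
    define y where "y = z / of_real (cmod z)"
    have "cmod y = 1" using False by (auto simp: y_def norm_divide)
    have "y * of_real (cmod z) = z" using False by (auto simp: y_def)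
    then have "z - y = y * of_real (cmod z - 1)" by (simp add: algebra_simps)
    then have "cmod (z - y) = cmod z - 1"
      using False \<open>cmod y = 1\<close> by (simp only: norm_mult norm_of_real) simp
    then have "dist y z = cmod z - 1" by (simp add: dist_norm norm_minus_commute)
    then show ?thesis using that e(2) \<open>cmod y = 1\<close> by (auto intro!: subsetD[OF e(2)] bexI[of _ y])
  qed (use assms in auto)
  then show thesis using e(1) by (intro that[of "1 + e"]) auto
qed

section \<open>The spectral factors of the density\<close>

text \<open>The density has the two spectral factors \<open>h\<close> and \<open>H\<close>; the latter is the outer factor \<open>hs\<close>, continued across the
  circle.\<close>

locale szego_data = pf_ext_data d K m p h \<rho> H hs R
  for d K m p h \<rho> H hs R +
  fixes w :: "complex \<Rightarrow> complex mat" and a a_t :: "nat \<Rightarrow> complex mat"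
  assumes H_det: "\<And>z. z \<in> cball 0 1 \<Longrightarrow> Determinant.det (H z) \<noteq> 0"
    and H_factor: "\<And>z. z \<in> sphere 0 1 \<Longrightarrow> h z * mat_adjoint (h z) = mat_adjoint (H z) * H z"
    and w: "\<And>z. z \<in> sphere 0 1 \<Longrightarrow> w z = h z * mat_adjoint (h z)"
    and a: "has_mat_power_series d (\<lambda>z. - mat_inv (h z)) a"
    and a_t: "has_mat_power_series d (\<lambda>z. - mat_inv (mat_adjoint (hs (cnj z)))) a_t"

begin

abbreviation "hT \<theta> \<equiv> h (cis \<theta>)"

abbreviation "HT \<theta> \<equiv> H (cis \<theta>)"

abbreviation "hI \<theta> \<equiv> mat_inv (h (cis \<theta>))"

abbreviation "HI \<theta> \<equiv> mat_inv (H (cis \<theta>))"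

lemma cis_in [simp]: "cis \<theta> \<in> cball 0 1" "cis \<theta> \<in> sphere 0 1"
  by auto

lemma hI_props: "hI \<theta> \<in> carrier_mat d d" "hT \<theta> * hI \<theta> = 1\<^sub>m d" "hI \<theta> * hT \<theta> = 1\<^sub>m d"
  using mat_inv_props[OF h_carrier h_det[OF cis_in(1)]] by auto

lemma HI_props: "HI \<theta> \<in> carrier_mat d d" "HT \<theta> * HI \<theta> = 1\<^sub>m d" "HI \<theta> * HT \<theta> = 1\<^sub>m d"
  using mat_inv_props[OF H_carrier H_det[OF cis_in(1)]] by auto

lemma h_series: "\<exists>C. mseries d d hT C int"
proof -
  obtain r where r: "r > 1" "\<And>i j. i < d \<Longrightarrow> j < d \<Longrightarrow> (\<lambda>z. h z $$ (i, j)) holomorphic_on ball 0 r"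
    by (rule h_holomorphic) (rule that)
  have "\<exists>c. wiener (\<lambda>z. h z $$ (i, j)) c" if "i < d" "j < d" for i j
    using holomorphic_wiener[OF r(2)[OF that] r(1)] by blast
  then obtain c where c: "\<And>i j. i < d \<Longrightarrow> j < d \<Longrightarrow> wiener (\<lambda>z. h z $$ (i, j)) (c i j)" by metis
  have "mseries d d hT (\<lambda>k. Matrix.mat d d (\<lambda>(i, j). c i j k)) int"
    by (rule mseries_wiener[OF h_carrier]) (use c in auto)
  then show ?thesis by blast
qed

lemma H_series: "\<exists>C. mseries d d HT C int"
proof -
  have "\<exists>c. wiener (\<lambda>z. H z $$ (i, j)) c" if "i < d" "j < d" for i j
    using holomorphic_wiener[OF H_holomorphic[OF that] R] by blast
  then obtain c where c: "\<And>i j. i < d \<Longrightarrow> j < d \<Longrightarrow> wiener (\<lambda>z. H z $$ (i, j)) (c i j)" by metis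
  have "mseries d d HT (\<lambda>k. Matrix.mat d d (\<lambda>(i, j). c i j k)) int"
    by (rule mseries_wiener[OF H_carrier]) (use c in auto)
  then show ?thesis by blast
qed

text \<open>The Taylor coefficients of \<open>h\<close> and \<open>H\<close>.\<close>

definition "ch = (SOME C. mseries d d hT C int)"

definition "cH = (SOME C. mseries d d HT C int)"

lemma hT: "mseries d d hT ch int"
  unfolding ch_def using h_series by (rule someI_ex)

lemma HT: "mseries d d HT cH int"
  unfolding cH_def using H_series by (rule someI_ex)

lemma a_carrier: "a k \<in> carrier_mat d d" "a_t k \<in> carrier_mat d d"
  using a a_t by (simp_all add: has_mat_power_series_def)

text \<open>The partial fractions are holomorphic beyond the closed disk, so the power series \<open>a\<close> converges absolutely on the
  circle.\<close>

lemma hI: "mseries d d (\<lambda>\<theta>. - hI \<theta>) a int"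
proof -
  obtain R where R: "R > 1" "pf_poles \<inter> ball 0 R = {}" using finite_outside_cdisk_radius[OF pf_poles] .
  have "wiener (\<lambda>z. (- pf z) $$ (i, j)) (\<lambda>k. a k $$ (i, j))" if ij: "i < d" "j < d" for i j
  proof -
    have e: "(- pf z) $$ (i, j) = - (pf z $$ (i, j))" for z using ij carrier_matD[OF pf_carrier[of z]] by simp
    have "(\<lambda>z. (- pf z) $$ (i, j)) holomorphic_on ball 0 R"
      unfolding e by (intro holomorphic_intros holomorphic_on_subset[OF pf_holomorphic[OF ij]]) (use R(2) in auto)
    from holomorphic_wiener[OF this R(1)] obtain c where c: "wiener (\<lambda>z. (- pf z) $$ (i, j)) c" .
    have "(\<lambda>k. a k $$ (i, j)) = c"
    proof (rule power_series_eq_wiener[OF c])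
      fix z :: complex assume z: "z \<in> ball 0 1"
      then have "(\<lambda>k. z ^ k * a k $$ (i, j)) sums ((- mat_inv (h z)) $$ (i, j))"
        using a ij unfolding has_mat_power_series_def by blast
      moreover have "mat_inv (h z) = pf z" using z by (intro partial_fractions) auto
      ultimately show "(\<lambda>k. a k $$ (i, j) * z ^ k) sums ((- pf z) $$ (i, j))" by (simp only: mult.commute)
    qed
    with c show ?thesis by simp
  qed
  from mseries_wiener[OF _ a_carrier(1) this]
  have "mseries d d (\<lambda>\<theta>. - pf (cis \<theta>)) a int" using pf_carrier by simp
  then show ?thesis by (simp add: partial_fractions)
qed

text \<open>The series \<open>a_t\<close> is given in terms of \<open>hs (cnj z)\<close>. On the circle this is a series with frequencies
  \<open>\<le> 0\<close> for the adjoint inverse of \<open>H\<close>.\<close>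

lemma HIa: "mseries d d (\<lambda>\<theta>. - mat_adjoint (HI \<theta>)) a_t (\<lambda>k. - int k)"
proof -
  have Hdet_hol: "(\<lambda>z. Determinant.det (H z)) holomorphic_on ball 0 R"
    by (rule det_closed[where Q = "\<lambda>f. f holomorphic_on ball 0 R" and A = H and n = d])
      (auto intro!: holomorphic_intros H_carrier H_holomorphic)
  have Hadj_hol: "(\<lambda>z. adj_mat (H z) $$ (i, j)) holomorphic_on ball 0 R" if "i < d" "j < d" for i j
    by (rule adj_mat_closed[where Q = "\<lambda>f. f holomorphic_on ball 0 R" and A = H and n = d])
      (use that in \<open>auto intro!: holomorphic_intros H_carrier H_holomorphic\<close>)
  let ?S = "{z \<in> ball 0 R. Determinant.det (H z) \<noteq> 0}"
  have "?S = ball 0 R \<inter> (\<lambda>z. Determinant.det (H z)) -` (- {0})" by auto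
  then have "open ?S"
    using continuous_open_preimage[OF holomorphic_on_imp_continuous_on[OF Hdet_hol] open_ball, of "- {0}"] by auto
  moreover have "cball 0 1 \<subseteq> ?S" using H_det R by auto
  ultimately obtain r where r: "r > 1" "ball 0 r \<subseteq> ?S" using open_superset_cdisk by blast
  define V where "V = (\<lambda>z. (1 / Determinant.det (H z)) \<cdot>\<^sub>m adj_mat (H z))"
  have Vc: "V z \<in> carrier_mat d d" for z using adj_mat(1)[OF H_carrier] by (simp add: V_def)
  have V: "mat_inv (H z) = V z" if "z \<in> cball 0 1" for z
    unfolding V_def by (rule mat_inv_props(4)[OF H_carrier H_det[OF that]])
  have "wiener (\<lambda>z. (- V z) $$ (i, j)) (\<lambda>k. mat_adjoint (a_t k) $$ (i, j))" if ij: "i < d" "j < d" for i j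
  proof -
    have e: "(- V z) $$ (i, j) = - (adj_mat (H z) $$ (i, j) / Determinant.det (H z))" for z
      using ij carrier_matD[OF adj_mat(1)[OF H_carrier[of z]]] by (simp add: V_def)
    have nz: "Determinant.det (H z) \<noteq> 0" if "z \<in> ball 0 r" for z using that r(2) by blast
    have "(\<lambda>z. (- V z) $$ (i, j)) holomorphic_on ball 0 r"
      unfolding e using r(2) nz
      by (intro holomorphic_intros holomorphic_on_subset[OF Hadj_hol[OF ij]] holomorphic_on_subset[OF Hdet_hol]) auto
    from holomorphic_wiener[OF this r(1)] obtain c where c: "wiener (\<lambda>z. (- V z) $$ (i, j)) c" .
    have "(\<lambda>k. mat_adjoint (a_t k) $$ (i, j)) = c"
    proof (rule power_series_eq_wiener[OF c])
      fix z :: complex assume z: "z \<in> ball 0 1"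
      then have cz: "cnj z \<in> ball 0 1" by simp
      have z': "z \<in> cball 0 1" using z by auto
      have "(\<lambda>k. cnj z ^ k * a_t k $$ (j, i)) sums ((- mat_inv (mat_adjoint (hs (cnj (cnj z))))) $$ (j, i))"
        using a_t ij cz unfolding has_mat_power_series_def by blast
      also have "hs (cnj (cnj z)) = H z" using H_hs[OF z] by simp
      also have "mat_inv (mat_adjoint (H z)) = mat_adjoint (V z)"
        using mat_inv_adjoint[OF H_carrier H_det[OF z']] V[OF z'] by simp
      also have "(- mat_adjoint (V z)) $$ (j, i) = cnj ((- V z) $$ (i, j))"
        using ij carrier_matD[OF Vc[of z]] by simp
      finally have "(\<lambda>k. cnj (z ^ k * cnj (a_t k $$ (j, i)))) sums cnj ((- V z) $$ (i, j))" by simp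
      then have "(\<lambda>k. z ^ k * cnj (a_t k $$ (j, i))) sums ((- V z) $$ (i, j))" by (simp only: sums_cnj)
      then show "(\<lambda>k. mat_adjoint (a_t k) $$ (i, j) * z ^ k) sums ((- V z) $$ (i, j))"
        using ij carrier_matD[OF a_carrier(2)] by (simp add: mult.commute)
    qed
    with c show ?thesis by simp
  qed
  from mseries_wiener[OF _ _ this] have "mseries d d (\<lambda>\<theta>. - V (cis \<theta>)) (\<lambda>k. mat_adjoint (a_t k)) int"
    using Vc a_carrier(2) by simp
  from mseries_adjoint[OF this] show ?thesis by (simp add: mat_adjoint_uminus V)
qed

subsection \<open>Relations between the coefficients\<close>

text \<open>The density, the phase function and the Fourier coefficients of the density.\<close>

abbreviation "wT \<theta> \<equiv> hT \<theta> * mat_adjoint (hT \<theta>)"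

abbreviation "U \<theta> \<equiv> HT \<theta> * mat_adjoint (hI \<theta>)"

abbreviation "\<gamma> k \<equiv> mfc d d wT k"

lemma carriers [simp]:
  "hT \<theta> \<in> carrier_mat d d" "HT \<theta> \<in> carrier_mat d d" "hI \<theta> \<in> carrier_mat d d" "HI \<theta> \<in> carrier_mat d d"
  using h_carrier H_carrier hI_props(1) HI_props(1) by auto

lemma dims [simp]:
  "dim_row (hT \<theta>) = d" "dim_col (hT \<theta>) = d" "dim_row (HT \<theta>) = d" "dim_col (HT \<theta>) = d"
  "dim_row (hI \<theta>) = d" "dim_col (hI \<theta>) = d" "dim_row (HI \<theta>) = d" "dim_col (HI \<theta>) = d"
  using carrier_matD[OF carriers(1)] carrier_matD[OF carriers(2)]
    carrier_matD[OF carriers(3)] carrier_matD[OF carriers(4)] by auto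

lemma wT_eq: "wT \<theta> = mat_adjoint (HT \<theta>) * HT \<theta>"
  by (rule H_factor) simp

lemma hI_w: "hI \<theta> * wT \<theta> = mat_adjoint (hT \<theta>)"
  using assoc_mult_mat[of "hI \<theta>" d d "hT \<theta>" d "mat_adjoint (hT \<theta>)" d] by (simp add: hI_props)

lemma HI_adjoint: "mat_adjoint (HI \<theta>) * mat_adjoint (HT \<theta>) = 1\<^sub>m d"
  using mat_adjoint_mult[of "HT \<theta>" d d "HI \<theta>" d] by (simp add: HI_props)

lemma hI_adjoint: "mat_adjoint (hT \<theta>) * mat_adjoint (hI \<theta>) = 1\<^sub>m d"
  using mat_adjoint_mult[of "hI \<theta>" d d "hT \<theta>" d] by (simp add: hI_props)

lemma HI_w: "mat_adjoint (HI \<theta>) * wT \<theta> = HT \<theta>"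
  unfolding wT_eq using assoc_mult_mat[of "mat_adjoint (HI \<theta>)" d d "mat_adjoint (HT \<theta>)" d "HT \<theta>" d]
  by (simp add: HI_adjoint)

lemma HU: "mat_adjoint (HT \<theta>) * U \<theta> = hT \<theta>"
proof -
  have "mat_adjoint (HT \<theta>) * U \<theta> = wT \<theta> * mat_adjoint (hI \<theta>)"
    unfolding wT_eq by (rule assoc_mult_mat[symmetric, of _ d d _ d _ d]) simp_all
  also have "\<dots> = hT \<theta> * (mat_adjoint (hT \<theta>) * mat_adjoint (hI \<theta>))"
    by (rule assoc_mult_mat[of _ d d _ d _ d]) simp_all
  finally show ?thesis by (simp add: hI_adjoint)
qed

lemma U_carrier [simp]: "U \<theta> \<in> carrier_mat d d"
  by (simp add: mult_carrier_mat_iff)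

lemma U_hI: "U \<theta> * hI \<theta> = mat_adjoint (HI \<theta>)"
proof -
  have "U \<theta> = mat_adjoint (HI \<theta>) * mat_adjoint (HT \<theta>) * U \<theta>" by (simp add: HI_adjoint)
  also have "\<dots> = mat_adjoint (HI \<theta>) * (mat_adjoint (HT \<theta>) * U \<theta>)"
    by (rule assoc_mult_mat[of _ d d _ d _ d]) simp_all
  finally have "U \<theta> * hI \<theta> = mat_adjoint (HI \<theta>) * hT \<theta> * hI \<theta>" by (simp add: HU)
  also have "\<dots> = mat_adjoint (HI \<theta>) * (hT \<theta> * hI \<theta>)"
    by (rule assoc_mult_mat[of _ d d _ d _ d]) simp_all
  finally show ?thesis by (simp add: hI_props)
qed

lemma U_adjoint: "mat_adjoint (U \<theta>) = hI \<theta> * mat_adjoint (HT \<theta>)"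
  by (subst mat_adjoint_mult[of _ d d _ d]) simp_all

lemma U_adjoint_HI: "mat_adjoint (U \<theta>) * mat_adjoint (HI \<theta>) = hI \<theta>"
proof -
  have "mat_adjoint (HT \<theta>) * mat_adjoint (HI \<theta>) = 1\<^sub>m d"
    using mat_adjoint_mult[of "HI \<theta>" d d "HT \<theta>" d] by (simp add: HI_props)
  then show ?thesis
    unfolding U_adjoint by (subst assoc_mult_mat[of _ d d _ d _ d]) simp_all
qed

lemma U_unitary: "mat_adjoint (U \<theta>) * U \<theta> = 1\<^sub>m d"
proof -
  have "mat_adjoint (U \<theta>) * U \<theta> = hI \<theta> * (mat_adjoint (HT \<theta>) * U \<theta>)"
    unfolding U_adjoint by (rule assoc_mult_mat[of _ d d _ d _ d]) simp_all
  then show ?thesis by (simp add: HU hI_props)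
qed

lemma mint_basic:
  "mint d d hT" "mint d d HT" "mint d d wT" "mint d d U" "mint d d (\<lambda>\<theta>. mat_adjoint (U \<theta>))"
  "mint d d (\<lambda>\<theta>. - hI \<theta>)" "mint d d (\<lambda>\<theta>. mat_adjoint (hT \<theta>))"
proof -
  show hi: "mint d d hT" by (rule mseries_fcoef(1)[OF hT])
  show Hi: "mint d d HT" by (rule mseries_fcoef(1)[OF HT])
  show "mint d d (\<lambda>\<theta>. mat_adjoint (hT \<theta>))" by (rule mint_adjoint[OF hi])
  show "mint d d wT" by (rule mfc_mult_left(1)[OF hT mint_adjoint[OF hi]])
  show hIi: "mint d d (\<lambda>\<theta>. - hI \<theta>)" by (rule mseries_fcoef(1)[OF hI])
  have "mint d d (\<lambda>\<theta>. - (- hI \<theta>))" by (rule mseries_fcoef(1)[OF mseries_uminus[OF hI]])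
  moreover have "- (- hI \<theta>) = hI \<theta>" for \<theta> by (rule eq_matI) auto
  ultimately have "mint d d hI" by simp
  then show "mint d d U" by (intro mfc_mult_left(1)[OF HT] mint_adjoint)
  then show "mint d d (\<lambda>\<theta>. mat_adjoint (U \<theta>))" by (rule mint_adjoint)
qed

lemma \<gamma>_herm: "mat_adjoint (\<gamma> k) = \<gamma> (- k)"
proof -
  have "mat_adjoint (wT \<theta>) = wT \<theta>" for \<theta>
    by (subst mat_adjoint_mult[of _ d d _ d]) simp_all
  then have "\<gamma> (- k) = mfc d d (\<lambda>\<theta>. mat_adjoint (wT \<theta>)) (- k)" by simp
  then show ?thesis using mfc_adjoint[OF mint_basic(3), of "- k"] by simp
qed

lemma uminus_mult: "- A * B = - (A * B)" if "A \<in> carrier_mat d d" "B \<in> carrier_mat d q" for A B :: "complex mat"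
  using that by (intro uminus_mult_left_mat) auto

lemma mult_uminus: "A * - B = - (A * B)" if "A \<in> carrier_mat q d" "B \<in> carrier_mat d d" for A B :: "complex mat"
  using that by (intro uminus_mult_right_mat) auto

text \<open>The product of the inverse of \<open>h\<close> and \<open>w = h h\<^sup>*\<close> is \<open>h\<^sup>*\<close>.\<close>

lemma a_\<gamma>: "mat_has_sum d d (\<lambda>k. a k * \<gamma> (j - int k)) (mfc d d (\<lambda>\<theta>. - mat_adjoint (hT \<theta>)) j) UNIV"
proof -
  have "- hI \<theta> * wT \<theta> = - mat_adjoint (hT \<theta>)" for \<theta>
    by (subst uminus_mult) (simp_all add: mult_carrier_mat_iff hI_w)
  with mfc_mult_left(2)[OF hI mint_basic(3), of j] show ?thesis by simp
qed

text \<open>The product of the adjoint inverse of \<open>H\<close> and \<open>w = H\<^sup>* H\<close> is \<open>H\<close>.\<close>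

lemma a_t_\<gamma>: "mat_has_sum d d (\<lambda>k. a_t k * \<gamma> (j + int k)) (mfc d d (\<lambda>\<theta>. - HT \<theta>) j) UNIV"
proof -
  have "- mat_adjoint (HI \<theta>) * wT \<theta> = - HT \<theta>" for \<theta>
    by (subst uminus_mult) (simp_all add: mult_carrier_mat_iff HI_w)
  with mfc_mult_left(2)[OF HIa mint_basic(3), of j] show ?thesis by simp
qed

lemma mfc_h_adjoint: "mfc d d (\<lambda>\<theta>. - mat_adjoint (hT \<theta>)) (- int j) = - mat_adjoint (ch j)"
  "i > 0 \<Longrightarrow> mfc d d (\<lambda>\<theta>. - mat_adjoint (hT \<theta>)) i = 0\<^sub>m d d"
proof -
  note S = mseries_uminus[OF mseries_adjoint[OF hT]]
  show "mfc d d (\<lambda>\<theta>. - mat_adjoint (hT \<theta>)) (- int j) = - mat_adjoint (ch j)"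
    using mseries_fcoef(2)[OF S, of j] by (simp add: inj_def)
  assume "i > 0"
  then have "i \<notin> range (\<lambda>k. - int k)" by auto
  then show "mfc d d (\<lambda>\<theta>. - mat_adjoint (hT \<theta>)) i = 0\<^sub>m d d" by (rule mseries_fcoef(3)[OF S])
qed

lemma mfc_H: "mfc d d (\<lambda>\<theta>. - HT \<theta>) (int j) = - cH j"
  "i < 0 \<Longrightarrow> mfc d d (\<lambda>\<theta>. - HT \<theta>) i = 0\<^sub>m d d"
proof -
  note S = mseries_uminus[OF HT]
  show "mfc d d (\<lambda>\<theta>. - HT \<theta>) (int j) = - cH j" using mseries_fcoef(2)[OF S, of j] by simp
  assume "i < 0"
  then have "i \<notin> range int" by auto
  then show "mfc d d (\<lambda>\<theta>. - HT \<theta>) i = 0\<^sub>m d d" by (rule mseries_fcoef(3)[OF S])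
qed

text \<open>The phase function maps the inverse of \<open>h\<close> to the adjoint inverse of \<open>H\<close>; its adjoint maps it back
  (\<open>U_adjoint_a_t\<close>).\<close>

lemma U_a: "mat_has_sum d d (\<lambda>l. mfc d d U (- int (k + 1) - int l) * a l) (a_t (k + 1)) UNIV"
proof -
  have "U \<theta> * - hI \<theta> = - mat_adjoint (HI \<theta>)" for \<theta>
    by (subst mult_uminus[OF U_carrier carriers(3)]) (simp only: U_hI)
  with mfc_mult_right(2)[OF hI mint_basic(4), of "- int (k + 1)"]
  have "mat_has_sum d d (\<lambda>l. mfc d d U (- int (k + 1) - int l) * a l) (mfc d d (\<lambda>\<theta>. - mat_adjoint (HI \<theta>)) (- int (k + 1))) UNIV"
    by simp
  moreover have "mfc d d (\<lambda>\<theta>. - mat_adjoint (HI \<theta>)) (- int (k + 1)) = a_t (k + 1)"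
    using mseries_fcoef(2)[OF HIa, of "k + 1"] by (simp add: inj_def)
  ultimately show ?thesis by simp
qed

lemma U_adjoint_a_t:
  "mat_has_sum d d (\<lambda>l. mat_adjoint (mfc d d U (- int (k + 1) - int l)) * a_t l) (a (k + 1)) UNIV"
proof -
  have "mat_adjoint (U \<theta>) * - mat_adjoint (HI \<theta>) = - hI \<theta>" for \<theta>
    by (subst mult_uminus[OF mat_adjoint_carrier[OF U_carrier] mat_adjoint_carrier[OF carriers(4)]]) (simp only: U_adjoint_HI)
  with mfc_mult_right(2)[OF HIa mint_basic(5), of "int (k + 1)"]
  have "mat_has_sum d d (\<lambda>l. mfc d d (\<lambda>\<theta>. mat_adjoint (U \<theta>)) (int (k + 1) + int l) * a_t l) (mfc d d (\<lambda>\<theta>. - hI \<theta>) (int (k + 1))) UNIV"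
    by simp
  moreover have "mfc d d (\<lambda>\<theta>. - hI \<theta>) (int (k + 1)) = a (k + 1)"
    using mseries_fcoef(2)[OF hI, of "k + 1"] by simp
  moreover have "mfc d d (\<lambda>\<theta>. mat_adjoint (U \<theta>)) (int (k + 1) + int l) = mat_adjoint (mfc d d U (- int (k + 1) - int l))" for l
    unfolding mfc_adjoint[OF mint_basic(4)] by (simp add: algebra_simps)
  ultimately show ?thesis by simp
qed

abbreviation "hsym \<equiv> hank_symbol h hs"

lemma hsym_carrier [simp]: "hsym e \<in> carrier_mat d d"
  by (simp add: hank_symbol_def)

lemma hsym_eq:
  assumes "k \<ge> m 0"
  shows "hsym (int k) = - mfc d d U (- int (k + 1))"
proof (rule eq_matI)
  fix x y assume "x < dim_row (- mfc d d U (- int (k + 1)))" "y < dim_col (- mfc d d U (- int (k + 1)))"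
  then have xy: "x < d" "y < d" by (auto simp: mfc_def)
  have "U \<theta> $$ (x, y) = (\<Sum>c<d. HT \<theta> $$ (x, c) * cnj (hI \<theta> $$ (y, c)))" for \<theta>
    using xy by (simp add: scalar_prod_def atLeast0LessThan)
  then show "hsym (int k) $$ (x, y) = (- mfc d d U (- int (k + 1))) $$ (x, y)"
    unfolding hank_symbol_fcoef[OF xy assms] using xy by (simp add: mfc_def)
qed (simp_all add: hank_symbol_def mfc_def)

lemma a_t_rel:
  assumes "k \<ge> m 0"
  shows "mat_has_sum d d (\<lambda>l. hsym (int (k + l)) * a l) (- a_t (Suc k)) UNIV"
proof (rule mat_has_sum_congI[OF mat_has_sum_uminus[OF U_a[of k]]])
  fix l
  have "hsym (int (k + l)) = - mfc d d U (- int (k + 1) - int l)"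
    using hsym_eq[of "k + l"] assms by (simp add: algebra_simps)
  then show "hsym (int (k + l)) * a l = - (mfc d d U (- int (k + 1) - int l) * a l)"
    using uminus_mult[OF mfc_carrier a_carrier(1)] by simp
qed simp

lemma a_rel:
  assumes "k \<ge> m 0"
  shows "mat_has_sum d d (\<lambda>l. mat_adjoint (hsym (int (k + l))) * a_t l) (- a (Suc k)) UNIV"
proof (rule mat_has_sum_congI[OF mat_has_sum_uminus[OF U_adjoint_a_t[of k]]])
  fix l
  have "hsym (int (k + l)) = - mfc d d U (- int (k + 1) - int l)"
    using hsym_eq[of "k + l"] assms by (simp add: algebra_simps)
  then show "mat_adjoint (hsym (int (k + l))) * a_t l =
      - (mat_adjoint (mfc d d U (- int (k + 1) - int l)) * a_t l)"
    using uminus_mult[OF mat_adjoint_carrier[OF mfc_carrier] a_carrier(2)] by (simp add: mat_adjoint_uminus)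
qed simp

text \<open>Compare the Fourier coefficients of \<open>A F = - 1\<close>; the sum is finite since \<open>F\<close> has no negative frequencies.\<close>

lemma convolution_inverse:
  assumes A: "mseries d d A C int" and F: "mint d d F" and inv: "\<And>\<theta>. A \<theta> * F \<theta> = - 1\<^sub>m d"
    and neg: "\<And>j. j < 0 \<Longrightarrow> mfc d d F j = 0\<^sub>m d d"
  shows "mat_sum d d {..q} (\<lambda>i. C i * mfc d d F (int (q - i))) = (if q = 0 then - 1\<^sub>m d else 0\<^sub>m d d)"
proof (rule mat_sum_eqI)
  have "mat_has_sum d d (\<lambda>k. C k * mfc d d F (int q - int k)) (mfc d d (\<lambda>\<theta>. - 1\<^sub>m d) (int q)) UNIV"
    using mfc_mult_left(2)[OF A F, of "int q"] by (simp add: inv)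
  moreover have "mfc d d (\<lambda>\<theta>. - 1\<^sub>m d) (int q) = (if q = 0 then - 1\<^sub>m d else 0\<^sub>m d d)"
  proof (rule eq_matI)
    fix i j assume "i < dim_row (if q = 0 then - 1\<^sub>m d else 0\<^sub>m d d :: complex mat)"
      "j < dim_col (if q = 0 then - 1\<^sub>m d else 0\<^sub>m d d :: complex mat)"
    then have "i < d" "j < d" by (auto split: if_splits)
    then show "mfc d d (\<lambda>\<theta>. - 1\<^sub>m d) (int q) $$ (i, j) = (if q = 0 then - 1\<^sub>m d else 0\<^sub>m d d) $$ (i, j)"
      using fcoef_mult_const[of "- 1" "\<lambda>_. 1" "int q"] fcoef_mult_const[of 0 "\<lambda>_. 1" "int q"]
      by (auto simp: mfc_def fcoef_one)
  qed (simp_all add: mfc_def)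
  ultimately have 1: "mat_has_sum d d (\<lambda>k. C k * mfc d d F (int q - int k)) (if q = 0 then - 1\<^sub>m d else 0\<^sub>m d d) UNIV" by simp
  have Cc: "C k \<in> carrier_mat d d" for k by (rule mseriesD(2)[OF A])
  let ?f = "\<lambda>k. C k * mfc d d F (int q - int k)"
  let ?S = "mat_sum d d {..q} ?f"
  have 2: "mat_has_sum d d ?f ?S {..q}"
    by (rule mat_has_sum_finite) (auto intro!: mult_carrier_mat[OF Cc])
  have "?f k = 0\<^sub>m d d" if "k \<in> {q<..}" for k
    using that Cc[of k] by (subst neg) (auto simp: right_mult_zero_mat[of _ d d])
  note zero = this
  have 3: "mat_has_sum d d ?f (0\<^sub>m d d) {q<..}"
    by (rule mat_has_sum_congI[OF mat_has_sum_0]) (simp_all only: zero)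
  have "mat_has_sum d d ?f (?S + 0\<^sub>m d d) ({..q} \<union> {q<..})" by (rule mat_has_sum_Un[OF 2 3]) auto
  also have "{..q} \<union> {q<..} = UNIV" by auto
  finally have "?S + 0\<^sub>m d d = (if q = 0 then - 1\<^sub>m d else 0\<^sub>m d d)" using 1 mat_has_sum_unique by blast
  then have "?S = (if q = 0 then - 1\<^sub>m d else 0\<^sub>m d d)" by simp
  with 2 have "mat_has_sum d d ?f (if q = 0 then - 1\<^sub>m d else 0\<^sub>m d d) {..q}" by simp
  then show "mat_has_sum d d (\<lambda>i. C i * mfc d d F (int (q - i))) (if q = 0 then - 1\<^sub>m d else 0\<^sub>m d d) {..q}"
    by (rule mat_has_sum_congI) (simp_all add: of_nat_diff)
qed simp

lemma ch_inv: "mat_sum d d {..q} (\<lambda>i. ch i * a (q - i)) = (if q = 0 then - 1\<^sub>m d else 0\<^sub>m d d)"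
proof -
  have "mat_sum d d {..q} (\<lambda>i. ch i * mfc d d (\<lambda>\<theta>. - hI \<theta>) (int (q - i))) = (if q = 0 then - 1\<^sub>m d else 0\<^sub>m d d)"
  proof (rule convolution_inverse[OF hT mint_basic(6)])
    show "hT \<theta> * - hI \<theta> = - 1\<^sub>m d" for \<theta> by (subst mult_uminus[OF carriers(1,3)]) (simp only: hI_props)
    show "mfc d d (\<lambda>\<theta>. - hI \<theta>) j = 0\<^sub>m d d" if "j < 0" for j
      by (rule mseries_fcoef(3)[OF hI]) (use that in auto)
  qed
  moreover have "mfc d d (\<lambda>\<theta>. - hI \<theta>) (int k) = a k" for k by (rule mseries_fcoef(2)[OF hI]) simp
  ultimately show ?thesis by simp
qed

lemma cH_carrier [simp]: "cH k \<in> carrier_mat d d" and ch_carrier [simp]: "ch k \<in> carrier_mat d d"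
  by (rule mseriesD(2)[OF HT], rule mseriesD(2)[OF hT])

lemma cH_inv: "mat_sum d d {..q} (\<lambda>i. mat_adjoint (cH i) * a_t (q - i)) = (if q = 0 then - 1\<^sub>m d else 0\<^sub>m d d)"
proof -
  have A: "mseries d d (\<lambda>\<theta>. - HI \<theta>) (\<lambda>k. mat_adjoint (a_t k)) int"
    using mseries_adjoint[OF HIa] by (simp add: mat_adjoint_uminus)
  have "mat_sum d d {..q} (\<lambda>i. mat_adjoint (a_t i) * mfc d d HT (int (q - i))) = (if q = 0 then - 1\<^sub>m d else 0\<^sub>m d d)"
  proof (rule convolution_inverse[OF A mint_basic(2)])
    show "- HI \<theta> * HT \<theta> = - 1\<^sub>m d" for \<theta> by (subst uminus_mult[OF carriers(4,2)]) (simp only: HI_props)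
    show "mfc d d HT j = 0\<^sub>m d d" if "j < 0" for j
      by (rule mseries_fcoef(3)[OF HT]) (use that in auto)
  qed
  moreover have "mfc d d HT (int k) = cH k" for k by (rule mseries_fcoef(2)[OF HT]) simp
  ultimately have eq: "mat_sum d d {..q} (\<lambda>i. mat_adjoint (a_t i) * cH (q - i)) = (if q = 0 then - 1\<^sub>m d else 0\<^sub>m d d)"
    by simp
  have "mat_has_sum d d (\<lambda>i. mat_adjoint (a_t i) * cH (q - i)) (if q = 0 then - 1\<^sub>m d else 0\<^sub>m d d) {..q}"
    unfolding eq[symmetric]
    by (rule mat_has_sum_finite) (auto intro!: mult_carrier_mat[OF mat_adjoint_carrier[OF a_carrier(2)] cH_carrier])
  from mat_has_sum_adjoint[OF this]
  have "mat_has_sum d d (\<lambda>i. mat_adjoint (mat_adjoint (a_t i) * cH (q - i))) (if q = 0 then - 1\<^sub>m d else 0\<^sub>m d d) {..q}"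
    by (simp add: mat_adjoint_uminus split: if_splits)
  moreover have "bij_betw (\<lambda>i. q - i) {..q} {..q}"
    by (rule bij_betwI[where g = "\<lambda>i. q - i"]) auto
  ultimately have "mat_has_sum d d (\<lambda>i. mat_adjoint (mat_adjoint (a_t (q - i)) * cH (q - (q - i))))
      (if q = 0 then - 1\<^sub>m d else 0\<^sub>m d d) {..q}"
    using mat_has_sum_reindex[of "\<lambda>i. q - i" "{..q}" "{..q}" d d "\<lambda>i. mat_adjoint (mat_adjoint (a_t i) * cH (q - i))"]
    by simp
  then have "mat_has_sum d d (\<lambda>i. mat_adjoint (cH i) * a_t (q - i)) (if q = 0 then - 1\<^sub>m d else 0\<^sub>m d d) {..q}"
  proof (rule mat_has_sum_congI)
    fix i assume "i \<in> {..q}"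
    then show "mat_adjoint (cH i) * a_t (q - i) = mat_adjoint (mat_adjoint (a_t (q - i)) * cH (q - (q - i)))"
      using mat_adjoint_mult[OF mat_adjoint_carrier[OF a_carrier(2)] cH_carrier, of "q - i" "q - (q - i)"] by simp
  qed simp
  then show ?thesis by (intro mat_sum_eqI) auto
qed

lemma fourier_coeff_eq: "fourier_coeff d w k = \<gamma> k"
proof (rule eq_matI)
  fix i j assume "i < dim_row (\<gamma> k)" "j < dim_col (\<gamma> k)"
  then have ij: "i < d" "j < d" by (auto simp: mfc_def)
  have "integrable circ (\<lambda>\<theta>. cis (- of_int k * \<theta>) * wT \<theta> $$ (i, j))"
    by (rule integrable_cis_mult[OF mintD(4)[OF mint_basic(3) ij]])
  from lebesgue_integral_eq_integral[OF this]
  show "fourier_coeff d w k $$ (i, j) = \<gamma> k $$ (i, j)"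
    using ij by (simp add: fourier_coeff_def mfc_def fcoef_def w)
qed (simp_all add: fourier_coeff_def mfc_def)

subsection \<open>Invertibility\<close>

lemma mint_w_mult:
  assumes X: "mseries d q X c \<sigma>"
  shows "mint d q (\<lambda>\<theta>. wT \<theta> * X \<theta>)"
    "mat_has_sum d q (\<lambda>k. \<gamma> (j - \<sigma> k) * c k) (mfc d q (\<lambda>\<theta>. wT \<theta> * X \<theta>) j) UNIV"
  using mfc_mult_right[OF X mint_basic(3)] by auto

text \<open>If the product of \<open>w\<close> with an analytic series \<open>X\<close> is orthogonal to the frequencies of \<open>X\<close>, then \<open>h\<^sup>* X\<close>
  has mean square zero.\<close>

lemma toeplitz_form_definite:
  assumes X: "mseries d 1 (\<lambda>\<theta>. X (cis \<theta>)) c int"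
    and orth: "\<And>k. c k \<noteq> 0\<^sub>m d 1 \<Longrightarrow> mfc d 1 (\<lambda>\<theta>. wT \<theta> * X (cis \<theta>)) (int k) = 0\<^sub>m d 1"
  shows "c k = 0\<^sub>m d 1"
proof -
  note Xc [simp] = mseriesD(1)[OF X]
  note [simp] = carrier_matD[OF Xc]
  note One_nat_def [simp del]
  let ?D = "\<lambda>z. mat_adjoint (h z) * X z"
  have "mfc 1 1 (\<lambda>\<theta>. mat_adjoint (X (cis \<theta>)) * (wT \<theta> * X (cis \<theta>))) 0 = 0\<^sub>m 1 1"
    by (rule mfc_orthogonal[OF X mint_w_mult(1)[OF X] orth])
  moreover have "mat_adjoint (X (cis \<theta>)) * (wT \<theta> * X (cis \<theta>)) = mat_adjoint (?D (cis \<theta>)) * ?D (cis \<theta>)" for \<theta>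
  proof -
    have "wT \<theta> * X (cis \<theta>) = hT \<theta> * ?D (cis \<theta>)" by (rule assoc_mult_mat[of _ d d _ d _ 1]) simp_all
    moreover have "mat_adjoint (?D (cis \<theta>)) = mat_adjoint (X (cis \<theta>)) * hT \<theta>"
      by (subst mat_adjoint_mult[of _ d d _ 1]) simp_all
    moreover have "mat_adjoint (X (cis \<theta>)) * hT \<theta> * ?D (cis \<theta>) = mat_adjoint (X (cis \<theta>)) * (hT \<theta> * ?D (cis \<theta>))"
      by (rule assoc_mult_mat[of _ 1 d _ d _ 1]) (simp_all add: mult_carrier_mat_iff)
    ultimately show ?thesis by (simp only:)
  qed
  ultimately have zero: "mfc 1 1 (\<lambda>\<theta>. mat_adjoint (?D (cis \<theta>)) * ?D (cis \<theta>)) 0 = 0\<^sub>m 1 1" by (simp only:)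
  have D0: "?D (cis \<theta>) = 0\<^sub>m d 1" for \<theta>
  proof (rule mean_square_zero[OF _ _ zero])
    show "mint d 1 (\<lambda>\<theta>. ?D (cis \<theta>))"
      by (rule mfc_mult_right(1)[OF X mint_basic(7)])
    show "mcont d 1 ?D"
      by (intro mcont_mult[of _ d] mcont_adjoint mseries_continuous[OF hT] mseries_continuous[OF X])
  qed
  have "X (cis \<theta>) = 0\<^sub>m d 1" for \<theta>
  proof -
    have "mat_adjoint (hI \<theta>) * mat_adjoint (hT \<theta>) = 1\<^sub>m d"
      using mat_adjoint_mult[of "hT \<theta>" d d "hI \<theta>" d] by (simp add: hI_props)
    then have "X (cis \<theta>) = mat_adjoint (hI \<theta>) * mat_adjoint (hT \<theta>) * X (cis \<theta>)" by simp
    also have "\<dots> = mat_adjoint (hI \<theta>) * ?D (cis \<theta>)" by (rule assoc_mult_mat[of _ d d _ d _ 1]) simp_all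
    finally show ?thesis unfolding D0 by (simp add: right_mult_zero_mat[of _ d d])
  qed
  then have "mfc d 1 (\<lambda>\<theta>. X (cis \<theta>)) (int k) = mfc d 1 (\<lambda>\<theta>. 0\<^sub>m d 1) (int k)" by simp
  also have "\<dots> = 0\<^sub>m d 1" by (rule eq_matI) (simp_all add: mfc_def fcoef_def)
  finally show ?thesis using mseries_fcoef(2)[OF X, of k] by simp
qed

lemma toeplitz_carrier: "toeplitz d w n \<in> carrier_mat (d * n) (d * n)"
  by (simp add: toeplitz_def)

text \<open>A vector in the kernel of the Toeplitz matrix gives the coefficients of a polynomial \<open>X\<close> such that the product of
  \<open>w\<close> and \<open>X\<close> is orthogonal to its frequencies.\<close>

lemma toeplitz_det: "Determinant.det (toeplitz d w n) \<noteq> 0"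
proof (rule det_nonzeroI[OF toeplitz_carrier])
  fix x assume xc: "x \<in> carrier_mat (d * n) 1" and Tx: "toeplitz d w n * x = 0\<^sub>m (d * n) 1"
  define c where "c k = (if k < n then Matrix.mat d 1 (\<lambda>(i, j). x $$ (d * k + i, 0)) else 0\<^sub>m d 1)" for k
  have cc: "c k \<in> carrier_mat d 1" for k by (simp add: c_def)
  have summ: "summable (\<lambda>k. mnorm (c k))"
    by (rule summable_finite[of "{..<n}"]) (auto simp: c_def mnorm_def)
  obtain X where X: "mseries d 1 (\<lambda>\<theta>. X (cis \<theta>)) c int" by (rule mseries_exists[OF cc summ])
  have "mfc d 1 (\<lambda>\<theta>. wT \<theta> * X (cis \<theta>)) (int s) = 0\<^sub>m d 1" if s: "s < n" for s
  proof (rule eq_matI)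
    fix i j assume "i < dim_row (0\<^sub>m d 1 :: complex mat)" "j < dim_col (0\<^sub>m d 1 :: complex mat)"
    then have i: "i < d" and j: "j = 0" by auto
    have T: "toeplitz d w n $$ (d * s + i, d * r + k) = \<gamma> (int s - int r) $$ (i, k)" if "r < n" "k < d" for r k
      using mat_of_blocks_index[of "Suc s" n "Suc r" n i d k] s i that
      by (simp add: toeplitz_def fourier_coeff_eq)
    have si: "d * s + i < d * n" using block_index_less[of i d "Suc s" n] i s by simp
    have "0 = (toeplitz d w n * x) $$ (d * s + i, 0)" unfolding Tx using si by simp
    also have "\<dots> = (\<Sum>k<d * n. toeplitz d w n $$ (d * s + i, k) * x $$ (k, 0))"
      using si xc carrier_matD[OF toeplitz_carrier[of n]] by (simp add: scalar_prod_def atLeast0LessThan)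
    also have "\<dots> = (\<Sum>r=1..n. \<Sum>k<d. toeplitz d w n $$ (d * s + i, d * (r - 1) + k) * x $$ (d * (r - 1) + k, 0))"
      by (rule sum_blocks)
    also have "\<dots> = (\<Sum>r<n. \<Sum>k<d. toeplitz d w n $$ (d * s + i, d * r + k) * x $$ (d * r + k, 0))"
      by (rule sum.reindex_bij_witness[of _ Suc "\<lambda>r. r - 1"]) auto
    also have "\<dots> = (\<Sum>r<n. (\<gamma> (int s - int r) * c r) $$ (i, 0))"
      using i by (intro sum.cong refl) (auto simp: T c_def scalar_prod_def atLeast0LessThan mfc_def)
    finally have sum0: "(\<Sum>r<n. (\<gamma> (int s - int r) * c r) $$ (i, 0)) = 0" by simp
    have 1: "((\<lambda>r. (\<gamma> (int s - int r) * c r) $$ (i, 0)) has_sum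
        mfc d 1 (\<lambda>\<theta>. wT \<theta> * X (cis \<theta>)) (int s) $$ (i, 0)) UNIV"
      by (rule mat_has_sumD(3)[OF mint_w_mult(2)[OF X] i]) simp
    have 2: "((\<lambda>r. (\<gamma> (int s - int r) * c r) $$ (i, 0)) has_sum
        (\<Sum>r<n. (\<gamma> (int s - int r) * c r) $$ (i, 0))) UNIV"
    proof (rule has_sum_finite_neutralI)
      fix r assume "r \<in> UNIV - {..<n}"
      then have "c r = 0\<^sub>m d 1" by (simp add: c_def)
      then have "\<gamma> (int s - int r) * c r = 0\<^sub>m d 1" by (simp add: right_mult_zero_mat[of _ d d])
      then show "(\<gamma> (int s - int r) * c r) $$ (i, 0) = 0" using i by simp
    qed auto
    have "mfc d 1 (\<lambda>\<theta>. wT \<theta> * X (cis \<theta>)) (int s) $$ (i, 0) = 0"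
      using has_sum_unique[OF 1 2] sum0 by (rule trans)
    then show "mfc d 1 (\<lambda>\<theta>. wT \<theta> * X (cis \<theta>)) (int s) $$ (i, j) = 0\<^sub>m d 1 $$ (i, j)"
      using i j by simp
  qed (simp_all add: mfc_def)
  moreover have "k < n" if "c k \<noteq> 0\<^sub>m d 1" for k
    using that by (rule contrapos_np) (simp add: c_def)
  ultimately have c0: "c k = 0\<^sub>m d 1" for k
    by (intro toeplitz_form_definite[OF X]) blast
  show "x = 0\<^sub>m (d * n) 1"
  proof (rule eq_matI)
    fix i j assume "i < dim_row (0\<^sub>m (d * n) 1 :: complex mat)" "j < dim_col (0\<^sub>m (d * n) 1 :: complex mat)"
    then have i: "i < d * n" and j: "j = 0" by auto
    then have d: "d > 0" by (cases d) auto
    have "i div d < n" using i by (simp add: less_mult_imp_div_less mult.commute)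
    moreover have "c (i div d) $$ (i mod d, 0) = 0" unfolding c0 using d by simp
    ultimately show "x $$ (i, j) = 0\<^sub>m (d * n) 1 $$ (i, j)" using i j d by (simp add: c_def)
  qed (use xc in auto)
qed

lemma toeplitz_data:
  assumes n: "m 0 + 1 \<le> n"
  shows "toeplitz_inverse_data d (d * M) (m 0) n \<gamma> a a_t cH P hsym (Pi_mat d K m p (int n) * Theta d K m p h hs)"
proof
  show "mat_has_sum d d (\<lambda>k. a k * \<gamma> (j - int k)) (0\<^sub>m d d) UNIV" if "j \<ge> 1" for j
    using a_\<gamma>[of j] mfc_h_adjoint(2)[of j] that by simp
  show "mat_has_sum d d (\<lambda>k. a_t k * \<gamma> (int k - j)) (0\<^sub>m d d) UNIV" if "j \<ge> 1" for j
    using a_t_\<gamma>[of "- j"] mfc_H(2)[of "- j"] that by (simp add: algebra_simps)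
  show "mat_has_sum d d (\<lambda>k. a_t k * \<gamma> (int k + int j)) (- cH j) UNIV" for j
    using a_t_\<gamma>[of "int j"] mfc_H(1)[of j] by (simp add: algebra_simps)
  show "summable (\<lambda>l. mnorm (P (int l)))" by (rule P_summable)
  show "Pi_mat d K m p (int n) * Theta d K m p h hs \<in> carrier_mat (d * M) (d * M)"
    by (rule mult_carrier_mat[OF Pi_carrier Theta_carrier])
  show "summable (\<lambda>l. mnorm (a l))" "summable (\<lambda>l. mnorm (a_t l))"
    by (rule mseries_summable[OF hI], rule mseries_summable[OF HIa])
  show "\<exists>C. \<forall>k. mnorm (\<gamma> k) \<le> C" by (rule mfc_bounded[OF mint_basic(3)])
  show "mat_has_sum d d (\<lambda>l. hsym (int (k + l)) * a l) (- a_t (Suc k)) UNIV"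
    "mat_has_sum d d (\<lambda>l. mat_adjoint (hsym (int (k + l))) * a_t l) (- a (Suc k)) UNIV" if "k \<ge> m 0" for k
    using a_t_rel[OF that] a_rel[OF that] by blast+
  show "transpose_mat (P k) * (Pi_mat d K m p (int n) * Theta d K m p h hs) * P l = hsym (int n + k + l)" for k l
    by (rule hankel_identity)
qed (use n in \<open>simp_all add: P_carrier a_carrier \<gamma>_herm cH_inv\<close>)

text \<open>The roles of \<open>h\<close> and \<open>H\<close> are exchanged, and frequencies change their sign.\<close>

lemma toeplitz_data_dual:
  assumes n: "m 0 + 1 \<le> n"
  shows "toeplitz_inverse_data d (d * M) (m 0) n (\<lambda>k. \<gamma> (- k)) a_t a (\<lambda>k. mat_adjoint (ch k))
    (\<lambda>k. mat_cnj (P k)) (\<lambda>e. mat_adjoint (hsym e)) (mat_adjoint (Pi_mat d K m p (int n) * Theta d K m p h hs))"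
proof -
  interpret T: toeplitz_inverse_data d "d * M" "m 0" n \<gamma> a a_t cH P hsym
    "Pi_mat d K m p (int n) * Theta d K m p h hs" by (rule toeplitz_data[OF n])
  show ?thesis
  proof
    show "mat_has_sum d d (\<lambda>k. a k * \<gamma> (- (int k - j))) (0\<^sub>m d d) UNIV" if "j \<ge> 1" for j
      using T.a_orth[OF that] by simp
    show "mat_has_sum d d (\<lambda>k. a_t k * \<gamma> (- (j - int k))) (0\<^sub>m d d) UNIV" if "j \<ge> 1" for j
      using T.a'_orth[OF that] by simp
    show "mat_has_sum d d (\<lambda>k. a k * \<gamma> (- (int k + int j))) (- mat_adjoint (ch j)) UNIV" for j
    proof -
      have "- (int k + int j) = - int j - int k" for k by simp
      then show ?thesis using a_\<gamma>[of "- int j"] by (simp only: mfc_h_adjoint(1))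
    qed
    show "transpose_mat (mat_cnj (P k)) * mat_adjoint (Pi_mat d K m p (int n) * Theta d K m p h hs) * mat_cnj (P l) =
        mat_adjoint (hsym (int n + k + l))" for k l by (rule T.hank')
    show "\<exists>C. \<forall>k. mnorm (\<gamma> (- k)) \<le> C"
    proof -
      obtain C where "\<And>k. mnorm (\<gamma> k) \<le> C" using T.g_bounded by auto
      then show ?thesis by (intro exI[of _ C] allI)
    qed
    show "mat_has_sum d d (\<lambda>l. mat_adjoint (hsym (int (k + l))) * a_t l) (- a (Suc k)) UNIV"
      "mat_has_sum d d (\<lambda>l. mat_adjoint (mat_adjoint (hsym (int (k + l)))) * a l) (- a_t (Suc k)) UNIV"
      if "k \<ge> m 0" for k
      using a_t_rel[OF that] a_rel[OF that] by simp_all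
    show "summable (\<lambda>l. mnorm (mat_cnj (P (int l))))" using P_summable by simp
    show "mat_sum d d {..q} (\<lambda>i. mat_adjoint (mat_adjoint (ch i)) * a (q - i)) = (if q = 0 then - 1\<^sub>m d else 0\<^sub>m d d)" for q
      using ch_inv[of q] by simp
    show "mat_adjoint (Pi_mat d K m p (int n) * Theta d K m p h hs) \<in> carrier_mat (d * M) (d * M)"
      by (rule mat_adjoint_carrier[OF T.Q_carrier])
    show "mat_adjoint (\<gamma> (- k)) = \<gamma> (- (- k))" for k by (rule \<gamma>_herm)
    show "summable (\<lambda>l. mnorm (a_t l))" "summable (\<lambda>l. mnorm (a l))" by (rule T.a_summable)+
    show "m 0 + 1 \<le> n" by (rule n)
  qed (simp_all add: P_carrier a_carrier)
qed

lemma mcont_U: "mcont d d (\<lambda>z. H z * mat_adjoint (mat_inv (h z)))"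
proof -
  have "mcont d d (\<lambda>z. - (- mat_inv (h z)))" by (rule mseries_continuous[OF mseries_uminus[OF hI]])
  moreover have "- (- mat_inv (h z)) = mat_inv (h z)" for z by (rule eq_matI) auto
  ultimately have "mcont d d (\<lambda>z. mat_inv (h z))" by simp
  then show ?thesis by (intro mcont_mult[of _ d] mcont_adjoint mseries_continuous[OF HT])
qed

text \<open>Let \<open>x = G x'\<close> with \<open>x' = G' x\<close>. The series \<open>Z\<close> with coefficients \<open>P\<^sub>l\<^sup>* x'\<close> at \<open>l \<ge> 0\<close> and \<open>Y\<close> with
  coefficients \<open>P\<^sub>l\<^sup>T x\<close> at \<open>- (n + 1 + l)\<close> are coupled by the Hankel form: \<open>U Z + Y\<close> has no
  frequencies of \<open>Y\<close>, and \<open>Z + U\<^sup>* Y\<close> none of \<open>Z\<close>. As \<open>U\<close> is unitary, \<open>D = U Z + Y\<close> satisfies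
  \<open>D\<^sup>* D = Z\<^sup>* (Z + U\<^sup>* Y) + Y\<^sup>* D\<close>, so its mean square is zero. Then
  \<open>h Z = - H\<^sup>* Y\<close> is analytic and antianalytic with negative frequencies only, hence zero. It follows that \<open>Z = 0\<close>,
  \<open>\<Lambda> x' = 0\<close> and \<open>x = 0\<close>.\<close>

lemma G_det:
  assumes n: "m 0 + 1 \<le> n"
  shows "Determinant.det (1\<^sub>m (d * M) - G_mat d K m p h hs (int n) * G_mat_t d K m p h hs (int n)) \<noteq> 0"
proof -
  let ?N = "d * M" and ?Q = "Pi_mat d K m p (int n) * Theta d K m p h hs"
  interpret T: toeplitz_inverse_data d ?N "m 0" n \<gamma> a a_t cH P hsym ?Q by (rule toeplitz_data[OF n])
  note One_nat_def [simp del]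
  have Pc [simp]: "P k \<in> carrier_mat ?N d" for k by (rule P_carrier)
  have "Determinant.det (1\<^sub>m ?N - T.G * T.G') \<noteq> 0"
  proof (rule det_nonzeroI[of _ ?N])
    show "1\<^sub>m ?N - T.G * T.G' \<in> carrier_mat ?N ?N"
      by (intro minus_carrier_mat mult_carrier_mat[OF T.G_carrier])
    fix x assume x [simp]: "x \<in> carrier_mat ?N 1" and zero: "(1\<^sub>m ?N - T.G * T.G') * x = 0\<^sub>m ?N 1"
    define x' where "x' = T.G' * x"
    have x' [simp]: "x' \<in> carrier_mat ?N 1" unfolding x'_def by (rule mult_carrier_mat[OF T.G_carrier(2) x])
    have "x = T.G * x'"
      by (rule minus_mat_eq_zero[OF x mult_carrier_mat[OF T.G_carrier(1) x']])
        (use zero one_minus_mult_mult[OF T.G_carrier x] in \<open>simp add: x'_def\<close>)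
    then have xQ: "?Q * (T.Lam * x') = x"
      unfolding T.G_def by (simp add: assoc_mult_mat[OF T.Q_carrier T.Lam_carrier x'])
    have xQ': "mat_adjoint ?Q * (transpose_mat T.Lam * x) = x'"
      unfolding x'_def T.G'_def
      using assoc_mult_mat[of "mat_adjoint ?Q" ?N ?N "transpose_mat T.Lam" ?N x 1] T.Q_carrier by simp
    define z where "z l = mat_adjoint (P (int l)) * x'" for l
    define y where "y l = transpose_mat (P (int l)) * x" for l
    have zc [simp]: "z l \<in> carrier_mat d 1" and yc [simp]: "y l \<in> carrier_mat d 1" for l
      unfolding z_def y_def by (intro mult_carrier_mat[of _ d ?N] x x'; simp)+
    have sz: "summable (\<lambda>l. mnorm (z l))"
      unfolding z_def by (rule mnorm_mult_summable[OF mat_adjoint_carrier[OF Pc] x']) (use P_summable in simp)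
    have sy: "summable (\<lambda>l. mnorm (y l))"
    proof -
      have "mnorm (transpose_mat (P k)) = mnorm (P k)" for k
        using mnorm_adjoint[of "mat_cnj (P k)"] by (simp add: mat_adjoint_cnj)
      then show ?thesis
        unfolding y_def by (intro mnorm_mult_summable[where m = d, OF _ x]) (use P_summable in simp_all)
    qed
    obtain Z where Z: "mseries d 1 (\<lambda>\<theta>. Z (cis \<theta>)) z int" by (rule mseries_exists[OF zc sz])
    obtain Y where Y: "mseries d 1 (\<lambda>\<theta>. Y (cis \<theta>)) y (\<lambda>k. - (int n + 1 + int k))"
      by (rule mseries_exists[OF yc sy])
    have Zc [simp]: "Z (cis \<theta>) \<in> carrier_mat d 1" and Yc [simp]: "Y (cis \<theta>) \<in> carrier_mat d 1" for \<theta>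
      by (rule mseriesD(1)[OF Z], rule mseriesD(1)[OF Y])
    note Zi = mseries_fcoef(1)[OF Z] and Yi = mseries_fcoef(1)[OF Y]
    have "mat_has_sum ?N 1 (\<lambda>l. P (int l) * mat_adjoint (P (int l)) * x') (T.Lam * x') UNIV"
      by (rule mat_has_sum_mult_right[OF x']) (use T.Y.gram_has_sum in \<open>simp add: T.Lam_eq transpose_cnj\<close>)
    then have Lz: "mat_has_sum ?N 1 (\<lambda>l. P (int l) * z l) (T.Lam * x') UNIV"
      by (rule mat_has_sum_congI) (auto simp: z_def assoc_mult_mat[of _ ?N d _ ?N _ 1])
    have "mat_has_sum ?N 1 (\<lambda>l. mat_cnj (P (int l)) * transpose_mat (P (int l)) * x) (transpose_mat T.Lam * x) UNIV"
      by (rule mat_has_sum_mult_right[OF x]) (use T.X.gram_has_sum in \<open>simp add: T.Lam_transpose\<close>)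
    then have Ly: "mat_has_sum ?N 1 (\<lambda>l. mat_cnj (P (int l)) * y l) (transpose_mat T.Lam * x) UNIV"
      by (rule mat_has_sum_congI) (auto simp: y_def assoc_mult_mat[of _ ?N d _ ?N _ 1])
    have Us: "hsym (int n + int k + int l) = - mfc d d U (- (int n + 1 + int k) - int l)" for k l
      using hsym_eq[of "n + k + l"] n by (simp add: algebra_simps)
    have UZ: "mfc d 1 (\<lambda>\<theta>. U \<theta> * Z (cis \<theta>)) (- (int n + 1 + int k)) = - y k" for k
    proof -
      have "mat_has_sum d 1 (\<lambda>l. - (mfc d d U (- (int n + 1 + int k) - int l) * z l))
          (- mfc d 1 (\<lambda>\<theta>. U \<theta> * Z (cis \<theta>)) (- (int n + 1 + int k))) UNIV"
        by (rule mat_has_sum_uminus[OF mfc_mult_right(2)[OF Z mint_basic(4)]])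
      then have 1: "mat_has_sum d 1 (\<lambda>l. hsym (int n + int k + int l) * z l)
          (- mfc d 1 (\<lambda>\<theta>. U \<theta> * Z (cis \<theta>)) (- (int n + 1 + int k))) UNIV"
        by (rule mat_has_sum_congI) (simp_all only: Us uminus_mult[OF mfc_carrier zc])
      have 2: "mat_has_sum d 1 (\<lambda>l. hsym (int n + int k + int l) * z l)
          (transpose_mat (P (int k)) * (?Q * (T.Lam * x'))) UNIV"
        by (rule hankel_series[OF Pc T.Q_carrier T.hank zc Lz])
      have "- mfc d 1 (\<lambda>\<theta>. U \<theta> * Z (cis \<theta>)) (- (int n + 1 + int k)) = y k"
        using mat_has_sum_unique[OF 1 2] by (simp only: xQ y_def)
      then show ?thesis by (metis uminus_uminus_mat)
    qed
    have UY: "mfc d 1 (\<lambda>\<theta>. mat_adjoint (U \<theta>) * Y (cis \<theta>)) (int k) = - z k" for k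
    proof -
      have e: "mfc d d (\<lambda>\<theta>. mat_adjoint (U \<theta>)) (int k - - (int n + 1 + int l)) = - mat_adjoint (hsym (int n + int k + int l))" for l
      proof -
        have "- (int k - - (int n + 1 + int l)) = - (int n + 1 + int k) - int l" by simp
        then have "mfc d d U (- (int k - - (int n + 1 + int l))) = mfc d d U (- (int n + 1 + int k) - int l)"
          by (simp only:)
        then show ?thesis
          unfolding mfc_adjoint[OF mint_basic(4)] Us by (simp only: mat_adjoint_uminus uminus_uminus_mat)
      qed
      have "mat_has_sum d 1 (\<lambda>l. - (mfc d d (\<lambda>\<theta>. mat_adjoint (U \<theta>)) (int k - - (int n + 1 + int l)) * y l))
          (- mfc d 1 (\<lambda>\<theta>. mat_adjoint (U \<theta>) * Y (cis \<theta>)) (int k)) UNIV"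
        by (rule mat_has_sum_uminus[OF mfc_mult_right(2)[OF Y mint_basic(5)]])
      then have 1: "mat_has_sum d 1 (\<lambda>l. mat_adjoint (hsym (int n + int k + int l)) * y l)
          (- mfc d 1 (\<lambda>\<theta>. mat_adjoint (U \<theta>) * Y (cis \<theta>)) (int k)) UNIV"
        by (rule mat_has_sum_congI)
          (simp_all only: e uminus_mult[OF mat_adjoint_carrier[OF hsym_carrier] yc] uminus_uminus_mat)
      have 2: "mat_has_sum d 1 (\<lambda>l. mat_adjoint (hsym (int n + int k + int l)) * y l)
          (transpose_mat (mat_cnj (P (int k))) * (mat_adjoint ?Q * (transpose_mat T.Lam * x))) UNIV"
        by (rule hankel_series[where B = "\<lambda>e. mat_adjoint (hsym e)", OF _ _ T.hank' yc Ly])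
          (use T.Q_carrier in simp_all)
      have "- mfc d 1 (\<lambda>\<theta>. mat_adjoint (U \<theta>) * Y (cis \<theta>)) (int k) = z k"
        using mat_has_sum_unique[OF 1 2] by (simp only: xQ' z_def transpose_cnj)
      then show ?thesis by (metis uminus_uminus_mat)
    qed
    define D where "D c = H c * mat_adjoint (mat_inv (h c)) * Z c + Y c" for c
    define E where "E \<theta> = Z (cis \<theta>) + mat_adjoint (U \<theta>) * Y (cis \<theta>)" for \<theta>
    have UZi: "mint d 1 (\<lambda>\<theta>. U \<theta> * Z (cis \<theta>))" by (rule mfc_mult_right(1)[OF Z mint_basic(4)])
    have UYi: "mint d 1 (\<lambda>\<theta>. mat_adjoint (U \<theta>) * Y (cis \<theta>))" by (rule mfc_mult_right(1)[OF Y mint_basic(5)])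
    have Di: "mint d 1 (\<lambda>\<theta>. D (cis \<theta>))" unfolding D_def by (rule mfc_add(1)[OF UZi Yi])
    have Ei: "mint d 1 E" unfolding E_def by (rule mfc_add(1)[OF Zi UYi])
    have cancel: "- A + A = 0\<^sub>m d 1" "A + - A = 0\<^sub>m d 1" if "A \<in> carrier_mat d 1" for A :: "complex mat"
      using that by auto
    have D0: "mfc d 1 (\<lambda>\<theta>. D (cis \<theta>)) (- (int n + 1 + int k)) = 0\<^sub>m d 1" for k
      unfolding D_def mfc_add(2)[OF UZi Yi] UZ using mseries_fcoef(2)[OF Y, of k] by (simp add: inj_def cancel)
    have E0: "mfc d 1 E (int k) = 0\<^sub>m d 1" for k
      unfolding E_def mfc_add(2)[OF Zi UYi] UY using mseries_fcoef(2)[OF Z, of k] by (simp add: cancel)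
    have DE: "mat_adjoint (D (cis \<theta>)) * D (cis \<theta>) =
        mat_adjoint (Z (cis \<theta>)) * E \<theta> + mat_adjoint (Y (cis \<theta>)) * D (cis \<theta>)" for \<theta>
    proof -
      have UZc: "U \<theta> * Z (cis \<theta>) \<in> carrier_mat d 1" by (rule mult_carrier_mat[OF U_carrier Zc])
      have Dc: "D (cis \<theta>) \<in> carrier_mat d 1" by (rule mintD(1)[OF Di])
      have "mat_adjoint (U \<theta>) * (U \<theta> * Z (cis \<theta>)) = Z (cis \<theta>)"
        using assoc_mult_mat[OF mat_adjoint_carrier[OF U_carrier] U_carrier Zc, of \<theta> \<theta> \<theta>] by (simp add: U_unitary left_mult_one_mat[OF Zc])
      then have E: "mat_adjoint (U \<theta>) * D (cis \<theta>) = E \<theta>"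
        unfolding D_def E_def using mult_add_distrib_mat[OF mat_adjoint_carrier[OF U_carrier] UZc Yc] by simp
      have "mat_adjoint (D (cis \<theta>)) = mat_adjoint (U \<theta> * Z (cis \<theta>)) + mat_adjoint (Y (cis \<theta>))"
        unfolding D_def by (rule mat_adjoint_add[OF UZc Yc])
      also have "mat_adjoint (U \<theta> * Z (cis \<theta>)) = mat_adjoint (Z (cis \<theta>)) * mat_adjoint (U \<theta>)"
        by (rule mat_adjoint_mult[OF U_carrier Zc])
      finally have "mat_adjoint (D (cis \<theta>)) * D (cis \<theta>) =
          mat_adjoint (Z (cis \<theta>)) * mat_adjoint (U \<theta>) * D (cis \<theta>) + mat_adjoint (Y (cis \<theta>)) * D (cis \<theta>)"
        using add_mult_distrib_mat[OF mult_carrier_mat[OF mat_adjoint_carrier[OF Zc] mat_adjoint_carrier[OF U_carrier]]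
            mat_adjoint_carrier[OF Yc] Dc] by (simp only:)
      then show ?thesis
        using assoc_mult_mat[OF mat_adjoint_carrier[OF Zc] mat_adjoint_carrier[OF U_carrier] Dc] by (simp only: E)
    qed
    have Dzero: "D (cis \<theta>) = 0\<^sub>m d 1" for \<theta>
    proof (rule mean_square_zero[OF Di])
      show "mcont d 1 D"
        unfolding D_def
        by (intro mcont_add mcont_mult[OF mcont_U] mseries_continuous[OF Z] mseries_continuous[OF Y])
      show "mfc 1 1 (\<lambda>\<theta>. mat_adjoint (D (cis \<theta>)) * D (cis \<theta>)) 0 = 0\<^sub>m 1 1"
        unfolding DE
        using mfc_add(2)[OF mfc_mult_left(1)[OF mseries_adjoint[OF Z] Ei] mfc_mult_left(1)[OF mseries_adjoint[OF Y] Di], of 0]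
          mfc_orthogonal[OF Z Ei E0] mfc_orthogonal[OF Y Di D0] by simp
    qed
    \<comment> \<open>the analytic function \<open>h Z\<close> equals \<open>- H\<^sup>* Y\<close>, which has only negative frequencies\<close>
    define W where "W \<theta> = hT \<theta> * Z (cis \<theta>)" for \<theta>
    have Wi: "mint d 1 W" unfolding W_def by (rule mfc_mult_left(1)[OF hT Zi])
    have Vi: "mint d 1 (\<lambda>\<theta>. mat_adjoint (HT \<theta>) * Y (cis \<theta>))"
      by (rule mfc_mult_left(1)[OF mseries_adjoint[OF HT] Yi])
    have W0: "mfc d 1 W k = 0\<^sub>m d 1" for k
    proof (cases "k < 0")
      case True
      show ?thesis
        unfolding W_def
      proof (rule mfc_mult_zero[OF hT Zi])
        show "mfc d 1 (\<lambda>\<theta>. Z (cis \<theta>)) (k - int i) = 0\<^sub>m d 1" for i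
          by (rule mseries_fcoef(3)[OF Z]) (use True in auto)
      qed
    next
      case False
      have WV: "W \<theta> + mat_adjoint (HT \<theta>) * Y (cis \<theta>) = 0\<^sub>m d 1" for \<theta>
      proof -
        have UZc: "U \<theta> * Z (cis \<theta>) \<in> carrier_mat d 1" by (rule mult_carrier_mat[OF U_carrier Zc])
        have Hc: "mat_adjoint (HT \<theta>) \<in> carrier_mat d d" by simp
        have "W \<theta> = mat_adjoint (HT \<theta>) * (U \<theta> * Z (cis \<theta>))"
          using assoc_mult_mat[OF Hc U_carrier Zc, of \<theta> \<theta>] by (simp only: W_def HU)
        then have "W \<theta> + mat_adjoint (HT \<theta>) * Y (cis \<theta>) = mat_adjoint (HT \<theta>) * D (cis \<theta>)"
          unfolding D_def by (simp only: mult_add_distrib_mat[OF Hc UZc Yc])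
        then show ?thesis unfolding Dzero by (simp add: right_mult_zero_mat[of _ d d])
      qed
      have V0: "mfc d 1 (\<lambda>\<theta>. mat_adjoint (HT \<theta>) * Y (cis \<theta>)) k = 0\<^sub>m d 1"
      proof (rule mfc_mult_zero[OF mseries_adjoint[OF HT] Yi])
        show "mfc d 1 (\<lambda>\<theta>. Y (cis \<theta>)) (k - - int i) = 0\<^sub>m d 1" for i
          by (rule mseries_fcoef(3)[OF Y]) (use False in auto)
      qed
      have "mfc d 1 W k + 0\<^sub>m d 1 = mfc d 1 (\<lambda>\<theta>. 0\<^sub>m d 1) k"
        using mfc_add(2)[OF Wi Vi, of k] unfolding WV V0 by simp
      also have "\<dots> = 0\<^sub>m d 1" by (rule eq_matI) (simp_all add: mfc_def fcoef_def)
      finally show ?thesis by simp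
    qed
    have z0: "z k = 0\<^sub>m d 1" for k
    proof -
      have "- hI \<theta> * W \<theta> = - Z (cis \<theta>)" for \<theta>
      proof -
        have "hI \<theta> * W \<theta> = Z (cis \<theta>)"
          unfolding W_def using assoc_mult_mat[OF carriers(3,1) Zc, of \<theta> \<theta> \<theta>]
            by (simp add: hI_props left_mult_one_mat[OF Zc])
        then show ?thesis by (subst uminus_mult[OF carriers(3) mintD(1)[OF Wi]]) simp
      qed
      moreover have "mfc d 1 (\<lambda>\<theta>. - hI \<theta> * W \<theta>) (int k) = 0\<^sub>m d 1"
        by (rule mfc_mult_zero[OF hI Wi W0])
      ultimately have "- z k = 0\<^sub>m d 1" using mseries_fcoef(2)[OF mseries_uminus[OF Z], of k] by simp
      then have "z k = - 0\<^sub>m d 1" by (metis uminus_uminus_mat)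
      then show ?thesis by auto
    qed
    have "mat_has_sum ?N 1 (\<lambda>l. 0\<^sub>m ?N 1) (T.Lam * x') (UNIV :: nat set)"
      using Lz unfolding z0 by (simp add: right_mult_zero_mat[of _ ?N d])
    then have "T.Lam * x' = 0\<^sub>m ?N 1" using mat_has_sum_0 mat_has_sum_unique by blast
    then show "x = 0\<^sub>m ?N 1"
      using xQ T.Q_carrier by (simp add: right_mult_zero_mat[of _ ?N ?N])
  qed
  then show ?thesis
    by (simp add: T.G_def T.G'_def T.Lam_def G_mat_def G_mat_t_def Lambda_def)
qed

subsection \<open>The inverse of the Toeplitz matrix\<close>

lemma v_carrier [simp]: "v_mat d K m p a k \<in> carrier_mat (d * M) d" "v_mat_t d K m p a_t k \<in> carrier_mat (d * M) d"
  "w_mat d K m p a e \<in> carrier_mat (d * M) d" "w_mat_t d K m p a_t e \<in> carrier_mat (d * M) d"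
  by (simp_all add: v_mat_def v_mat_t_def w_mat_def w_mat_t_def)

lemma G_mat_carrier [simp]: "G_mat d K m p h hs k \<in> carrier_mat (d * M) (d * M)"
    "G_mat_t d K m p h hs k \<in> carrier_mat (d * M) (d * M)"
    "Pi_mat d K m p k * Theta d K m p h hs \<in> carrier_mat (d * M) (d * M)"
proof -
  show PT: "Pi_mat d K m p k * Theta d K m p h hs \<in> carrier_mat (d * M) (d * M)"
    by (rule mult_carrier_mat[OF Pi_carrier Theta_carrier])
  have L: "Lambda d K m p \<in> carrier_mat (d * M) (d * M)" by (simp add: Lambda_def)
  show "G_mat d K m p h hs k \<in> carrier_mat (d * M) (d * M)"
    unfolding G_mat_def by (rule mult_carrier_mat[OF PT L])
  show "G_mat_t d K m p h hs k \<in> carrier_mat (d * M) (d * M)"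
    unfolding G_mat_t_def by (rule mult_carrier_mat[OF mat_adjoint_carrier[OF PT]]) (use L in simp)
qed

lemma r_carrier: "r_mat d K m p h hs a a_t n s \<in> carrier_mat (d * M) d"
  "r_mat_t d K m p h hs a a_t n s \<in> carrier_mat (d * M) d"
  unfolding r_mat_def r_mat_t_def Let_def
  by (intro add_carrier_mat mult_carrier_mat[of _ "d * M" "d * M"] mat_adjoint_carrier G_mat_carrier v_carrier)+

lemma ell_carrier:
  assumes "m 0 + 1 \<le> n"
  shows "ell d K m p h hs a n s \<in> carrier_mat d (d * M)" "ell_t d K m p h hs a_t n s \<in> carrier_mat d (d * M)"
proof -
  let ?A = "G_mat d K m p h hs (int n)" and ?B = "G_mat_t d K m p h hs (int n)"
  have c: "1\<^sub>m (d * M) - ?A * ?B \<in> carrier_mat (d * M) (d * M)" "1\<^sub>m (d * M) - ?B * ?A \<in> carrier_mat (d * M) (d * M)"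
    by (intro minus_carrier_mat mult_carrier_mat[OF G_mat_carrier(1,2)] mult_carrier_mat[OF G_mat_carrier(2,1)])+
  note D = mat_inv_props(1)[OF c(1) G_det[OF assms]]
    mat_inv_props(1)[OF c(2) det_one_minus_commute[OF G_mat_carrier(1,2) G_det[OF assms]]]
  have diff: "X - Y \<in> carrier_mat (d * M) d" if "Y \<in> carrier_mat (d * M) d" for X Y :: "complex mat"
    using that by (rule minus_carrier_mat)
  show "ell d K m p h hs a n s \<in> carrier_mat d (d * M)" "ell_t d K m p h hs a_t n s \<in> carrier_mat d (d * M)"
    unfolding ell_def ell_t_def
    by (intro mult_carrier_mat[of _ d "d * M"] mat_adjoint_carrier diff v_carrier D)+
qed

lemma inverse_block_t:
  assumes n: "m 0 + 1 \<le> n" and s: "s \<in> {1..n}" and t: "t \<in> {1..n - m 0}"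
  shows "block d (mat_inv (toeplitz d w n)) s t =
    mat_adjoint (r_mat_t d K m p h hs a a_t n s) * mat_adjoint (ell_t d K m p h hs a_t n t)
    + mat_sum d d {1..min s t} (\<lambda>l. mat_adjoint (a_t (s - l)) * a_t (t - l))"
proof (rule toeplitz_block_column[OF _ toeplitz_det])
  let ?Q = "Pi_mat d K m p (int n) * Theta d K m p h hs"
  interpret T: toeplitz_inverse_data d "d * M" "m 0" n \<gamma> a a_t cH P hsym ?Q by (rule toeplitz_data[OF n])
  have G: "T.G = G_mat d K m p h hs (int n)" "T.G' = G_mat_t d K m p h hs (int n)"
    by (simp_all add: T.G_def T.G'_def T.Lam_def G_mat_def G_mat_t_def Lambda_def)
  have R: "T.R s = r_mat_t d K m p h hs a a_t n s" for s
    by (simp only: T.R_def r_mat_t_def Let_def G v_mat_def v_mat_t_def vseq_def)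
  have L: "T.L t = ell_t d K m p h hs a_t n t" for t
    by (simp only: T.L_def ell_t_def G v_mat_t_def w_mat_t_def vseq_def wseq_def)
  show "mat_sum d d {1..n} (\<lambda>s. fourier_coeff d w (int u - int s) *
      (mat_adjoint (r_mat_t d K m p h hs a a_t n s) * mat_adjoint (ell_t d K m p h hs a_t n t)
        + mat_sum d d {1..min s t} (\<lambda>l. mat_adjoint (a_t (s - l)) * a_t (t - l)))) =
      (if u = t then 1\<^sub>m d else 0\<^sub>m d d)" if "u \<in> {1..n}" for u
    using T.column_equation[OF that t] G_det[OF n] by (simp only: G R L T.Y_def fourier_coeff_eq simp_thms)
  show "mat_adjoint (r_mat_t d K m p h hs a a_t n s) * mat_adjoint (ell_t d K m p h hs a_t n t)
        + mat_sum d d {1..min s t} (\<lambda>l. mat_adjoint (a_t (s - l)) * a_t (t - l)) \<in> carrier_mat d d" for s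
    by (rule add_carrier_mat) simp
qed (use s t in \<open>auto simp: fourier_coeff_eq\<close>)

text \<open>The dual data give the columns of the matrix with the blocks \<open>\<gamma> (t - s)\<close>, which is the Toeplitz matrix with
  rows and columns in reversed order.\<close>

lemma inverse_block:
  assumes n: "m 0 + 1 \<le> n" and s: "s \<in> {1..n}" and t: "t \<in> {m 0 + 1..n}"
  shows "block d (mat_inv (toeplitz d w n)) s t =
    mat_adjoint (r_mat d K m p h hs a a_t n s) * mat_adjoint (ell d K m p h hs a n t)
    + mat_sum d d {max s t..n} (\<lambda>l. mat_adjoint (a (l - s)) * a (l - t))"
proof (rule toeplitz_block_column[OF _ toeplitz_det])
  let ?Q = "Pi_mat d K m p (int n) * Theta d K m p h hs"
  interpret T: toeplitz_inverse_data d "d * M" "m 0" n \<gamma> a a_t cH P hsym ?Q by (rule toeplitz_data[OF n])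
  interpret D: toeplitz_inverse_data d "d * M" "m 0" n "\<lambda>k. \<gamma> (- k)" a_t a "\<lambda>k. mat_adjoint (ch k)"
    "\<lambda>k. mat_cnj (P k)" "\<lambda>e. mat_adjoint (hsym e)" "mat_adjoint ?Q" by (rule toeplitz_data_dual[OF n])
  have "D.Lam = T.X.gram"
    by (simp only: D.Lam_def T.X.gram_def mat_adjoint_cnj)
  then have Lam: "D.Lam = transpose_mat (Lambda d K m p)"
    by (simp only: T.Lam_transpose[symmetric] T.Lam_def Lambda_def)
  have G: "D.G' = G_mat d K m p h hs (int n)" "D.G = G_mat_t d K m p h hs (int n)"
    by (simp_all only: D.G_def D.G'_def Lam G_mat_def G_mat_t_def mat_adjoint_adjoint transpose_transpose)
  have R: "D.R (n + 1 - s) = r_mat d K m p h hs a a_t n s" if "s \<in> {1..n}" for s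
  proof -
    have "n + 1 - (n + 1 - s) = s" using that by auto
    then show ?thesis
      by (simp only: D.R_def r_mat_def Let_def G v_mat_def v_mat_t_def vseq_def mat_cnj_cnj mat_adjoint_adjoint)
  qed
  have L: "D.L (n + 1 - t) = ell d K m p h hs a n t" for t
    by (simp only: D.L_def ell_def G v_mat_def w_mat_def vseq_def wseq_def mat_cnj_cnj)
  have Y: "D.Y (n + 1 - s) (n + 1 - t) = mat_sum d d {max s t..n} (\<lambda>l. mat_adjoint (a (l - s)) * a (l - t))"
    if "s \<in> {1..n}" "t \<in> {1..n}" for s t
  proof -
    have "bij_betw (\<lambda>l. n + 1 - l) {max s t..n} {1..min (n + 1 - s) (n + 1 - t)}"
      by (rule bij_betwI[where g = "\<lambda>l. n + 1 - l"]) (use that in auto)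
    then have "D.Y (n + 1 - s) (n + 1 - t) =
        mat_sum d d {max s t..n} (\<lambda>l. mat_adjoint (a (n + 1 - s - (n + 1 - l))) * a (n + 1 - t - (n + 1 - l)))"
      unfolding D.Y_def by (rule mat_sum_reindex)
    also have "\<dots> = mat_sum d d {max s t..n} (\<lambda>l. mat_adjoint (a (l - s)) * a (l - t))"
    proof (rule mat_sum_cong)
      fix l assume "l \<in> {max s t..n}"
      then have "n + 1 - s - (n + 1 - l) = l - s" "n + 1 - t - (n + 1 - l) = l - t" by auto
      then show "mat_adjoint (a (n + 1 - s - (n + 1 - l))) * a (n + 1 - t - (n + 1 - l)) =
        mat_adjoint (a (l - s)) * a (l - t)" by (simp only:)
    qed
    finally show ?thesis .
  qed
  have det: "Determinant.det (1\<^sub>m (d * M) - D.G * D.G') \<noteq> 0"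
    unfolding G by (rule det_one_minus_commute[OF G_mat_carrier(1,2) G_det[OF n]])
  have t1: "t \<in> {1..n}" using t by auto
  show "mat_sum d d {1..n} (\<lambda>s. fourier_coeff d w (int u - int s) *
      (mat_adjoint (r_mat d K m p h hs a a_t n s) * mat_adjoint (ell d K m p h hs a n t)
        + mat_sum d d {max s t..n} (\<lambda>l. mat_adjoint (a (l - s)) * a (l - t)))) =
      (if u = t then 1\<^sub>m d else 0\<^sub>m d d)" if u: "u \<in> {1..n}" for u
  proof -
    have "mat_sum d d {1..n} (\<lambda>s. fourier_coeff d w (int u - int s) *
        (mat_adjoint (r_mat d K m p h hs a a_t n s) * mat_adjoint (ell d K m p h hs a n t)
          + mat_sum d d {max s t..n} (\<lambda>l. mat_adjoint (a (l - s)) * a (l - t)))) =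
      mat_sum d d {1..n} (\<lambda>s. \<gamma> (- (int (n + 1 - u) - int (n + 1 - s))) *
        (mat_adjoint (D.R (n + 1 - s)) * mat_adjoint (D.L (n + 1 - t)) + D.Y (n + 1 - s) (n + 1 - t)))"
    proof (rule mat_sum_cong)
      fix s assume s: "s \<in> {1..n}"
      then have "int u - int s = - (int (n + 1 - u) - int (n + 1 - s))" using u by auto
      then show "fourier_coeff d w (int u - int s) *
        (mat_adjoint (r_mat d K m p h hs a a_t n s) * mat_adjoint (ell d K m p h hs a n t)
          + mat_sum d d {max s t..n} (\<lambda>l. mat_adjoint (a (l - s)) * a (l - t))) =
        \<gamma> (- (int (n + 1 - u) - int (n + 1 - s))) *
        (mat_adjoint (D.R (n + 1 - s)) * mat_adjoint (D.L (n + 1 - t)) + D.Y (n + 1 - s) (n + 1 - t))"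
        by (simp only: fourier_coeff_eq R[OF s] L Y[OF s t1])
    qed
    also have "\<dots> = mat_sum d d {1..n} (\<lambda>s. \<gamma> (- (int (n + 1 - u) - int s)) *
        (mat_adjoint (D.R s) * mat_adjoint (D.L (n + 1 - t)) + D.Y s (n + 1 - t)))"
      by (rule mat_sum_reindex[OF bij_betw_reverse, symmetric])
    also have "\<dots> = (if n + 1 - u = n + 1 - t then 1\<^sub>m d else 0\<^sub>m d d)"
      by (rule D.column_equation[OF _ _ det]) (use u t in auto)
    also have "n + 1 - u = n + 1 - t \<longleftrightarrow> u = t" using u t by auto
    finally show ?thesis .
  qed
  show "mat_adjoint (r_mat d K m p h hs a a_t n s) * mat_adjoint (ell d K m p h hs a n t)
        + mat_sum d d {max s t..n} (\<lambda>l. mat_adjoint (a (l - s)) * a (l - t)) \<in> carrier_mat d d" for s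
    by (rule add_carrier_mat) simp
qed (use s t in \<open>auto simp: fourier_coeff_eq\<close>)

lemma inverse_block_adjoint:
  assumes s: "s \<in> {1..n}" and t: "t \<in> {1..n}"
  shows "block d (mat_inv (toeplitz d w n)) s t = mat_adjoint (block d (mat_inv (toeplitz d w n)) t s)"
proof -
  let ?T = "toeplitz d w n"
  have blk: "block d ?T u r = \<gamma> (int u - int r)" if "u \<in> {1..n}" "r \<in> {1..n}" for u r
    unfolding toeplitz_def fourier_coeff_eq by (rule block_mat_of_blocks[OF that]) simp
  have "mat_adjoint ?T = ?T"
  proof (rule block_mat_eqI[OF mat_adjoint_carrier[OF toeplitz_carrier] toeplitz_carrier])
    fix u r assume ur: "u \<in> {1..n}" "r \<in> {1..n}"
    then show "block d (mat_adjoint ?T) u r = block d ?T u r"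
      by (simp add: block_adjoint[OF toeplitz_carrier] blk \<gamma>_herm)
  qed
  then have "mat_adjoint (mat_inv ?T) = mat_inv ?T"
    using mat_inv_adjoint[OF toeplitz_carrier[of n] toeplitz_det[of n]] by simp
  then show ?thesis
    using block_adjoint[OF mat_inv_props(1)[OF toeplitz_carrier toeplitz_det] s t] by simp
qed

text \<open>The form of the passage from (i) to (ii) and from (iii) to (iv).\<close>

lemma adjoint_formula:
  fixes r l S :: "complex mat"
  assumes "r \<in> carrier_mat (d * M) d" "l \<in> carrier_mat d (d * M)" "S \<in> carrier_mat d d"
  shows "mat_adjoint (mat_adjoint r * mat_adjoint l + S) = l * r + mat_adjoint S"
proof -
  have c: "mat_adjoint r \<in> carrier_mat d (d * M)" "mat_adjoint l \<in> carrier_mat (d * M) d" using assms by auto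
  show ?thesis
    using mat_adjoint_add[OF mult_carrier_mat[OF c] assms(3)] mat_adjoint_mult[OF c] by simp
qed

lemma inverse_block_t_adjoint:
  assumes n: "m 0 + 1 \<le> n" and s: "s \<in> {1..n - m 0}" and t: "t \<in> {1..n}"
  shows "block d (mat_inv (toeplitz d w n)) s t =
    ell_t d K m p h hs a_t n s * r_mat_t d K m p h hs a a_t n t
    + mat_sum d d {1..min s t} (\<lambda>l. mat_adjoint (a_t (s - l)) * a_t (t - l))"
proof -
  have "s \<in> {1..n}" using s by auto
  from inverse_block_adjoint[OF this t] show ?thesis
    unfolding inverse_block_t[OF n t s] adjoint_formula[OF r_carrier(2) ell_carrier(2)[OF n] mat_sum_carrier]
      mat_sum_gram_adjoint[OF finite_atLeastAtMost a_carrier(2) a_carrier(2)] by (simp only: min.commute)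
qed

lemma inverse_block_adjoint_form:
  assumes n: "m 0 + 1 \<le> n" and s: "s \<in> {m 0 + 1..n}" and t: "t \<in> {1..n}"
  shows "block d (mat_inv (toeplitz d w n)) s t =
    ell d K m p h hs a n s * r_mat d K m p h hs a a_t n t
    + mat_sum d d {max s t..n} (\<lambda>l. mat_adjoint (a (l - s)) * a (l - t))"
proof -
  have "s \<in> {1..n}" using s by auto
  from inverse_block_adjoint[OF this t] show ?thesis
    unfolding inverse_block[OF n t s] adjoint_formula[OF r_carrier(1) ell_carrier(1)[OF n] mat_sum_carrier]
      mat_sum_gram_adjoint[OF finite_atLeastAtMost a_carrier(1) a_carrier(1)] by (simp only: max.commute)
qed

end

theorem theorem5p2:
  fixes d K :: nat
    and h hs w :: "complex \<Rightarrow> complex mat"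
    and m :: "nat \<Rightarrow> nat"
    and p :: "nat \<Rightarrow> complex"
    and \<rho> :: "nat \<Rightarrow> nat \<Rightarrow> complex mat"
    and a a_t :: "nat \<Rightarrow> complex mat"
  assumes d: "d \<ge> 1"
    and h_carrier: "\<And>z. h z \<in> carrier_mat d d"
    and h_rational: "\<And>i j. i < d \<Longrightarrow> j < d \<Longrightarrow> rational_no_poles_cdisk (\<lambda>z. h z $$ (i, j))"
    and h_det: "\<And>z. z \<in> cball 0 1 \<Longrightarrow> Determinant.det (h z) \<noteq> 0"
    and w: "\<And>z. z \<in> sphere 0 1 \<Longrightarrow> w z = h z * mat_adjoint (h z)"
    and K: "K \<ge> 1"
    and m: "\<And>\<mu>. \<mu> \<in> {1..K} \<Longrightarrow> m \<mu> \<ge> 1"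
    and p_distinct: "inj_on p {1..K}"
    and p_disk: "\<And>\<mu>. \<mu> \<in> {1..K} \<Longrightarrow> p \<mu> \<in> ball 0 1 - {0}"
    and \<rho>_carrier: "\<And>\<mu> j. \<mu> \<le> K \<Longrightarrow> j \<le> m \<mu> \<Longrightarrow> \<rho> \<mu> j \<in> carrier_mat d d"
    and \<rho>_lead: "\<And>\<mu>. \<mu> \<in> {1..K} \<Longrightarrow> \<rho> \<mu> (m \<mu>) \<noteq> 0\<^sub>m d d"
    and \<rho>_lead_0: "m 0 \<ge> 1 \<Longrightarrow> \<rho> 0 (m 0) \<noteq> 0\<^sub>m d d"
    and partial_fractions: "\<And>z. z \<in> cball 0 1 \<Longrightarrow> mat_inv (h z) = pf_rhs d K m p \<rho> z"
    and hs_outer: "outer_H2_mat d hs"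
    and hs_factor: "AE \<theta> in lebesgue_on {-pi..pi}.
        w (cis \<theta>) = mat_adjoint (hs (cis \<theta>)) * hs (cis \<theta>)"
    and a: "has_mat_power_series d (\<lambda>z. - mat_inv (h z)) a"
    and a_t: "has_mat_power_series d (\<lambda>z. - mat_inv (mat_adjoint (hs (cnj z)))) a_t"
  shows "(\<forall>n s t. n \<ge> m 0 + 1 \<longrightarrow> s \<in> {1..n} \<longrightarrow> t \<in> {1..n - m 0} \<longrightarrow>
            block d (mat_inv (toeplitz d w n)) s t =
              mat_adjoint (r_mat_t d K m p h hs a a_t n s) * mat_adjoint (ell_t d K m p h hs a_t n t)
              + mat_sum d d {1..min s t} (\<lambda>l. mat_adjoint (a_t (s - l)) * a_t (t - l)))
       \<and> (\<forall>n s t. n \<ge> m 0 + 1 \<longrightarrow> s \<in> {1..n - m 0} \<longrightarrow> t \<in> {1..n} \<longrightarrow>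
            block d (mat_inv (toeplitz d w n)) s t =
              ell_t d K m p h hs a_t n s * r_mat_t d K m p h hs a a_t n t
              + mat_sum d d {1..min s t} (\<lambda>l. mat_adjoint (a_t (s - l)) * a_t (t - l)))
       \<and> (\<forall>n s t. n \<ge> m 0 + 1 \<longrightarrow> s \<in> {1..n} \<longrightarrow> t \<in> {m 0 + 1..n} \<longrightarrow>
            block d (mat_inv (toeplitz d w n)) s t =
              mat_adjoint (r_mat d K m p h hs a a_t n s) * mat_adjoint (ell d K m p h hs a n t)
              + mat_sum d d {max s t..n} (\<lambda>l. mat_adjoint (a (l - s)) * a (l - t)))
       \<and> (\<forall>n s t. n \<ge> m 0 + 1 \<longrightarrow> s \<in> {m 0 + 1..n} \<longrightarrow> t \<in> {1..n} \<longrightarrow>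
            block d (mat_inv (toeplitz d w n)) s t =
              ell d K m p h hs a n s * r_mat d K m p h hs a a_t n t
              + mat_sum d d {max s t..n} (\<lambda>l. mat_adjoint (a (l - s)) * a (l - t)))"
proof -
  interpret D: pf_data d K m p h \<rho>
    by unfold_locales
      (use p_disk h_carrier h_rational h_det p_distinct m \<rho>_carrier partial_fractions in auto)
  obtain R where R: "R > 1" "\<And>i j. i < d \<Longrightarrow> j < d \<Longrightarrow> (\<lambda>z. h z $$ (i, j)) holomorphic_on ball 0 R"
    by (rule D.h_holomorphic) (rule that)
  have factor: "AE \<theta> in circ. h (cis \<theta>) * mat_adjoint (h (cis \<theta>)) = mat_adjoint (hs (cis \<theta>)) * hs (cis \<theta>)"
    using hs_factor by (simp add: w)
  obtain r H where H: "r > 1" "\<And>z. H z \<in> carrier_mat d d"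
      "\<And>i j. i < d \<Longrightarrow> j < d \<Longrightarrow> (\<lambda>z. H z $$ (i, j)) holomorphic_on ball 0 r"
      "\<And>z. z \<in> ball 0 1 \<Longrightarrow> H z = hs z"
      "\<And>z. z \<in> cball 0 1 \<Longrightarrow> Determinant.det (H z) \<noteq> 0"
      "\<And>z. z \<in> sphere 0 1 \<Longrightarrow> h z * mat_adjoint (h z) = mat_adjoint (H z) * H z"
    by (rule outer_factor_extends[OF h_carrier R h_det hs_outer factor]) (assumption | rule that)+
  interpret S: szego_data d K m p h \<rho> H hs r w a a_t
    by unfold_locales (fact H w a a_t)+
  show ?thesis
    by (intro conjI allI impI S.inverse_block_t S.inverse_block_t_adjoint S.inverse_block S.inverse_block_adjoint_form)
qed

end
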